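(* Let $2\le p\le\infty$, $1/p+1/q=1$, $N\in\mathbb Z_+$, let $M$ be a $d\times d$ dilation matrix, and let $L$ be the differential operator $Lf=\sum_{\beta\in\Delta_{N+1}}a_\beta D^\beta f$ with $a_\beta\in\mathbb C$, $a_{\mathbf 0}\neq0$. Suppose: (i) $\widetilde\varphi=\sum_{\beta\in\Delta_{N+1}}\overline{a_\beta}(-1)^{[\beta]}D^\beta\delta_0$ is the distribution associated with $L$ ($\delta_0$ the Dirac delta at the origin); (ii) $\varphi\in\mathcal L_p$, the function $\sum_{k\in\mathbb Z^d}|\widehat\varphi(\xi+k)|^q$ is bounded, and there exists $\delta\in(0,1/2)$ such that $\overline{\widehat\varphi(\xi)}\,\widehat{\widetilde\varphi}(\xi)=1$ a.e. on $\{|\xi|<\delta\}$ and $\widehat\varphi(\xi)=0$ a.e. on $\{|l-\xi|<\delta\}$ for all $l\in\mathbb Z^d\setminus\{\mathbf 0\}$; (iii) $f(x)=\widehat g(-x)$, where $g\in L_q(\mathbb R^d)$ and $g(\xi)=O(|\xi|^{-N-d-\varepsilon})$ as $|\xi|\to\infty$, $\varepsilon>0$. Then for every positive number $\theta$ which is smaller than the modulus of every eigenvalue of $M$ there is a constant $C$ not depending on $j$ such that for all $j\in\mathbb Z_+$ $$\Big\|f-m^{-j/2}\sum_{k\in\mathbb Z^d}Lf(M^{-j}\cdot)(-k)\,\varphi_{jk}\Big\|_p\le C\,\theta^{-j(N+\frac dp+\varepsilon)}.$$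
   Context: A dilation matrix is an integer $d\times d$ matrix $M$ all of whose eigenvalues are greater than $1$ in modulus; $m=|\det M|$. $\mathbb Z_+=\{0,1,2,\dots\}$, $\mathbb T^d=[-\frac12,\frac12]^d$. For $\beta\in\mathbb Z_+^d$, $[\beta]=\beta_1+\dots+\beta_d$ and $D^\beta$ is the corresponding partial derivative; $\Delta_n=\{\beta\in\mathbb Z_+^d:[\beta]<n\}$. Fourier transform: $\widehat f(\xi)=\int_{\mathbb R^d}f(x)e^{-2\pi i(x,\xi)}dx$, extended to tempered distributions as usual; thus $\widehat{\widetilde\varphi}(\xi)=\sum_{\beta\in\Delta_{N+1}}\overline{a_\beta}(-1)^{[\beta]}(2\pi i\xi)^\beta$. $\mathcal L_p$ is the space of $f\in L_p(\mathbb R^d)$ with $\big\|\sum_{k\in\mathbb Z^d}|f(\cdot+k)|\big\|_{L_p(\mathbb T^d)}<\infty$. $\varphi_{jk}(x)=m^{j/2}\varphi(M^jx+k)$. $Lf(M^{-j}\cdot)(-k)$ denotes the value at the point $-k$ of $L$ applied to the function $x\mapsto f(M^{-j}x)$. *)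

theory Defs
  imports "HOL-Analysis.Analysis" "HOL-Probability.Essential_Supremum"
begin

section \<open>Dilation matrices and the integer lattice\<close>

definition is_eigenvalue :: "real^'d^'d \<Rightarrow> complex \<Rightarrow> bool" where
  "is_eigenvalue M \<mu> \<longleftrightarrow> (\<exists>v::complex^'d. v \<noteq> 0 \<and> map_matrix complex_of_real M *v v = \<mu> *s v)"

definition dilation_matrix :: "real^'d^'d \<Rightarrow> bool" where
  "dilation_matrix M \<longleftrightarrow> (\<forall>i j. M $ i $ j \<in> \<int>) \<and> (\<forall>\<mu>. is_eigenvalue M \<mu> \<longrightarrow> 1 < cmod \<mu>)"

text \<open>Powers of matrices are expressed by iterating the linear map, because the power operation of
  the type class instance for vectors is componentwise.\<close>

definition mat_pow :: "real^'d^'d \<Rightarrow> nat \<Rightarrow> real^'d \<Rightarrow> real^'d" where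
  "mat_pow M j = ((*v) M) ^^ j"

definition zlattice :: "(real^'d) set" where
  "zlattice = {k. \<forall>i. k $ i \<in> \<int>}"

definition torus :: "(real^'d) set" where
  "torus = {x. \<forall>i. - (1/2) \<le> x $ i \<and> x $ i \<le> 1/2}"


section \<open>Lebesgue norms\<close>

text \<open>The norm is first defined for functions with values in the extended nonnegative reals, since
  the periodization of a function may be infinite at some points. Real powers on this type
  are only meant for positive exponents.\<close>

definition ennreal_powr :: "ennreal \<Rightarrow> real \<Rightarrow> ennreal" where
  "ennreal_powr x r = (if x = \<infinity> then \<infinity> else ennreal (enn2real x powr r))"

definition eLp_norm :: "ennreal \<Rightarrow> 'a measure \<Rightarrow> ('a \<Rightarrow> ennreal) \<Rightarrow> ennreal" where
  "eLp_norm p X F =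
     (if p = \<infinity> then esssup X F
      else ennreal_powr (\<integral>\<^sup>+x. ennreal_powr (F x) (enn2real p) \<partial>X) (1 / enn2real p))"

definition Lp_norm :: "ennreal \<Rightarrow> (real^'d \<Rightarrow> complex) \<Rightarrow> ennreal" where
  "Lp_norm p f = eLp_norm p lebesgue (\<lambda>x. ennreal (cmod (f x)))"

definition Lp :: "ennreal \<Rightarrow> (real^'d \<Rightarrow> complex) set" where
  "Lp p = {f. f \<in> borel_measurable lebesgue \<and> Lp_norm p f < \<infinity>}"

definition periodized_Lp :: "ennreal \<Rightarrow> (real^'d \<Rightarrow> complex) set" where
  "periodized_Lp p =
     {f \<in> Lp p. eLp_norm p (lebesgue_on torus)
        (\<lambda>x. \<Sum>\<^sub>\<infinity>k\<in>zlattice. ennreal (cmod (f (x + k)))) < \<infinity>}"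


section \<open>Partial derivatives\<close>

definition multi_order :: "nat^'d \<Rightarrow> nat" where
  "multi_order \<beta> = (\<Sum>i\<in>UNIV. \<beta> $ i)"

definition multi_below :: "nat \<Rightarrow> (nat^'d) set" where
  "multi_below n = {\<beta>. multi_order \<beta> < n}"

definition partial :: "'d::finite \<Rightarrow> (real^'d \<Rightarrow> complex) \<Rightarrow> real^'d \<Rightarrow> complex" where
  "partial i f x = vector_derivative (\<lambda>t. f (x + t *\<^sub>R axis i 1)) (at 0)"

definition partials :: "'d::finite list \<Rightarrow> (real^'d \<Rightarrow> complex) \<Rightarrow> real^'d \<Rightarrow> complex" where
  "partials is f = foldr partial is f"

text \<open>The index type carries no order, so \<open>D\<^sup>\<beta>\<close> takes the coordinate derivatives in some unspecified
  order that realizes \<open>\<beta>\<close>. The order is immaterial for functions whose partial derivatives up to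
  order \<open>[\<beta>]\<close> are continuous, and the operator is only applied to such functions.\<close>

definition multi_deriv :: "nat^'d \<Rightarrow> (real^'d \<Rightarrow> complex) \<Rightarrow> real^'d \<Rightarrow> complex" where
  "multi_deriv \<beta> = partials (SOME is. \<forall>i. count_list is i = \<beta> $ i)"

definition diff_op :: "nat \<Rightarrow> (nat^'d \<Rightarrow> complex) \<Rightarrow> (real^'d \<Rightarrow> complex) \<Rightarrow> real^'d \<Rightarrow> complex" where
  "diff_op N a f x = (\<Sum>\<beta>\<in>multi_below (N + 1). a \<beta> * multi_deriv \<beta> f x)"


section \<open>Fourier transform and tempered distributions\<close>

text \<open>This is the transform of integrable functions. It covers all functions to which it is applied:
  members of the periodized class are integrable, and so is a function in \<open>L\<^sub>q\<close>, \<open>q \<ge> 1\<close>, that decays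
  faster than \<open>|\<xi>|\<^sup>-\<^sup>d\<close>.\<close>

definition fourier :: "(real^'d \<Rightarrow> complex) \<Rightarrow> real^'d \<Rightarrow> complex" where
  "fourier f \<xi> = (\<integral>x. f x * exp (- 2 * of_real pi * \<i> * of_real (x \<bullet> \<xi>)) \<partial>lebesgue)"

definition schwartz :: "(real^'d \<Rightarrow> complex) \<Rightarrow> bool" where
  "schwartz \<psi> \<longleftrightarrow>
     (\<forall>is x. partials is \<psi> differentiable (at x)) \<and>
     (\<forall>is (n::nat). bounded (range (\<lambda>x. norm x ^ n *\<^sub>R partials is \<psi> x)))"

text \<open>A distribution is given by its action on test functions, with the bilinear pairing; only the
  values on Schwartz functions matter.\<close>

type_synonym 'd distr = "(real^'d \<Rightarrow> complex) \<Rightarrow> complex"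

definition dirac :: "'d::finite distr" where
  "dirac \<psi> = \<psi> 0"

definition distr_deriv :: "nat^'d \<Rightarrow> 'd::finite distr \<Rightarrow> 'd distr" where
  "distr_deriv \<beta> T \<psi> = (-1) ^ multi_order \<beta> * T (multi_deriv \<beta> \<psi>)"

definition distr_fourier :: "'d::finite distr \<Rightarrow> 'd distr" where
  "distr_fourier T \<psi> = T (fourier \<psi>)"

definition represents :: "(real^'d \<Rightarrow> complex) \<Rightarrow> 'd::finite distr \<Rightarrow> bool" where
  "represents h T \<longleftrightarrow>
     (\<forall>\<psi>. schwartz \<psi> \<longrightarrow> integrable lebesgue (\<lambda>x. h x * \<psi> x) \<and> T \<psi> = (\<integral>x. h x * \<psi> x \<partial>lebesgue))"

definition assoc_distr :: "nat \<Rightarrow> (nat^'d \<Rightarrow> complex) \<Rightarrow> 'd::finite distr" where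
  "assoc_distr N a \<psi> =
     (\<Sum>\<beta>\<in>multi_below (N + 1). cnj (a \<beta>) * (-1) ^ multi_order \<beta> * distr_deriv \<beta> dirac \<psi>)"


section \<open>Scaled translates\<close>

definition scaled_translate ::
  "real^'d^'d \<Rightarrow> (real^'d \<Rightarrow> complex) \<Rightarrow> nat \<Rightarrow> real^'d \<Rightarrow> real^'d \<Rightarrow> complex" where
  "scaled_translate M \<phi> j k x =
     of_real (\<bar>det M\<bar> powr (real j / 2)) * \<phi> (mat_pow M j x + k)"

definition sample_coeff ::
  "real^'d^'d \<Rightarrow> nat \<Rightarrow> (nat^'d \<Rightarrow> complex) \<Rightarrow> (real^'d \<Rightarrow> complex) \<Rightarrow> nat \<Rightarrow> real^'d \<Rightarrow> complex" where
  "sample_coeff M N a f j k = diff_op N a (\<lambda>x. f (mat_pow (matrix_inv M) j x)) (- k)"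

end

theory Submission
  imports Defs "HOL-Probability.Probability" "HOL-Complex_Analysis.Complex_Analysis"
begin

text \<open>After the substitution \<open>y = M\<^sup>j x\<close> the scale \<open>j\<close> only enters through the spectrum: \<open>f(M\<^sup>-\<^sup>j \<cdot>)\<close> is the
  transform of a dilation \<open>G\<close> of \<open>g\<close>, and the quasi-interpolant becomes \<open>\<Sum>\<^sub>k c\<^sub>k \<phi>(y + k)\<close>, where \<open>c\<^sub>k\<close> is
  the value at \<open>-k\<close> of the transform of \<open>s G\<close> and \<open>s\<close> is the symbol of \<open>L\<close>. When the quasi-interpolant is
  paired with a test function \<open>u\<close>, Poisson summation yields the integral of \<open>s G\<close> against the periodization
  of \<open>F\<phi> \<cdot> Fu\<close>, where \<open>F\<close> is the Fourier transform. In the ball of radius \<open>\<delta>\<close> only the summand \<open>k = 0\<close>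
  survives, and there it cancels against \<open>f\<close>. Outside the ball, the lattice sum is estimated by Young's
  inequality from the bound on \<open>\<Sum>\<^sub>k |F\<phi>(\<xi> + k)|\<^sup>q\<close> and the Hausdorff--Young inequality for \<open>u\<close>; a surplus
  factor \<open>|\<eta>|\<^sup>\<sigma>\<close> with \<open>\<sigma> p > d\<close>, taken from the decay of \<open>G\<close>, makes the lattice sums converge. The error is
  thus controlled by a weighted \<open>L\<^sub>q\<close> norm of \<open>G\<close> outside the ball, that is, of \<open>g\<close> on a set
  \<open>|\<xi>| \<ge> const \<cdot> \<theta>\<^sup>j\<close>, and the decay of \<open>g\<close> gives the rate.\<close>

text \<open>Duality is forced by the quasi-interpolant: its coefficients are only known to be
  bounded and its series converges absolutely only locally, so it has no spectrum to compare with
  \<open>g\<close> directly. Against a continuous function of bounded support every exchange of sum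
  and integral is justified, and the error need not be known to lie in L_p beforehand. The exponent
  of the rate has this origin. Write b for a bound of the norm of M^-j, a constant times
  \<theta>^-j. In L_q, a decay of order N + d + \<epsilon> leaves N + d + \<epsilon> - d/q = N + d/p
  + \<epsilon> after integration over the tail. With \<sigma> = d/p + \<epsilon>/2 the weight
  |\<eta>|^(N + \<sigma>) accounts for b^(N + \<sigma>) and the tail beyond \<delta>/b for the
  remaining b^(\<epsilon>/2). The powers of |det M^j| cancel, so its size never enters; that the
  same constant belongs to the matrix and to its adjoint does. Since M is controlled only through
  its eigenvalues, the bound on M^-j cannot come from the norm of M^-1.\<close>

no_notation fps_nth (infixl "$" 75)

section \<open>The Fourier transform of integrable functions\<close>

definition echar :: "real \<Rightarrow> complex" where
  "echar t = exp (- 2 * of_real pi * \<i> * of_real t)"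

lemma echar_add: "echar (s + t) = echar s * echar t"
  by (simp add: echar_def algebra_simps flip: exp_add)

lemma echar_0 [simp]: "echar 0 = 1"
  by (simp add: echar_def)

lemma norm_echar [simp]: "cmod (echar t) = 1"
  by (simp add: echar_def norm_exp_eq_Re)

lemma cnj_echar: "cnj (echar t) = echar (- t)"
  by (simp add: echar_def exp_cnj)

lemma echar_minus_mult [simp]: "echar (- t) * echar t = 1" "echar t * echar (- t) = 1"
  by (simp_all flip: echar_add)

lemma echar_Ints: "t \<in> \<int> \<Longrightarrow> echar t = 1"
proof -
  assume "t \<in> \<int>"
  then obtain n where n: "t = of_int n" by (auto elim: Ints_cases)
  have "echar t = exp (2 * of_real pi * \<i> * of_int (- n))"
    by (simp add: echar_def n)
  then show ?thesis
    by (metis exp_2pi_1_int mult.assoc mult.commute)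
qed

lemma continuous_on_echar [continuous_intros]:
  "continuous_on S f \<Longrightarrow> continuous_on S (\<lambda>x. echar (f x))"
  unfolding echar_def by (intro continuous_intros)

lemma borel_measurable_echar [measurable]: "echar \<in> borel_measurable borel"
  by (intro borel_measurable_continuous_onI continuous_intros)

lemma borel_measurable_cnj [measurable]: "cnj \<in> borel_measurable borel"
  by (intro borel_measurable_continuous_onI continuous_intros)

lemma integrable_mult_echar:
  assumes "integrable M h" "f \<in> borel_measurable M"
  shows "integrable M (\<lambda>x. h x * echar (f x))"
  using assms by (intro Bochner_Integration.integrable_bound[OF assms(1)]) (auto simp: norm_mult)

text \<open>The notions of the theorem integrate over the completed measure. For Borel functions the
  transform can be taken over \<open>lborel\<close>, where products of measures and Fubini's theorem
  are at hand.\<close>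

lemma fourier_eq_lborel:
  fixes h :: "real^'d \<Rightarrow> complex"
  assumes [measurable]: "h \<in> borel_measurable borel"
  shows "fourier h \<xi> = (\<integral>x. h x * echar (x \<bullet> \<xi>) \<partial>lborel)"
  unfolding fourier_def echar_def
  by (subst integral_completion) auto

lemma norm_fourier_le:
  fixes h :: "real^'d \<Rightarrow> complex"
  assumes [measurable]: "h \<in> borel_measurable borel"
  shows "cmod (fourier h \<xi>) \<le> (\<integral>x. cmod (h x) \<partial>lborel)"
  unfolding fourier_eq_lborel[OF assms]
  by (rule order_trans[OF integral_norm_bound]) (simp add: norm_mult)

lemma borel_measurable_fourier [measurable]:
  fixes h :: "real^'d \<Rightarrow> complex"
  assumes [measurable]: "h \<in> borel_measurable borel"
  shows "fourier h \<in> borel_measurable borel"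
proof -
  have "(\<lambda>\<xi>. \<integral>x. h x * echar (x \<bullet> \<xi>) \<partial>lborel) \<in> borel_measurable borel"
    by (intro lborel.borel_measurable_lebesgue_integral) simp
  also have "(\<lambda>\<xi>. \<integral>x. h x * echar (x \<bullet> \<xi>) \<partial>lborel) = fourier h"
    by (simp add: fun_eq_iff fourier_eq_lborel)
  finally show ?thesis .
qed

lemma integrable_mult_fourier:
  fixes h w :: "real^'d \<Rightarrow> complex"
  assumes w: "integrable lborel w" and [measurable]: "h \<in> borel_measurable borel"
  shows "integrable lborel (\<lambda>x. w x * fourier h x)"
proof -
  have [measurable]: "w \<in> borel_measurable borel" using w by auto
  show ?thesis
    by (rule Bochner_Integration.integrable_bound[OF integrable_mult_left[OF integrable_norm[OF w],
             of "\<integral>x. cmod (h x) \<partial>lborel"]])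
       (auto simp: norm_mult intro!: mult_left_mono norm_fourier_le abs_ge_self[THEN order_trans[rotated]])
qed

lemma integrable_lborel_pair_mult:
  fixes f :: "'a::euclidean_space \<Rightarrow> complex" and g :: "'b::euclidean_space \<Rightarrow> complex"
  assumes "integrable lborel f" "integrable lborel g"
  shows "integrable (lborel \<Otimes>\<^sub>M lborel) (\<lambda>(x, y). f x * g y)"
proof -
  have [measurable]: "f \<in> borel_measurable borel" "g \<in> borel_measurable borel"
    using assms by auto
  show ?thesis
    by (rule lborel_pair.Fubini_integrable) (use assms in \<open>auto simp: norm_mult\<close>)
qed

lemma fourier_multiplication_formula:
  fixes f g :: "real^'d \<Rightarrow> complex"
  assumes f: "integrable lborel f" and g: "integrable lborel g"
  shows "(\<integral>x. fourier f x * g x \<partial>lborel) = (\<integral>x. f x * fourier g x \<partial>lborel)"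
proof -
  have [measurable]: "f \<in> borel_measurable borel" "g \<in> borel_measurable borel"
    using assms by auto
  have int: "integrable (lborel \<Otimes>\<^sub>M lborel) (\<lambda>(x, y). f x * g y * echar (x \<bullet> y))"
    by (rule Bochner_Integration.integrable_bound[OF integrable_lborel_pair_mult[OF f g]])
       (auto simp: norm_mult)
  have "(\<integral>x. f x * fourier g x \<partial>lborel) = (\<integral>x. (\<integral>y. f x * g y * echar (x \<bullet> y) \<partial>lborel) \<partial>lborel)"
    by (simp add: fourier_eq_lborel mult.assoc inner_commute)
  also have "\<dots> = (\<integral>y. (\<integral>x. f x * g y * echar (x \<bullet> y) \<partial>lborel) \<partial>lborel)"
    using lborel_pair.Fubini_integral[OF int] by simp
  also have "\<dots> = (\<integral>y. fourier f y * g y \<partial>lborel)"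
    by (simp add: fourier_eq_lborel mult_ac flip: integral_mult_left_zero integral_mult_right_zero)
  finally show ?thesis by simp
qed

section \<open>Translations, dilations and reflections under the integral and the transform\<close>

lemma integral_lborel_translate:
  fixes F :: "'a::euclidean_space \<Rightarrow> 'b::{banach, second_countable_topology}"
  shows "(\<integral>x. F (x + a) \<partial>lborel) = (\<integral>x. F x \<partial>lborel)"
proof -
  have "(\<integral>x. F x \<partial>lborel) = (\<integral>x. F x \<partial>distr lborel borel ((+) a))"
    by (simp add: lborel_distr_plus)
  show ?thesis
  proof (cases "F \<in> borel_measurable borel")
    case True
    then have "(\<integral>x. F x \<partial>distr lborel borel ((+) a)) = (\<integral>x. F (a + x) \<partial>lborel)"
      by (intro integral_distr) auto
    then show ?thesis by (simp add: lborel_distr_plus add.commute)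
  next
    case False
    \<comment> \<open>For a non-measurable \<open>F\<close> both integrals have the default value
      0.\<close>
    have "\<not> integrable lborel F" using False by auto
    moreover have "\<not> integrable lborel (\<lambda>x. F (x + a))"
    proof
      assume "integrable lborel (\<lambda>x. F (x + a))"
      then have "(\<lambda>x. F (x + a)) \<in> borel_measurable borel" by auto
      from measurable_compose[OF _ this, of "\<lambda>x. x - a" borel] have "F \<in> borel_measurable borel" by simp
      with False show False by simp
    qed
    ultimately show ?thesis by (simp add: not_integrable_integral_eq)
  qed
qed

lemma nn_integral_lborel_translate:
  fixes F :: "'a::euclidean_space \<Rightarrow> ennreal"
  assumes [measurable]: "F \<in> borel_measurable borel"
  shows "(\<integral>\<^sup>+x. F (x + a) \<partial>lborel) = (\<integral>\<^sup>+x. F x \<partial>lborel)"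
proof -
  have "(\<integral>\<^sup>+x. F x \<partial>lborel) = (\<integral>\<^sup>+x. F x \<partial>distr lborel borel ((+) a))"
    by (simp add: lborel_distr_plus)
  also have "\<dots> = (\<integral>\<^sup>+x. F (a + x) \<partial>lborel)"
    by (subst nn_integral_distr) auto
  finally show ?thesis by (simp add: add.commute)
qed

lemma integrable_lborel_translate:
  fixes F :: "'a::euclidean_space \<Rightarrow> 'b::{banach, second_countable_topology}"
  assumes "integrable lborel F"
  shows "integrable lborel (\<lambda>x. F (x + a))"
proof -
  have [measurable]: "F \<in> borel_measurable borel" using assms by auto
  have "integrable (distr lborel borel ((+) a)) F"
    using assms by (simp add: lborel_distr_plus)
  then show ?thesis
    by (subst (asm) integrable_distr_eq) (auto simp: add.commute)
qed

lemma lborel_distr_scale: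
  fixes c :: real
  assumes "c \<noteq> 0"
  shows "(lborel :: 'a::euclidean_space measure)
    = density (distr lborel borel (\<lambda>x. c *\<^sub>R x)) (\<lambda>_. ennreal (\<bar>c\<bar> ^ DIM('a)))"
  using lborel_affine[OF assms, of "0::'a"] by simp

lemma integral_lborel_scale:
  fixes F :: "'a::euclidean_space \<Rightarrow> 'b::{banach, second_countable_topology}"
  assumes "c \<noteq> 0" and [measurable]: "F \<in> borel_measurable borel"
  shows "(\<integral>x. F x \<partial>lborel) = (\<bar>c\<bar> ^ DIM('a)) *\<^sub>R (\<integral>x. F (c *\<^sub>R x) \<partial>lborel)"
  by (subst lborel_distr_scale[OF assms(1)], subst integral_density)
     (auto simp: integral_distr)

lemma integrable_lborel_scale:
  fixes F :: "'a::euclidean_space \<Rightarrow> 'b::{banach, second_countable_topology}"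
  assumes "c \<noteq> 0" and F: "integrable lborel F"
  shows "integrable lborel (\<lambda>x. F (c *\<^sub>R x))"
proof -
  have [measurable]: "F \<in> borel_measurable borel" using assms by auto
  have "integrable (density (distr lborel borel (\<lambda>x. c *\<^sub>R x)) (\<lambda>_. ennreal (\<bar>c\<bar> ^ DIM('a)))) F"
    using F lborel_distr_scale[OF assms(1), where 'a='a] by simp
  then have "integrable (distr lborel borel (\<lambda>x. c *\<^sub>R x)) (\<lambda>x. (\<bar>c\<bar> ^ DIM('a)) *\<^sub>R F x)"
    by (subst (asm) integrable_density) auto
  from integrable_scaleR_right[OF this, of "1 / \<bar>c\<bar> ^ DIM('a)"]
  have "integrable (distr lborel borel (\<lambda>x. c *\<^sub>R x)) F"
    using assms by simp
  then show ?thesis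
    by (subst (asm) integrable_distr_eq) auto
qed

lemma fourier_translate:
  fixes h :: "real^'d \<Rightarrow> complex"
  assumes [measurable]: "h \<in> borel_measurable borel"
  shows "fourier (\<lambda>x. h (x + a)) \<xi> = echar (- (a \<bullet> \<xi>)) * fourier h \<xi>"
proof -
  have "fourier (\<lambda>x. h (x + a)) \<xi> = (\<integral>x. h (x + a) * echar (x \<bullet> \<xi>) \<partial>lborel)"
    by (simp add: fourier_eq_lborel)
  also have "\<dots> = (\<integral>x. echar (- (a \<bullet> \<xi>)) * (h (x + a) * echar ((x + a) \<bullet> \<xi>)) \<partial>lborel)"
    by (intro Bochner_Integration.integral_cong refl)
       (simp add: inner_add_left echar_add)
  also have "\<dots> = echar (- (a \<bullet> \<xi>)) * (\<integral>x. h (x + a) * echar ((x + a) \<bullet> \<xi>) \<partial>lborel)"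
    by simp
  also have "(\<integral>x. h (x + a) * echar ((x + a) \<bullet> \<xi>) \<partial>lborel) = fourier h \<xi>"
    by (subst integral_lborel_translate) (simp add: fourier_eq_lborel)
  finally show ?thesis .
qed

lemma fourier_modulate:
  fixes h :: "real^'d \<Rightarrow> complex"
  assumes [measurable]: "h \<in> borel_measurable borel"
  shows "fourier (\<lambda>x. h x * echar (x \<bullet> a)) \<xi> = fourier h (\<xi> + a)"
  by (simp add: fourier_eq_lborel inner_add_right echar_add mult_ac)

lemma fourier_reflect:
  fixes h :: "real^'d \<Rightarrow> complex"
  assumes [measurable]: "h \<in> borel_measurable borel"
  shows "fourier (\<lambda>x. h (- x)) \<xi> = fourier h (- \<xi>)"
  using integral_lborel_scale[of "-1" "\<lambda>x. h x * echar (x \<bullet> (- \<xi>))"]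
  by (simp add: fourier_eq_lborel)

lemma fourier_cnj:
  fixes h :: "real^'d \<Rightarrow> complex"
  assumes [measurable]: "h \<in> borel_measurable borel"
  shows "fourier (\<lambda>x. cnj (h x)) \<xi> = cnj (fourier h (- \<xi>))"
proof -
  have "fourier (\<lambda>x. cnj (h x)) \<xi> = (\<integral>x. cnj (h x * echar (x \<bullet> (- \<xi>))) \<partial>lborel)"
    by (simp add: fourier_eq_lborel cnj_echar)
  also have "\<dots> = cnj (fourier h (- \<xi>))"
    by (simp only: Bochner_Integration.integral_cnj fourier_eq_lborel[OF assms])
  finally show ?thesis .
qed

section \<open>The Gaussian as its own Fourier transform\<close>

definition gauss :: "'a::euclidean_space \<Rightarrow> real" where
  "gauss x = exp (- pi * (norm x)\<^sup>2)"

lemma gauss_pos [simp]: "0 < gauss x" and gauss_nonneg [simp]: "0 \<le> gauss x"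
  and gauss_0 [simp]: "gauss 0 = 1" and gauss_minus [simp]: "gauss (- x) = gauss x"
  and gauss_le_1 [simp]: "gauss x \<le> 1"
  by (simp_all add: gauss_def)

lemma continuous_on_gauss [continuous_intros]:
  "continuous_on S f \<Longrightarrow> continuous_on S (\<lambda>x. gauss (f x))"
  unfolding gauss_def by (intro continuous_intros)

lemma borel_measurable_gauss [measurable]: "gauss \<in> borel_measurable borel"
  by (intro borel_measurable_continuous_onI continuous_intros)

text \<open>Read off from the characteristic function exp(-t^2/2) of the standard normal law at t =
  - sqrt(2 pi) s, after the substitution x -> sqrt(2 pi) x, which turns the normal density into
  \<open>gauss\<close> up to a factor.\<close>

lemma integral_gauss_echar_real:
  "integrable lborel (\<lambda>x::real. gauss x)"
  "(\<integral>x. of_real (gauss x) * echar (x * s) \<partial>lborel) = of_real (gauss s)"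
proof -
  define c where "c = sqrt (2 * pi)"
  have c: "c > 0" "c\<^sup>2 = 2 * pi" by (simp_all add: c_def)
  define F :: "real \<Rightarrow> complex" where
    "F x = of_real (std_normal_density x) * iexp ((- c * s) * x)" for x
  have [measurable]: "F \<in> borel_measurable borel" unfolding F_def by measurable
  have sq: "(c * x)\<^sup>2 / 2 = pi * x\<^sup>2" for x
    by (simp add: power_mult_distrib c)
  have std: "std_normal_density (c * x) = gauss x / c" for x
    using sq[of x] by (simp add: std_normal_density_def gauss_def c_def power_mult_distrib)
  have exp: "iexp ((- c * s) * (c * x)) = echar (x * s)" for x
  proof -
    have "(- c * s) * (c * x) = - 2 * pi * (x * s)"
      using c by (simp add: power2_eq_square algebra_simps)
    then show ?thesis by (simp only: echar_def) (simp add: algebra_simps)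
  qed
  have Fc: "F (c * x) = of_real (gauss x / c) * echar (x * s)" for x
    unfolding F_def by (simp only: std exp)
  have "of_real (gauss s) = (of_real (exp (- ((- c * s)\<^sup>2) / 2)) :: complex)"
    using c by (simp add: gauss_def power_mult_distrib)
  also have "\<dots> = char std_normal_distribution (- c * s)"
    by (simp add: char_std_normal_distribution)
  also have "\<dots> = (\<integral>x. F x \<partial>lborel)"
    unfolding char_def F_def
    by (subst integral_density) (auto simp: normal_density_nonneg scaleR_conv_of_real)
  also have "\<dots> = c *\<^sub>R (\<integral>x. F (c *\<^sub>R x) \<partial>lborel)"
    using c by (subst integral_lborel_scale[of c]) auto
  also have "\<dots> = (\<integral>x. of_real (gauss x) * echar (x * s) \<partial>lborel)"
    using c by (subst integral_scaleR_right[symmetric]) (simp add: Fc scaleR_conv_of_real)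
  finally show "(\<integral>x. of_real (gauss x) * echar (x * s) \<partial>lborel) = of_real (gauss s)" by simp
  have "integrable lborel (\<lambda>x. c * std_normal_density (c *\<^sub>R x))"
    using c by (intro integrable_mult_right integrable_lborel_scale) auto
  then show "integrable lborel (\<lambda>x::real. gauss x)"
    using c by (simp add: std)
qed

lemma gauss_sum_Basis:
  "gauss (\<Sum>b\<in>Basis. f b *\<^sub>R b :: 'a::euclidean_space) = (\<Prod>b\<in>(Basis::'a set). gauss (f b))"
proof -
  have "(norm (\<Sum>b\<in>Basis. f b *\<^sub>R b :: 'a))\<^sup>2 = (\<Sum>b\<in>(Basis::'a set). (f b)\<^sup>2)"
    by (subst norm_sum_Pythagorean)
       (auto simp: pairwise_def orthogonal_def inner_not_same_Basis power_mult_distrib)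
  then show ?thesis
    by (simp add: gauss_def sum_distrib_left flip: exp_sum)
qed

lemma echar_sum: "echar (\<Sum>b\<in>A. f b) = (\<Prod>b\<in>A. echar (f b))"
  by (induction A rule: infinite_finite_induct) (auto simp: echar_add)

text \<open>Both the Gaussian and the character are products over the coordinates of an orthonormal
  basis, so the integral factorizes into one-dimensional ones.\<close>

lemma integral_gauss_echar:
  fixes \<xi> :: "'a::euclidean_space"
  shows "integrable lborel (\<lambda>x::'a. gauss x)"
    "(\<integral>x. of_real (gauss x) * echar (x \<bullet> \<xi>) \<partial>lborel) = of_real (gauss \<xi>)"
proof -
  interpret product_sigma_finite "\<lambda>_::'a. lborel :: real measure" by standard
  let ?P = "Pi\<^sub>M Basis (\<lambda>_::'a. lborel :: real measure)"
  let ?s = "\<lambda>f. (\<Sum>b\<in>Basis. f b *\<^sub>R b) :: 'a"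
  have "integrable ?P (\<lambda>f. \<Prod>b\<in>Basis. gauss (f b))"
    by (intro product_integrable_prod) (auto intro: integral_gauss_echar_real)
  then have "integrable (distr ?P borel ?s) (\<lambda>x::'a. gauss x)"
    by (subst integrable_distr_eq) (auto simp: gauss_sum_Basis)
  then show int: "integrable lborel (\<lambda>x::'a. gauss x)"
    by (simp add: lborel_eq[where 'a='a])
  have "(\<integral>x. of_real (gauss x) * echar (x \<bullet> \<xi>) \<partial>lborel)
      = (\<integral>x. of_real (gauss x) * echar (x \<bullet> \<xi>) \<partial>(distr ?P borel ?s))"
    by (simp add: lborel_eq[where 'a='a])
  also have "\<dots> = (\<integral>f. of_real (gauss (?s f)) * echar (?s f \<bullet> \<xi>) \<partial>?P)"
    by (subst integral_distr) auto
  also have "\<dots> = (\<integral>f. (\<Prod>b\<in>Basis. of_real (gauss (f b)) * echar (f b * (b \<bullet> \<xi>))) \<partial>?P)"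
    by (simp add: gauss_sum_Basis inner_sum_left echar_sum prod.distrib)
  also have "\<dots> = (\<Prod>b\<in>Basis. (\<integral>x. of_real (gauss x) * echar (x * (b \<bullet> \<xi>)) \<partial>lborel))"
    by (intro product_integral_prod integrable_mult_echar integrable_of_real integral_gauss_echar_real) auto
  also have "\<dots> = of_real (gauss (\<Sum>b\<in>Basis. (b \<bullet> \<xi>) *\<^sub>R b))"
    by (simp add: integral_gauss_echar_real gauss_sum_Basis)
  also have "(\<Sum>b\<in>Basis. (b \<bullet> \<xi>) *\<^sub>R b) = \<xi>"
    by (simp add: euclidean_representation inner_commute[of _ \<xi>])
  finally show "(\<integral>x. of_real (gauss x) * echar (x \<bullet> \<xi>) \<partial>lborel) = of_real (gauss \<xi>)" .
qed

lemma integral_gauss: "(\<integral>x. gauss (x::'a::euclidean_space) \<partial>lborel) = 1"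
proof -
  have "of_real (\<integral>x. gauss (x::'a) \<partial>lborel) = (of_real 1 :: complex)"
    using integral_gauss_echar(2)[of "0::'a"] by (simp flip: integral_complex_of_real)
  then show ?thesis by (simp only: of_real_eq_iff)
qed

lemma nn_integral_gauss: "(\<integral>\<^sup>+x. ennreal (gauss x) \<partial>lborel) = 1"
  by (subst nn_integral_eq_integral) (auto simp: integral_gauss integral_gauss_echar)

lemma integrable_gauss_scale:
  "c \<noteq> 0 \<Longrightarrow> integrable lborel (\<lambda>x::'a::euclidean_space. gauss (c *\<^sub>R x))"
  by (rule integrable_lborel_scale) (auto intro: integral_gauss_echar)

lemma fourier_gauss_scale:
  fixes \<xi> :: "real^'d"
  assumes "r > 0"
  shows "fourier (\<lambda>x. of_real (gauss (x /\<^sub>R r))) \<xi> = of_real (r ^ CARD('d) * gauss (r *\<^sub>R \<xi>))"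
proof -
  have "fourier (\<lambda>x. of_real (gauss (x /\<^sub>R r))) \<xi>
      = (\<integral>x. of_real (gauss (x /\<^sub>R r)) * echar (x \<bullet> \<xi>) \<partial>lborel)"
    by (simp add: fourier_eq_lborel)
  also have "\<dots> = (r ^ CARD('d)) *\<^sub>R (\<integral>x. of_real (gauss (x::real^'d)) * echar (x \<bullet> (r *\<^sub>R \<xi>)) \<partial>lborel)"
    using assms by (subst integral_lborel_scale[of r]) auto
  finally show ?thesis
    by (simp add: integral_gauss_echar scaleR_conv_of_real)
qed

text \<open>Gaussian regularization of the Parseval identity; the inner integral on the right is the
  convolution of \<open>u\<close> with an approximate identity as \<open>r \<rightarrow> \<infinity>\<close>.\<close>

lemma fourier_gauss_regularized:
  fixes f u :: "real^'d \<Rightarrow> complex"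
  assumes f: "integrable lborel f" and u: "integrable lborel u" and r: "r > 0"
  shows "(\<integral>\<xi>. fourier f \<xi> * fourier u (- \<xi>) * of_real (gauss (\<xi> /\<^sub>R r)) \<partial>lborel)
    = (\<integral>x. f x * (\<integral>z. u (x + z /\<^sub>R r) * of_real (gauss z) \<partial>lborel) \<partial>lborel)"
proof -
  have [measurable]: "f \<in> borel_measurable borel" "u \<in> borel_measurable borel"
    using assms by auto
  define w where "w \<xi> = fourier u (- \<xi>) * of_real (gauss (\<xi> /\<^sub>R r))" for \<xi>
  have gi: "complex_integrable lborel (\<lambda>\<xi>::real^'d. of_real (gauss (\<xi> /\<^sub>R r)))"
    using integrable_gauss_scale[of "inverse r"] r by (intro integrable_of_real) auto
  have w: "integrable lborel w"
    using integrable_mult_fourier[OF gi, of "\<lambda>x. u (- x)"]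
    unfolding w_def by (simp add: fourier_reflect mult.commute)
  \<comment> \<open>The multiplication formula moves the transform onto the modulated Gaussian. That
    becomes a Gaussian of width 1 / r centred at y = - x, against which u(- y) is averaged near
    u(x).\<close>
  have fw: "fourier w x = (\<integral>z. u (x + z /\<^sub>R r) * of_real (gauss z) \<partial>lborel)" for x
  proof -
    have "fourier w x = (\<integral>\<xi>. fourier (\<lambda>x. u (- x)) \<xi> * (of_real (gauss (\<xi> /\<^sub>R r)) * echar (\<xi> \<bullet> x)) \<partial>lborel)"
      using w by (subst fourier_eq_lborel) (auto simp: w_def fourier_reflect mult_ac)
    also have "\<dots> = (\<integral>y. u (- y) * fourier (\<lambda>\<xi>. of_real (gauss (\<xi> /\<^sub>R r)) * echar (\<xi> \<bullet> x)) y \<partial>lborel)"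
      using integrable_lborel_scale[of "-1", OF _ u]
      by (intro fourier_multiplication_formula integrable_mult_echar gi) auto
    also have "\<dots> = (\<integral>y. u (- y) * of_real (r ^ CARD('d) * gauss (r *\<^sub>R (y + x))) \<partial>lborel)"
      using r by (simp add: fourier_modulate fourier_gauss_scale)
    also have "\<dots> = (\<integral>y. u (x - y) * of_real (r ^ CARD('d) * gauss (r *\<^sub>R y)) \<partial>lborel)"
      using integral_lborel_translate[of "\<lambda>y. u (x - y) * of_real (r ^ CARD('d) * gauss (r *\<^sub>R y))" x]
      by simp
    also have "\<dots> = (\<integral>z. u (x + z /\<^sub>R r) * of_real (gauss z) \<partial>lborel)"
      using r by (subst integral_lborel_scale[of "- inverse r"], simp, measurable)
        (simp add: power_inverse scaleR_conv_of_real[where 'a=complex] mult_ac,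
          simp add: mult.assoc mult.left_commute[of _ "complex_of_real r ^ CARD('d)"])
    finally show ?thesis .
  qed
  have "(\<integral>\<xi>. fourier f \<xi> * fourier u (- \<xi>) * of_real (gauss (\<xi> /\<^sub>R r)) \<partial>lborel)
     = (\<integral>\<xi>. fourier f \<xi> * w \<xi> \<partial>lborel)"
    by (simp add: w_def mult.assoc)
  also have "\<dots> = (\<integral>x. f x * fourier w x \<partial>lborel)"
    by (rule fourier_multiplication_formula[OF f w])
  finally show ?thesis by (simp add: fw)
qed

section \<open>Plancherel and Hausdorff--Young inequalities\<close>

text \<open>For a non-integrable \<open>f\<close> the left side has the default value 0, so the
  bound can be used before integrability is settled.\<close>

lemma integral_norm_bound_ennreal':
  fixes f :: "'a \<Rightarrow> 'b::{banach, second_countable_topology}"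
  shows "ennreal (norm (integral\<^sup>L M f)) \<le> (\<integral>\<^sup>+x. ennreal (norm (f x)) \<partial>M)"
  by (cases "integrable M f") (auto simp: integral_norm_bound_ennreal not_integrable_integral_eq)

lemma gauss_scale_tendsto:
  fixes x :: "'a::euclidean_space"
  shows "(\<lambda>n. gauss (x /\<^sub>R real (Suc n))) \<longlonglongrightarrow> 1"
proof -
  have "(\<lambda>n. inverse (real (Suc n)) *\<^sub>R x) \<longlonglongrightarrow> 0 *\<^sub>R x"
    by (intro tendsto_intros LIMSEQ_inverse_real_of_nat)
  then have "(\<lambda>n. gauss (x /\<^sub>R real (Suc n))) \<longlonglongrightarrow> gauss (0 *\<^sub>R x)"
    by (intro isCont_tendsto_compose[where g = gauss] continuous_on_interior[of UNIV] continuous_intros) auto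
  then show ?thesis by simp
qed

text \<open>Under Gaussian regularization the left side becomes an average over \<open>z\<close> of
  autocorrelations of \<open>u\<close> at distance z / r. The inequality a b \<le> a^2/2 + b^2/2 and
  translation invariance bound each of them by the right side, uniformly in r, and Fatou's lemma
  removes the regularization. Only this inequality is ever used, and the right side may be
  infinite.\<close>

lemma nn_integral_plancherel_le:
  fixes u :: "real^'d \<Rightarrow> complex"
  assumes u: "integrable lborel u"
  shows "(\<integral>\<^sup>+\<xi>. ennreal ((cmod (fourier u \<xi>))\<^sup>2) \<partial>lborel) \<le> (\<integral>\<^sup>+x. ennreal ((cmod (u x))\<^sup>2) \<partial>lborel)"
    (is "_ \<le> ?X")
proof -
  have [measurable]: "u \<in> borel_measurable borel"
    using u by auto
  define Y where "Y = (\<integral>\<^sup>+x. ennreal ((cmod (u x))\<^sup>2 / 2) \<partial>lborel)"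
  have Y: "Y + Y = ?X"
    unfolding Y_def by (subst nn_integral_add[symmetric]) (auto simp flip: ennreal_plus)
  have le: "(\<integral>\<^sup>+\<xi>. ennreal ((cmod (fourier u \<xi>))\<^sup>2 * gauss (\<xi> /\<^sub>R r)) \<partial>lborel) \<le> ?X" if r: "r > 0" for r :: real
  proof -
    have gi: "integrable lborel (\<lambda>\<xi>::real^'d. gauss (\<xi> /\<^sub>R r))"
      using integrable_gauss_scale[of "inverse r"] r by auto
    have int: "integrable lborel (\<lambda>\<xi>. (cmod (fourier u \<xi>))\<^sup>2 * gauss (\<xi> /\<^sub>R r))"
      by (rule Bochner_Integration.integrable_bound[OF integrable_mult_right[OF gi, of "(\<integral>x. cmod (u x) \<partial>lborel)\<^sup>2"]])
         (auto intro!: mult_right_mono power_mono norm_fourier_le)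
    have "of_real (\<integral>\<xi>. (cmod (fourier u \<xi>))\<^sup>2 * gauss (\<xi> /\<^sub>R r) \<partial>lborel)
       = (\<integral>\<xi>. fourier u \<xi> * fourier (\<lambda>x. cnj (u x)) (- \<xi>) * of_real (gauss (\<xi> /\<^sub>R r)) \<partial>lborel)"
      by (simp add: fourier_cnj flip: integral_complex_of_real complex_norm_square of_real_power of_real_mult)
    also have "\<dots> = (\<integral>x. u x * (\<integral>z. cnj (u (x + z /\<^sub>R r)) * of_real (gauss z) \<partial>lborel) \<partial>lborel)"
      using u r by (intro fourier_gauss_regularized) auto
    finally have eq: "of_real (\<integral>\<xi>. (cmod (fourier u \<xi>))\<^sup>2 * gauss (\<xi> /\<^sub>R r) \<partial>lborel) = \<dots>" .
    have "(\<integral>\<^sup>+\<xi>. ennreal ((cmod (fourier u \<xi>))\<^sup>2 * gauss (\<xi> /\<^sub>R r)) \<partial>lborel)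
       = ennreal (\<integral>\<xi>. (cmod (fourier u \<xi>))\<^sup>2 * gauss (\<xi> /\<^sub>R r) \<partial>lborel)"
      by (rule nn_integral_eq_integral[OF int]) auto
    also have "\<dots> \<le> ennreal (cmod (of_real (\<integral>\<xi>. (cmod (fourier u \<xi>))\<^sup>2 * gauss (\<xi> /\<^sub>R r) \<partial>lborel)))"
      by (intro ennreal_leI) simp
    also have "\<dots> \<le> (\<integral>\<^sup>+x. norm (u x * (\<integral>z. cnj (u (x + z /\<^sub>R r)) * of_real (gauss z) \<partial>lborel)) \<partial>lborel)"
      unfolding eq by (rule integral_norm_bound_ennreal')
    also have "\<dots> \<le> (\<integral>\<^sup>+x. (\<integral>\<^sup>+z. ennreal (cmod (u x)) * ennreal (cmod (u (x + z /\<^sub>R r)) * gauss z) \<partial>lborel) \<partial>lborel)"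
    proof (rule nn_integral_mono)
      fix x
      have "ennreal (norm (u x * (\<integral>z. cnj (u (x + z /\<^sub>R r)) * of_real (gauss z) \<partial>lborel)))
          = ennreal (cmod (u x)) * ennreal (norm (\<integral>z. cnj (u (x + z /\<^sub>R r)) * of_real (gauss z) \<partial>lborel))"
        by (simp add: norm_mult ennreal_mult)
      also have "\<dots> \<le> ennreal (cmod (u x)) * (\<integral>\<^sup>+z. norm (cnj (u (x + z /\<^sub>R r)) * of_real (gauss z)) \<partial>lborel)"
        by (intro mult_left_mono integral_norm_bound_ennreal') auto
      also have "\<dots> = (\<integral>\<^sup>+z. ennreal (cmod (u x)) * ennreal (cmod (u (x + z /\<^sub>R r)) * gauss z) \<partial>lborel)"
        by (subst nn_integral_cmult) (auto simp: norm_mult)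
      finally show "ennreal (norm (u x * (\<integral>z. cnj (u (x + z /\<^sub>R r)) * of_real (gauss z) \<partial>lborel))) \<le> \<dots>" .
    qed
    also have "\<dots> \<le> (\<integral>\<^sup>+x. (\<integral>\<^sup>+z. ennreal ((cmod (u x))\<^sup>2 / 2) * ennreal (gauss z)
        + ennreal ((cmod (u (x + z /\<^sub>R r)))\<^sup>2 / 2) * ennreal (gauss z) \<partial>lborel) \<partial>lborel)"
    proof (intro nn_integral_mono)
      fix x z
      let ?a = "cmod (u x)" and ?b = "cmod (u (x + z /\<^sub>R r))"
      have "0 \<le> (?a - ?b)\<^sup>2" by simp
      then have "?a * ?b \<le> ?a\<^sup>2 / 2 + ?b\<^sup>2 / 2" by (simp add: power2_diff)
      then have "?a * ?b * gauss z \<le> (?a\<^sup>2 / 2 + ?b\<^sup>2 / 2) * gauss z"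
        by (intro mult_right_mono) auto
      then show "ennreal ?a * ennreal (?b * gauss z)
         \<le> ennreal (?a\<^sup>2 / 2) * ennreal (gauss z) + ennreal (?b\<^sup>2 / 2) * ennreal (gauss z)"
        by (simp add: algebra_simps flip: ennreal_mult ennreal_plus)
    qed
    also have "\<dots> = (\<integral>\<^sup>+x. (\<integral>\<^sup>+z. ennreal ((cmod (u x))\<^sup>2 / 2) * ennreal (gauss (z::real^'d)) \<partial>lborel) \<partial>lborel)
      + (\<integral>\<^sup>+x. (\<integral>\<^sup>+z. ennreal ((cmod (u (x + z /\<^sub>R r)))\<^sup>2 / 2) * ennreal (gauss z) \<partial>lborel) \<partial>lborel)"
    proof -
      have inner: "(\<integral>\<^sup>+z. ennreal ((cmod (u x))\<^sup>2 / 2) * ennreal (gauss z)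
        + ennreal ((cmod (u (x + z /\<^sub>R r)))\<^sup>2 / 2) * ennreal (gauss z) \<partial>lborel)
        = (\<integral>\<^sup>+z. ennreal ((cmod (u x))\<^sup>2 / 2) * ennreal (gauss (z::real^'d)) \<partial>lborel)
        + (\<integral>\<^sup>+z. ennreal ((cmod (u (x + z /\<^sub>R r)))\<^sup>2 / 2) * ennreal (gauss z) \<partial>lborel)" for x
        by (rule nn_integral_add) measurable
      show ?thesis unfolding inner by (rule nn_integral_add) measurable
    qed
    also have "(\<integral>\<^sup>+x. (\<integral>\<^sup>+z. ennreal ((cmod (u x))\<^sup>2 / 2) * ennreal (gauss (z::real^'d)) \<partial>lborel) \<partial>lborel) = Y"
      unfolding Y_def
      by (subst nn_integral_cmult) (auto simp: nn_integral_gauss)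
    also have "(\<integral>\<^sup>+x. (\<integral>\<^sup>+z. ennreal ((cmod (u (x + z /\<^sub>R r)))\<^sup>2 / 2) * ennreal (gauss z) \<partial>lborel) \<partial>lborel)
        = (\<integral>\<^sup>+z. (\<integral>\<^sup>+x. ennreal ((cmod (u (x + z /\<^sub>R r)))\<^sup>2 / 2) * ennreal (gauss z) \<partial>lborel) \<partial>lborel)"
      by (rule lborel_pair.Fubini'[symmetric]) simp
    also have "\<dots> = (\<integral>\<^sup>+z. Y * ennreal (gauss (z::real^'d)) \<partial>lborel)"
      unfolding Y_def
      by (subst nn_integral_multc, simp, subst nn_integral_lborel_translate) auto
    also have "\<dots> = Y"
      by (subst nn_integral_cmult) (auto simp: nn_integral_gauss)
    finally show ?thesis using Y by simp
  qed
  have "(\<integral>\<^sup>+\<xi>. ennreal ((cmod (fourier u \<xi>))\<^sup>2) \<partial>lborel)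
     = (\<integral>\<^sup>+\<xi>. liminf (\<lambda>n. ennreal ((cmod (fourier u \<xi>))\<^sup>2 * gauss (\<xi> /\<^sub>R real (Suc n)))) \<partial>lborel)"
  proof (rule nn_integral_cong)
    fix \<xi> :: "real^'d"
    note gauss_scale_tendsto[of \<xi>]
    then have "(\<lambda>n. ennreal ((cmod (fourier u \<xi>))\<^sup>2 * gauss (\<xi> /\<^sub>R real (Suc n)))) \<longlonglongrightarrow> ennreal ((cmod (fourier u \<xi>))\<^sup>2 * 1)"
      by (intro tendsto_ennrealI tendsto_intros) simp
    from lim_imp_Liminf[OF sequentially_bot this] show "ennreal ((cmod (fourier u \<xi>))\<^sup>2) = liminf (\<lambda>n. ennreal ((cmod (fourier u \<xi>))\<^sup>2 * gauss (\<xi> /\<^sub>R real (Suc n))))"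
      by (simp del: of_nat_Suc)
  qed
  also have "\<dots> \<le> liminf (\<lambda>n. \<integral>\<^sup>+\<xi>. ennreal ((cmod (fourier u \<xi>))\<^sup>2 * gauss (\<xi> /\<^sub>R real (Suc n))) \<partial>lborel)"
    by (rule nn_integral_liminf) measurable
  also have "\<dots> \<le> liminf (\<lambda>n. ?X)"
    by (intro Liminf_mono always_eventually allI le) simp
  finally show ?thesis by (simp add: Liminf_const)
qed

text \<open>The limit r -> \<infinity> of the regularized identity: continuity and boundedness of
  \<open>u\<close> make the Gaussian averages converge pointwise under the bound \<open>B\<close>,
  while on the frequency side the assumed integrability of the product dominates. No inversion
  formula enters.\<close>

lemma fourier_parseval:
  fixes f u :: "real^'d \<Rightarrow> complex"
  assumes f: "integrable lborel f" and u: "integrable lborel u"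
    and cont: "continuous_on UNIV u" and B: "\<And>x. cmod (u x) \<le> B"
    and int: "integrable lborel (\<lambda>\<xi>. fourier f \<xi> * fourier u (- \<xi>))"
  shows "(\<integral>x. f x * u x \<partial>lborel) = (\<integral>\<xi>. fourier f \<xi> * fourier u (- \<xi>) \<partial>lborel)"
proof (rule LIMSEQ_unique)
  have [measurable]: "f \<in> borel_measurable borel" "u \<in> borel_measurable borel"
    using f u by auto
  let ?r = "\<lambda>n. real (Suc n)"
  let ?I = "\<lambda>n. \<integral>\<xi>. fourier f \<xi> * fourier u (- \<xi>) * of_real (gauss (\<xi> /\<^sub>R ?r n)) \<partial>lborel"
  show "?I \<longlonglongrightarrow> (\<integral>\<xi>. fourier f \<xi> * fourier u (- \<xi>) \<partial>lborel)"
  proof (rule integral_dominated_convergence[where w = "\<lambda>\<xi>. cmod (fourier f \<xi> * fourier u (- \<xi>))"])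
    show "AE \<xi> in lborel. (\<lambda>n. fourier f \<xi> * fourier u (- \<xi>) * of_real (gauss (\<xi> /\<^sub>R ?r n)))
        \<longlonglongrightarrow> fourier f \<xi> * fourier u (- \<xi>)"
    proof (intro AE_I2)
      fix \<xi>
      have "(\<lambda>n. fourier f \<xi> * fourier u (- \<xi>) * of_real (gauss (\<xi> /\<^sub>R ?r n)))
        \<longlonglongrightarrow> fourier f \<xi> * fourier u (- \<xi>) * of_real 1"
        by (intro tendsto_intros gauss_scale_tendsto)
      then show "(\<lambda>n. fourier f \<xi> * fourier u (- \<xi>) * of_real (gauss (\<xi> /\<^sub>R ?r n)))
        \<longlonglongrightarrow> fourier f \<xi> * fourier u (- \<xi>)" by simp
    qed
  qed (use int integrable_norm[OF int] in \<open>auto simp: norm_mult intro!: mult_left_le\<close>)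
  have eq: "?I n = (\<integral>x. f x * (\<integral>z. u (x + z /\<^sub>R ?r n) * of_real (gauss z) \<partial>lborel) \<partial>lborel)" for n
    by (rule fourier_gauss_regularized[OF f u]) simp
  have inner: "(\<lambda>n. \<integral>z. u (x + z /\<^sub>R ?r n) * of_real (gauss z) \<partial>lborel) \<longlonglongrightarrow> u x" for x
  proof -
    have "(\<lambda>n. \<integral>z. u (x + z /\<^sub>R ?r n) * of_real (gauss z) \<partial>lborel) \<longlonglongrightarrow> (\<integral>z. u x * of_real (gauss (z::real^'d)) \<partial>lborel)"
    proof (rule integral_dominated_convergence[where w = "\<lambda>z::real^'d. B * gauss z"])
      show "AE z in lborel. (\<lambda>n. u (x + z /\<^sub>R ?r n) * of_real (gauss z)) \<longlonglongrightarrow> u x * of_real (gauss z)"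
      proof (intro AE_I2 tendsto_mult tendsto_const)
        fix z
        have "(\<lambda>n. x + inverse (real (Suc n)) *\<^sub>R z) \<longlonglongrightarrow> x + 0 *\<^sub>R z"
          by (intro tendsto_intros LIMSEQ_inverse_real_of_nat)
        then show "(\<lambda>n. u (x + z /\<^sub>R ?r n)) \<longlonglongrightarrow> u x"
          using cont by (intro isCont_tendsto_compose[where g = u] continuous_on_interior[of UNIV]) auto
      qed
    qed (use B in \<open>auto simp: norm_mult integral_gauss_echar intro!: mult_right_mono\<close>)
    then show ?thesis by (simp add: integral_gauss)
  qed
  have B0: "0 \<le> B" using B[of 0] norm_ge_zero order_trans by blast
  have inner_le: "cmod (\<integral>z. u (x + z /\<^sub>R ?r n) * of_real (gauss z) \<partial>lborel) \<le> B" for x n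
  proof -
    have "cmod (\<integral>z. u (x + z /\<^sub>R ?r n) * of_real (gauss z) \<partial>lborel) \<le> (\<integral>z. B * gauss (z::real^'d) \<partial>lborel)"
      using B B0 by (intro order_trans[OF integral_norm_bound integral_mono'])
        (auto simp: norm_mult integral_gauss_echar intro!: mult_right_mono)
    then show ?thesis by (simp add: integral_gauss)
  qed
  show "?I \<longlonglongrightarrow> (\<integral>x. f x * u x \<partial>lborel)"
    unfolding eq
  proof (rule integral_dominated_convergence[where w = "\<lambda>x. cmod (f x) * B"])
    show "(\<lambda>x. f x * (\<integral>z. u (x + z /\<^sub>R ?r n) * of_real (gauss z) \<partial>lborel)) \<in> borel_measurable lborel" for n
      by (intro borel_measurable_times lborel.borel_measurable_lebesgue_integral) auto
  qed (use f in \<open>auto simp: norm_mult simp del: of_nat_Suc intro!: tendsto_intros inner mult_left_mono inner_le\<close>)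
qed

section \<open>The Hausdorff--Young inequality by real interpolation\<close>

lemma nn_integral_powr_from_0:
  assumes "-1 < a" "0 \<le> c"
  shows "(\<integral>\<^sup>+t. ennreal (t powr a) * indicator {0..c} t \<partial>lborel) = ennreal (c powr (a + 1) / (a + 1))"
  using has_integral_powr_from_0[OF assms] by (intro nn_integral_has_integral_lebesgue') auto

text \<open>Marcinkiewicz' argument between \<open>L\<^sub>1 \<rightarrow> L\<^sub>\<infinity>\<close> and \<open>L\<^sub>2 \<rightarrow> L\<^sub>2\<close>: at level \<open>t\<close> the function is cut at the
  height \<open>s\<close> that keeps the transform of its large part below \<open>t / 2\<close>.\<close>

lemma hausdorff_young_level:
  fixes u :: "real^'d \<Rightarrow> complex"
  assumes u: "integrable lborel u" and P: "2 < P" and Q: "Q = P / (P - 1)"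
    and norm: "(\<integral>\<^sup>+x. ennreal (cmod (u x) powr Q) \<partial>lborel) \<le> 1" and t: "0 < t"
  shows "(\<integral>\<^sup>+\<xi>. indicator {t..} (cmod (fourier u \<xi>)) \<partial>lborel)
    \<le> ennreal (4 / t\<^sup>2) * (\<integral>\<^sup>+x. ennreal ((cmod (u x))\<^sup>2) * indicator {..2 * cmod (u x) powr (- 1 / (P - 1))} t
        * indicator {0<..} (cmod (u x)) \<partial>lborel)"
proof -
  have [measurable]: "u \<in> borel_measurable borel" using u by auto
  \<comment> \<open>As (P - 1)(Q - 1) = 1, this height gives s^(1 - Q) = t / 2, which bounds the L_1
    norm of the part of \<open>u\<close> above \<open>s\<close>.\<close>
  define s where "s = (t / 2) powr (- (P - 1))"
  have s: "s > 0" using t by (simp add: s_def)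
  have Q1: "Q - 1 = 1 / (P - 1)" using P by (simp add: Q field_simps)
  have Q2: "Q > 1" using P by (simp add: Q field_simps)
  have sQ: "s powr (1 - Q) = t / 2"
  proof -
    have "- (P - 1) * (1 - Q) = 1" using Q1 P by (simp add: field_simps)
    then show ?thesis using t by (simp add: s_def powr_powr)
  qed
  define u1 where "u1 x = (if cmod (u x) > s then u x else 0)" for x
  define u2 where "u2 x = (if cmod (u x) > s then 0 else u x)" for x
  have [measurable]: "u1 \<in> borel_measurable borel" "u2 \<in> borel_measurable borel"
    unfolding u1_def u2_def by measurable
  have int: "integrable lborel u1" "integrable lborel u2"
    by (rule Bochner_Integration.integrable_bound[OF u]; simp add: u1_def u2_def)+
  have split: "fourier u \<xi> = fourier u1 \<xi> + fourier u2 \<xi>" for \<xi>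
  proof -
    have "u1 x + u2 x = u x" for x by (simp add: u1_def u2_def)
    then show ?thesis
      using int by (simp add: fourier_eq_lborel integrable_mult_echar flip: Bochner_Integration.integral_add distrib_right)
  qed
  have "ennreal (\<integral>x. cmod (u1 x) \<partial>lborel) = (\<integral>\<^sup>+x. ennreal (cmod (u1 x)) \<partial>lborel)"
    using int by (intro nn_integral_eq_integral[symmetric]) auto
  also have "\<dots> \<le> (\<integral>\<^sup>+x. ennreal (s powr (1 - Q)) * ennreal (cmod (u x) powr Q) \<partial>lborel)"
  proof (rule nn_integral_mono)
    fix x
    have "cmod (u x) \<le> s powr (1 - Q) * cmod (u x) powr Q" if "cmod (u x) > s"
    proof -
      have "cmod (u x) powr (1 - Q) \<le> s powr (1 - Q)"
        using that s Q2 by (intro powr_mono2') auto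
      then have "cmod (u x) powr (1 - Q) * cmod (u x) powr Q \<le> s powr (1 - Q) * cmod (u x) powr Q"
        by (intro mult_right_mono) auto
      then show ?thesis using that s by (simp flip: powr_add)
    qed
    then show "ennreal (cmod (u1 x)) \<le> ennreal (s powr (1 - Q)) * ennreal (cmod (u x) powr Q)"
      by (auto simp: u1_def simp flip: ennreal_mult intro!: ennreal_leI)
  qed
  also have "\<dots> = ennreal (s powr (1 - Q)) * (\<integral>\<^sup>+x. ennreal (cmod (u x) powr Q) \<partial>lborel)"
    by (rule nn_integral_cmult) measurable
  also have "\<dots> \<le> ennreal (s powr (1 - Q)) * 1"
    by (intro mult_left_mono norm) auto
  finally have "(\<integral>x. cmod (u1 x) \<partial>lborel) \<le> t / 2"
    using t by (simp add: sQ)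
  then have u1: "cmod (fourier u1 \<xi>) \<le> t / 2" for \<xi>
    using norm_fourier_le[of u1 \<xi>] by simp
  have "(\<integral>\<^sup>+\<xi>. indicator {t..} (cmod (fourier u \<xi>)) \<partial>lborel)
      \<le> (\<integral>\<^sup>+\<xi>. ennreal (4 / t\<^sup>2) * ennreal ((cmod (fourier u2 \<xi>))\<^sup>2) \<partial>lborel)"
  proof (rule nn_integral_mono)
    fix \<xi>
    have "1 \<le> 4 / t\<^sup>2 * (cmod (fourier u2 \<xi>))\<^sup>2" if "t \<le> cmod (fourier u \<xi>)"
    proof -
      have "t / 2 \<le> cmod (fourier u2 \<xi>)"
        using that u1[of \<xi>] norm_triangle_ineq[of "fourier u1 \<xi>" "fourier u2 \<xi>"] split[of \<xi>] by simp
      then have "(t / 2)\<^sup>2 \<le> (cmod (fourier u2 \<xi>))\<^sup>2"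
        using t by (intro power_mono) auto
      then show ?thesis using t by (simp add: field_simps)
    qed
    then show "(indicator {t..} (cmod (fourier u \<xi>)) :: ennreal) \<le> ennreal (4 / t\<^sup>2) * ennreal ((cmod (fourier u2 \<xi>))\<^sup>2)"
      by (auto simp: indicator_def simp flip: ennreal_mult ennreal_1 intro!: ennreal_leI)
  qed
  also have "\<dots> = ennreal (4 / t\<^sup>2) * (\<integral>\<^sup>+\<xi>. ennreal ((cmod (fourier u2 \<xi>))\<^sup>2) \<partial>lborel)"
    by (rule nn_integral_cmult) measurable
  also have "\<dots> \<le> ennreal (4 / t\<^sup>2) * (\<integral>\<^sup>+x. ennreal ((cmod (u2 x))\<^sup>2) \<partial>lborel)"
    by (intro mult_left_mono nn_integral_plancherel_le int) auto
  also have "\<dots> \<le> ennreal (4 / t\<^sup>2) * (\<integral>\<^sup>+x. ennreal ((cmod (u x))\<^sup>2)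
        * indicator {..2 * cmod (u x) powr (- 1 / (P - 1))} t * indicator {0<..} (cmod (u x)) \<partial>lborel)"
  proof (intro mult_left_mono nn_integral_mono)
    fix x
    \<comment> \<open>The condition |u x| \<le> s is solved for \<open>t\<close>, so that later
      \<open>t\<close> can be integrated out with \<open>x\<close> fixed.\<close>
    have "t \<le> 2 * cmod (u x) powr (- 1 / (P - 1))" if "cmod (u x) \<le> s" "u x \<noteq> 0"
    proof -
      have "s powr (- 1 / (P - 1)) \<le> cmod (u x) powr (- 1 / (P - 1))"
        using that P by (intro powr_mono2') auto
      moreover have "- (P - 1) * (- 1 / (P - 1)) = 1" using P by (simp add: divide_simps)
      then have "s powr (- 1 / (P - 1)) = t / 2"
        using t by (simp only: s_def powr_powr) simp
      ultimately show ?thesis by simp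
    qed
    then show "ennreal ((cmod (u2 x))\<^sup>2) \<le> ennreal ((cmod (u x))\<^sup>2)
        * indicator {..2 * cmod (u x) powr (- 1 / (P - 1))} t * indicator {0<..} (cmod (u x))"
      by (auto simp: u2_def indicator_def)
  qed auto
  finally show ?thesis .
qed

text \<open>Layer cake: |F u|^P is the integral of P t^(P - 1) over the levels t below |F u|. The
  level estimate replaces this by |u|^2 t^(P - 3) on t \<le> 2 |u|^(- 1/(P - 1)). For P > 2 the
  power is integrable at 0, and the result is proportional to |u| raised to 2 - (P - 2)/(P - 1) =
  Q.\<close>

lemma hausdorff_young_normalized:
  fixes u :: "real^'d \<Rightarrow> complex"
  assumes u: "integrable lborel u" and P: "2 < P" and Q: "Q = P / (P - 1)"
    and norm: "(\<integral>\<^sup>+x. ennreal (cmod (u x) powr Q) \<partial>lborel) \<le> 1"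
  shows "(\<integral>\<^sup>+\<xi>. ennreal (cmod (fourier u \<xi>) powr P) \<partial>lborel) \<le> ennreal (4 * P * 2 powr (P - 2) / (P - 2))"
proof -
  have [measurable]: "u \<in> borel_measurable borel" using u by auto
  let ?c = "\<lambda>x. 2 * cmod (u x) powr (- 1 / (P - 1))"
  have "(\<integral>\<^sup>+\<xi>. ennreal (cmod (fourier u \<xi>) powr P) \<partial>lborel)
      = (\<integral>\<^sup>+\<xi>. (\<integral>\<^sup>+t. ennreal (P * t powr (P - 1)) * indicator {0..} t * indicator {t..} (cmod (fourier u \<xi>)) \<partial>lborel) \<partial>lborel)"
  proof (rule nn_integral_cong)
    fix \<xi>
    have "(\<integral>\<^sup>+t. ennreal (P * t powr (P - 1)) * indicator {0..} t * indicator {t..} (cmod (fourier u \<xi>)) \<partial>lborel)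
        = (\<integral>\<^sup>+t. ennreal P * (ennreal (t powr (P - 1)) * indicator {0..cmod (fourier u \<xi>)} t) \<partial>lborel)"
      using P by (intro nn_integral_cong) (auto simp: indicator_def ennreal_mult)
    also have "\<dots> = ennreal P * ennreal (cmod (fourier u \<xi>) powr P / P)"
      using P by (subst nn_integral_cmult) (simp_all add: nn_integral_powr_from_0)
    also have "\<dots> = ennreal (cmod (fourier u \<xi>) powr P)"
      using P by (simp flip: ennreal_mult)
    finally show "ennreal (cmod (fourier u \<xi>) powr P) = (\<integral>\<^sup>+t. ennreal (P * t powr (P - 1)) * indicator {0..} t * indicator {t..} (cmod (fourier u \<xi>)) \<partial>lborel)" ..
  qed
  also have "\<dots> = (\<integral>\<^sup>+t. (\<integral>\<^sup>+\<xi>. ennreal (P * t powr (P - 1)) * indicator {0..} t * indicator {t..} (cmod (fourier u \<xi>)) \<partial>lborel) \<partial>lborel)"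
    by (rule lborel_pair.Fubini'[symmetric]) (simp add: indicator_def)
  also have "\<dots> \<le> (\<integral>\<^sup>+t. (\<integral>\<^sup>+x. ennreal (4 * P * t powr (P - 3)) * indicator {0..} t * (ennreal ((cmod (u x))\<^sup>2)
      * indicator {..?c x} t * indicator {0<..} (cmod (u x))) \<partial>lborel) \<partial>lborel)"
  proof (rule nn_integral_mono)
    fix t :: real
    show "(\<integral>\<^sup>+\<xi>. ennreal (P * t powr (P - 1)) * indicator {0..} t * indicator {t..} (cmod (fourier u \<xi>)) \<partial>lborel)
      \<le> (\<integral>\<^sup>+x. ennreal (4 * P * t powr (P - 3)) * indicator {0..} t * (ennreal ((cmod (u x))\<^sup>2)
      * indicator {..?c x} t * indicator {0<..} (cmod (u x))) \<partial>lborel)"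
    proof (cases "t > 0")
      case True
      have pw: "P * t powr (P - 1) * (4 / t\<^sup>2) = 4 * P * t powr (P - 3)"
        using True by (simp add: powr_diff powr_numeral power_numeral_reduce field_simps)
      have "(\<integral>\<^sup>+\<xi>. ennreal (P * t powr (P - 1)) * indicator {0..} t * indicator {t..} (cmod (fourier u \<xi>)) \<partial>lborel)
        = ennreal (P * t powr (P - 1)) * (\<integral>\<^sup>+\<xi>. indicator {t..} (cmod (fourier u \<xi>)) \<partial>lborel)"
        using True by (subst nn_integral_cmult[symmetric]) (auto simp: indicator_def)
      also have "\<dots> \<le> ennreal (P * t powr (P - 1)) * (ennreal (4 / t\<^sup>2) * (\<integral>\<^sup>+x. ennreal ((cmod (u x))\<^sup>2)
          * indicator {..?c x} t * indicator {0<..} (cmod (u x)) \<partial>lborel))"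
        by (intro mult_left_mono hausdorff_young_level[OF u P Q norm True]) auto
      also have "\<dots> = ennreal (4 * P * t powr (P - 3)) * (\<integral>\<^sup>+x. ennreal ((cmod (u x))\<^sup>2)
          * indicator {..?c x} t * indicator {0<..} (cmod (u x)) \<partial>lborel)"
        using P by (subst mult.assoc[symmetric], subst ennreal_mult[symmetric]) (simp_all only: pw, auto)
      also have "\<dots> = (\<integral>\<^sup>+x. ennreal (4 * P * t powr (P - 3)) * (ennreal ((cmod (u x))\<^sup>2)
          * indicator {..?c x} t * indicator {0<..} (cmod (u x))) \<partial>lborel)"
        by (subst nn_integral_cmult) (auto simp: indicator_def)
      finally show ?thesis using True by simp
    next
      case False
      then have "t < 0 \<or> t = 0" by auto
      then show ?thesis using P by (auto simp: indicator_def)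
    qed
  qed
  also have "\<dots> = (\<integral>\<^sup>+x. (\<integral>\<^sup>+t. ennreal (4 * P * t powr (P - 3)) * indicator {0..} t * (ennreal ((cmod (u x))\<^sup>2)
      * indicator {..?c x} t * indicator {0<..} (cmod (u x))) \<partial>lborel) \<partial>lborel)"
    by (rule lborel_pair.Fubini') (simp add: indicator_def)
  also have "\<dots> \<le> (\<integral>\<^sup>+x. ennreal (4 * P * 2 powr (P - 2) / (P - 2)) * ennreal (cmod (u x) powr Q) \<partial>lborel)"
  proof (rule nn_integral_mono)
    fix x
    show "(\<integral>\<^sup>+t. ennreal (4 * P * t powr (P - 3)) * indicator {0..} t * (ennreal ((cmod (u x))\<^sup>2)
      * indicator {..?c x} t * indicator {0<..} (cmod (u x))) \<partial>lborel)
      \<le> ennreal (4 * P * 2 powr (P - 2) / (P - 2)) * ennreal (cmod (u x) powr Q)"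
    proof (cases "u x = 0")
      case False
      let ?t = "cmod (u x)"
      have ex: "2 + (- 1 / (P - 1)) * (P - 2) = Q" using P by (simp add: Q field_simps)
      have "?t\<^sup>2 * (?c x powr (P - 2)) = 2 powr (P - 2) * (?t powr 2 * ?t powr ((- 1 / (P - 1)) * (P - 2)))"
        using False P by (simp add: powr_mult powr_powr)
      also have "\<dots> = 2 powr (P - 2) * ?t powr Q"
        by (simp only: powr_add[symmetric] ex)
      finally have pw: "?t\<^sup>2 * (?c x powr (P - 2)) = 2 powr (P - 2) * ?t powr Q" .
      have "(\<integral>\<^sup>+t. ennreal (4 * P * t powr (P - 3)) * indicator {0..} t * (ennreal ((cmod (u x))\<^sup>2)
        * indicator {..?c x} t * indicator {0<..} (cmod (u x))) \<partial>lborel)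
        = (\<integral>\<^sup>+t. ennreal (4 * P * ?t\<^sup>2) * (ennreal (t powr (P - 3)) * indicator {0..?c x} t) \<partial>lborel)"
        using False P by (intro nn_integral_cong) (auto simp: indicator_def mult_ac simp flip: ennreal_mult)
      also have "\<dots> = ennreal (4 * P * ?t\<^sup>2) * ennreal (?c x powr (P - 2) / (P - 2))"
        using P nn_integral_powr_from_0[of "P - 3" "?c x"] by (subst nn_integral_cmult) (simp_all)
      also have "\<dots> = ennreal (4 * P * (?t\<^sup>2 * ?c x powr (P - 2)) / (P - 2))"
        using P by (simp add: mult_ac flip: ennreal_mult)
      also have "\<dots> = ennreal (4 * P * 2 powr (P - 2) / (P - 2)) * ennreal (?t powr Q)"
        using P unfolding pw by (simp add: mult_ac flip: ennreal_mult)
      finally show ?thesis by simp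
    qed simp
  qed
  also have "\<dots> = ennreal (4 * P * 2 powr (P - 2) / (P - 2)) * (\<integral>\<^sup>+x. ennreal (cmod (u x) powr Q) \<partial>lborel)"
    by (rule nn_integral_cmult) measurable
  also have "\<dots> \<le> ennreal (4 * P * 2 powr (P - 2) / (P - 2)) * 1"
    by (intro mult_left_mono norm) auto
  finally show ?thesis by simp
qed

text \<open>The interpolation constant blows up as P tends to 2, hence that exponent is taken from
  the Plancherel inequality. The restriction to L_Q norm at most 1 is lifted by homogeneity where
  the inequality is applied.\<close>

theorem hausdorff_young:
  assumes "2 \<le> P" "Q = P / (P - 1)"
  obtains C :: real where "0 < C"
    "\<And>u :: real^'d \<Rightarrow> complex. integrable lborel u \<Longrightarrow> (\<integral>\<^sup>+x. ennreal (cmod (u x) powr Q) \<partial>lborel) \<le> 1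
       \<Longrightarrow> (\<integral>\<^sup>+\<xi>. ennreal (cmod (fourier u \<xi>) powr P) \<partial>lborel) \<le> ennreal C"
proof (cases "P = 2")
  case True
  show ?thesis
  proof (rule that[of 1])
    fix u :: "real^'d \<Rightarrow> complex"
    assume u: "integrable lborel u" and 1: "(\<integral>\<^sup>+x. ennreal (cmod (u x) powr Q) \<partial>lborel) \<le> 1"
    have "(\<integral>\<^sup>+\<xi>. ennreal (cmod (fourier u \<xi>) powr P) \<partial>lborel) \<le> (\<integral>\<^sup>+x. ennreal (cmod (u x) powr Q) \<partial>lborel)"
      using nn_integral_plancherel_le[OF u] assms True by simp
    then show "(\<integral>\<^sup>+\<xi>. ennreal (cmod (fourier u \<xi>) powr P) \<partial>lborel) \<le> ennreal 1"
      using 1 by simp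
  qed simp
next
  case False
  then have "2 < P" using assms by simp
  then show ?thesis
    using hausdorff_young_normalized assms(2) by (intro that[of "4 * P * 2 powr (P - 2) / (P - 2)"]) auto
qed

section \<open>Test functions and duality\<close>

text \<open>Continuity and the resulting boundedness are what the Parseval identity asks of
  \<open>u\<close>; bounded support is what makes sums over lattice translates converge against
  it.\<close>

definition test_fun :: "('a::euclidean_space \<Rightarrow> complex) \<Rightarrow> bool" where
  "test_fun u \<longleftrightarrow> continuous_on UNIV u \<and> (\<exists>R. \<forall>x. R < norm x \<longrightarrow> u x = 0)"

lemma test_fun_borel: "test_fun u \<Longrightarrow> u \<in> borel_measurable borel"
  by (auto simp: test_fun_def intro: borel_measurable_continuous_onI)

lemma test_fun_bounded:
  assumes "test_fun u"
  obtains B where "0 < B" "\<And>x. cmod (u x) \<le> B"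
proof -
  from assms obtain R where R: "\<And>x. R < norm x \<Longrightarrow> u x = 0" and c: "continuous_on UNIV u"
    by (auto simp: test_fun_def)
  have "compact (u ` cball 0 R)"
    by (intro compact_continuous_image continuous_on_subset[OF c]) auto
  then obtain B where B: "\<And>x. x \<in> cball 0 R \<Longrightarrow> cmod (u x) \<le> B"
    by (meson bounded_iff compact_imp_bounded imageI)
  have "cmod (u x) \<le> max B 1" for x
    by (cases "norm x \<le> R") (use B[of x] R[of x] in auto)
  then show ?thesis by (intro that[of "max B 1"]) auto
qed

lemma test_fun_cmult: "test_fun u \<Longrightarrow> test_fun (\<lambda>x. c * u x)"
  unfolding test_fun_def by (auto intro!: continuous_intros)

lemma integrable_bounded_support:
  fixes v :: "'a::euclidean_space \<Rightarrow> 'b::{banach, second_countable_topology}"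
  assumes [measurable]: "v \<in> borel_measurable borel"
    and B: "\<And>x. norm (v x) \<le> B" and R: "\<And>x. R < norm x \<Longrightarrow> v x = 0"
  shows "integrable lborel v"
proof (rule Bochner_Integration.integrable_bound)
  have "emeasure lborel (cball (0::'a) R) < \<infinity>"
    by (rule emeasure_bounded_finite) auto
  then show "integrable lborel (\<lambda>x::'a. B * indicator (cball 0 R) x)"
    by (intro integrable_mult_right integrable_real_indicator) auto
  have "0 \<le> B" using B[of 0] norm_ge_zero order_trans by blast
  then show "AE x in lborel. norm (v x) \<le> norm (B * indicator (cball 0 R) x)"
    using B R by (auto simp: indicator_def not_le)
qed simp

lemma test_fun_integrable: "test_fun u \<Longrightarrow> integrable lborel u"
  by (metis integrable_bounded_support test_fun_borel test_fun_bounded test_fun_def)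

lemma test_fun_integrable_powr:
  assumes u: "test_fun u" and Q: "0 < Q"
  shows "integrable lborel (\<lambda>x. cmod (u x) powr Q)"
proof -
  obtain B where B: "\<And>x. cmod (u x) \<le> B" using test_fun_bounded[OF u] by metis
  obtain R where R: "\<And>x. R < norm x \<Longrightarrow> u x = 0" using u by (auto simp: test_fun_def)
  show ?thesis
    using test_fun_borel[OF u] B R Q
    by (intro integrable_bounded_support[where B = "B powr Q" and R = R]) (auto intro!: powr_mono2)
qed

text \<open>Lebesgue measurability supplies continuous functions converging to \<open>v\<close>
  almost everywhere. Shrinking their values radially to modulus at most \<open>B\<close> and
  multiplying by the cut-off \<open>K\<close> keeps continuity, and it leaves the limit unchanged
  because \<open>v\<close> already satisfies both constraints.\<close>

lemma test_fun_approx: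
  fixes v :: "'a::euclidean_space \<Rightarrow> complex"
  assumes [measurable]: "v \<in> borel_measurable borel"
    and B: "0 < B" "\<And>x. cmod (v x) \<le> B" and R: "\<And>x. R < norm x \<Longrightarrow> v x = 0"
  obtains u where "\<And>n::nat. test_fun (u n)" "\<And>n x. cmod (u n x) \<le> B"
    "\<And>n x. R + 1 < norm x \<Longrightarrow> u n x = 0" "AE x in lborel. (\<lambda>n. u n x) \<longlonglongrightarrow> v x"
proof -
  have "v measurable_on UNIV"
    by (rule lebesgue_measurable_imp_measurable_on) (auto intro: measurable_completion)
  then obtain N g where N: "negligible N" and g: "\<And>n::nat. continuous_on UNIV (g n)"
    and lim: "\<And>x. x \<notin> N \<Longrightarrow> (\<lambda>n. g n x) \<longlonglongrightarrow> v x"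
    by (auto simp: measurable_on_def)
  define K where "K x = max 0 (min 1 (R + 1 - norm x))" for x :: 'a
  define u where "u n x = (K x * (B / max B (cmod (g n x)))) *\<^sub>R g n x" for n x
  have K: "0 \<le> K x" "K x \<le> 1" for x by (auto simp: K_def)
  show ?thesis
  proof
    show "test_fun (u n)" for n
      unfolding test_fun_def
    proof (intro conjI exI[of _ "R + 1"] allI impI)
      have "max B (cmod (g n x)) \<noteq> 0" for x using B(1) by (metis less_irrefl less_max_iff_disj)
      then show "continuous_on UNIV (u n)"
        unfolding u_def K_def by (intro continuous_intros g) auto
    qed (auto simp: u_def K_def)
    show "u n x = 0" if "R + 1 < norm x" for n x
      using that by (auto simp: u_def K_def)
    show "cmod (u n x) \<le> B" for n x
    proof -
      have "B / max B (cmod (g n x)) * cmod (g n x) \<le> B"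
        using B(1) by (auto simp: field_simps max_def)
      then have "K x * (B / max B (cmod (g n x)) * cmod (g n x)) \<le> 1 * B"
        using K[of x] B(1) by (intro mult_mono) auto
      moreover have "cmod (u n x) = K x * (B / max B (cmod (g n x)) * cmod (g n x))"
        using K[of x] B(1) by (simp add: u_def abs_mult max_def)
      ultimately show ?thesis by simp
    qed
    have "AE x in lebesgue. x \<notin> N"
      using N by (simp add: AE_not_in negligible_iff_null_sets)
    then have "AE x in lborel. x \<notin> N" by (simp add: AE_completion_iff)
    then show "AE x in lborel. (\<lambda>n. u n x) \<longlonglongrightarrow> v x"
    proof eventually_elim
      case (elim x)
      have "(\<lambda>n. u n x) \<longlonglongrightarrow> (K x * (B / max B (cmod (v x)))) *\<^sub>R v x"
        unfolding u_def by (intro tendsto_intros lim elim) (use B in auto)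
      moreover have "max B (cmod (v x)) = B" using B(2)[of x] by simp
      moreover have "K x *\<^sub>R v x = v x"
        using R[of x] by (cases "norm x \<le> R") (auto simp: K_def)
      ultimately show ?case using B(1) by simp
    qed
  qed
qed

section \<open>Norm bounds from pairings with test functions\<close>

definition locally_integrable :: "('a::euclidean_space \<Rightarrow> complex) \<Rightarrow> bool" where
  "locally_integrable e \<longleftrightarrow> (\<forall>R. integrable lborel (\<lambda>x. indicator (cball 0 R) x *\<^sub>R e x))"

lemma locally_integrable_borel:
  fixes e :: "'a::euclidean_space \<Rightarrow> complex"
  assumes "locally_integrable e"
  shows "e \<in> borel_measurable borel"
proof (rule borel_measurable_LIMSEQ_metric)
  show "(\<lambda>x. indicator (cball 0 (real n)) x *\<^sub>R e x) \<in> borel_measurable borel" for n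
  proof -
    have "integrable lborel (\<lambda>x. indicator (cball 0 (real n)) x *\<^sub>R e x)"
      using assms by (simp add: locally_integrable_def)
    from borel_measurable_integrable[OF this] show ?thesis by simp
  qed
  fix x :: 'a
  obtain n0 :: nat where "norm x \<le> real n0" using real_arch_simple by blast
  then have "eventually (\<lambda>n. indicator (cball 0 (real n)) x *\<^sub>R e x = e x) sequentially"
    by (intro eventually_sequentiallyI[of n0]) auto
  then show "(\<lambda>n. indicator (cball 0 (real n)) x *\<^sub>R e x) \<longlonglongrightarrow> e x"
    by (rule tendsto_eventually)
qed

lemma locally_integrable_mult:
  assumes e: "locally_integrable e" and [measurable]: "v \<in> borel_measurable borel"
    and B: "\<And>x. cmod (v x) \<le> B" and R: "\<And>x. R < norm x \<Longrightarrow> v x = 0"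
  shows "integrable lborel (\<lambda>x. e x * v x)"
proof (rule Bochner_Integration.integrable_bound)
  note locally_integrable_borel[OF e, measurable]
  show "integrable lborel (\<lambda>x. B *\<^sub>R (indicator (cball 0 R) x *\<^sub>R e x))"
    using e by (intro integrable_scaleR_right) (auto simp: locally_integrable_def)
  show "(\<lambda>x. e x * v x) \<in> borel_measurable lborel" by measurable
  have "0 \<le> B" using B[of undefined] norm_ge_zero order_trans by blast
  then show "AE x in lborel. norm (e x * v x) \<le> norm (B *\<^sub>R (indicator (cball 0 R) x *\<^sub>R e x))"
    using B R by (auto simp: indicator_def norm_mult not_le mult.commute[of "cmod (e _)"] intro!: mult_right_mono)
qed

text \<open>The extremal functions of L_p duality involve the phase of \<open>e\<close> and are not
  continuous. Dominated convergence carries the hypothesis on test functions over to bounded Borel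
  functions of bounded support.\<close>

lemma dual_bound_extend:
  fixes e :: "'a::euclidean_space \<Rightarrow> complex"
  assumes e: "locally_integrable e" and Q: "1 \<le> Q" and A: "0 \<le> A"
    and H: "\<And>u. test_fun u \<Longrightarrow>
        cmod (\<integral>x. e x * u x \<partial>lborel) \<le> A * (\<integral>x. cmod (u x) powr Q \<partial>lborel) powr (1 / Q)"
    and [measurable]: "v \<in> borel_measurable borel"
    and B: "0 < B" "\<And>x. cmod (v x) \<le> B" and R: "\<And>x. R < norm x \<Longrightarrow> v x = 0"
  shows "cmod (\<integral>x. e x * v x \<partial>lborel) \<le> A * (\<integral>x. cmod (v x) powr Q \<partial>lborel) powr (1 / Q)"
proof -
  note locally_integrable_borel[OF e, measurable]
  obtain u where u: "\<And>n::nat. test_fun (u n)" "\<And>n x. cmod (u n x) \<le> B"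
    "\<And>n x. R + 1 < norm x \<Longrightarrow> u n x = 0" and lim: "AE x in lborel. (\<lambda>n. u n x) \<longlonglongrightarrow> v x"
    using test_fun_approx[of v B R] B R by auto
  have [measurable]: "u n \<in> borel_measurable borel" for n by (rule test_fun_borel[OF u(1)])
  have "(\<lambda>n. \<integral>x. e x * u n x \<partial>lborel) \<longlonglongrightarrow> (\<integral>x. e x * v x \<partial>lborel)"
  proof (rule integral_dominated_convergence[where w = "\<lambda>x. norm (B *\<^sub>R (indicator (cball 0 (R + 1)) x *\<^sub>R e x))"])
    show "integrable lborel (\<lambda>x. norm (B *\<^sub>R (indicator (cball 0 (R + 1)) x *\<^sub>R e x)))"
      using e by (intro integrable_norm integrable_scaleR_right) (auto simp: locally_integrable_def)
    show "AE x in lborel. (\<lambda>n. e x * u n x) \<longlonglongrightarrow> e x * v x"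
      using lim by eventually_elim (intro tendsto_intros)
    show "AE x in lborel. norm (e x * u n x) \<le> norm (B *\<^sub>R (indicator (cball 0 (R + 1)) x *\<^sub>R e x))" for n
      using B u by (auto simp: indicator_def norm_mult not_le mult.commute[of "cmod (e _)"] intro!: mult_right_mono)
  qed measurable
  then have 1: "(\<lambda>n. cmod (\<integral>x. e x * u n x \<partial>lborel)) \<longlonglongrightarrow> cmod (\<integral>x. e x * v x \<partial>lborel)"
    by (rule tendsto_norm)
  have "(\<lambda>n. \<integral>x. cmod (u n x) powr Q \<partial>lborel) \<longlonglongrightarrow> (\<integral>x. cmod (v x) powr Q \<partial>lborel)"
  proof (rule integral_dominated_convergence[where w = "\<lambda>x. B powr Q * indicator (cball 0 (R + 1)) x"])
    have "emeasure lborel (cball (0::'a) (R + 1)) < \<infinity>"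
      by (rule emeasure_bounded_finite) auto
    then show "integrable lborel (\<lambda>x::'a. B powr Q * indicator (cball 0 (R + 1)) x)"
      by (intro integrable_mult_right integrable_real_indicator) auto
    show "AE x in lborel. (\<lambda>n. cmod (u n x) powr Q) \<longlonglongrightarrow> cmod (v x) powr Q"
      using lim by eventually_elim (use Q in \<open>intro tendsto_powr' tendsto_intros; auto\<close>)
    show "AE x in lborel. norm (cmod (u n x) powr Q) \<le> B powr Q * indicator (cball 0 (R + 1)) x" for n
      using u Q B by (auto simp: indicator_def not_le intro!: powr_mono2)
  qed measurable
  then have 2: "(\<lambda>n. A * (\<integral>x. cmod (u n x) powr Q \<partial>lborel) powr (1 / Q))
      \<longlonglongrightarrow> A * (\<integral>x. cmod (v x) powr Q \<partial>lborel) powr (1 / Q)"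
    using Q by (intro tendsto_mult tendsto_const tendsto_powr') auto
  show ?thesis
    using LIMSEQ_le[OF 1 2] H[OF u(1)] by auto
qed

lemma mult_cnj_sgn: "z * cnj (sgn z) = of_real (cmod z)"
proof (cases "z = 0")
  case False
  have "z * cnj (sgn z) = (z * cnj z) / of_real (cmod z)"
    by (simp add: sgn_div_norm scaleR_conv_of_real divide_inverse)
  also have "z * cnj z = of_real ((cmod z)\<^sup>2)" by (rule complex_norm_square[symmetric])
  finally show ?thesis using False by (simp add: power2_eq_square)
qed simp

text \<open>The extremal function of Hoelder's inequality is restricted to the set where |x| and |e
  x| are at most n. This makes the integral J of |e|^P over that set finite, so J \<le> A J^(1/Q)
  may be divided by J^(1/Q), giving J \<le> A^P. Monotone convergence then yields membership in L_P
  together with the bound.\<close>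

lemma dual_bound_Lp:
  fixes e :: "'a::euclidean_space \<Rightarrow> complex"
  assumes e: "locally_integrable e" and P: "1 < P" and Q: "Q = P / (P - 1)" and A: "0 \<le> A"
    and H: "\<And>u. test_fun u \<Longrightarrow>
        cmod (\<integral>x. e x * u x \<partial>lborel) \<le> A * (\<integral>x. cmod (u x) powr Q \<partial>lborel) powr (1 / Q)"
  shows "(\<integral>\<^sup>+x. ennreal (cmod (e x) powr P) \<partial>lborel) \<le> ennreal (A powr P)"
proof -
  note locally_integrable_borel[OF e, measurable]
  have Q1: "1 < Q" using P by (simp add: Q field_simps)
  define S where "S n = {x. norm x \<le> real n \<and> cmod (e x) \<le> real n}" for n
  have [measurable]: "S n \<in> sets borel" for n unfolding S_def by measurable
  have bound: "(\<integral>\<^sup>+x. ennreal (cmod (e x) powr P * indicator (S n) x) \<partial>lborel) \<le> ennreal (A powr P)" for n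
  proof -
    define v where "v x = indicator (S n) x *\<^sub>R (cnj (sgn (e x)) * of_real (cmod (e x) powr (P - 1)))" for x
    have [measurable]: "v \<in> borel_measurable borel" unfolding v_def sgn_div_norm by measurable
    have nv: "cmod (v x) = indicator (S n) x * cmod (e x) powr (P - 1)" for x
      using P by (auto simp: v_def norm_mult norm_sgn indicator_def)
    have ev: "e x * v x = of_real (cmod (e x) powr P * indicator (S n) x)" for x
    proof -
      have "e x * (cnj (sgn (e x)) * of_real (cmod (e x) powr (P - 1)))
          = of_real (cmod (e x) * cmod (e x) powr (P - 1))"
        by (simp add: mult_cnj_sgn flip: mult.assoc)
      also have "cmod (e x) * cmod (e x) powr (P - 1) = cmod (e x) powr P"
        by (simp add: powr_mult_base)
      finally show ?thesis by (simp add: v_def indicator_def)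
    qed
    have nvQ: "cmod (v x) powr Q = cmod (e x) powr P * indicator (S n) x" for x
    proof -
      have "(P - 1) * Q = P" using P by (simp add: Q)
      then show ?thesis by (simp add: nv indicator_def powr_powr)
    qed
    define J where "J = (\<integral>x. cmod (e x) powr P * indicator (S n) x \<partial>lborel)"
    have intJ: "integrable lborel (\<lambda>x. cmod (e x) powr P * indicator (S n) x)"
      using P by (intro integrable_bounded_support[where B = "real n powr P" and R = "real n"])
        (auto simp: S_def indicator_def intro!: powr_mono2)
    have J0: "0 \<le> J" unfolding J_def by (intro integral_nonneg_AE) auto
    have "cmod (\<integral>x. e x * v x \<partial>lborel) \<le> A * (\<integral>x. cmod (v x) powr Q \<partial>lborel) powr (1 / Q)"
    proof (rule dual_bound_extend[OF e _ A H, where B = "real n powr (P - 1) + 1" and R = "real n"])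
      show "cmod (v x) \<le> real n powr (P - 1) + 1" for x
        using P powr_mono2[of "P - 1" "cmod (e x)" "real n"]
        by (auto simp: nv indicator_def S_def intro: add_nonneg_nonneg)
    qed (use Q1 in \<open>auto simp: v_def S_def indicator_def add_nonneg_pos\<close>)
    then have "J \<le> A * J powr (1 / Q)"
      using J0 unfolding nvQ ev integral_complex_of_real J_def by simp
    then have "J \<le> A powr P"
    proof (cases "J = 0")
      case False
      then have "J > 0" using J0 by simp
      have "J powr (1 - 1 / Q) * J powr (1 / Q) = J" using \<open>J > 0\<close> by (simp flip: powr_add)
      with \<open>J \<le> A * J powr (1 / Q)\<close> have "J powr (1 - 1 / Q) * J powr (1 / Q) \<le> A * J powr (1 / Q)" by simp
      then have "J powr (1 - 1 / Q) \<le> A" using \<open>J > 0\<close> by simp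
      then have "(J powr (1 - 1 / Q)) powr P \<le> A powr P" using P by (intro powr_mono2) auto
      moreover have "(1 - 1 / Q) * P = 1" using P by (simp add: Q field_simps)
      ultimately show ?thesis using \<open>J > 0\<close> by (simp add: powr_powr)
    qed simp
    then show ?thesis
      using intJ by (subst nn_integral_eq_integral) (auto simp: J_def)
  qed
  have "(\<lambda>n. \<integral>\<^sup>+x. ennreal (cmod (e x) powr P * indicator (S n) x) \<partial>lborel)
      \<longlonglongrightarrow> (\<integral>\<^sup>+x. ennreal (cmod (e x) powr P) \<partial>lborel)"
  proof (rule nn_integral_LIMSEQ)
    show "incseq (\<lambda>n x. ennreal (cmod (e x) powr P * indicator (S n) x))"
      by (auto simp: incseq_def le_fun_def indicator_def S_def)
    fix x
    obtain n0 :: nat where n0: "max (norm x) (cmod (e x)) \<le> real n0" using real_arch_simple by blast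
    then have "eventually (\<lambda>n. ennreal (cmod (e x) powr P * indicator (S n) x) = ennreal (cmod (e x) powr P)) sequentially"
      by (intro eventually_sequentiallyI[of n0]) (auto simp: S_def)
    then show "(\<lambda>n. ennreal (cmod (e x) powr P * indicator (S n) x)) \<longlonglongrightarrow> ennreal (cmod (e x) powr P)"
      by (rule tendsto_eventually)
  qed measurable
  then show ?thesis
    by (rule LIMSEQ_le_const2) (use bound in auto)
qed

text \<open>Testing with the phase of \<open>e\<close> on the bounded set \<open>S n\<close> where
  |e| exceeds A + 1/(n + 1) gives (A + 1/(n + 1)) |S n| \<le> A |S n|, so \<open>S n\<close> is
  null.\<close>

lemma dual_bound_Linf:
  fixes e :: "'a::euclidean_space \<Rightarrow> complex"
  assumes e: "locally_integrable e" and A: "0 \<le> A"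
    and H: "\<And>u. test_fun u \<Longrightarrow>
        cmod (\<integral>x. e x * u x \<partial>lborel) \<le> A * (\<integral>x. cmod (u x) \<partial>lborel)"
  shows "AE x in lborel. cmod (e x) \<le> A"
proof -
  note locally_integrable_borel[OF e, measurable]
  define S where "S n = {x. norm x \<le> real n \<and> A + 1 / real (Suc n) < cmod (e x)}" for n
  have [measurable]: "S n \<in> sets borel" for n unfolding S_def by measurable
  have "AE x in lborel. x \<notin> S n" for n
  proof -
    define v where "v x = indicator (S n) x *\<^sub>R cnj (sgn (e x))" for x
    have [measurable]: "v \<in> borel_measurable borel" unfolding v_def sgn_div_norm by measurable
    have nv: "cmod (v x) = indicator (S n) x" for x
    proof -
      \<comment> \<open>On \<open>S n\<close> the value of \<open>e\<close> is therefore nonzero and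
        its sign has modulus 1.\<close>
      have "0 < A + 1 / real (Suc n)" using A by (simp add: add_nonneg_pos)
      then show ?thesis by (auto simp: v_def norm_sgn indicator_def S_def simp del: of_nat_Suc)
    qed
    have ev: "e x * v x = of_real (cmod (e x) * indicator (S n) x)" for x
      by (simp add: v_def indicator_def mult_cnj_sgn)
    have "cmod (\<integral>x. e x * v x \<partial>lborel) \<le> A * (\<integral>x. cmod (v x) powr 1 \<partial>lborel) powr (1 / 1)"
    proof (rule dual_bound_extend[OF e _ A, where B = "1" and R = "real n"])
      show "cmod (\<integral>x. e x * u x \<partial>lborel) \<le> A * (\<integral>x. cmod (u x) powr 1 \<partial>lborel) powr (1 / 1)" if "test_fun u" for u
        using H[OF that] by (simp add: integral_nonneg_AE)
    qed (auto simp: norm_sgn v_def S_def indicator_def)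
    then have le: "(\<integral>x. cmod (e x) * indicator (S n) x \<partial>lborel) \<le> A * (\<integral>x. indicator (S n) x \<partial>lborel)"
      unfolding nv ev integral_complex_of_real by (simp add: integral_nonneg_AE)
    have intS: "integrable lborel (indicator (S n) :: 'a \<Rightarrow> real)"
      by (intro integrable_bounded_support[where B = 1 and R = "real n"]) (auto simp: S_def indicator_def)
    have intE: "integrable lborel (\<lambda>x. cmod (e x) * indicator (S n) x)"
      using integrable_norm[OF locally_integrable_mult[OF e, of v 1 "real n"]]
      by (simp add: ev nv norm_mult, auto simp: v_def S_def indicator_def nv)
    have "(\<integral>x. (A + 1 / real (Suc n)) * indicator (S n) x \<partial>lborel) \<le> (\<integral>x. cmod (e x) * indicator (S n) x \<partial>lborel)"
      by (intro integral_mono integrable_mult_right intS intE) (auto simp: S_def indicator_def simp del: of_nat_Suc)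
    then have "(A + 1 / real (Suc n)) * (\<integral>x. indicator (S n) x \<partial>lborel) \<le> A * (\<integral>x. indicator (S n) x \<partial>lborel)"
      using le by simp
    then have "(1 / real (Suc n)) * (\<integral>x. indicator (S n) x \<partial>lborel) \<le> 0"
      by (simp add: distrib_right)
    then have "(\<integral>x. indicator (S n) x \<partial>lborel) \<le> (0::real)"
      by (simp add: divide_le_0_iff del: of_nat_Suc) 
    then have "measure lborel (S n) = 0"
      using measure_nonneg[of lborel "S n"] by simp
    moreover have "emeasure lborel (S n) < \<infinity>"
      by (rule emeasure_bounded_finite) (auto simp: S_def bounded_iff)
    ultimately have "emeasure lborel (S n) = 0"
      by (simp add: emeasure_eq_ennreal_measure)
    then show ?thesis by (intro AE_not_in) auto
  qed
  then have "AE x in lborel. \<forall>n. x \<notin> S n" by (simp add: AE_all_countable)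
  then show ?thesis
  proof eventually_elim
    case (elim x)
    show ?case
    proof (rule ccontr)
      assume "\<not> ?thesis"
      then have pos: "0 < cmod (e x) - A" by simp
      then obtain n1 where n1: "inverse (real (Suc n1)) < cmod (e x) - A" using reals_Archimedean by blast
      obtain n2 :: nat where n2: "norm x \<le> real n2" using real_arch_simple by blast
      let ?n = "max n1 n2"
      have "1 / real (Suc ?n) \<le> 1 / real (Suc n1)" by (intro divide_left_mono) auto
      then have "A + 1 / real (Suc ?n) < cmod (e x)" using n1 by (simp add: inverse_eq_divide)
      moreover have "norm x \<le> real ?n" using n2 by simp
      ultimately have "x \<in> S ?n" by (simp add: S_def)
      with elim show False by blast
    qed
  qed
qed

section \<open>Sums over the integer lattice\<close>

lemma zlattice_closed:
  "0 \<in> zlattice" "k \<in> zlattice \<Longrightarrow> l \<in> zlattice \<Longrightarrow> k + l \<in> zlattice"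
  "k \<in> zlattice \<Longrightarrow> - k \<in> zlattice" "k \<in> zlattice \<Longrightarrow> l \<in> zlattice \<Longrightarrow> k - l \<in> zlattice"
  by (auto simp: zlattice_def)

lemma countable_zlattice: "countable (zlattice :: (real^'d) set)"
proof -
  have "zlattice \<subseteq> range (\<lambda>f :: int^'d. \<chi> i. real_of_int (f $ i))"
  proof
    fix k :: "real^'d" assume "k \<in> zlattice"
    then have "k = (\<chi> i. real_of_int ((\<chi> i. \<lfloor>k $ i\<rfloor>) $ i))"
      by (simp add: vec_eq_iff zlattice_def)
    then show "k \<in> range (\<lambda>f :: int^'d. \<chi> i. real_of_int (f $ i))" by blast
  qed
  then show ?thesis by (rule countable_subset) auto
qed

lemma inner_zlattice: "k \<in> zlattice \<Longrightarrow> l \<in> zlattice \<Longrightarrow> k \<bullet> l \<in> \<int>"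
  by (auto simp: inner_vec_def zlattice_def intro!: Ints_sum Ints_mult)

text \<open>Lattice sums are treated as integrals over a counting measure, so that Tonelli and
  Fubini cover the exchange of sums with integrals.\<close>

abbreviation ZS :: "(real^'d) measure" where "ZS \<equiv> count_space zlattice"

interpretation ZS: sigma_finite_measure "ZS :: (real^'d) measure"
  by (rule sigma_finite_measure_count_space_countable[OF countable_zlattice])

interpretation ZS_lborel: pair_sigma_finite "ZS :: (real^'d) measure" "lborel :: (real^'e) measure"
  by unfold_locales

lemma measurable_ZS_pair:
  assumes "\<And>k. k \<in> zlattice \<Longrightarrow> f k \<in> borel_measurable borel"
  shows "case_prod f \<in> borel_measurable (ZS \<Otimes>\<^sub>M lborel)"
  using assms by (intro measurable_pair_measure_countable1 countable_zlattice) auto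

lemma borel_measurable_nn_integral_ZS:
  fixes f :: "real^'d \<Rightarrow> real^'e \<Rightarrow> ennreal"
  assumes "\<And>k. k \<in> zlattice \<Longrightarrow> f k \<in> borel_measurable borel"
  shows "(\<lambda>x. \<integral>\<^sup>+k. f k x \<partial>ZS) \<in> borel_measurable borel"
proof -
  have "(\<lambda>(x, k). f k x) \<in> borel_measurable (lborel \<Otimes>\<^sub>M ZS)"
    using measurable_pair_swap[OF measurable_ZS_pair[OF assms]] by simp
  then have "(\<lambda>x. \<integral>\<^sup>+k. f k x \<partial>ZS) \<in> borel_measurable lborel"
    by (rule ZS.borel_measurable_nn_integral)
  then show ?thesis by simp
qed

lemma borel_measurable_integral_ZS:
  fixes f :: "real^'d \<Rightarrow> real^'e \<Rightarrow> complex"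
  assumes "\<And>k. k \<in> zlattice \<Longrightarrow> f k \<in> borel_measurable borel"
  shows "(\<lambda>x. \<integral>k. f k x \<partial>ZS) \<in> borel_measurable borel"
proof -
  have "(\<lambda>(x, k). f k x) \<in> borel_measurable (lborel \<Otimes>\<^sub>M ZS)"
    using measurable_pair_swap[OF measurable_ZS_pair[OF assms]] by simp
  then have "(\<lambda>x. \<integral>k. f k x \<partial>ZS) \<in> borel_measurable lborel"
    by (rule ZS.borel_measurable_lebesgue_integral)
  then show ?thesis by simp
qed

lemma nn_integral_ZS_swap:
  fixes f :: "real^'d \<Rightarrow> real^'e \<Rightarrow> ennreal"
  assumes "\<And>k. k \<in> zlattice \<Longrightarrow> f k \<in> borel_measurable borel"
  shows "(\<integral>\<^sup>+x. \<integral>\<^sup>+k. f k x \<partial>ZS \<partial>lborel) = (\<integral>\<^sup>+k. \<integral>\<^sup>+x. f k x \<partial>lborel \<partial>ZS)"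
  using assms by (intro nn_integral_count_space_nn_integral countable_zlattice) auto

lemma integral_ZS_swap:
  fixes f :: "real^'d \<Rightarrow> real^'e \<Rightarrow> complex"
  assumes f: "\<And>k. k \<in> zlattice \<Longrightarrow> f k \<in> borel_measurable borel"
    and fin: "(\<integral>\<^sup>+x. \<integral>\<^sup>+k. ennreal (cmod (f k x)) \<partial>ZS \<partial>lborel) < \<infinity>"
  shows "(\<integral>x. \<integral>k. f k x \<partial>ZS \<partial>lborel) = (\<integral>k. \<integral>x. f k x \<partial>lborel \<partial>ZS)" (is ?eq)
    and "integrable lborel (\<lambda>x. \<integral>k. f k x \<partial>ZS)" (is ?int)
    and "AE x in lborel. integrable ZS (\<lambda>k. f k x)" (is ?ae)
    and "k \<in> zlattice \<Longrightarrow> integrable lborel (f k)"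
proof -
  have m: "case_prod f \<in> borel_measurable (ZS \<Otimes>\<^sub>M lborel)"
    by (rule measurable_ZS_pair[OF f])
  have "(\<integral>\<^sup>+z. ennreal (norm (case_prod f z)) \<partial>(ZS \<Otimes>\<^sub>M lborel)) =
     (\<integral>\<^sup>+k. \<integral>\<^sup>+x. ennreal (cmod (f k x)) \<partial>lborel \<partial>ZS)"
    using m by (subst lborel.nn_integral_fst[symmetric]) (auto simp: split_beta)
  also have "\<dots> < \<infinity>"
    using fin f by (subst (asm) nn_integral_ZS_swap) auto
  finally have fin': "(\<integral>\<^sup>+z. ennreal (norm (case_prod f z)) \<partial>(ZS \<Otimes>\<^sub>M lborel)) < \<infinity>" .
  have int: "integrable (ZS \<Otimes>\<^sub>M lborel) (case_prod f)"
    by (intro integrableI_bounded m fin')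
  show ?eq by (rule ZS_lborel.Fubini_integral[OF int])
  show ?int using ZS_lborel.integrable_snd[OF int] by simp
  show ?ae using ZS_lborel.AE_integrable_snd[OF int] by simp
  have "(\<integral>\<^sup>+k. \<integral>\<^sup>+x. ennreal (cmod (f k x)) \<partial>lborel \<partial>ZS) \<noteq> \<infinity>"
    using fin f by (subst (asm) nn_integral_ZS_swap) auto
  then have "AE k in ZS. (\<integral>\<^sup>+x. ennreal (cmod (f k x)) \<partial>lborel) \<noteq> \<infinity>"
    by (intro nn_integral_PInf_AE) auto
  then show "integrable lborel (f k)" if "k \<in> zlattice"
    using that f by (intro integrableI_bounded) (auto simp: AE_count_space less_top)
qed

lemma bij_betw_zlattice:
  assumes "l \<in> zlattice"
  shows "bij_betw (\<lambda>k. k + l) zlattice zlattice" "bij_betw (\<lambda>k. l - k) zlattice zlattice"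
proof -
  show "bij_betw (\<lambda>k. k + l) zlattice zlattice"
    by (rule bij_betw_byWitness[where f' = "\<lambda>k. k - l"]) (use assms in \<open>auto simp: zlattice_closed\<close>)
  show "bij_betw (\<lambda>k. l - k) zlattice zlattice"
    by (rule bij_betw_byWitness[where f' = "\<lambda>k. l - k"]) (use assms in \<open>auto simp: zlattice_closed\<close>)
qed

lemma nn_integral_ZS_reflect: "(\<integral>\<^sup>+k. f (- k) \<partial>ZS) = (\<integral>\<^sup>+k. f k \<partial>ZS)"
  using nn_integral_bij_count_space[OF bij_betw_zlattice(2)[OF zlattice_closed(1)], of f] by simp

lemma integral_ZS_translate:
  fixes f :: "real^'d \<Rightarrow> complex"
  shows "l \<in> zlattice \<Longrightarrow> (\<integral>k. f (k + l) \<partial>ZS) = (\<integral>k. f k \<partial>ZS)"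
  by (rule integral_bij_count_space[OF bij_betw_zlattice(1)])

text \<open>Half-open, unlike \<open>torus\<close>, so that the lattice translates cover every point
  exactly once and \<open>circle_emb\<close> is injective on it.\<close>

definition cube :: "(real^'d) set" where
  "cube = {x. \<forall>i. - (1/2) \<le> x $ i \<and> x $ i < 1/2}"

lemma cube_borel [measurable]: "cube \<in> sets borel"
  unfolding cube_def by measurable

lemma cube_subset_torus: "cube \<subseteq> torus"
  by (auto simp: cube_def torus_def intro: less_imp_le)

lemma emeasure_cube: "emeasure lborel (cube :: (real^'d) set) = 1"
proof (rule antisym)
  let ?h = "(\<chi> i. (1/2 :: real)) :: real^'d"
  have sub: "cube \<subseteq> cbox (- ?h) ?h" "box (- ?h) ?h \<subseteq> cube"
    by (auto simp: cube_def mem_box_cart less_imp_le)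
  have half: "?h \<bullet> b = 1/2" if "b \<in> Basis" for b
    using that by (auto simp: Basis_vec_def inner_axis)
  have "(2 * ?h) \<bullet> b = 1" if "b \<in> Basis" for b
    using half[OF that] by (simp only: mult_2 inner_add_left)
  then have one: "(\<Prod>b\<in>Basis. (2 * ?h) \<bullet> b) = 1"
    by (intro prod.neutral) blast
  have "emeasure lborel (cube :: (real^'d) set) \<le> emeasure lborel (cbox (- ?h) ?h)"
    by (rule emeasure_mono[OF sub(1)]) simp
  also have "\<dots> = 1" by (subst emeasure_lborel_cbox) (auto simp: half one)
  finally show "emeasure lborel (cube :: (real^'d) set) \<le> 1" .
  have "1 = emeasure lborel (box (- ?h) ?h)" by (subst emeasure_lborel_box) (auto simp: half one)
  also have "\<dots> \<le> emeasure lborel (cube :: (real^'d) set)" by (rule emeasure_mono[OF sub(2)]) simp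
  finally show "1 \<le> emeasure lborel (cube :: (real^'d) set)" .
qed

lemma cube_tiling: "(\<integral>\<^sup>+k. indicator cube (x + k) \<partial>ZS) = 1"
proof -
  define k0 where "k0 = (\<chi> i. (- of_int \<lfloor>x $ i + 1/2\<rfloor> :: real))"
  have k0: "k0 \<in> zlattice" by (simp add: k0_def zlattice_def)
  have "x + k \<in> cube \<longleftrightarrow> k = k0" if "k \<in> zlattice" for k
  proof -
    have "- (1/2) \<le> x $ i + k $ i \<and> x $ i + k $ i < 1/2 \<longleftrightarrow> k $ i = k0 $ i" for i
    proof -
      obtain n where n: "k $ i = of_int n"
        using \<open>k \<in> zlattice\<close> by (auto simp: zlattice_def elim: Ints_cases)
      have "- (1/2) \<le> x $ i + k $ i \<and> x $ i + k $ i < 1/2 \<longleftrightarrow> \<lfloor>x $ i + 1/2\<rfloor> = - n"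
        by (subst floor_eq_iff) (auto simp: n)
      then show ?thesis by (simp add: n k0_def) (simp flip: of_int_minus, linarith)
    qed
    then show ?thesis by (simp add: cube_def vec_eq_iff)
  qed
  then have "(\<integral>\<^sup>+k. indicator cube (x + k) \<partial>ZS) = (\<integral>\<^sup>+k. indicator {k0} k \<partial>ZS)"
    by (intro nn_integral_cong) (auto simp: indicator_def)
  also have "\<dots> = 1" using k0 by (subst nn_integral_indicator) auto
  finally show ?thesis .
qed

lemma cube_tiling_minus: "(\<integral>\<^sup>+k. indicator cube (x - k) \<partial>ZS) = 1"
  using nn_integral_ZS_reflect[of "\<lambda>k. indicator cube (x + k)"] by (simp add: cube_tiling)

text \<open>Insert the partition of unity formed by the translated cubes, exchange sum and integral,
  and move each translate back to the cube.\<close>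

lemma nn_integral_unfold:
  fixes F :: "real^'d \<Rightarrow> ennreal"
  assumes [measurable]: "F \<in> borel_measurable borel"
  shows "(\<integral>\<^sup>+x. F x \<partial>lborel) = (\<integral>\<^sup>+x. indicator cube x * (\<integral>\<^sup>+k. F (x + k) \<partial>ZS) \<partial>lborel)"
proof -
  have "(\<integral>\<^sup>+x. F x \<partial>lborel) = (\<integral>\<^sup>+x. (\<integral>\<^sup>+k. indicator cube (x + - k) \<partial>ZS) * F x \<partial>lborel)"
    by (simp add: cube_tiling_minus)
  also have "\<dots> = (\<integral>\<^sup>+x. (\<integral>\<^sup>+k. indicator cube (x + - k) * F x \<partial>ZS) \<partial>lborel)"
    by (simp add: nn_integral_multc)
  also have "\<dots> = (\<integral>\<^sup>+k. (\<integral>\<^sup>+x. indicator cube (x + - k) * F x \<partial>lborel) \<partial>ZS)"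
    by (rule nn_integral_ZS_swap) measurable
  also have "\<dots> = (\<integral>\<^sup>+k. (\<integral>\<^sup>+x. indicator cube x * F (x + k) \<partial>lborel) \<partial>ZS)"
    using nn_integral_lborel_translate[of "\<lambda>x. indicator cube (x + - k) * F x" k for k] by simp
  also have "\<dots> = (\<integral>\<^sup>+x. (\<integral>\<^sup>+k. indicator cube x * F (x + k) \<partial>ZS) \<partial>lborel)"
    by (rule nn_integral_ZS_swap[symmetric]) measurable
  also have "\<dots> = (\<integral>\<^sup>+x. indicator cube x * (\<integral>\<^sup>+k. F (x + k) \<partial>ZS) \<partial>lborel)"
    by (simp add: nn_integral_cmult)
  finally show ?thesis .
qed

lemma integral_unfold:
  fixes F :: "real^'d \<Rightarrow> complex"
  assumes F: "integrable lborel F"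
  shows "(\<integral>x. F x \<partial>lborel) = (\<integral>x. indicator cube x *\<^sub>R (\<integral>k. F (x + k) \<partial>ZS) \<partial>lborel)"
    and "integrable lborel (\<lambda>x. indicator cube x *\<^sub>R (\<integral>k. F (x + k) \<partial>ZS))"
proof -
  have [measurable]: "F \<in> borel_measurable borel" using F by auto
  let ?f = "\<lambda>k x. indicator cube x *\<^sub>R F (x + k)"
  have "(\<integral>\<^sup>+x. \<integral>\<^sup>+k. ennreal (cmod (?f k x)) \<partial>ZS \<partial>lborel)
      = (\<integral>\<^sup>+x. indicator cube x * (\<integral>\<^sup>+k. ennreal (cmod (F (x + k))) \<partial>ZS) \<partial>lborel)"
    by (intro nn_integral_cong) (auto simp: indicator_def)
  also have "\<dots> = (\<integral>\<^sup>+x. ennreal (cmod (F x)) \<partial>lborel)"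
    by (rule nn_integral_unfold[symmetric]) measurable
  also have "\<dots> < \<infinity>" using F by (simp add: integrable_iff_bounded)
  finally have fin1: "(\<integral>\<^sup>+x. \<integral>\<^sup>+k. ennreal (cmod (?f k x)) \<partial>ZS \<partial>lborel) < \<infinity>" .
  show "integrable lborel (\<lambda>x. indicator cube x *\<^sub>R (\<integral>k. F (x + k) \<partial>ZS))"
    using integral_ZS_swap(2)[OF _ fin1] by simp
  let ?g = "\<lambda>k x. indicator cube (x + - k) *\<^sub>R F x"
  have "(\<integral>\<^sup>+x. \<integral>\<^sup>+k. ennreal (cmod (?g k x)) \<partial>ZS \<partial>lborel)
     = (\<integral>\<^sup>+x. (\<integral>\<^sup>+k. indicator cube (x + - k) * ennreal (cmod (F x)) \<partial>ZS) \<partial>lborel)"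
    by (intro nn_integral_cong) (auto simp: indicator_def)
  also have "\<dots> = (\<integral>\<^sup>+x. (\<integral>\<^sup>+k. indicator cube (x + - k) \<partial>ZS) * ennreal (cmod (F x)) \<partial>lborel)"
    by (simp add: nn_integral_multc)
  also have "\<dots> = (\<integral>\<^sup>+x. ennreal (cmod (F x)) \<partial>lborel)"
    by (simp add: cube_tiling_minus)
  also have "\<dots> < \<infinity>" using F by (simp add: integrable_iff_bounded)
  finally have fin2: "(\<integral>\<^sup>+x. \<integral>\<^sup>+k. ennreal (cmod (?g k x)) \<partial>ZS \<partial>lborel) < \<infinity>" .
  have one: "(\<integral>k. ?g k x \<partial>ZS) = F x" for x
  proof -
    have "(\<integral>\<^sup>+k. indicator cube (x + - k) \<partial>ZS) = 1"
      by (simp add: cube_tiling_minus)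
    then have "has_bochner_integral ZS (\<lambda>k. indicator cube (x + - k) :: real) 1"
      by (intro has_bochner_integral_nn_integral) (auto simp: ennreal_indicator)
    then have "has_bochner_integral ZS (\<lambda>k. (indicator cube (x + - k) :: real) *\<^sub>R F x) (1 *\<^sub>R F x)"
      by (rule has_bochner_integral_scaleR_left)
    then show ?thesis by (simp add: has_bochner_integral_iff)
  qed
  have "(\<integral>x. F x \<partial>lborel) = (\<integral>x. (\<integral>k. ?g k x \<partial>ZS) \<partial>lborel)" by (simp only: one)
  also have "\<dots> = (\<integral>k. (\<integral>x. ?g k x \<partial>lborel) \<partial>ZS)"
    by (rule integral_ZS_swap(1)[OF _ fin2]) measurable
  also have "\<dots> = (\<integral>k. (\<integral>x. ?f k x \<partial>lborel) \<partial>ZS)"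
    using integral_lborel_translate[of "\<lambda>x. indicator cube (x + - k) *\<^sub>R F x" k for k] by simp
  also have "\<dots> = (\<integral>x. (\<integral>k. ?f k x \<partial>ZS) \<partial>lborel)"
    by (rule integral_ZS_swap(1)[OF _ fin1, symmetric]) measurable
  also have "\<dots> = (\<integral>x. indicator cube x *\<^sub>R (\<integral>k. F (x + k) \<partial>ZS) \<partial>lborel)" by simp
  finally show "(\<integral>x. F x \<partial>lborel) = (\<integral>x. indicator cube x *\<^sub>R (\<integral>k. F (x + k) \<partial>ZS) \<partial>lborel)" .
qed

text \<open>A lattice sum is compared with an integral by averaging over the unit cube.\<close>

lemma lattice_sum_le_integral:
  fixes F G :: "real^'d \<Rightarrow> ennreal"
  assumes [measurable]: "F \<in> borel_measurable borel" "G \<in> borel_measurable borel"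
    and le: "\<And>x t. t \<in> cube \<Longrightarrow> F x \<le> G (x + t)"
  shows "(\<integral>\<^sup>+k. F (y + k) \<partial>ZS) \<le> (\<integral>\<^sup>+x. G x \<partial>lborel)"
proof -
  have "F (y + k) \<le> (\<integral>\<^sup>+t. indicator cube t * G (y + t + k) \<partial>lborel)" for k
  proof -
    have "F (y + k) = (\<integral>\<^sup>+t. F (y + k) * indicator cube (t::real^'d) \<partial>lborel)"
      by (subst nn_integral_cmult_indicator) (auto simp: emeasure_cube)
    also have "\<dots> \<le> (\<integral>\<^sup>+t. indicator cube t * G (y + t + k) \<partial>lborel)"
      using le[of _ "y + k"] by (intro nn_integral_mono) (auto simp: indicator_def add_ac)
    finally show ?thesis .
  qed
  then have "(\<integral>\<^sup>+k. F (y + k) \<partial>ZS) \<le> (\<integral>\<^sup>+k. \<integral>\<^sup>+t. indicator cube t * G (y + t + k) \<partial>lborel \<partial>ZS)"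
    by (intro nn_integral_mono) auto
  also have "\<dots> = (\<integral>\<^sup>+t. \<integral>\<^sup>+k. indicator cube t * G (y + t + k) \<partial>ZS \<partial>lborel)"
    by (rule nn_integral_ZS_swap[symmetric]) measurable
  also have "\<dots> = (\<integral>\<^sup>+t. indicator cube t * (\<integral>\<^sup>+k. G (y + (t + k)) \<partial>ZS) \<partial>lborel)"
    by (simp add: nn_integral_cmult add.assoc)
  also have "\<dots> = (\<integral>\<^sup>+x. G (y + x) \<partial>lborel)"
    by (rule nn_integral_unfold[symmetric]) measurable
  also have "\<dots> = (\<integral>\<^sup>+x. G x \<partial>lborel)"
    using nn_integral_lborel_translate[of G y] by (simp add: add.commute)
  finally show ?thesis .
qed

text \<open>For m \<noteq> 0 a shift by \<open>t\<close> with m . t = 1/2 reverses the sign of the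
  character, while by periodicity its integral over the shifted cube equals the one over the cube.
  The integral is thus its own negative.\<close>

lemma integral_cube_echar:
  fixes m :: "real^'d"
  assumes m: "m \<in> zlattice"
  shows "(\<integral>x. indicator cube x *\<^sub>R echar (m \<bullet> x) \<partial>lborel) = (if m = 0 then 1 else 0)"
proof (cases "m = 0")
  case True
  have "(\<integral>x. indicator cube (x::real^'d) *\<^sub>R (1::complex) \<partial>lborel) = measure lborel (cube :: (real^'d) set) *\<^sub>R 1"
    by (simp add: emeasure_cube)
  then show ?thesis using True by (simp add: measure_def emeasure_cube)
next
  case False
  then obtain i where i: "m $ i \<noteq> 0" by (auto simp: vec_eq_iff)
  define t :: "real^'d" where "t = axis i (1 / (2 * m $ i))"
  have mt: "m \<bullet> t = 1/2" using i by (simp add: t_def inner_axis)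
  have e2: "echar (1/2) = -1"
  proof -
    have "echar (1/2) = exp (- (of_real pi * \<i>))" by (simp add: echar_def)
    then show ?thesis by (simp add: exp_minus mult.commute[of "of_real pi"])
  qed
  have half: "echar (m \<bullet> (x + t)) = - echar (m \<bullet> x)" for x
    by (simp only: inner_add_right echar_add mt e2) simp
  have per: "echar (m \<bullet> (x + k)) = echar (m \<bullet> x)" if "k \<in> zlattice" for x k
    using inner_zlattice[OF m that] by (simp add: inner_add_right echar_add echar_Ints)
  let ?F = "\<lambda>x. indicator cube (x - t) *\<^sub>R echar (m \<bullet> x)"
  have fin: "emeasure lborel (cube :: (real^'d) set) < \<infinity>" by (simp add: emeasure_cube)
  have int0: "integrable lborel (\<lambda>x. indicator cube x *\<^sub>R echar (m \<bullet> (x + t)))"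
    by (rule Bochner_Integration.integrable_bound[of _ "indicator cube :: _ \<Rightarrow> real"])
      (use fin in \<open>auto simp: indicator_def\<close>)
  have "integrable lborel ?F"
    using integrable_lborel_translate[OF int0, of "- t"] by simp
  note unf = integral_unfold(1)[OF this]
  have one: "(\<integral>k. ?F (x + k) \<partial>ZS) = echar (m \<bullet> x)" for x
  proof -
    have "(\<integral>\<^sup>+k. indicator cube ((x - t) + k) \<partial>ZS) = 1" by (rule cube_tiling)
    then have "has_bochner_integral ZS (\<lambda>k. indicator cube ((x - t) + k) :: real) 1"
      by (intro has_bochner_integral_nn_integral) (auto simp: ennreal_indicator)
    then have "has_bochner_integral ZS (\<lambda>k. (indicator cube ((x - t) + k) :: real) *\<^sub>R echar (m \<bullet> x)) (1 *\<^sub>R echar (m \<bullet> x))"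
      by (rule has_bochner_integral_scaleR_left)
    then have "(\<integral>k. (indicator cube ((x - t) + k) :: real) *\<^sub>R echar (m \<bullet> x) \<partial>ZS) = echar (m \<bullet> x)"
      by (simp add: has_bochner_integral_iff)
    also have "(\<integral>k. (indicator cube ((x - t) + k) :: real) *\<^sub>R echar (m \<bullet> x) \<partial>ZS) = (\<integral>k. ?F (x + k) \<partial>ZS)"
      by (intro Bochner_Integration.integral_cong refl) (subst per, auto simp: algebra_simps)
    finally show ?thesis .
  qed
  have "(\<integral>x. indicator cube x *\<^sub>R echar (m \<bullet> x) \<partial>lborel) = (\<integral>x. ?F x \<partial>lborel)"
    using unf by (simp only: one)
  also have "\<dots> = (\<integral>x. indicator cube x *\<^sub>R echar (m \<bullet> (x + t)) \<partial>lborel)"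
    using integral_lborel_translate[of ?F t] by simp
  also have "\<dots> = - (\<integral>x. indicator cube x *\<^sub>R echar (m \<bullet> x) \<partial>lborel)"
    by (simp add: half)
  finally show ?thesis using False by simp
qed

section \<open>Poisson summation\<close>

text \<open>By inner regularity the set where r > 0 is exhausted up to measure e by a compact subset
  \<open>T\<close>. On \<open>T\<close> a positive function has integral 0, so \<open>T\<close> is
  null and the whole set has measure at most e.\<close>

lemma AE_le_0_of_compact:
  fixes r :: "'a::euclidean_space \<Rightarrow> real"
  assumes [measurable]: "r \<in> borel_measurable borel" "X \<in> sets borel" and X: "bounded X"
    and int: "integrable lborel (\<lambda>x. indicator X x * r x)"
    and zero: "\<And>T. compact T \<Longrightarrow> T \<subseteq> X \<Longrightarrow> (\<integral>x. indicator T x * r x \<partial>lborel) = 0"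
  shows "AE x in lborel. x \<in> X \<longrightarrow> r x \<le> 0"
proof -
  define A where "A = {x. x \<in> X \<and> 0 < r x}"
  have A [measurable]: "A \<in> sets borel" unfolding A_def by measurable
  have "emeasure lborel A \<le> ennreal e" if e: "e > 0" for e
  proof -
    have "A \<in> sets lebesgue" by simp
    then obtain T where T: "closed T" "T \<subseteq> A" "emeasure lebesgue (A - T) < ennreal e"
      by (rule sets_lebesgue_inner_closed[of A e]) (use e in auto)
    have [measurable]: "T \<in> sets borel" using T by simp
    have "compact T"
      using T X by (auto simp: compact_eq_bounded_closed A_def intro: bounded_subset)
    then have "(\<integral>x. indicator T x * r x \<partial>lborel) = 0"
      using T by (intro zero) (auto simp: A_def)
    moreover have intT: "integrable lborel (\<lambda>x. indicator T x * r x)"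
      by (rule Bochner_Integration.integrable_bound[OF int]) (use T in \<open>auto simp: indicator_def A_def\<close>)
    moreover have "AE x in lborel. 0 \<le> indicator T x * r x"
      by (intro AE_I2) (use T in \<open>auto simp: indicator_def A_def\<close>)
    ultimately have "AE x in lborel. indicator T x * r x = 0"
      using integral_nonneg_eq_0_iff_AE by blast
    then have "AE x in lborel. x \<notin> T"
      by eventually_elim (use T in \<open>auto simp: A_def split: split_indicator_asm\<close>)
    then have T0: "emeasure lborel T = 0"
      by (subst (asm) AE_iff_measurable[of T]) auto
    have "A = T \<union> (A - T)" using T by auto
    then have "emeasure lborel A \<le> emeasure lborel T + emeasure lborel (A - T)"
      by (metis A \<open>T \<in> sets borel\<close> emeasure_subadditive sets.Diff sets_lborel)
    then show ?thesis using T T0 by simp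
  qed
  note small = this
  have "emeasure lborel A \<le> 0"
  proof (rule ennreal_le_epsilon)
    fix e :: real assume "0 < e"
    then show "emeasure lborel A \<le> 0 + ennreal e" using small[of e] by simp
  qed
  then have "AE x in lborel. x \<notin> A"
    by (intro AE_not_in) auto
  then show ?thesis by eventually_elim (auto simp: A_def)
qed

section \<open>Uniqueness of Fourier coefficients on the unit cube\<close>

lemma exp_eq_echar: "echar s = echar t \<Longrightarrow> s - t \<in> \<int>"
proof -
  assume "echar s = echar t"
  then obtain n :: int where "- 2 * of_real pi * \<i> * of_real s = - 2 * of_real pi * \<i> * of_real t + 2 * of_int n * of_real pi * \<i>"
    unfolding echar_def by (auto simp: exp_eq)
  then have "(2 * of_real pi * \<i>) * (of_real (s - t) + of_int n) = 0"
    by (simp add: algebra_simps)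
  then have "of_real (s - t) + of_int n = (0 :: complex)" by simp
  then have "of_real (s - t + of_int n) = (0 :: complex)" by simp
  then have "s - t = - of_int n" unfolding of_real_eq_0_iff by simp
  then show ?thesis by simp
qed

text \<open>The torus as a product of unit circles in complex space: trigonometric polynomials
  become polynomials in these coordinates, which brings the Stone--Weierstrass theorem for a
  Euclidean ball into play.\<close>

definition circle_emb :: "real^'d \<Rightarrow> complex^'d" where
  "circle_emb x = (\<chi> i. echar (x $ i))"

lemma circle_emb_inj:
  assumes "x \<in> cube" "y \<in> cube" "circle_emb x = circle_emb y"
  shows "x = y"
proof -
  have "x $ i = y $ i" for i
  proof -
    have "x $ i - y $ i \<in> \<int>" using assms(3) by (intro exp_eq_echar) (simp add: circle_emb_def vec_eq_iff)
    then obtain n where n: "x $ i - y $ i = of_int n" by (auto elim: Ints_cases)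
    have "- (1/2) \<le> x $ i" "x $ i < 1/2" "- (1/2) \<le> y $ i" "y $ i < 1/2" using assms(1,2) by (auto simp: cube_def)
    then have "\<bar>of_int n :: real\<bar> < 1" unfolding n[symmetric] by linarith
    then have "n = 0" by linarith
    then show ?thesis using n by simp
  qed
  then show ?thesis by (simp add: vec_eq_iff)
qed

lemma continuous_on_circle_emb: "continuous_on S circle_emb"
  unfolding circle_emb_def by (intro continuous_intros)

lemma norm_circle_emb: "norm (circle_emb (x :: real^'d)) \<le> real CARD('d)"
  unfolding norm_vec_def circle_emb_def by (rule order_trans[OF L2_set_le_sum]) auto

definition coeff_free :: "(real^'d \<Rightarrow> complex) \<Rightarrow> bool" where
  "coeff_free w \<longleftrightarrow> integrable lborel (\<lambda>x. indicator cube x *\<^sub>R w x) \<and> w \<in> borel_measurable borel \<and>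
     (\<forall>m\<in>zlattice. (\<integral>x. indicator cube x *\<^sub>R (w x * echar (m \<bullet> x)) \<partial>lborel) = 0)"

lemma coeff_free_integrable:
  assumes "coeff_free w"
  shows "integrable lborel (\<lambda>x. indicator cube x *\<^sub>R (w x * echar (m \<bullet> x)))"
  by (rule Bochner_Integration.integrable_bound[of _ "\<lambda>x. indicator cube x *\<^sub>R w x"])
     (use assms in \<open>auto simp: coeff_free_def norm_mult\<close>)

lemma coeff_free_add: "coeff_free v \<Longrightarrow> coeff_free w \<Longrightarrow> coeff_free (\<lambda>x. v x + w x)"
  using coeff_free_integrable[of v] coeff_free_integrable[of w]
  by (auto simp: coeff_free_def scaleR_add_right distrib_right)

lemma coeff_free_cmult: 
  assumes "coeff_free w" shows "coeff_free (\<lambda>x. c * w x)"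
proof -
  have "integrable lborel (\<lambda>x. c * (indicator cube x *\<^sub>R w x))"
    using assms by (intro integrable_mult_right) (auto simp: coeff_free_def)
  moreover have "(\<integral>x. indicator cube x *\<^sub>R (c * w x * echar (m \<bullet> x)) \<partial>lborel)
    = c * (\<integral>x. indicator cube x *\<^sub>R (w x * echar (m \<bullet> x)) \<partial>lborel)" for m
    by (subst integral_mult_right_zero[symmetric]) (simp add: mult.assoc)
  ultimately show ?thesis using assms by (auto simp: coeff_free_def)
qed

lemma coeff_free_sum: "finite A \<Longrightarrow> (\<And>b. b \<in> A \<Longrightarrow> coeff_free (w b)) \<Longrightarrow> coeff_free (\<lambda>x. \<Sum>b\<in>A. w b x)"
proof (induction A rule: finite_induct)
  case empty
  show ?case by (simp add: coeff_free_def)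
qed (auto intro: coeff_free_add)

lemma coeff_free_echar:
  assumes "coeff_free w" and l: "l \<in> zlattice" shows "coeff_free (\<lambda>x. w x * echar (l \<bullet> x))"
proof -
  have "w x * echar (l \<bullet> x) * echar (m \<bullet> x) = w x * echar ((l + m) \<bullet> x)" for m x
    by (simp add: inner_add_left echar_add)
  then show ?thesis
    using assms coeff_free_integrable[OF assms(1), of l] unfolding coeff_free_def
    by (simp only: zlattice_closed ball_simps) (auto simp: zlattice_closed)
qed

text \<open>The coordinates of \<open>circle_emb\<close> and their conjugates are characters, and
  multiplication by a character only shifts the Fourier coefficients. The function \<open>w\<close>
  is generalized because the case of a product applies the hypothesis for one factor to
  \<open>w\<close> times the other.\<close>

lemma coeff_free_polynomial:
  fixes w :: "real^'d \<Rightarrow> complex"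
  assumes "real_polynomial_function p" "coeff_free w"
  shows "coeff_free (\<lambda>x. w x * of_real (p (circle_emb x)))"
  using assms
proof (induction arbitrary: w rule: real_polynomial_function.induct)
  case (linear f)
  have comp: "coeff_free (\<lambda>x. w x * of_real (circle_emb x \<bullet> b))" if b: "b \<in> Basis" for b
  proof -
    obtain i u where b': "b = axis i u" "u \<in> Basis" using b by (auto simp: Basis_vec_def)
    have ax: "axis i 1 \<in> (zlattice :: (real^'d) set)" by (auto simp: zlattice_def axis_def)
    have xi: "x $ i = axis i 1 \<bullet> x" for x :: "real^'d" by (simp add: inner_axis inner_commute)
    \<comment> \<open>As a real space each complex coordinate has the basis 1, \<i>; the inner
      product with \<open>u\<close> selects the real or the imaginary part, and both are
      combinations of a character and its conjugate.\<close>
    have e: "echar (x $ i) \<bullet> u = (if u = 1 then Re (echar (x $ i)) else Im (echar (x $ i)))" for x :: "real^'d"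
      using b'(2) by (auto simp: Basis_complex_def)
    have re: "(of_real (Re z) :: complex) = z * (1/2) + cnj z * (1/2)" for z by (simp add: complex_eq_iff)
    have im: "(of_real (Im z) :: complex) = z * (1/(2*\<i>)) + cnj z * (- 1/(2*\<i>))" for z
      by (simp add: complex_eq_iff)
    have "\<exists>c1 c2. \<forall>z. of_real (if u = 1 then Re z else Im z) = z * c1 + cnj z * c2"
    proof (cases "u = 1")
      case True
      show ?thesis by (rule exI[of _ "1/2"], rule exI[of _ "1/2"]) (use re True in simp)
    next
      case False
      show ?thesis by (rule exI[of _ "1/(2*\<i>)"], rule exI[of _ "- 1/(2*\<i>)"]) (use im False in simp)
    qed
    then obtain c1 c2 where "\<And>x::real^'d. of_real (echar (x $ i) \<bullet> u) = echar (x $ i) * c1 + cnj (echar (x $ i)) * c2"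
      unfolding e by blast
    then have *: "(\<lambda>x. w x * of_real (circle_emb x \<bullet> b))
       = (\<lambda>x. c1 * (w x * echar (axis i 1 \<bullet> x)) + c2 * (w x * echar ((- axis i 1) \<bullet> x)))"
      by (simp add: fun_eq_iff circle_emb_def b' inner_axis cnj_echar xi algebra_simps)
    show ?thesis
      unfolding * by (intro coeff_free_add coeff_free_cmult coeff_free_echar linear ax zlattice_closed(3))
  qed
  interpret f: bounded_linear f by fact
  have fz: "f z = (\<Sum>b\<in>Basis. (z \<bullet> b) * f b)" for z :: "complex^'d"
  proof -
    have "f z = f (\<Sum>b\<in>Basis. (z \<bullet> b) *\<^sub>R b)" by (simp add: euclidean_representation)
    also have "\<dots> = (\<Sum>b\<in>Basis. (z \<bullet> b) * f b)" by (simp only: f.sum f.scaleR real_scaleR_def)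
    finally show ?thesis .
  qed
  have **: "(\<lambda>x. w x * of_real (f (circle_emb x))) = (\<lambda>x. \<Sum>b\<in>Basis. of_real (f b) * (w x * of_real (circle_emb x \<bullet> b)))"
  proof
    fix x
    have "w x * of_real (f (circle_emb x)) = w x * of_real (\<Sum>b\<in>Basis. (circle_emb x \<bullet> b) * f b)"
      by (subst fz) (rule refl)
    then show "w x * of_real (f (circle_emb x)) = (\<Sum>b\<in>Basis. of_real (f b) * (w x * of_real (circle_emb x \<bullet> b)))"
      by (simp add: sum_distrib_left mult_ac)
  qed
  show ?case
    unfolding ** by (intro coeff_free_sum coeff_free_cmult comp) auto
next
  case (const c)
  show ?case using coeff_free_cmult[OF const, of "of_real c"] by (simp add: mult.commute)
next
  case (add f g)
  show ?case using coeff_free_add[OF add.IH(1) add.IH(2), OF add.prems add.prems] by (simp add: distrib_left)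
next
  case (mult f g)
  show ?case using mult.IH(2)[OF mult.IH(1)[OF mult.prems]] by (simp add: mult_ac)
qed

text \<open>Polynomials approximate \<open>F\<close> uniformly on a ball containing the embedded
  torus. Replacing \<open>F\<close> by such a polynomial annihilates the integral and changes it by
  at most e times the L_1 norm of \<open>w\<close> over the cube.\<close>

lemma coeff_free_continuous:
  fixes w :: "real^'d \<Rightarrow> complex"
  assumes w: "coeff_free w" and F: "continuous_on UNIV (F :: complex^'d \<Rightarrow> real)"
  shows "(\<integral>x. indicator cube x *\<^sub>R (w x * of_real (F (circle_emb x))) \<partial>lborel) = 0" (is "?I = 0")
proof -
  have [measurable]: "w \<in> borel_measurable borel" and int: "integrable lborel (\<lambda>x. indicator cube x *\<^sub>R w x)"
    using w by (auto simp: coeff_free_def)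
  define L where "L = (\<integral>x. norm (indicator cube x *\<^sub>R w x) \<partial>lborel)"
  have L: "0 \<le> L" unfolding L_def by (intro integral_nonneg_AE) auto
  let ?S = "cball (0::complex^'d) (real CARD('d))"
  have S: "circle_emb x \<in> ?S" for x :: "real^'d" using norm_circle_emb[of x] by simp
  have [measurable]: "circle_emb \<in> (borel :: (real^'d) measure) \<rightarrow>\<^sub>M borel" "F \<in> borel_measurable borel"
    using F by (auto intro!: borel_measurable_continuous_onI continuous_on_circle_emb)
  have bnd: "cmod ?I \<le> e * L" if e: "e > 0" for e
  proof -
    obtain p where p: "real_polynomial_function p" and close: "\<And>z. z \<in> ?S \<Longrightarrow> \<bar>F z - p z\<bar> < e"
      by (rule Stone_Weierstrass_real_polynomial_function[of ?S F e])
         (use e F in \<open>auto intro: continuous_on_subset\<close>)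
    have wp: "coeff_free (\<lambda>x. w x * of_real (p (circle_emb x)))" by (rule coeff_free_polynomial[OF p w])
    have int1: "integrable lborel (\<lambda>x. indicator cube x *\<^sub>R (w x * of_real (p (circle_emb x))))"
      and zero: "(\<integral>x. indicator cube x *\<^sub>R (w x * of_real (p (circle_emb x))) \<partial>lborel) = 0"
      using wp zlattice_closed(1) by (auto simp: coeff_free_def dest!: bspec[where x = 0])
    have pm [measurable]: "p \<in> borel_measurable borel"
      using p by (intro borel_measurable_continuous_onI continuous_on_polymonial_function) (simp add: real_polynomial_function_eq)
    have eq: "indicator cube x *\<^sub>R (w x * of_real (F (circle_emb x)))
        = indicator cube x *\<^sub>R (w x * of_real (F (circle_emb x) - p (circle_emb x)))
          + indicator cube x *\<^sub>R (w x * of_real (p (circle_emb x)))" for x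
      by (simp add: algebra_simps)
    have bd: "cmod (indicator cube x *\<^sub>R (w x * of_real (F (circle_emb x) - p (circle_emb x))))
        \<le> e * norm (indicator cube x *\<^sub>R w x)" for x
      using close[OF S[of x]] by (auto simp: norm_mult indicator_def mult.commute[of e] intro!: mult_left_mono simp flip: of_real_diff)
    have int2: "integrable lborel (\<lambda>x. indicator cube x *\<^sub>R (w x * of_real (F (circle_emb x) - p (circle_emb x))))"
      using bd e by (intro Bochner_Integration.integrable_bound[OF integrable_mult_right[OF integrable_norm[OF int], of e]]) auto
    have "?I = (\<integral>x. indicator cube x *\<^sub>R (w x * of_real (F (circle_emb x) - p (circle_emb x))) \<partial>lborel)"
      unfolding eq using int1 int2 zero by (subst Bochner_Integration.integral_add) auto
    also have "cmod \<dots> \<le> (\<integral>x. e * norm (indicator cube x *\<^sub>R w x) \<partial>lborel)"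
      by (rule order_trans[OF integral_norm_bound integral_mono'[OF integrable_mult_right[OF integrable_norm[OF int]] bd]])
        (use e in auto)
    finally show ?thesis by (simp add: L_def)
  qed
  have "cmod ?I \<le> 0"
  proof (rule field_le_epsilon)
    fix e :: real assume "e > 0"
    have "cmod ?I \<le> e / (L + 1) * L"
      using \<open>e > 0\<close> L by (intro bnd) simp
    also have "\<dots> \<le> e" using \<open>e > 0\<close> L by (simp add: field_simps)
    finally show "cmod ?I \<le> 0 + e" by simp
  qed
  then show ?thesis by simp
qed

text \<open>On the cube the indicator of \<open>T\<close> is a pointwise limit of continuous
  functions of \<open>circle_emb x\<close>, formed from the distance to the image of
  \<open>T\<close>. Points outside \<open>T\<close> keep a positive distance because the embedding
  is injective on the half-open cube and the image is compact; no care at opposite faces is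
  required.\<close>

lemma coeff_free_compact:
  fixes w :: "real^'d \<Rightarrow> complex"
  assumes w: "coeff_free w" and T: "compact T" "T \<subseteq> cube"
  shows "(\<integral>x. indicator T x *\<^sub>R w x \<partial>lborel) = 0"
proof (cases "T = {}")
  case False
  have [measurable]: "w \<in> borel_measurable borel" "T \<in> sets borel" and int: "integrable lborel (\<lambda>x. indicator cube x *\<^sub>R w x)"
    using w T by (auto simp: coeff_free_def compact_imp_closed)
  define Y where "Y = circle_emb ` T"
  have Y: "compact Y" "Y \<noteq> {}"
    unfolding Y_def using T False by (auto intro: compact_continuous_image continuous_on_circle_emb)
  define F where "F n z = max 0 (1 - real n * infdist z Y)" for n z
  have contF: "continuous_on UNIV (F n)" for n unfolding F_def by (intro continuous_intros)
  have [measurable]: "circle_emb \<in> (borel :: (real^'d) measure) \<rightarrow>\<^sub>M borel" "F n \<in> borel_measurable borel" for n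
    using contF by (auto intro!: borel_measurable_continuous_onI continuous_on_circle_emb)
  have F01: "0 \<le> F n z" "F n z \<le> 1" for n z by (auto simp: F_def infdist_nonneg)
  have lim: "(\<lambda>n. F n (circle_emb x)) \<longlonglongrightarrow> indicator T x" if "x \<in> cube" for x
  proof (cases "x \<in> T")
    case True
    then have "F n (circle_emb x) = 1" for n by (simp add: F_def Y_def)
    then show ?thesis using True by simp
  next
    case False
    have "circle_emb x \<notin> Y" using False that T circle_emb_inj by (auto simp: Y_def)
    then have pos: "infdist (circle_emb x) Y > 0"
      using Y by (metis compact_imp_closed in_closed_iff_infdist_zero infdist_nonneg less_le)
    obtain n0 :: nat where "1 / infdist (circle_emb x) Y \<le> real n0" using real_arch_simple by blast
    then have n0: "1 \<le> real n0 * infdist (circle_emb x) Y" using pos by (simp add: field_simps)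
    have "F n (circle_emb x) = indicator T x" if "n \<ge> n0" for n
    proof -
      have "real n0 * infdist (circle_emb x) Y \<le> real n * infdist (circle_emb x) Y"
        using that pos by (intro mult_right_mono) auto
      then show ?thesis using n0 False by (simp add: F_def)
    qed
    then show ?thesis by (intro tendsto_eventually eventually_sequentiallyI[of n0])
  qed
  have "(\<lambda>n. \<integral>x. indicator cube x *\<^sub>R (w x * of_real (F n (circle_emb x))) \<partial>lborel) \<longlonglongrightarrow> (\<integral>x. indicator T x *\<^sub>R w x \<partial>lborel)"
  proof (rule integral_dominated_convergence[where w = "\<lambda>x. norm (indicator cube x *\<^sub>R w x)"])
    show "AE x in lborel. (\<lambda>n. indicator cube x *\<^sub>R (w x * of_real (F n (circle_emb x)))) \<longlonglongrightarrow> indicator T x *\<^sub>R w x"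
    proof (intro AE_I2)
      fix x
      show "(\<lambda>n. indicator cube x *\<^sub>R (w x * of_real (F n (circle_emb x)))) \<longlonglongrightarrow> indicator T x *\<^sub>R w x"
      proof (cases "x \<in> cube")
        case True
        have "(\<lambda>n. w x * of_real (F n (circle_emb x))) \<longlonglongrightarrow> w x * of_real (indicator T x)"
          by (intro tendsto_intros lim True)
        then show ?thesis using True by (simp add: scaleR_conv_of_real mult.commute)
      qed (use T in \<open>auto simp: indicator_def\<close>)
    qed
  qed (use int integrable_norm[OF int] F01 in \<open>auto simp: norm_mult indicator_def intro!: mult_left_le\<close>)
  then have "(\<lambda>n. 0) \<longlonglongrightarrow> (\<integral>x. indicator T x *\<^sub>R w x \<partial>lborel)"
    by (simp only: coeff_free_continuous[OF w contF])
  then show ?thesis by (simp add: LIMSEQ_const_iff)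
qed simp

text \<open>Vanishing integrals over all compact subsets give the one-sided bound Re (c w) \<le> 0
  almost everywhere; the four values 1, -1, \<i>, -\<i> of c confine both the real and the imaginary
  part to 0.\<close>

lemma fourier_coeff_unique:
  fixes w :: "real^'d \<Rightarrow> complex"
  assumes w: "coeff_free w"
  shows "AE x in lborel. x \<in> cube \<longrightarrow> w x = 0"
proof -
  have cb: "bounded (cube :: (real^'d) set)"
  proof (rule bounded_subset[OF bounded_cbox])
    show "(cube :: (real^'d) set) \<subseteq> cbox (\<chi> i. (- 1 :: real)) (\<chi> i. 1)"
    proof
      fix x :: "real^'d" assume x: "x \<in> cube"
      have "- 1 \<le> x $ i \<and> x $ i \<le> 1" for i
      proof -
        have "- (1/2) \<le> x $ i \<and> x $ i < 1/2" using x by (simp add: cube_def)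
        then show ?thesis by linarith
      qed
      then show "x \<in> cbox (\<chi> i. (- 1 :: real)) (\<chi> i. 1)" by (simp add: mem_box_cart)
    qed
  qed
  have Re: "AE x in lborel. x \<in> cube \<longrightarrow> Re (c * w x) \<le> 0" for c
  proof (rule AE_le_0_of_compact[OF _ _ cb])
    have cw: "coeff_free (\<lambda>x. c * w x)" by (rule coeff_free_cmult[OF w])
    have [measurable]: "w \<in> borel_measurable borel" using w by (simp add: coeff_free_def)
    show "(\<lambda>x. Re (c * w x)) \<in> borel_measurable borel" by measurable
    have "integrable lborel (\<lambda>x. Re (indicator cube x *\<^sub>R (c * w x)))"
      using cw by (intro integrable_Re) (simp add: coeff_free_def)
    then show "integrable lborel (\<lambda>x. indicator cube x * Re (c * w x))" by simp
    fix T :: "(real^'d) set" assume T: "compact T" "T \<subseteq> cube"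
    have [measurable]: "T \<in> sets borel" using T by (simp add: compact_imp_closed)
    have "integrable lborel (\<lambda>x. indicator T x *\<^sub>R (c * w x))"
      by (rule Bochner_Integration.integrable_bound[of _ "\<lambda>x. indicator cube x *\<^sub>R (c * w x)"])
         (use cw T in \<open>auto simp: coeff_free_def indicator_def\<close>)
    then have "(\<integral>x. Re (indicator T x *\<^sub>R (c * w x)) \<partial>lborel) = 0"
      using coeff_free_compact[OF cw T] by (subst integral_Re) auto
    then show "(\<integral>x. indicator T x * Re (c * w x) \<partial>lborel) = 0" by simp
  qed simp
  show ?thesis
    using Re[of 1] Re[of "-1"] Re[of \<i>] Re[of "-\<i>"]
    by eventually_elim (auto simp: complex_eq_iff)
qed

text \<open>Both sides are periodic and integrable over the cube with the same Fourier coefficients: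
  the periodization by unfolding, the series by orthogonality and absolute convergence. Uniqueness
  of coefficients gives equality almost everywhere, which is all that an integrable \<open>W\<close>
  without continuity allows.\<close>

theorem poisson_summation:
  fixes W :: "real^'d \<Rightarrow> complex"
  assumes W: "integrable lborel W"
    and sum: "(\<integral>\<^sup>+k. ennreal (cmod (fourier W (- k))) \<partial>ZS) < \<infinity>"
  shows "AE x in lborel. (\<integral>k. W (x + k) \<partial>ZS) = (\<integral>k. fourier W (- k) * echar (k \<bullet> x) \<partial>ZS)"
proof -
  have [measurable]: "W \<in> borel_measurable borel" using W by auto
  define b where "b k = fourier W (- k)" for k
  define V where "V x = (\<integral>k. b k * echar (k \<bullet> x) \<partial>ZS)" for x
  define U where "U x = (\<integral>k. W (x + k) \<partial>ZS)" for x
  have [measurable]: "V \<in> borel_measurable borel" "U \<in> borel_measurable borel"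
    unfolding V_def U_def by (auto intro!: borel_measurable_integral_ZS)
  have U_int: "integrable lborel (\<lambda>x. indicator cube x *\<^sub>R (U x * echar (m \<bullet> x)))"
    and U_coeff: "(\<integral>x. indicator cube x *\<^sub>R (U x * echar (m \<bullet> x)) \<partial>lborel) = b (- m)" if m: "m \<in> zlattice" for m
  proof -
    have "integrable lborel (\<lambda>x. W x * echar (m \<bullet> x))" by (intro integrable_mult_echar W) auto
    note unf = integral_unfold[OF this]
    have "W (x + k) * echar (m \<bullet> (x + k)) = W (x + k) * echar (m \<bullet> x)" if "k \<in> zlattice" for x k
      using inner_zlattice[OF m that] by (simp add: inner_add_right echar_add echar_Ints)
    then have "(\<integral>k. W (x + k) * echar (m \<bullet> (x + k)) \<partial>ZS) = (\<integral>k. W (x + k) * echar (m \<bullet> x) \<partial>ZS)" for x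
      by (intro Bochner_Integration.integral_cong) auto
    then have eq: "(\<integral>k. W (x + k) * echar (m \<bullet> (x + k)) \<partial>ZS) = U x * echar (m \<bullet> x)" for x
      by (simp add: U_def)
    show "integrable lborel (\<lambda>x. indicator cube x *\<^sub>R (U x * echar (m \<bullet> x)))"
      using unf(2) unfolding eq .
    show "(\<integral>x. indicator cube x *\<^sub>R (U x * echar (m \<bullet> x)) \<partial>lborel) = b (- m)"
      using unf(1) unfolding eq by (simp add: b_def fourier_eq_lborel inner_commute)
  qed
  have b_int: "integrable ZS b"
    using sum by (intro integrableI_bounded) (auto simp: b_def)
  have V_swap: "(\<integral>\<^sup>+x. \<integral>\<^sup>+k. ennreal (cmod (indicator cube x *\<^sub>R (b k * echar (k \<bullet> x) * echar (m \<bullet> x)))) \<partial>ZS \<partial>lborel) < \<infinity>" for m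
  proof -
    have "(\<integral>\<^sup>+x. \<integral>\<^sup>+k. ennreal (cmod (indicator cube x *\<^sub>R (b k * echar (k \<bullet> x) * echar (m \<bullet> x)))) \<partial>ZS \<partial>lborel)
      = (\<integral>\<^sup>+x. (\<integral>\<^sup>+k. ennreal (cmod (b k)) \<partial>ZS) * indicator cube (x::real^'d) \<partial>lborel)"
      by (intro nn_integral_cong) (auto simp: indicator_def norm_mult)
    also have "\<dots> = (\<integral>\<^sup>+k. ennreal (cmod (b k)) \<partial>ZS)"
      by (subst nn_integral_cmult_indicator) (auto simp: emeasure_cube)
    finally show ?thesis using sum by (simp add: b_def)
  qed
  have V_eq: "(\<integral>k. indicator cube x *\<^sub>R (b k * echar (k \<bullet> x) * echar (m \<bullet> x)) \<partial>ZS) = indicator cube x *\<^sub>R (V x * echar (m \<bullet> x))" for x m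
    by (simp add: V_def)
  have V_int: "integrable lborel (\<lambda>x. indicator cube x *\<^sub>R (V x * echar (m \<bullet> x)))" for m
    using integral_ZS_swap(2)[OF _ V_swap[of m]] unfolding V_eq by simp
  have V_coeff: "(\<integral>x. indicator cube x *\<^sub>R (V x * echar (m \<bullet> x)) \<partial>lborel) = b (- m)" if m: "m \<in> zlattice" for m
  proof -
    have "(\<integral>x. indicator cube x *\<^sub>R (V x * echar (m \<bullet> x)) \<partial>lborel)
      = (\<integral>k. \<integral>x. indicator cube x *\<^sub>R (b k * echar (k \<bullet> x) * echar (m \<bullet> x)) \<partial>lborel \<partial>ZS)"
      using integral_ZS_swap(1)[OF _ V_swap[of m]] unfolding V_eq by simp
    also have "\<dots> = (\<integral>k. (if k = - m then b (- m) else 0) \<partial>ZS)"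
    proof (intro Bochner_Integration.integral_cong refl)
      fix k :: "real^'d" assume "k \<in> space ZS"
      then have k: "k + m \<in> zlattice" using m by (simp add: zlattice_closed)
      have "(\<integral>x. indicator cube x *\<^sub>R (b k * echar (k \<bullet> x) * echar (m \<bullet> x)) \<partial>lborel)
         = (\<integral>x. b k * (indicator cube x *\<^sub>R echar ((k + m) \<bullet> x)) \<partial>lborel)"
        by (simp add: inner_add_left echar_add mult.assoc)
      also have "\<dots> = b k * (\<integral>x. indicator cube x *\<^sub>R echar ((k + m) \<bullet> x) \<partial>lborel)"
        by (rule integral_mult_right_zero)
      also have "\<dots> = (if k = - m then b (- m) else 0)"
        unfolding integral_cube_echar[OF k] by (auto simp: add_eq_0_iff2)
      finally show "(\<integral>x. indicator cube x *\<^sub>R (b k * echar (k \<bullet> x) * echar (m \<bullet> x)) \<partial>lborel) = (if k = - m then b (- m) else 0)" .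
    qed
    also have "\<dots> = (\<integral>k. indicator {- m} k *\<^sub>R b (- m) \<partial>ZS)"
      by (intro Bochner_Integration.integral_cong) (auto simp: indicator_def)
    also have "\<dots> = b (- m)"
      using zlattice_closed(3)[OF m] by (simp add: measure_count_space)
    finally show ?thesis .
  qed
  have "coeff_free (\<lambda>x. U x - V x)"
    unfolding coeff_free_def
  proof (intro conjI ballI)
    show "integrable lborel (\<lambda>x. indicator cube x *\<^sub>R (U x - V x))"
      using U_int[OF zlattice_closed(1)] V_int[of 0] by (simp add: scaleR_diff_right)
    show "(\<integral>x. indicator cube x *\<^sub>R ((U x - V x) * echar (m \<bullet> x)) \<partial>lborel) = 0" if "m \<in> zlattice" for m
      using U_int[OF that] V_int[of m] U_coeff[OF that] V_coeff[OF that]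
      by (simp add: left_diff_distrib scaleR_diff_right)
  qed measurable
  then have "AE x in lborel. x \<in> cube \<longrightarrow> U x - V x = 0" by (rule fourier_coeff_unique)
  moreover have per: "U (x + l) = U x" "V (x + l) = V x" if l: "l \<in> zlattice" for x l
  proof -
    show "U (x + l) = U x"
      using integral_ZS_translate[OF l, of "\<lambda>k. W (x + k)"] by (simp add: U_def add_ac)
    have "b k * echar (k \<bullet> (x + l)) = b k * echar (k \<bullet> x)" if "k \<in> zlattice" for k
      using inner_zlattice[OF that l] by (simp add: inner_add_right echar_add echar_Ints)
    then show "V (x + l) = V x" unfolding V_def by (intro Bochner_Integration.integral_cong) auto
  qed
  \<comment> \<open>From the cube to the whole space: unfolding expresses the integral of |U - V| as
    a lattice sum over the cube, and by periodicity each summand vanishes where U = V.\<close>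
  ultimately have "(\<integral>\<^sup>+x. indicator cube x * (\<integral>\<^sup>+k. ennreal (cmod (U (x + k) - V (x + k))) \<partial>ZS) \<partial>lborel) = 0"
  proof (subst nn_integral_0_iff_AE)
    show "(\<lambda>x. indicator cube x * (\<integral>\<^sup>+k. ennreal (cmod (U (x + k) - V (x + k))) \<partial>ZS)) \<in> borel_measurable lborel"
      by (auto intro!: borel_measurable_times_ennreal borel_measurable_nn_integral_ZS)
    assume "AE x in lborel. x \<in> cube \<longrightarrow> U x - V x = 0"
    then show "AE x in lborel. indicator cube x * (\<integral>\<^sup>+k. ennreal (cmod (U (x + k) - V (x + k))) \<partial>ZS) = 0"
    proof eventually_elim
      case (elim x)
      have "(\<integral>\<^sup>+k. ennreal (cmod (U (x + k) - V (x + k))) \<partial>ZS) = (\<integral>\<^sup>+k. ennreal (cmod (U x - V x)) \<partial>(ZS :: (real^'d) measure))"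
        by (intro nn_integral_cong) (auto simp: per)
      then show ?case using elim by (auto simp: indicator_def)
    qed
  qed
  then have "(\<integral>\<^sup>+x. ennreal (cmod (U x - V x)) \<partial>lborel) = 0"
    by (subst nn_integral_unfold) auto
  then have "AE x in lborel. ennreal (cmod (U x - V x)) = 0"
    by (subst (asm) nn_integral_0_iff_AE) auto
  then show ?thesis by eventually_elim (auto simp: U_def V_def b_def)
qed

section \<open>Powers of the inverse of a dilation matrix\<close>

definition cvec :: "real^'d \<Rightarrow> complex^'d" where
  "cvec x = (\<chi> i. of_real (x $ i))"

lemma cvec_mult: "map_matrix complex_of_real M *v cvec x = cvec (M *v x)"
  by (simp add: cvec_def vec_eq_iff matrix_vector_mult_def map_matrix_def)

lemma mat_pow_Suc: "mat_pow M (Suc j) x = M *v mat_pow M j x"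
  by (simp add: mat_pow_def)

lemma mat_pow_0 [simp]: "mat_pow M 0 x = x"
  by (simp add: mat_pow_def)

lemma linear_mat_pow: "linear (mat_pow M j)"
proof (induction j)
  case 0
  show ?case by (simp add: mat_pow_def linear_iff)
next
  case (Suc j)
  have "mat_pow M (Suc j) = (*v) M \<circ> mat_pow M j" by (simp add: mat_pow_def)
  show ?case unfolding \<open>mat_pow M (Suc j) = _\<close> by (rule linear_compose[OF Suc matrix_vector_mul_linear])
qed

lemma not_eigenvalue_ker:
  fixes M :: "real^'d^'d"
  assumes "\<not> is_eigenvalue M z" "map_matrix complex_of_real M *v v = z *s v"
  shows "v = 0"
  using assms by (auto simp: is_eigenvalue_def)

lemma matrix_inv_right_left:
  fixes M :: "real^'d^'d"
  assumes "\<not> is_eigenvalue M 0"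
  shows "M ** matrix_inv M = mat 1" "matrix_inv M ** M = mat 1" "det M \<noteq> 0"
proof -
  have "x = 0" if "M *v x = 0" for x
  proof -
    have "map_matrix complex_of_real M *v cvec x = 0 *s cvec x"
      unfolding cvec_mult that by (simp add: cvec_def vec_eq_iff)
    then have "cvec x = 0" using assms not_eigenvalue_ker by blast
    then show ?thesis by (simp add: cvec_def vec_eq_iff)
  qed
  then have "invertible M"
    unfolding invertible_left_inverse matrix_left_invertible_ker by blast
  then show "M ** matrix_inv M = mat 1" "matrix_inv M ** M = mat 1" "det M \<noteq> 0"
    using someI_ex[of "\<lambda>A. M ** A = mat 1 \<and> A ** M = mat 1"]
    by (auto simp: matrix_inv_def invertible_def simp flip: invertible_det_nz)
qed

lemma mat_pow_inverse:
  fixes M :: "real^'d^'d"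
  assumes "\<not> is_eigenvalue M 0"
  shows "mat_pow M j (mat_pow (matrix_inv M) j x) = x" "mat_pow (matrix_inv M) j (mat_pow M j x) = x"
proof -
  have *: "A ** B = mat 1 \<Longrightarrow> mat_pow A j (mat_pow B j x) = x" for A B :: "real^'d^'d"
  proof (induction j arbitrary: x)
    case (Suc j)
    have "mat_pow B (Suc j) x = mat_pow B j (B *v x)" for x
      by (simp add: mat_pow_def funpow_Suc_right del: funpow.simps)
    then show ?case
      using Suc by (simp add: mat_pow_Suc matrix_vector_mul_assoc)
  qed simp
  show "mat_pow M j (mat_pow (matrix_inv M) j x) = x" "mat_pow (matrix_inv M) j (mat_pow M j x) = x"
    using * matrix_inv_right_left[OF assms] by auto
qed

text \<open>The Taylor coefficients at \<open>0\<close> of the solution \<open>X(z)\<close> of \<open>(M - z) X(z) = b\<close> are the vectors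
  \<open>M\<^sup>-\<^sup>(\<^sup>n\<^sup>+\<^sup>1\<^sup>) b\<close>; since \<open>X\<close> has no poles in the disc of radius \<open>\<theta>\<close>, Cauchy's inequality bounds them.\<close>

lemma mat_pow_inverse_component_bound:
  fixes M :: "real^'d^'d"
  assumes \<theta>: "0 < \<theta>" "\<And>\<mu>. is_eigenvalue M \<mu> \<Longrightarrow> \<theta> < cmod \<mu>"
  shows "\<exists>B. \<forall>n. \<bar>mat_pow (matrix_inv M) (Suc n) b $ k\<bar> \<le> B / \<theta> ^ n"
proof -
  have ne: "\<not> is_eigenvalue M z" if "cmod z \<le> \<theta>" for z using \<theta>(2)[of z] that by auto
  define A where "A z = (\<chi> i j. complex_of_real (M $ i $ j) - (if i = j then z else 0))" for z
  have A_mult: "(A z *v v) $ i = (map_matrix complex_of_real M *v v) $ i - z * v $ i" for z v i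
  proof -
    have "(\<Sum>j\<in>UNIV. (if i = j then z else 0) * v $ j) = z * v $ i"
      by (simp add: if_distrib[of "\<lambda>x. x * _"] cong: if_cong)
    then show ?thesis
      by (simp add: A_def matrix_vector_mult_def map_matrix_def left_diff_distrib sum_subtractf)
  qed
  have det: "det (A z) \<noteq> 0" if "cmod z \<le> \<theta>" for z
  proof -
    have "v = 0" if v: "A z *v v = 0" for v
    proof (rule not_eigenvalue_ker[OF ne])
      show "cmod z \<le> \<theta>" by fact
      show "map_matrix complex_of_real M *v v = z *s v"
        using v A_mult[of z v] by (simp add: vec_eq_iff)
    qed
    then have "invertible (A z)"
      unfolding invertible_left_inverse matrix_left_invertible_ker by blast
    then show ?thesis by (simp add: invertible_det_nz)
  qed
  \<comment> \<open>Cramer's rule presents the solution as quotients of polynomials in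
    \<open>z\<close> whose denominator has no zero in the closed disc.\<close>
  define D where "D l z = (\<chi> i j. if j = l then complex_of_real (b $ i) else A z $ i $ j)" for l z
  define X where "X l z = det (D l z) / det (A z)" for l z
  have solve: "A z *v (\<chi> l. X l z) = cvec b" if "cmod z \<le> \<theta>" for z
  proof -
    have "(\<chi> l. X l z) = (\<chi> k. det (\<chi> i j. if j = k then cvec b $ i else A z $ i $ j) / det (A z))"
      by (simp add: X_def D_def cvec_def cong: if_cong)
    then show ?thesis using cramer[OF det[OF that]] by blast
  qed
  have holA: "(\<lambda>z. det (A z)) holomorphic_on S" for S
  proof -
    have "(\<lambda>z. A z $ i $ j) holomorphic_on S" for i j
      by (cases "i = j") (auto simp: A_def intro!: holomorphic_intros)
    then show ?thesis unfolding det_def by (intro holomorphic_intros) auto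
  qed
  have holD: "(\<lambda>z. det (D l z)) holomorphic_on S" for S l
  proof -
    have "(\<lambda>z. D l z $ i $ j) holomorphic_on S" for i j
      by (cases "j = l"; cases "i = j") (auto simp: D_def A_def intro!: holomorphic_intros)
    then show ?thesis unfolding det_def by (intro holomorphic_intros) auto
  qed
  have holX: "X l holomorphic_on cball 0 \<theta>" for l
    unfolding X_def by (intro holomorphic_intros holA holD) (auto simp: det)
  then have holX': "X l holomorphic_on ball 0 \<theta>" for l
    by (rule holomorphic_on_subset) auto
  define c where "c n l = (deriv ^^ n) (X l) 0 / fact n" for n l
  \<comment> \<open>The equation (M - z) X = b in the form M X = b + z X. Comparing Taylor
    coefficients at 0 gives M C_0 = b and M C_(n+1) = C_n.\<close>
  have eqn: "(\<Sum>j\<in>UNIV. of_real (M $ i $ j) * X j z) = of_real (b $ i) + z * X i z" if "z \<in> ball 0 \<theta>" for i z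
  proof -
    have "cmod z \<le> \<theta>" using that by simp
    from solve[OF this] have "(A z *v (\<chi> l. X l z)) $ i = of_real (b $ i)" by (simp add: cvec_def)
    then show ?thesis
      unfolding A_mult by (simp add: matrix_vector_mult_def map_matrix_def algebra_simps)
  qed
  have ball: "open (ball (0::complex) \<theta>)" "0 \<in> ball (0::complex) \<theta>" using \<theta> by auto
  have hd_sum: "(deriv ^^ n) (\<lambda>z. \<Sum>j\<in>J. of_real (r j) * X j z) 0 = (\<Sum>j\<in>J. of_real (r j) * (deriv ^^ n) (X j) 0)"
    if "finite J" for n J r
    using that
  proof (induction J rule: finite_induct)
    case empty
    show ?case by (induction n) (simp_all add: higher_deriv_const)
  next
    case (insert j J)
    have h1: "(\<lambda>z. of_real (r j) * X j z) holomorphic_on ball 0 \<theta>"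
      and h2: "(\<lambda>z. \<Sum>j\<in>J. of_real (r j) * X j z) holomorphic_on ball 0 \<theta>"
      by (intro holomorphic_intros holX')+
    have "(deriv ^^ n) (\<lambda>z. of_real (r j) * X j z) 0 = of_real (r j) * (deriv ^^ n) (X j) 0"
      by (rule higher_deriv_cmult[OF holX' ball(2,1)])
    then show ?case
      using insert higher_deriv_add[OF h1 h2 ball] by simp
  qed
  have hd_eq: "(\<Sum>j\<in>UNIV. of_real (M $ i $ j) * (deriv ^^ n) (X j) 0) = (deriv ^^ n) (\<lambda>z. of_real (b $ i) + z * X i z) 0" for n i
    unfolding hd_sum[symmetric, OF finite]
    by (rule higher_deriv_transform_within_open[OF _ _ ball]) (auto intro!: holomorphic_intros holX' eqn)
  have hd_rhs: "(deriv ^^ n) (\<lambda>z. of_real (b $ i) + z * X i z) 0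
      = (if n = 0 then of_real (b $ i) else of_nat n * (deriv ^^ (n - 1)) (X i) 0)" for n i
  proof (cases n)
    case (Suc m)
    have "(deriv ^^ n) (\<lambda>z. of_real (b $ i) + z * X i z) 0
       = (deriv ^^ n) (\<lambda>z. of_real (b $ i)) 0 + (deriv ^^ n) (\<lambda>z. z * X i z) 0"
      by (rule higher_deriv_add[OF _ _ ball]) (auto intro!: holomorphic_intros holX')
    also have "(deriv ^^ n) (\<lambda>z. of_real (b $ i)) 0 = (0 :: complex)"
      using Suc by (simp add: higher_deriv_const)
    also have "(deriv ^^ n) (\<lambda>z. z * X i z) 0
       = (\<Sum>l = 0..n. of_nat (n choose l) * (deriv ^^ l) (\<lambda>w. w) 0 * (deriv ^^ (n - l)) (X i) 0)"
      by (rule higher_deriv_mult[OF _ holX' ball]) (intro holomorphic_intros)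
    \<comment> \<open>In Leibniz' rule at 0 only the first derivative of the identity is nonzero;
      the term l = 0 carries the value 0 of the identity itself.\<close>
    also have "\<dots> = (\<Sum>l\<in>{1}. of_nat (n choose l) * (deriv ^^ l) (\<lambda>w. w) 0 * (deriv ^^ (n - l)) (X i) 0)"
      using Suc by (intro sum.mono_neutral_right) (auto simp: higher_deriv_ident simp del: funpow.simps)
    also have "\<dots> = of_nat n * (deriv ^^ (n - 1)) (X i) 0"
      by simp
    finally show ?thesis using Suc by simp
  qed simp
  define C where "C n = (\<chi> l. c n l)" for n
  have rec: "map_matrix complex_of_real M *v C 0 = cvec b" "map_matrix complex_of_real M *v C (Suc n) = C n" for n
  proof -
    show "map_matrix complex_of_real M *v C 0 = cvec b"
      using hd_eq[of _ 0] unfolding hd_rhs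
      by (simp add: vec_eq_iff matrix_vector_mult_def map_matrix_def C_def c_def cvec_def)
    have "(\<Sum>j\<in>UNIV. of_real (M $ i $ j) * c (Suc n) j) = c n i" for i
    proof -
      have "(\<Sum>j\<in>UNIV. of_real (M $ i $ j) * c (Suc n) j)
         = (\<Sum>j\<in>UNIV. of_real (M $ i $ j) * (deriv ^^ Suc n) (X j) 0) / fact (Suc n)"
        by (simp add: c_def sum_divide_distrib del: funpow.simps fact_Suc)
      also have "\<dots> = c n i"
        unfolding hd_eq hd_rhs by (simp add: c_def field_simps del: of_nat_Suc)
      finally show ?thesis .
    qed
    then show "map_matrix complex_of_real M *v C (Suc n) = C n"
      by (simp add: vec_eq_iff matrix_vector_mult_def map_matrix_def C_def)
  qed
  have ne0: "\<not> is_eigenvalue M 0" using ne[of 0] \<theta> by simp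
  have inj: "v = w" if "map_matrix complex_of_real M *v v = map_matrix complex_of_real M *v w" for v w
  proof -
    have "map_matrix complex_of_real M *v (v - w) = 0 *s (v - w)"
      using that by (simp add: matrix_vector_mult_diff_distrib)
    then show ?thesis using not_eigenvalue_ker[OF ne0] by fastforce
  qed
  have C_eq: "C n = cvec (mat_pow (matrix_inv M) (Suc n) b)" for n
  proof (induction n)
    case 0
    show ?case
      by (rule inj) (use matrix_inv_right_left[OF ne0] in \<open>simp add: rec cvec_mult mat_pow_Suc matrix_vector_mul_assoc\<close>)
  next
    case (Suc n)
    have "M *v mat_pow (matrix_inv M) (Suc (Suc n)) b = mat_pow (matrix_inv M) (Suc n) b"
      using matrix_inv_right_left[OF ne0] by (subst mat_pow_Suc) (simp add: matrix_vector_mul_assoc)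
    then show ?case
      by (intro inj[of "C (Suc n)"]) (simp add: rec cvec_mult Suc)
  qed
  have contX: "continuous_on (cball 0 \<theta>) (X k)"
    by (rule holomorphic_on_imp_continuous_on[OF holX])
  then have "bounded (X k ` cball 0 \<theta>)"
    by (intro compact_imp_bounded compact_continuous_image) auto
  then obtain B where B: "\<And>z. z \<in> cball 0 \<theta> \<Longrightarrow> cmod (X k z) \<le> B"
    unfolding bounded_iff by (metis image_eqI)
  have "\<bar>mat_pow (matrix_inv M) (Suc n) b $ k\<bar> \<le> B / \<theta> ^ n" for n
  proof -
    have "cmod ((deriv ^^ n) (X k) 0) \<le> fact n * B / \<theta> ^ n"
      by (rule Cauchy_inequality[OF holX' contX \<theta>(1)]) (auto intro: B)
    then have "cmod (c n k) \<le> B / \<theta> ^ n" by (simp add: c_def norm_divide field_simps)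
    moreover have "c n k = of_real (mat_pow (matrix_inv M) (Suc n) b $ k)"
      using C_eq[of n] by (simp add: C_def cvec_def vec_eq_iff)
    ultimately show ?thesis by simp
  qed
  then show ?thesis by blast
qed

lemma mat_pow_inverse_bound:
  fixes M :: "real^'d^'d"
  assumes \<theta>: "0 < \<theta>" "\<And>\<mu>. is_eigenvalue M \<mu> \<Longrightarrow> \<theta> < cmod \<mu>"
  obtains c where "0 < c" "\<And>j x. norm (mat_pow (matrix_inv M) j x) \<le> c * norm x / \<theta> ^ j"
proof -
  have "\<forall>i k. \<exists>B. \<forall>n. \<bar>mat_pow (matrix_inv M) (Suc n) (axis i 1) $ k\<bar> \<le> B / \<theta> ^ n"
    using mat_pow_inverse_component_bound[OF assms] by blast
  then obtain B where B: "\<And>i k n. \<bar>mat_pow (matrix_inv M) (Suc n) (axis i 1) $ k\<bar> \<le> B i k / \<theta> ^ n"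
    by metis
  have B0: "0 \<le> B i k" for i k using B[of 0 i k] by simp
  define S where "S = (\<Sum>i\<in>UNIV. \<Sum>k\<in>UNIV. B i k)"
  have S0: "0 \<le> S" unfolding S_def by (intro sum_nonneg B0)
  have bd: "norm (mat_pow (matrix_inv M) (Suc n) x) \<le> S * norm x / \<theta> ^ n" for n x
  proof -
    interpret l: linear "mat_pow (matrix_inv M) (Suc n)" by (rule linear_mat_pow)
    have "x = (\<Sum>i\<in>UNIV. (x $ i) *\<^sub>R axis i 1)"
      using basis_expansion[of x] by (simp add: scalar_mult_eq_scaleR)
    then have "norm (mat_pow (matrix_inv M) (Suc n) x) = norm (\<Sum>i\<in>UNIV. (x $ i) *\<^sub>R mat_pow (matrix_inv M) (Suc n) (axis i 1))"
      by (metis (no_types, lifting) l.scale l.sum sum.cong)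
    also have "\<dots> \<le> (\<Sum>i\<in>UNIV. norm x * norm (mat_pow (matrix_inv M) (Suc n) (axis i 1)))"
      by (rule order_trans[OF norm_sum]) (auto intro!: sum_mono mult_right_mono component_le_norm_cart)
    also have "\<dots> \<le> (\<Sum>i\<in>UNIV. norm x * (\<Sum>k\<in>UNIV. B i k / \<theta> ^ n))"
      by (intro sum_mono mult_left_mono order_trans[OF norm_le_l1_cart] sum_mono B) auto
    also have "\<dots> = S * norm x / \<theta> ^ n"
      by (simp add: S_def mult.commute flip: sum_distrib_left sum_divide_distrib)
    finally show ?thesis .
  qed
  \<comment> \<open>The bounds obtained so far compare the power n + 1 with \<theta>^n, which costs
    a factor \<theta> in the constant; the 1 in the maximum covers j = 0.\<close>
  show ?thesis
  proof (rule that[of "max 1 (S * \<theta>)"])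
    fix j x
    show "norm (mat_pow (matrix_inv M) j x) \<le> max 1 (S * \<theta>) * norm x / \<theta> ^ j"
    proof (cases j)
      case 0
      have "1 * norm x \<le> max 1 (S * \<theta>) * norm x" by (intro mult_right_mono) auto
      then show ?thesis using 0 by simp
    next
      case (Suc n)
      have "S * norm x / \<theta> ^ n = S * \<theta> * norm x / \<theta> ^ j" using \<theta> Suc by simp
      also have "\<dots> \<le> max 1 (S * \<theta>) * norm x / \<theta> ^ j"
        using \<theta> by (intro divide_right_mono mult_right_mono) auto
      finally show ?thesis using bd[of n x] Suc by simp
    qed
  qed auto
qed

lemma norm_adjoint_le:
  fixes f :: "'a::euclidean_space \<Rightarrow> 'a"
  assumes "linear f" and b: "\<And>x. norm (f x) \<le> b * norm x"
  shows "norm (adjoint f y) \<le> b * norm y"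
proof (cases "adjoint f y = 0")
  case True
  have "0 \<le> b * norm y" using b[of y] norm_ge_zero order_trans by blast
  then show ?thesis using True by simp
next
  case False
  have "norm (adjoint f y) * norm (adjoint f y) = adjoint f y \<bullet> adjoint f y"
    by (simp add: power2_norm_eq_inner flip: power2_eq_square)
  also have "\<dots> = f (adjoint f y) \<bullet> y"
    by (rule adjoint_works[OF assms(1)])
  also have "\<dots> \<le> norm (f (adjoint f y)) * norm y" by (rule norm_cauchy_schwarz)
  also have "\<dots> \<le> b * norm (adjoint f y) * norm y" by (intro mult_right_mono b) auto
  finally have "norm (adjoint f y) * norm (adjoint f y) \<le> (b * norm y) * norm (adjoint f y)"
    by (simp add: mult_ac)
  then show ?thesis using False by simp
qed

section \<open>Linear changes of variables\<close>

lemma nn_integral_lborel_uminus: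
  fixes F :: "'a::euclidean_space \<Rightarrow> ennreal"
  assumes [measurable]: "F \<in> borel_measurable borel"
  shows "(\<integral>\<^sup>+x. F (- x) \<partial>lborel) = (\<integral>\<^sup>+x. F x \<partial>lborel)"
proof -
  have "lborel = distr lborel borel (uminus :: 'a \<Rightarrow> 'a)"
    using lborel_distr_scale[of "-1", where 'a='a] by (simp add: density_1)
  then have "(\<integral>\<^sup>+x. F x \<partial>lborel) = (\<integral>\<^sup>+x. F x \<partial>distr lborel borel uminus)" by simp
  then show ?thesis by (simp add: nn_integral_distr)
qed

text \<open>The usual uniqueness argument for translation invariant measures; the constant is not identified
  with a determinant.\<close>

lemma nn_integral_linear_change:
  fixes f g :: "real^'d \<Rightarrow> real^'d"
  assumes f: "linear f" and g: "linear g" and fg: "\<And>x. f (g x) = x" and gf: "\<And>x. g (f x) = x"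
  obtains c :: real where "0 < c"
    "\<And>F. F \<in> borel_measurable borel \<Longrightarrow> (\<integral>\<^sup>+x. F (f x) \<partial>lborel) = ennreal c * (\<integral>\<^sup>+x. F x \<partial>lborel)"
proof -
  have [measurable]: "f \<in> borel \<rightarrow>\<^sub>M borel" "g \<in> borel \<rightarrow>\<^sub>M borel"
    using f g by (auto intro!: borel_measurable_continuous_onI linear_continuous_on simp: linear_conv_bounded_linear)
  define \<alpha> where "\<alpha> = (\<integral>\<^sup>+y. indicator cube (f y) \<partial>lborel)"
  have key: "(\<integral>\<^sup>+x. F (f x) \<partial>lborel) = (\<integral>\<^sup>+x. F x \<partial>lborel) * \<alpha>"
    if [measurable]: "F \<in> borel_measurable borel" for F
  proof -
    let ?G = "indicator cube :: real^'d \<Rightarrow> ennreal"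
    have "(\<integral>\<^sup>+x. F x \<partial>lborel) * \<alpha> = (\<integral>\<^sup>+y. (\<integral>\<^sup>+x. F x \<partial>lborel) * ?G (f y) \<partial>lborel)"
      unfolding \<alpha>_def by (rule nn_integral_cmult[symmetric]) measurable
    also have "\<dots> = (\<integral>\<^sup>+y. (\<integral>\<^sup>+x. F (x + f y) * ?G (f y) \<partial>lborel) \<partial>lborel)"
      by (simp add: nn_integral_multc nn_integral_lborel_translate[of F])
    also have "\<dots> = (\<integral>\<^sup>+x. (\<integral>\<^sup>+y. F (x + f y) * ?G (f y) \<partial>lborel) \<partial>lborel)"
      by (rule lborel_pair.Fubini') measurable
    also have "\<dots> = (\<integral>\<^sup>+x. (\<integral>\<^sup>+y. F (f y) * ?G (f y - x) \<partial>lborel) \<partial>lborel)"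
    proof (rule nn_integral_cong)
      \<comment> \<open>Shifting \<open>y\<close> by \<open>g x\<close> changes \<open>f y\<close>
        by \<open>x\<close>, which moves the translation from the argument of \<open>F\<close> to
        the cube.\<close>
      fix x
      have "(\<integral>\<^sup>+y. F (f y) * ?G (f y - x) \<partial>lborel) = (\<integral>\<^sup>+y. F (f (y + g x)) * ?G (f (y + g x) - x) \<partial>lborel)"
        by (rule nn_integral_lborel_translate[symmetric]) measurable
      then show "(\<integral>\<^sup>+y. F (x + f y) * ?G (f y) \<partial>lborel) = (\<integral>\<^sup>+y. F (f y) * ?G (f y - x) \<partial>lborel)"
        by (simp add: linear_add[OF f] fg add.commute)
    qed
    also have "\<dots> = (\<integral>\<^sup>+y. (\<integral>\<^sup>+x. F (f y) * ?G (f y - x) \<partial>lborel) \<partial>lborel)"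
      by (rule lborel_pair.Fubini'[symmetric]) measurable
    also have "\<dots> = (\<integral>\<^sup>+y. F (f y) \<partial>lborel)"
    proof (rule nn_integral_cong)
      fix y
      have "(\<integral>\<^sup>+x. F (f y) * ?G (f y - x) \<partial>lborel) = F (f y) * (\<integral>\<^sup>+x. ?G (f y - x) \<partial>lborel)"
        by (rule nn_integral_cmult) measurable
      also have "(\<integral>\<^sup>+x. ?G (f y - x) \<partial>lborel) = (\<integral>\<^sup>+x. ?G (- x) \<partial>lborel)"
        using nn_integral_lborel_translate[of "\<lambda>x. ?G (f y - x)" "f y"] by simp
      also have "\<dots> = (\<integral>\<^sup>+x. ?G x \<partial>lborel)"
        by (rule nn_integral_lborel_uminus) measurable
      also have "(\<integral>\<^sup>+x. ?G x \<partial>lborel) = 1" by (simp add: emeasure_cube)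
      finally show "(\<integral>\<^sup>+x. F (f y) * ?G (f y - x) \<partial>lborel) = F (f y)" by simp
    qed
    finally show ?thesis ..
  qed
  have "\<alpha> = emeasure lborel (g ` cube)"
  proof -
    have "f y \<in> cube \<longleftrightarrow> y \<in> g ` cube" for y by (metis fg gf image_iff)
    then have *: "g ` cube = f -` cube \<inter> space borel" by auto
    have "g ` cube \<in> sets borel" unfolding * by (rule measurable_sets) measurable
    moreover have "\<alpha> = (\<integral>\<^sup>+y. indicator (g ` cube) y \<partial>lborel)"
      unfolding \<alpha>_def by (intro nn_integral_cong) (simp add: indicator_def \<open>\<And>y. f y \<in> cube \<longleftrightarrow> y \<in> g ` cube\<close>)
    ultimately show ?thesis by simp
  qed
  moreover have "bounded (cube :: (real^'d) set)"
  proof (rule bounded_subset[OF bounded_cbox])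
    show "(cube :: (real^'d) set) \<subseteq> cbox (\<chi> i. (- (1/2) :: real)) (\<chi> i. 1/2)"
      by (auto simp: cube_def mem_box_cart less_imp_le)
  qed
  ultimately have fin: "\<alpha> < \<infinity>"
    using g emeasure_bounded_finite[OF bounded_linear_image[of cube g]] by (simp add: linear_conv_bounded_linear)
  have "\<alpha> \<noteq> 0"
  proof
    assume "\<alpha> = 0"
    \<comment> \<open>For the constant function 1 the identity would read \<infinity> = 0.\<close>
    with key[of "\<lambda>_. 1"] show False by simp
  qed
  then obtain c where c: "\<alpha> = ennreal c" "0 < c"
    using fin by (cases \<alpha>) (auto simp: ennreal_0 le_less)
  then show ?thesis
    using key by (intro that[of c]) (auto simp: mult.commute)
qed

lemma linear_measure_change:
  fixes f :: "real^'d \<Rightarrow> real^'d"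
  assumes f: "linear f" and c: "0 < c"
    "\<And>F. F \<in> borel_measurable borel \<Longrightarrow> (\<integral>\<^sup>+x. F (f x) \<partial>lborel) = ennreal c * (\<integral>\<^sup>+x. F x \<partial>lborel)"
  shows "distr lborel borel f = density lborel (\<lambda>_. ennreal c)"
proof (rule measure_eqI)
  have [measurable]: "f \<in> borel \<rightarrow>\<^sub>M borel"
    using f by (auto intro!: borel_measurable_continuous_onI linear_continuous_on simp: linear_conv_bounded_linear)
  fix A assume "A \<in> sets (distr lborel borel f)"
  then have [measurable]: "A \<in> sets borel" by simp
  have "emeasure (distr lborel borel f) A = (\<integral>\<^sup>+x. indicator A (f x) \<partial>lborel)"
  proof -
    have [measurable]: "f -` A \<in> sets borel"
      using measurable_sets[of f borel borel A] by simp
    have "emeasure (distr lborel borel f) A = (\<integral>\<^sup>+x. indicator (f -` A) x \<partial>lborel)"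
      by (simp add: emeasure_distr)
    then show ?thesis by (simp add: indicator_def)
  qed
  also have "\<dots> = ennreal c * emeasure lborel A" by (simp add: c(2))
  finally show "emeasure (distr lborel borel f) A = emeasure (density lborel (\<lambda>_. ennreal c)) A"
    by (simp add: emeasure_density nn_integral_cmult_indicator)
qed simp

lemma
  fixes f :: "real^'d \<Rightarrow> real^'d" and F :: "real^'d \<Rightarrow> complex"
  assumes f: "linear f" and c: "0 < c"
    "\<And>F. F \<in> borel_measurable borel \<Longrightarrow> (\<integral>\<^sup>+x. F (f x) \<partial>lborel) = ennreal c * (\<integral>\<^sup>+x. F x \<partial>lborel)"
    and [measurable]: "F \<in> borel_measurable borel"
  shows integral_linear_change: "(\<integral>x. F (f x) \<partial>lborel) = of_real c * (\<integral>x. F x \<partial>lborel)"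
    and integrable_linear_change: "integrable lborel F \<Longrightarrow> integrable lborel (\<lambda>x. F (f x))"
proof -
  have [measurable]: "f \<in> borel \<rightarrow>\<^sub>M borel"
    using f by (auto intro!: borel_measurable_continuous_onI linear_continuous_on simp: linear_conv_bounded_linear)
  have D: "distr lborel borel f = density lborel (\<lambda>_. ennreal c)"
    by (rule linear_measure_change[OF f c])
  have "(\<integral>x. F (f x) \<partial>lborel) = (\<integral>x. F x \<partial>distr lborel borel f)"
    by (simp add: integral_distr)
  also have "\<dots> = of_real c * (\<integral>x. F x \<partial>lborel)"
    unfolding D using c by (subst integral_density) (auto simp: scaleR_conv_of_real)
  finally show "(\<integral>x. F (f x) \<partial>lborel) = of_real c * (\<integral>x. F x \<partial>lborel)" .
  show "integrable lborel (\<lambda>x. F (f x))" if "integrable lborel F"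
  proof -
    have "integrable (distr lborel borel f) F"
      unfolding D using c that by (subst integrable_density) auto
    then show ?thesis by (simp add: integrable_distr_eq)
  qed
qed

text \<open>Both constants are the determinant; comparing them through the Fourier transform of a
  Gaussian avoids identifying them.\<close>

lemma nn_integral_linear_change_adjoint:
  fixes f g :: "real^'d \<Rightarrow> real^'d"
  assumes f: "linear f" and g: "linear g" and fg: "\<And>x. f (g x) = x" and gf: "\<And>x. g (f x) = x"
  obtains c :: real where "0 < c"
    "\<And>F. F \<in> borel_measurable borel \<Longrightarrow> (\<integral>\<^sup>+x. F (f x) \<partial>lborel) = ennreal c * (\<integral>\<^sup>+x. F x \<partial>lborel)"
    "\<And>F. F \<in> borel_measurable borel \<Longrightarrow> (\<integral>\<^sup>+x. F (adjoint f x) \<partial>lborel) = ennreal c * (\<integral>\<^sup>+x. F x \<partial>lborel)"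
proof -
  have af: "linear (adjoint f)" "linear (adjoint g)" using f g by (auto intro: adjoint_linear)
  have afg: "adjoint f (adjoint g x) = x" for x
  proof (rule vector_eq_ldot[THEN iffD1], intro allI)
    show "z \<bullet> adjoint f (adjoint g x) = z \<bullet> x" for z
      by (simp add: adjoint_works[OF f] adjoint_works[OF g] gf)
  qed
  have agf: "adjoint g (adjoint f x) = x" for x
  proof (rule vector_eq_ldot[THEN iffD1], intro allI)
    show "z \<bullet> adjoint g (adjoint f x) = z \<bullet> x" for z
      by (simp add: adjoint_works[OF f] adjoint_works[OF g] fg)
  qed
  obtain c where c: "0 < c"
    "\<And>F. F \<in> borel_measurable borel \<Longrightarrow> (\<integral>\<^sup>+x. F (f x) \<partial>lborel) = ennreal c * (\<integral>\<^sup>+x. F x \<partial>lborel)"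
    using nn_integral_linear_change[OF f g fg gf] by metis
  obtain c1 where c1: "0 < c1"
    "\<And>F. F \<in> borel_measurable borel \<Longrightarrow> (\<integral>\<^sup>+x. F (adjoint f x) \<partial>lborel) = ennreal c1 * (\<integral>\<^sup>+x. F x \<partial>lborel)"
    using nn_integral_linear_change[OF af afg agf] by metis
  have [measurable]: "f \<in> borel \<rightarrow>\<^sub>M borel" "g \<in> borel \<rightarrow>\<^sub>M borel" "adjoint f \<in> borel \<rightarrow>\<^sub>M borel" "adjoint g \<in> borel \<rightarrow>\<^sub>M borel"
    using f g af by (auto intro!: borel_measurable_continuous_onI linear_continuous_on simp: linear_conv_bounded_linear)
  define H :: "real^'d \<Rightarrow> complex" where "H x = of_real (gauss (f x))" for x
  have [measurable]: "H \<in> borel_measurable borel" unfolding H_def by measurable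
  have Hint: "integrable lborel H"
    unfolding H_def
    by (rule integrable_linear_change[OF f c]) (auto intro: integrable_of_real integral_gauss_echar)
  have FH: "fourier H \<xi> = of_real (c * gauss (adjoint g \<xi>))" for \<xi>
  proof -
    have "fourier H \<xi> = (\<integral>x. of_real (gauss (f x)) * echar (g (f x) \<bullet> \<xi>) \<partial>lborel)"
      by (simp add: fourier_eq_lborel H_def gf)
    also have "\<dots> = of_real c * (\<integral>y. of_real (gauss y) * echar (g y \<bullet> \<xi>) \<partial>lborel)"
    proof (rule integral_linear_change[OF f c])
      show "(\<lambda>y. of_real (gauss y) * echar (g y \<bullet> \<xi>)) \<in> borel_measurable borel"
        by (intro borel_measurable_times measurable_compose[OF _ borel_measurable_echar] borel_measurable_inner) measurable
    qed
    also have "\<dots> = of_real (c * gauss (adjoint g \<xi>))"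
      by (simp add: adjoint_works[OF g, symmetric] integral_gauss_echar)
    finally show ?thesis .
  qed
  have gag: "complex_of_real (gauss (adjoint g (adjoint f x))) = of_real (gauss x)" for x by (simp add: agf)
  have Gint: "integrable lborel (\<lambda>\<xi>. gauss (adjoint g \<xi>))"
  proof (rule integrableI_bounded)
    have "(\<integral>\<^sup>+\<xi>. ennreal (gauss (adjoint g (adjoint f \<xi>))) \<partial>lborel) = ennreal c1 * (\<integral>\<^sup>+\<xi>. ennreal (gauss (adjoint g \<xi>)) \<partial>lborel)"
      by (rule c1(2)) measurable
    then have "1 = ennreal c1 * (\<integral>\<^sup>+\<xi>. ennreal (gauss (adjoint g \<xi>)) \<partial>lborel)"
      by (simp add: agf nn_integral_gauss)
    then have "(\<integral>\<^sup>+\<xi>. ennreal (gauss (adjoint g \<xi>)) \<partial>lborel) \<noteq> \<infinity>"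
      using c1(1) by (auto simp: ennreal_mult_top)
    then show "(\<integral>\<^sup>+\<xi>. ennreal (norm (gauss (adjoint g \<xi>))) \<partial>lborel) < \<infinity>" by (simp add: less_top)
  qed measurable
  \<comment> \<open>The change of variables for \<open>adjoint f\<close>, applied to the Gaussian
    composed with \<open>adjoint g\<close>: the compositions cancel and leave a Gaussian of integral
    1.\<close>
  have c1': "of_real c1 * (\<integral>\<xi>. of_real (gauss (adjoint g \<xi>)) \<partial>lborel) = (1 :: complex)"
    using integral_linear_change[OF af(1) c1, of "\<lambda>\<xi>. of_real (gauss (adjoint g \<xi>))"]
    by (simp add: agf integral_gauss)
  \<comment> \<open>Fourier inversion for \<open>H\<close> at the origin, where \<open>H\<close>
    equals 1, once more by Gaussian regularization. In view of \<open>FH\<close> it says that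
    \<open>c\<close> times the integral of the same composed Gaussian is 1, which is then compared
    with \<open>c1'\<close>.\<close>
  have "(\<integral>\<xi>. fourier H \<xi> \<partial>lborel) = 1"
  proof (rule LIMSEQ_unique)
    let ?r = "\<lambda>n. real (Suc n)"
    let ?I = "\<lambda>n. \<integral>\<xi>. fourier H \<xi> * of_real (gauss (\<xi> /\<^sub>R ?r n)) \<partial>lborel"
    show "?I \<longlonglongrightarrow> (\<integral>\<xi>. fourier H \<xi> \<partial>lborel)"
    proof (rule integral_dominated_convergence[where w = "\<lambda>\<xi>. c * gauss (adjoint g \<xi>)"])
      show "AE \<xi> in lborel. (\<lambda>n. fourier H \<xi> * of_real (gauss (\<xi> /\<^sub>R ?r n))) \<longlonglongrightarrow> fourier H \<xi>"
      proof (intro AE_I2)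
        fix \<xi>
        have "(\<lambda>n. fourier H \<xi> * of_real (gauss (\<xi> /\<^sub>R ?r n))) \<longlonglongrightarrow> fourier H \<xi> * of_real 1"
          by (intro tendsto_intros gauss_scale_tendsto)
        then show "(\<lambda>n. fourier H \<xi> * of_real (gauss (\<xi> /\<^sub>R ?r n))) \<longlonglongrightarrow> fourier H \<xi>" by simp
      qed
    qed (use Gint c in \<open>auto simp: FH norm_mult intro!: mult_left_le\<close>)
    have eq: "?I n = (\<integral>z. H (z /\<^sub>R ?r n) * of_real (gauss z) \<partial>lborel)" for n
    proof -
      have r: "0 < ?r n" by simp
      have gi: "complex_integrable lborel (\<lambda>\<xi>::real^'d. of_real (gauss (\<xi> /\<^sub>R ?r n)))"
        using integrable_gauss_scale[of "inverse (?r n)"] r by (intro integrable_of_real) (auto simp del: of_nat_Suc)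
      have "?I n = (\<integral>x. H x * fourier (\<lambda>\<xi>. of_real (gauss (\<xi> /\<^sub>R ?r n))) x \<partial>lborel)"
        by (rule fourier_multiplication_formula[OF Hint gi])
      also have "\<dots> = (\<integral>x. H x * of_real (?r n ^ CARD('d) * gauss (?r n *\<^sub>R x)) \<partial>lborel)"
        by (simp only: fourier_gauss_scale[OF r])
      also have "\<dots> = (\<integral>z. H (z /\<^sub>R ?r n) * of_real (gauss z) \<partial>lborel)"
      proof -
        have rc: "complex_of_real (?r n) ^ CARD('d) \<noteq> 0" by (simp del: of_nat_Suc)
        have "(\<integral>x. H x * of_real (?r n ^ CARD('d) * gauss (?r n *\<^sub>R x)) \<partial>lborel)
          = (\<bar>inverse (?r n)\<bar> ^ DIM(real^'d)) *\<^sub>R (\<integral>z. H (inverse (?r n) *\<^sub>R z) * of_real (?r n ^ CARD('d) * gauss (?r n *\<^sub>R (inverse (?r n) *\<^sub>R z))) \<partial>lborel)"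
          by (rule integral_lborel_scale) (simp_all del: of_nat_Suc)
        also have "(\<integral>z. H (inverse (?r n) *\<^sub>R z) * of_real (?r n ^ CARD('d) * gauss (?r n *\<^sub>R (inverse (?r n) *\<^sub>R z))) \<partial>lborel)
          = (\<integral>z. of_real (?r n ^ CARD('d)) * (H (z /\<^sub>R ?r n) * of_real (gauss z)) \<partial>lborel)"
          by (intro Bochner_Integration.integral_cong refl) (simp add: mult_ac del: of_nat_Suc)
        also have "\<dots> = of_real (?r n ^ CARD('d)) * (\<integral>z. H (z /\<^sub>R ?r n) * of_real (gauss z) \<partial>lborel)"
          by (rule integral_mult_right_zero)
        finally show ?thesis
          using rc by (simp add: scaleR_conv_of_real[where 'a = complex] power_inverse del: of_nat_Suc)
      qed
      finally show ?thesis .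
    qed
    show "?I \<longlonglongrightarrow> 1"
      unfolding eq
    proof -
      have "(\<lambda>n. \<integral>z. H (z /\<^sub>R ?r n) * of_real (gauss z) \<partial>lborel) \<longlonglongrightarrow> (\<integral>z. 1 * of_real (gauss (z::real^'d)) \<partial>lborel)"
      proof (rule integral_dominated_convergence[where w = gauss])
        show "AE z in lborel. (\<lambda>n. H (z /\<^sub>R ?r n) * of_real (gauss z)) \<longlonglongrightarrow> 1 * of_real (gauss z)"
        proof (intro AE_I2 tendsto_mult tendsto_const)
          fix z :: "real^'d"
          have "(\<lambda>n. gauss (f z /\<^sub>R ?r n)) \<longlonglongrightarrow> 1" by (rule gauss_scale_tendsto)
          then have "(\<lambda>n. of_real (gauss (f z /\<^sub>R ?r n)) :: complex) \<longlonglongrightarrow> of_real 1" by (rule tendsto_of_real)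
          then show "(\<lambda>n. H (z /\<^sub>R ?r n)) \<longlonglongrightarrow> 1" by (simp add: H_def linear_scale[OF f])
        qed
      qed (auto simp: norm_mult H_def integral_gauss_echar intro!: mult_left_le_one_le)
      then show "(\<lambda>n. \<integral>z. H (z /\<^sub>R ?r n) * of_real (gauss z) \<partial>lborel) \<longlonglongrightarrow> 1"
        by (simp add: integral_gauss del: of_nat_Suc)
    qed
  qed
  then have "of_real c * (\<integral>\<xi>. of_real (gauss (adjoint g \<xi>)) \<partial>lborel) = (1 :: complex)"
    by (simp add: FH)
  with c1' have "c = c1"
    by (metis mult_right_cancel mult_zero_right of_real_eq_iff zero_neq_one)
  then show ?thesis using c c1 by (intro that[of c]) auto
qed

section \<open>Symbols of differential operators\<close>

text \<open>The multiplier of iterated derivatives of a transform: differentiating the kernel in the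
  i-th frequency coordinate brings down -2 pi \<i> x_i. Lists of indices match the encoding of
  \<open>partials\<close>.\<close>

definition symb :: "'d::finite list \<Rightarrow> real^'d \<Rightarrow> complex" where
  "symb is x = prod_list (map (\<lambda>i. - 2 * of_real pi * \<i> * of_real (x $ i)) is)"

lemma symb_simps [simp]: "symb [] x = 1" "symb (i # is) x = - 2 * of_real pi * \<i> * of_real (x $ i) * symb is x"
  by (simp_all add: symb_def)

lemma continuous_on_symb [continuous_intros]: "continuous_on S (symb is)"
  by (induction "is") (auto intro!: continuous_intros simp: symb_simps(2)[abs_def] symb_simps(1)[abs_def])

lemma borel_measurable_symb [measurable]: "symb is \<in> borel_measurable borel"
  by (intro borel_measurable_continuous_onI continuous_intros)

lemma norm_symb_le: "cmod (symb is x) \<le> (2 * pi * norm x) ^ length is"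
proof (induction "is")
  case (Cons i "is")
  have "cmod (symb (i # is) x) = 2 * pi * \<bar>x $ i\<bar> * cmod (symb is x)"
    by (simp add: norm_mult)
  also have "\<dots> \<le> (2 * pi * norm x) * (2 * pi * norm x) ^ length is"
    using Cons by (intro mult_mono component_le_norm_cart) auto
  finally show ?case by simp
qed simp

lemma norm_symb_le': "length is \<le> N \<Longrightarrow> cmod (symb is x) \<le> (2 * pi) ^ N * (1 + norm x) ^ N"
proof -
  assume l: "length is \<le> N"
  have "cmod (symb is x) \<le> (2 * pi * norm x) ^ length is" by (rule norm_symb_le)
  also have "\<dots> \<le> (2 * pi * (1 + norm x)) ^ length is"
    by (intro power_mono mult_left_mono) auto
  also have "\<dots> \<le> (2 * pi * (1 + norm x)) ^ N"
  proof (intro power_increasing l)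
    have "1 * 1 \<le> 2 * pi * (1 + norm x)" using pi_ge_two by (intro mult_mono) auto
    then show "1 \<le> 2 * pi * (1 + norm x)" by simp
  qed
  finally show ?thesis by (simp add: power_mult_distrib)
qed

section \<open>Differentiating Fourier transforms under the integral\<close>

lemma cmod_echar_minus_1_le: "cmod (echar s - 1) \<le> 2 * pi * \<bar>s\<bar>"
proof -
  have "echar s = iexp (- 2 * pi * s)" by (simp add: echar_def mult_ac)
  then show ?thesis using iexp_approx1[of "- 2 * pi * s" 0] by (simp add: abs_mult)
qed

lemma echar_has_vector_derivative_0:
  "((\<lambda>t. echar (s + t * r)) has_vector_derivative (- 2 * of_real pi * \<i> * of_real r * echar s)) (at 0)"
proof -
  have "((\<lambda>t. exp (- 2 * of_real pi * \<i> * of_real (s + t * r))) has_vector_derivative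
      (of_real r * (- 2 * of_real pi * \<i>)) * exp (- 2 * of_real pi * \<i> * of_real (s + 0 * r))) (at (0::real))"
    by (auto intro!: derivative_eq_intros has_vector_derivative_real_field simp: field_simps)
  then show ?thesis by (simp add: echar_def mult_ac)
qed

lemma has_vector_derivative_0_iff:
  fixes f :: "real \<Rightarrow> 'a::real_normed_vector"
  shows "(f has_vector_derivative D) (at 0) \<longleftrightarrow> ((\<lambda>t. (f t - f 0) /\<^sub>R t) \<longlongrightarrow> D) (at 0)"
proof -
  have "(f has_vector_derivative D) (at 0) \<longleftrightarrow> ((\<lambda>t. norm (f t - f 0 - t *\<^sub>R D) / norm t) \<longlongrightarrow> 0) (at 0)"
    by (simp add: has_vector_derivative_def has_derivative_at bounded_linear_scaleR_left)
  also have "\<dots> \<longleftrightarrow> ((\<lambda>t. norm ((f t - f 0) /\<^sub>R t - D)) \<longlongrightarrow> 0) (at 0)"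
  proof (rule filterlim_cong[OF refl refl])
    show "\<forall>\<^sub>F t in at 0. norm (f t - f 0 - t *\<^sub>R D) / norm t = norm ((f t - f 0) /\<^sub>R t - D)"
      unfolding eventually_at_filter
    proof (intro always_eventually allI impI)
      fix t :: real assume "t \<noteq> 0"
      then have "(f t - f 0) /\<^sub>R t - D = (f t - f 0 - t *\<^sub>R D) /\<^sub>R t"
        by (simp add: scaleR_diff_right)
      then show "norm (f t - f 0 - t *\<^sub>R D) / norm t = norm ((f t - f 0) /\<^sub>R t - D)"
        by (simp add: divide_inverse mult.commute)
    qed
  qed
  also have "\<dots> \<longleftrightarrow> ((\<lambda>t. (f t - f 0) /\<^sub>R t) \<longlongrightarrow> D) (at 0)"
    by (simp only: tendsto_norm_zero_iff LIM_zero_iff)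
  finally show ?thesis .
qed

text \<open>Dominated convergence along an arbitrary null sequence of increments; the difference
  quotients of the kernel are bounded by 2 pi |x|, independently of the increment.\<close>

lemma fourier_has_partial:
  fixes h :: "real^'d \<Rightarrow> complex"
  assumes h: "integrable lborel h" and h1: "integrable lborel (\<lambda>x. norm x * cmod (h x))"
  shows "((\<lambda>t. fourier h (\<xi> + t *\<^sub>R axis i 1)) has_vector_derivative
      fourier (\<lambda>x. - 2 * of_real pi * \<i> * of_real (x $ i) * h x) \<xi>) (at 0)"
proof -
  have [measurable]: "h \<in> borel_measurable borel" using h by auto
  let ?D = "fourier (\<lambda>x. - 2 * of_real pi * \<i> * of_real (x $ i) * h x) \<xi>"
  let ?F = "\<lambda>t. fourier h (\<xi> + t *\<^sub>R axis i 1)"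
  have F: "?F t = (\<integral>x. h x * echar (x \<bullet> \<xi> + t * (x $ i)) \<partial>lborel)" for t
    by (simp add: fourier_eq_lborel inner_add_right inner_axis)
  have "((\<lambda>t. (?F t - ?F 0) /\<^sub>R t) \<longlongrightarrow> ?D) (at 0)"
    unfolding tendsto_at_iff_sequentially
  proof (intro allI impI)
    fix X :: "nat \<Rightarrow> real"
    assume X: "\<forall>n. X n \<in> UNIV - {0}" and lim: "X \<longlonglongrightarrow> 0"
    let ?q = "\<lambda>n x. inverse (X n) *\<^sub>R (h x * (echar (x \<bullet> \<xi> + X n * (x $ i)) - echar (x \<bullet> \<xi>)))"
    have "(\<lambda>n. \<integral>x. ?q n x \<partial>lborel) \<longlonglongrightarrow> (\<integral>x. h x * (- 2 * of_real pi * \<i> * of_real (x $ i) * echar (x \<bullet> \<xi>)) \<partial>lborel)"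
    proof (rule integral_dominated_convergence[where w = "\<lambda>x. 2 * pi * (norm x * cmod (h x))"])
      show "AE x in lborel. (\<lambda>n. ?q n x) \<longlonglongrightarrow> h x * (- 2 * of_real pi * \<i> * of_real (x $ i) * echar (x \<bullet> \<xi>))"
      proof (intro AE_I2)
        fix x :: "real^'d"
        have "((\<lambda>t. (echar (x \<bullet> \<xi> + t * (x $ i)) - echar (x \<bullet> \<xi> + 0 * (x $ i))) /\<^sub>R t) \<longlongrightarrow>
            - 2 * of_real pi * \<i> * of_real (x $ i) * echar (x \<bullet> \<xi>)) (at 0)"
          using echar_has_vector_derivative_0[of "x \<bullet> \<xi>" "x $ i"]
          unfolding has_vector_derivative_0_iff .
        then have "(\<lambda>n. (echar (x \<bullet> \<xi> + X n * (x $ i)) - echar (x \<bullet> \<xi>)) /\<^sub>R X n) \<longlonglongrightarrow>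
            - 2 * of_real pi * \<i> * of_real (x $ i) * echar (x \<bullet> \<xi>)"
          using X lim unfolding tendsto_at_iff_sequentially by (auto simp: o_def)
        then have "(\<lambda>n. h x * ((echar (x \<bullet> \<xi> + X n * (x $ i)) - echar (x \<bullet> \<xi>)) /\<^sub>R X n)) \<longlonglongrightarrow>
            h x * (- 2 * of_real pi * \<i> * of_real (x $ i) * echar (x \<bullet> \<xi>))"
          by (intro tendsto_intros)
        then show "(\<lambda>n. ?q n x) \<longlonglongrightarrow> h x * (- 2 * of_real pi * \<i> * of_real (x $ i) * echar (x \<bullet> \<xi>))"
          by simp
      qed
      show "AE x in lborel. norm (?q n x) \<le> 2 * pi * (norm x * cmod (h x))" for n
      proof (intro AE_I2)
        fix x :: "real^'d"
        have Xn: "X n \<noteq> 0" using X by auto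
        have "cmod (echar (x \<bullet> \<xi> + X n * (x $ i)) - echar (x \<bullet> \<xi>)) = cmod (echar (x \<bullet> \<xi>) * (echar (X n * (x $ i)) - 1))"
          by (simp add: echar_add right_diff_distrib)
        also have "\<dots> \<le> 2 * pi * (\<bar>X n\<bar> * \<bar>x $ i\<bar>)"
          using cmod_echar_minus_1_le[of "X n * (x $ i)"] by (simp add: norm_mult abs_mult)
        finally have "norm (?q n x) \<le> inverse \<bar>X n\<bar> * (cmod (h x) * (2 * pi * (\<bar>X n\<bar> * \<bar>x $ i\<bar>)))"
          by (simp add: norm_mult mult_left_mono)
        also have "\<dots> = 2 * pi * (\<bar>x $ i\<bar> * cmod (h x))" using Xn by (simp add: field_simps)
        also have "\<dots> \<le> 2 * pi * (norm x * cmod (h x))"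
          by (intro mult_left_mono mult_right_mono component_le_norm_cart) auto
        finally show "norm (?q n x) \<le> 2 * pi * (norm x * cmod (h x))" .
      qed
    qed (use h1 in auto)
    moreover have "(\<integral>x. ?q n x \<partial>lborel) = (?F (X n) - ?F 0) /\<^sub>R X n" for n
    proof -
      have "(\<integral>x. ?q n x \<partial>lborel) = inverse (X n) *\<^sub>R (\<integral>x. h x * echar (x \<bullet> \<xi> + X n * (x $ i)) - h x * echar (x \<bullet> \<xi>) \<partial>lborel)"
        by (simp add: right_diff_distrib)
      then show ?thesis
        unfolding F using h by (subst (asm) Bochner_Integration.integral_diff) (auto intro!: integrable_mult_echar)
    qed
    moreover have "(\<integral>x. h x * (- 2 * of_real pi * \<i> * of_real (x $ i) * echar (x \<bullet> \<xi>)) \<partial>lborel) = ?D"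
      by (simp add: fourier_eq_lborel mult_ac)
    ultimately have "(\<lambda>n. (?F (X n) - ?F 0) /\<^sub>R X n) \<longlonglongrightarrow> ?D" by (simp only:)
    then show "((\<lambda>t. (?F t - ?F 0) /\<^sub>R t) \<circ> X) \<longlonglongrightarrow> ?D" by (simp only: o_def)
  qed
  then show ?thesis by (simp only: has_vector_derivative_0_iff)
qed

lemma integrable_weight_mult:
  fixes h :: "real^'d \<Rightarrow> complex"
  assumes h: "h \<in> borel_measurable borel" and w: "integrable lborel (\<lambda>x. (1 + norm x) ^ N * cmod (h x))"
    and v: "v \<in> borel_measurable borel" "\<And>x. cmod (v x) \<le> C * (1 + norm x) ^ N"
  shows "integrable lborel (\<lambda>x. v x * h x)"
proof (rule Bochner_Integration.integrable_bound[OF integrable_mult_right[OF w, of C]])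
  show "(\<lambda>x. v x * h x) \<in> borel_measurable lborel" using h v by measurable
  show "AE x in lborel. norm (v x * h x) \<le> norm (C * ((1 + norm x) ^ N * cmod (h x)))"
  proof (intro AE_I2)
    fix x
    have "cmod (v x * h x) \<le> C * (1 + norm x) ^ N * cmod (h x)"
      unfolding norm_mult by (intro mult_right_mono v) simp
    then show "norm (v x * h x) \<le> norm (C * ((1 + norm x) ^ N * cmod (h x)))"
      unfolding real_norm_def by (intro order_trans[OF _ abs_ge_self]) (simp add: mult.assoc)
  qed
qed

lemma partials_fourier:
  fixes h :: "real^'d \<Rightarrow> complex"
  assumes h [measurable]: "h \<in> borel_measurable borel" and w: "integrable lborel (\<lambda>x. (1 + norm x) ^ N * cmod (h x))"
    and "length is \<le> N"
  shows "partials is (fourier h) = fourier (\<lambda>x. symb is x * h x)"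
  using assms(3)
proof (induction "is")
  case Nil
  show ?case by (simp add: partials_def)
next
  case (Cons i "is")
  have int1: "integrable lborel (\<lambda>x. symb is x * h x)"
    by (rule integrable_weight_mult[OF h w _ norm_symb_le']) (use Cons in auto)
  \<comment> \<open>One more power of |x| is affordable: the list \<open>i # is\<close> still has
    length at most N, so |x| times the symbol stays below a multiple of (1 + |x|)^N.\<close>
  have int2: "integrable lborel (\<lambda>x. norm x * cmod (symb is x * h x))"
  proof -
    have "cmod (of_real (norm x) * symb is x) \<le> (2 * pi) ^ N * (1 + norm x) ^ N" for x
    proof -
      have "cmod (of_real (norm x) * symb is x) \<le> (2 * pi * norm x) * (2 * pi * norm x) ^ length is"
        unfolding norm_mult using pi_ge_two norm_symb_le[of "is" x]
        by (intro mult_mono) (auto intro!: mult_right_mono[of 1 "2 * pi" "norm x", simplified])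
      also have "\<dots> = (2 * pi * norm x) ^ (Suc (length is))" by simp
      also have "\<dots> \<le> (2 * pi * (1 + norm x)) ^ (Suc (length is))"
        by (intro power_mono mult_left_mono) auto
      also have "\<dots> \<le> (2 * pi * (1 + norm x)) ^ N"
      proof (intro power_increasing)
        have "1 * 1 \<le> 2 * pi * (1 + norm x)" using pi_ge_two by (intro mult_mono) auto
        then show "1 \<le> 2 * pi * (1 + norm x)" by simp
      qed (use Cons in simp)
      finally show ?thesis by (simp only: power_mult_distrib)
    qed
    then have "integrable lborel (\<lambda>x. (of_real (norm x) * symb is x) * h x)"
      by (intro integrable_weight_mult[OF h w]) auto
    from integrable_norm[OF this] show ?thesis by (simp add: norm_mult mult.assoc)
  qed
  show ?case
  proof
    fix \<xi>
    have "partials (i # is) (fourier h) \<xi> = partial i (fourier (\<lambda>x. symb is x * h x)) \<xi>"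
      using Cons by (simp add: partials_def)
    also have "\<dots> = fourier (\<lambda>x. - 2 * of_real pi * \<i> * of_real (x $ i) * (symb is x * h x)) \<xi>"
      unfolding partial_def by (rule vector_derivative_at[OF fourier_has_partial[OF int1 int2]])
    finally show "partials (i # is) (fourier h) \<xi> = fourier (\<lambda>x. symb (i # is) x * h x) \<xi>"
      by (simp add: mult.assoc)
  qed
qed

text \<open>A name for the list that \<open>multi_deriv\<close> selects; the estimates depend only
  on its length.\<close>

definition multi_list :: "nat^'d \<Rightarrow> 'd::finite list" where
  "multi_list \<beta> = (SOME is. \<forall>i. count_list is i = \<beta> $ i)"

lemma length_multi_list:
  fixes \<beta> :: "nat^'d"
  shows "length (multi_list \<beta>) = multi_order \<beta>"
proof -
  have "\<exists>is. \<forall>i. count_list is i = f i" for f :: "'d::finite \<Rightarrow> nat"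
  proof -
    obtain xs where "mset xs = (\<Sum>i\<in>UNIV. replicate_mset (f i) i)" using ex_mset by blast
    then have "count (mset xs) i = f i" for i
      by (simp add: count_sum if_distrib cong: if_cong)
    then show ?thesis by (metis count_mset)
  qed
  then have "\<forall>i. count_list (multi_list \<beta>) i = \<beta> $ i"
    unfolding multi_list_def by (rule someI_ex)
  moreover have "length xs = (\<Sum>i\<in>UNIV. count_list xs i)" for xs :: "'d::finite list"
    by (rule sum_count_set[symmetric]) auto
  ultimately show ?thesis by (simp add: multi_order_def)
qed

lemma multi_deriv_fourier:
  fixes h :: "real^'d \<Rightarrow> complex"
  assumes "h \<in> borel_measurable borel" "integrable lborel (\<lambda>x. (1 + norm x) ^ N * cmod (h x))" "multi_order \<beta> \<le> N"
  shows "multi_deriv \<beta> (fourier h) = fourier (\<lambda>x. symb (multi_list \<beta>) x * h x)"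
  unfolding multi_deriv_def multi_list_def[symmetric]
  by (rule partials_fourier[OF assms(1,2)]) (simp add: length_multi_list assms)

text \<open>The symbol of the operator acting on a function presented as \<open>fourier h\<close>,
  hence with powers of -2 pi \<i> x instead of the usual 2 pi \<i> x.\<close>

definition op_symb :: "nat \<Rightarrow> (nat^'d \<Rightarrow> complex) \<Rightarrow> real^'d \<Rightarrow> complex" where
  "op_symb N a x = (\<Sum>\<beta>\<in>multi_below (N + 1). a \<beta> * symb (multi_list \<beta>) x)"

lemma borel_measurable_op_symb [measurable]: "op_symb N a \<in> borel_measurable borel"
  unfolding op_symb_def by measurable

lemma op_symb_bound:
  fixes a :: "nat^'d \<Rightarrow> complex"
  obtains C where "0 < C" "\<And>x. cmod (op_symb N a x) \<le> C * (1 + norm x) ^ N"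
proof -
  define C where "C = (\<Sum>\<beta>\<in>multi_below (N + 1). cmod (a \<beta>) * (2 * pi) ^ N)"
  have "0 \<le> C" unfolding C_def by (intro sum_nonneg) auto
  have "cmod (op_symb N a x) \<le> C * (1 + norm x) ^ N" for x
  proof -
    have "cmod (op_symb N a x) \<le> (\<Sum>\<beta>\<in>multi_below (N + 1). cmod (a \<beta>) * ((2 * pi) ^ N * (1 + norm x) ^ N))"
      unfolding op_symb_def
    proof (rule order_trans[OF norm_sum], rule sum_mono)
      fix \<beta> :: "nat^'d" assume "\<beta> \<in> multi_below (N + 1)"
      then have "cmod (symb (multi_list \<beta>) x) \<le> (2 * pi) ^ N * (1 + norm x) ^ N"
        by (intro norm_symb_le') (simp add: multi_below_def length_multi_list)
      then show "cmod (a \<beta> * symb (multi_list \<beta>) x) \<le> cmod (a \<beta>) * ((2 * pi) ^ N * (1 + norm x) ^ N)"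
        unfolding norm_mult by (intro mult_left_mono) auto
    qed
    then show ?thesis by (simp only: C_def sum_distrib_right mult.assoc)
  qed
  moreover have "C * (1 + norm x) ^ N \<le> (C + 1) * (1 + norm x) ^ N" for x :: "real^'d"
    by (intro mult_right_mono) auto
  ultimately show ?thesis
    using \<open>0 \<le> C\<close> by (intro that[of "C + 1"]) (auto intro: order_trans)
qed

lemma diff_op_fourier:
  fixes h :: "real^'d \<Rightarrow> complex"
  assumes h [measurable]: "h \<in> borel_measurable borel" and w: "integrable lborel (\<lambda>x. (1 + norm x) ^ N * cmod (h x))"
  shows "diff_op N a (fourier h) \<xi> = fourier (\<lambda>x. op_symb N a x * h x) \<xi>"
proof -
  have int: "integrable lborel (\<lambda>x. symb (multi_list \<beta>) x * h x)" if "\<beta> \<in> multi_below (N + 1)" for \<beta> :: "nat^'d"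
    by (rule integrable_weight_mult[OF h w _ norm_symb_le'])
       (use that in \<open>auto simp: length_multi_list multi_below_def\<close>)
  have "diff_op N a (fourier h) \<xi> = (\<Sum>\<beta>\<in>multi_below (N + 1). a \<beta> * fourier (\<lambda>x. symb (multi_list \<beta>) x * h x) \<xi>)"
    unfolding diff_op_def
    by (intro sum.cong refl) (simp add: multi_below_def multi_deriv_fourier[OF h w])
  also have "\<dots> = (\<Sum>\<beta>\<in>multi_below (N + 1). (\<integral>x. a \<beta> * (symb (multi_list \<beta>) x * h x * echar (x \<bullet> \<xi>)) \<partial>lborel))"
    by (simp add: fourier_eq_lborel)
  also have "\<dots> = (\<integral>x. (\<Sum>\<beta>\<in>multi_below (N + 1). a \<beta> * (symb (multi_list \<beta>) x * h x * echar (x \<bullet> \<xi>))) \<partial>lborel)"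
    by (intro Bochner_Integration.integral_sum[symmetric] integrable_mult_right integrable_mult_echar int) auto
  also have "\<dots> = fourier (\<lambda>x. op_symb N a x * h x) \<xi>"
    by (simp add: fourier_eq_lborel op_symb_def sum_distrib_right mult.assoc)
  finally show ?thesis .
qed

text \<open>Products of a polynomial and the exponential of a polynomial are stable under partial derivatives;
  this makes modulated Gaussians Schwartz functions.\<close>

inductive cpoly :: "(real^'d \<Rightarrow> complex) \<Rightarrow> bool" where
  const: "cpoly (\<lambda>x. c)"
| coord: "cpoly (\<lambda>x. of_real (x $ i))"
| add: "cpoly p \<Longrightarrow> cpoly q \<Longrightarrow> cpoly (\<lambda>x. p x + q x)"
| mult: "cpoly p \<Longrightarrow> cpoly q \<Longrightarrow> cpoly (\<lambda>x. p x * q x)"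

lemma cpoly_sum: "finite A \<Longrightarrow> (\<And>i. i \<in> A \<Longrightarrow> cpoly (p i)) \<Longrightarrow> cpoly (\<lambda>x. \<Sum>i\<in>A. p i x)"
  by (induction A rule: finite_induct) (auto intro: cpoly.intros)

lemma cpoly_differentiable: "cpoly p \<Longrightarrow> p differentiable (at x)"
proof (induction rule: cpoly.induct)
  case (coord i)
  have "bounded_linear (\<lambda>x::real^'a. complex_of_real (x $ i))"
    by (intro bounded_linear_compose[OF bounded_linear_of_real bounded_linear_vec_nth])
  then show ?case by (rule bounded_linear_imp_differentiable)
qed (auto intro: differentiable_add differentiable_mult)

lemma cpoly_partial:
  assumes "cpoly p"
  shows "\<exists>p'. cpoly p' \<and> (\<forall>x. ((\<lambda>t. p (x + t *\<^sub>R axis i 1)) has_vector_derivative p' x) (at 0))"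
  using assms
proof (induction rule: cpoly.induct)
  case (const c)
  show ?case by (rule exI[of _ "\<lambda>x. 0"]) (auto intro: cpoly.const)
next
  case (coord j)
  have "((\<lambda>t. complex_of_real ((x + t *\<^sub>R axis i 1) $ j)) has_vector_derivative (if j = i then 1 else 0)) (at 0)" for x :: "real^'a"
    by (cases "j = i") (auto simp: axis_def intro!: derivative_eq_intros)
  then show ?case by (intro exI[of _ "\<lambda>x. if j = i then 1 else 0"]) (auto intro: cpoly.const)
next
  case (add p q)
  then obtain p' q' where "cpoly p'" "cpoly q'"
    "\<And>x. ((\<lambda>t. p (x + t *\<^sub>R axis i 1)) has_vector_derivative p' x) (at 0)"
    "\<And>x. ((\<lambda>t. q (x + t *\<^sub>R axis i 1)) has_vector_derivative q' x) (at 0)" by blast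
  then show ?case
    by (intro exI[of _ "\<lambda>x. p' x + q' x"]) (auto intro: cpoly.intros has_vector_derivative_add)
next
  case (mult p q)
  then obtain p' q' where "cpoly p'" "cpoly q'"
    "\<And>x. ((\<lambda>t. p (x + t *\<^sub>R axis i 1)) has_vector_derivative p' x) (at 0)"
    "\<And>x. ((\<lambda>t. q (x + t *\<^sub>R axis i 1)) has_vector_derivative q' x) (at 0)" by blast
  with mult(1,2) show ?case
    using has_vector_derivative_mult[of "\<lambda>t. p (_ + t *\<^sub>R axis i 1)" _ 0 UNIV "\<lambda>t. q (_ + t *\<^sub>R axis i 1)"]
    by (intro exI[of _ "\<lambda>x. p x * q' x + p' x * q x"]) (fastforce intro!: cpoly.intros)
qed

lemma cpoly_bound:
  assumes "cpoly p"
  shows "\<exists>C n. 0 \<le> C \<and> (\<forall>x. cmod (p x) \<le> C * (1 + norm x) ^ n)"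
  using assms
proof (induction rule: cpoly.induct)
  case (const c)
  show ?case by (rule exI[of _ "cmod c"], rule exI[of _ 0]) auto
next
  case (coord i)
  have "\<bar>x $ i\<bar> \<le> 1 + norm x" for x :: "real^'a" using component_le_norm_cart[of x i] by simp
  then show ?case by (intro exI[of _ 1]) auto
next
  case (add p q)
  then obtain C n D m where C: "0 \<le> C" "\<And>x. cmod (p x) \<le> C * (1 + norm x) ^ n"
    and D: "0 \<le> D" "\<And>x. cmod (q x) \<le> D * (1 + norm x) ^ m" by blast
  have "cmod (p x + q x) \<le> (C + D) * (1 + norm x) ^ (n + m)" for x
  proof -
    have "cmod (p x + q x) \<le> C * (1 + norm x) ^ n + D * (1 + norm x) ^ m"
      using C(2)[of x] D(2)[of x] norm_triangle_ineq[of "p x" "q x"] by linarith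
    also have "\<dots> \<le> C * (1 + norm x) ^ (n + m) + D * (1 + norm x) ^ (n + m)"
      using C D by (intro add_mono mult_left_mono power_increasing) auto
    finally show ?thesis by (simp add: distrib_right)
  qed
  then show ?case using C D by (intro exI[of _ "C + D"] exI[of _ "n + m"]) auto
next
  case (mult p q)
  then obtain C n D m where C: "0 \<le> C" "\<And>x. cmod (p x) \<le> C * (1 + norm x) ^ n"
    and D: "0 \<le> D" "\<And>x. cmod (q x) \<le> D * (1 + norm x) ^ m" by blast
  have "cmod (p x * q x) \<le> (C * D) * (1 + norm x) ^ (n + m)" for x
  proof -
    have "cmod (p x * q x) \<le> (C * (1 + norm x) ^ n) * (D * (1 + norm x) ^ m)"
      unfolding norm_mult by (intro mult_mono C D) (auto simp: C)
    then show ?thesis by (simp add: power_add mult_ac)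
  qed
  then show ?case using C D by (intro exI[of _ "C * D"] exI[of _ "n + m"]) auto
qed

lemma partials_poly_exp:
  fixes E :: "real^'d \<Rightarrow> complex"
  assumes E: "cpoly E"
  shows "\<exists>q. cpoly q \<and> partials is (\<lambda>x. exp (E x)) = (\<lambda>x. q x * exp (E x))"
proof (induction "is")
  case Nil
  show ?case by (rule exI[of _ "\<lambda>x. 1"]) (auto simp: partials_def intro: cpoly.const)
next
  case (Cons i "is")
  then obtain q where q: "cpoly q" "partials is (\<lambda>x. exp (E x)) = (\<lambda>x. q x * exp (E x))" by blast
  obtain q' where q': "cpoly q'" "\<And>x. ((\<lambda>t. q (x + t *\<^sub>R axis i 1)) has_vector_derivative q' x) (at 0)"
    using cpoly_partial[OF q(1)] by blast
  obtain E' where E': "cpoly E'" "\<And>x. ((\<lambda>t. E (x + t *\<^sub>R axis i 1)) has_vector_derivative E' x) (at 0)"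
    using cpoly_partial[OF E] by blast
  have "partial i (\<lambda>x. q x * exp (E x)) x = (q' x + q x * E' x) * exp (E x)" for x
  proof -
    have "((\<lambda>t. exp (E (x + t *\<^sub>R axis i 1))) has_vector_derivative E' x * exp (E (x + 0 *\<^sub>R axis i 1))) (at 0)"
      using field_vector_diff_chain_at[OF E'(2)[of x] DERIV_exp] by (simp add: o_def)
    from has_vector_derivative_mult[OF q'(2)[of x] this]
    show ?thesis
      unfolding partial_def by (intro vector_derivative_at) (simp add: algebra_simps)
  qed
  then have "partial i (\<lambda>x. q x * exp (E x)) = (\<lambda>x. (q' x + q x * E' x) * exp (E x))"
    by (rule ext)
  moreover have "partials (i # is) (\<lambda>x. exp (E x)) = partial i (\<lambda>x. q x * exp (E x))"
    unfolding q(2)[symmetric] by (simp add: partials_def)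
  ultimately have "partials (i # is) (\<lambda>x. exp (E x)) = (\<lambda>x. (q' x + q x * E' x) * exp (E x))"
    by (simp only:)
  moreover have "cpoly (\<lambda>x. q' x + q x * E' x)" using q(1) q'(1) E'(1) by (intro cpoly.intros)
  ultimately show ?case by blast
qed

section \<open>Modulated Gaussians as Schwartz functions\<close>

lemma power_le_fact_exp: "0 \<le> (x::real) \<Longrightarrow> x ^ n \<le> fact n * exp x"
proof -
  assume x: "0 \<le> x"
  have "(\<Sum>k\<in>{n}. x ^ k /\<^sub>R fact k) \<le> (\<Sum>k. x ^ k /\<^sub>R fact k)"
    using x by (intro sum_le_suminf summable_exp_generic) auto
  then have "x ^ n / fact n \<le> exp x" by (simp add: exp_def divide_inverse mult.commute)
  then show ?thesis by (simp add: field_simps)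
qed

text \<open>Bound (1 + |x|)^n by n! exp(1 + |x|) and use 1 + |x| - pi |x|^2 \<le> 2 in the
  exponent.\<close>

lemma power_mult_gauss_le:
  fixes x :: "'a::euclidean_space"
  shows "(1 + norm x) ^ n * gauss x \<le> fact n * exp 2"
proof -
  have "norm x \<le> 1 + (norm x)\<^sup>2"
    using zero_le_power2[of "norm x - 1/2"] by (simp add: power2_eq_square algebra_simps)
  also have "\<dots> \<le> 1 + pi * (norm x)\<^sup>2"
    using pi_ge_two mult_right_mono[of 1 pi "(norm x)\<^sup>2"] by simp
  finally have le: "1 + norm x - pi * (norm x)\<^sup>2 \<le> 2" by simp
  have "(1 + norm x) ^ n * gauss x \<le> (fact n * exp (1 + norm x)) * gauss x"
    by (intro mult_right_mono power_le_fact_exp) auto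
  also have "\<dots> = fact n * exp (1 + norm x - pi * (norm x)\<^sup>2)"
    by (simp add: gauss_def flip: exp_add)
  also have "\<dots> \<le> fact n * exp 2" using le by (intro mult_left_mono) auto
  finally show ?thesis .
qed

text \<open>These test functions suffice to evaluate \<open>represents\<close>: pairing
  \<open>h\<close> with all of them gives the Fourier transform of \<open>h\<close> times a
  Gaussian.\<close>

lemma schwartz_gauss_echar:
  fixes t :: "real^'d"
  shows "schwartz (\<lambda>x. of_real (gauss x) * echar (x \<bullet> t))"
proof -
  define E where "E x = (\<Sum>i\<in>UNIV. (of_real (- pi) * of_real (x $ i)) * of_real (x $ i) + (- 2 * of_real pi * \<i> * of_real (t $ i)) * of_real (x $ i))" for x :: "real^'d"
  have E: "cpoly E" unfolding E_def by (intro cpoly_sum cpoly.intros) auto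
  have eq: "(\<lambda>x. of_real (gauss x) * echar (x \<bullet> t)) = (\<lambda>x. exp (E x))"
  proof
    fix x :: "real^'d"
    have "(norm x)\<^sup>2 = (\<Sum>i\<in>UNIV. x $ i * x $ i)"
      by (simp add: power2_norm_eq_inner inner_vec_def)
    then have "of_real (gauss x) = exp (\<Sum>i\<in>UNIV. complex_of_real (- pi) * of_real (x $ i) * of_real (x $ i))"
      by (simp add: gauss_def sum_distrib_left sum_negf mult.assoc flip: exp_of_real)
    moreover have "echar (x \<bullet> t) = exp (\<Sum>i\<in>UNIV. (- 2 * of_real pi * \<i> * of_real (t $ i)) * of_real (x $ i))"
      by (simp add: echar_def inner_vec_def sum_distrib_left sum_negf mult_ac)
    ultimately show "of_real (gauss x) * echar (x \<bullet> t) = exp (E x)"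
      by (simp only: E_def sum.distrib exp_add)
  qed
  have nE: "cmod (exp (E x)) = gauss x" for x
    unfolding fun_cong[OF eq, of x, symmetric] by (simp add: norm_mult)
  show ?thesis
    unfolding schwartz_def eq
  proof (intro conjI allI)
    fix "is" :: "'d list" and n :: nat
    obtain q where q: "cpoly q" "partials is (\<lambda>x. exp (E x)) = (\<lambda>x. q x * exp (E x))"
      using partials_poly_exp[OF E] by blast
    show "partials is (\<lambda>x. exp (E x)) differentiable (at x)" for x
    proof -
      have "(exp \<circ> E) differentiable (at x)"
      proof (rule differentiable_chain_at)
        show "E differentiable (at x)" by (rule cpoly_differentiable[OF E])
        show "exp differentiable (at (E x))"
          using DERIV_exp[of "E x"] unfolding has_field_derivative_def differentiable_def by blast
      qed
      then show ?thesis
        unfolding q(2) by (intro differentiable_mult cpoly_differentiable[OF q(1)]) (simp add: o_def)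
    qed
    obtain C m where C: "0 \<le> C" "\<And>x. cmod (q x) \<le> C * (1 + norm x) ^ m"
      using cpoly_bound[OF q(1)] by blast
    have "norm (norm x ^ n *\<^sub>R partials is (\<lambda>x. exp (E x)) x) \<le> C * (fact (n + m) * exp 2)" for x
    proof -
      have "norm (norm x ^ n *\<^sub>R partials is (\<lambda>x. exp (E x)) x) = norm x ^ n * (cmod (q x) * gauss x)"
        by (simp add: q(2) norm_mult nE del: norm_exp_eq_Re)
      also have "\<dots> \<le> (1 + norm x) ^ n * ((C * (1 + norm x) ^ m) * gauss x)"
        by (intro mult_mono mult_right_mono C power_mono) auto
      also have "\<dots> = C * ((1 + norm x) ^ (n + m) * gauss x)" by (simp add: power_add mult_ac)
      also have "\<dots> \<le> C * (fact (n + m) * exp 2)"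
        by (intro mult_left_mono power_mult_gauss_le C)
      finally show ?thesis .
    qed
    then show "bounded (range (\<lambda>x. norm x ^ n *\<^sub>R partials is (\<lambda>x. exp (E x)) x))"
      unfolding bounded_iff by blast
  qed
qed

text \<open>Parseval's identity makes every pairing with a test function vanish, and the duality
  bound for p = \<infinity> applies with A = 0.\<close>

lemma fourier_zero_imp_AE_zero:
  fixes H :: "real^'d \<Rightarrow> complex"
  assumes H: "integrable lborel H" and z: "\<And>\<xi>. fourier H \<xi> = 0"
  shows "AE x in lborel. H x = 0"
proof -
  have "locally_integrable H"
    unfolding locally_integrable_def
    by (intro allI Bochner_Integration.integrable_bound[OF H]) (use H in \<open>auto simp: indicator_def\<close>)
  moreover have "(\<integral>x. H x * u x \<partial>lborel) = 0" if u: "test_fun u" for u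
  proof -
    obtain B where B: "\<And>x. cmod (u x) \<le> B" using test_fun_bounded[OF u] by metis
    have "(\<integral>x. H x * u x \<partial>lborel) = (\<integral>\<xi>. fourier H \<xi> * fourier u (- \<xi>) \<partial>lborel)"
      using u B by (intro fourier_parseval[OF H test_fun_integrable[OF u], of B]) (auto simp: test_fun_def z)
    then show ?thesis by (simp add: z)
  qed
  ultimately have "AE x in lborel. cmod (H x) \<le> 0"
    by (intro dual_bound_Linf) auto
  then show ?thesis by eventually_elim simp
qed

text \<open>Split the Gaussian into two equal factors: one absorbs the power of 1 + |x|, the other
  remains integrable.\<close>

lemma integrable_power_mult_gauss: "integrable lborel (\<lambda>x::'a::euclidean_space. (1 + norm x) ^ n * gauss x)"
proof -
  have s: "sqrt (1/2) * sqrt (1/2) = (1/2 :: real)" by simp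
  have half: "gauss x = gauss (sqrt (1/2) *\<^sub>R x) * gauss (sqrt (1/2) *\<^sub>R x)" for x :: 'a
    by (simp add: gauss_def power_mult_distrib flip: exp_add)
  have "(1 + norm x) ^ n * gauss x \<le> (2 ^ n * (fact n * exp 2)) * gauss (sqrt (1/2) *\<^sub>R x)" for x :: 'a
  proof -
    have "(1::real) \<le> 2 * sqrt (1/2)" by (rule power2_le_imp_le) (auto simp: power_mult_distrib)
    then have "1 * norm x \<le> 2 * sqrt (1/2) * norm x" by (intro mult_right_mono) auto
    then have "1 + norm x \<le> 2 * (1 + norm (sqrt (1/2) *\<^sub>R x))" by simp
    then have "(1 + norm x) ^ n \<le> (2 * (1 + norm (sqrt (1/2) *\<^sub>R x))) ^ n"
      by (intro power_mono) auto
    then have "(1 + norm x) ^ n * gauss x \<le> (2 * (1 + norm (sqrt (1/2) *\<^sub>R x))) ^ n * gauss x"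
      by (intro mult_right_mono) auto
    also have "\<dots> = 2 ^ n * ((1 + norm (sqrt (1/2) *\<^sub>R x)) ^ n * gauss (sqrt (1/2) *\<^sub>R x)) * gauss (sqrt (1/2) *\<^sub>R x)"
      unfolding half[of x] power_mult_distrib by (simp only: mult_ac)
    also have "\<dots> \<le> 2 ^ n * (fact n * exp 2) * gauss (sqrt (1/2) *\<^sub>R x)"
      by (intro mult_right_mono mult_left_mono power_mult_gauss_le) auto
    finally show ?thesis .
  qed
  then show ?thesis
    by (intro Bochner_Integration.integrable_bound[OF integrable_mult_right[OF integrable_gauss_scale[of "sqrt (1/2)"], of "2 ^ n * (fact n * exp 2)"]])
       (auto intro!: order_trans[OF _ abs_ge_self])
qed

text \<open>The sign in the definition of \<open>assoc_distr\<close> and the sign of the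
  distributional derivative cancel. What remains is the operator with conjugated coefficients
  applied to the transform of the test function at the origin, and there the kernel of the transform
  is 1.\<close>

lemma distr_fourier_assoc_distr:
  fixes \<psi> :: "real^'d \<Rightarrow> complex"
  assumes "\<psi> \<in> borel_measurable borel" "integrable lborel (\<lambda>x. (1 + norm x) ^ N * cmod (\<psi> x))"
  shows "distr_fourier (assoc_distr N a) \<psi> = (\<integral>x. op_symb N (\<lambda>\<beta>. cnj (a \<beta>)) x * \<psi> x \<partial>lborel)"
proof -
  have "distr_fourier (assoc_distr N a) \<psi> = diff_op N (\<lambda>\<beta>. cnj (a \<beta>)) (fourier \<psi>) 0"
    unfolding distr_fourier_def assoc_distr_def distr_deriv_def dirac_def diff_op_def
    by (intro sum.cong refl) (simp flip: power_mult_distrib mult.assoc)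
  also have "\<dots> = (\<integral>x. op_symb N (\<lambda>\<beta>. cnj (a \<beta>)) x * \<psi> x \<partial>lborel)"
    using assms by (simp add: diff_op_fourier) (simp add: fourier_eq_lborel)
  finally show ?thesis .
qed

lemma completion_ex_borel_measurable_complex:
  fixes g :: "'a \<Rightarrow> complex"
  assumes [measurable]: "g \<in> borel_measurable (completion M)"
  obtains h where "h \<in> borel_measurable M" "AE x in M. g x = h x"
proof -
  obtain h1 where h1: "h1 \<in> borel_measurable M" "AE x in M. Re (g x) = h1 x"
    using completion_ex_borel_measurable_real[of "\<lambda>x. Re (g x)" M] by auto
  obtain h2 where h2: "h2 \<in> borel_measurable M" "AE x in M. Im (g x) = h2 x"
    using completion_ex_borel_measurable_real[of "\<lambda>x. Im (g x)" M] by auto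
  show ?thesis
  proof (rule that[of "\<lambda>x. Complex (h1 x) (h2 x)"])
    have "(\<lambda>x. of_real (h1 x) + \<i> * of_real (h2 x)) \<in> borel_measurable M"
      using h1(1) h2(1) by measurable
    then show "(\<lambda>x. Complex (h1 x) (h2 x)) \<in> borel_measurable M" by (simp add: Complex_eq)
    show "AE x in M. g x = Complex (h1 x) (h2 x)"
      using h1(2) h2(2) by eventually_elim (simp add: complex_eq_iff)
  qed
qed

text \<open>The representing function is given only weakly. Multiplied by a Gaussian, its difference
  from the symbol becomes integrable and has a vanishing Fourier transform, so it is 0 almost
  everywhere, and the Gaussian has no zeros.\<close>

lemma represents_fourier_assoc_distr:
  fixes h :: "real^'d \<Rightarrow> complex"
  assumes h: "represents h (distr_fourier (assoc_distr N a))"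
  shows "AE x in lebesgue. h x = op_symb N (\<lambda>\<beta>. cnj (a \<beta>)) x"
proof -
  let ?S = "op_symb N (\<lambda>\<beta>. cnj (a \<beta>))"
  let ?g = "\<lambda>t x. complex_of_real (gauss x) * echar (x \<bullet> t)"
  have rep: "integrable lebesgue (\<lambda>x. h x * ?g t x)"
    "distr_fourier (assoc_distr N a) (?g t) = (\<integral>x. h x * ?g t x \<partial>lebesgue)" for t
    using h schwartz_gauss_echar[of t] unfolding represents_def by blast+
  obtain C where C: "\<And>x. cmod (?S x) \<le> C * (1 + norm x) ^ N" using op_symb_bound by metis
  have w: "integrable lborel (\<lambda>x. (1 + norm x) ^ N * cmod (?g t x))" for t
    using integrable_power_mult_gauss[of N] by (simp add: norm_mult)
  have Sint: "integrable lborel (\<lambda>x. ?S x * ?g t x)" for t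
    by (rule integrable_weight_mult[OF _ w _ C]) auto
  have Sint': "integrable lebesgue (\<lambda>x. ?S x * ?g t x)" for t
    using Sint[of t] by (subst integrable_completion) auto
  define G where "G x = (h x - ?S x) * of_real (gauss x)" for x
  have Gint: "integrable lebesgue G"
    using Bochner_Integration.integrable_diff[OF rep(1)[of 0] Sint'[of 0]] by (simp add: G_def[abs_def] left_diff_distrib)
  \<comment> \<open>The difference is only Lebesgue measurable; injectivity of the transform is
    applied to a Borel representative.\<close>
  obtain H where H [measurable]: "H \<in> borel_measurable lborel" and GH: "AE x in lborel. G x = H x"
    using completion_ex_borel_measurable_complex[OF borel_measurable_integrable[OF Gint]] by blast
  have GH': "AE x in lebesgue. G x = H x" using GH by (rule AE_completion)
  have [measurable]: "G \<in> borel_measurable lebesgue" using Gint by auto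
  have Hm: "H \<in> borel_measurable borel" using H by simp
  have Hm' [measurable]: "H \<in> borel_measurable lebesgue" using H by (rule measurable_completion)
  have "integrable lebesgue H"
    using Gint by (subst integrable_cong_AE[OF _ _ GH', symmetric]) auto
  then have Hint: "integrable lborel H" by (subst (asm) integrable_completion) auto
  have "fourier H t = 0" for t
  proof -
    have e [measurable]: "(\<lambda>x. echar (x \<bullet> t)) \<in> borel_measurable lebesgue"
      by (rule measurable_completion) simp
    have "fourier H t = (\<integral>x. H x * echar (x \<bullet> t) \<partial>lebesgue)"
      by (simp add: fourier_def echar_def)
    also have "\<dots> = (\<integral>x. G x * echar (x \<bullet> t) \<partial>lebesgue)"
      by (rule integral_cong_AE) (use GH' in \<open>auto elim!: eventually_mono\<close>)
    also have "\<dots> = (\<integral>x. h x * ?g t x - ?S x * ?g t x \<partial>lebesgue)"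
      by (simp add: G_def algebra_simps)
    also have "\<dots> = (\<integral>x. h x * ?g t x \<partial>lebesgue) - (\<integral>x. ?S x * ?g t x \<partial>lebesgue)"
      by (rule Bochner_Integration.integral_diff[OF rep(1) Sint'])
    also have "(\<integral>x. ?S x * ?g t x \<partial>lebesgue) = (\<integral>x. ?S x * ?g t x \<partial>lborel)"
      by (rule integral_completion) measurable
    also have "\<dots> = (\<integral>x. h x * ?g t x \<partial>lebesgue)"
      using distr_fourier_assoc_distr[OF _ w[of t], of a] rep(2)[of t] by simp
    finally show ?thesis by simp
  qed
  then have "AE x in lborel. H x = 0" by (rule fourier_zero_imp_AE_zero[OF Hint])
  then have "AE x in lebesgue. H x = 0" by (rule AE_completion)
  with GH' show ?thesis
  proof eventually_elim
    case (elim x)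
    then have "(h x - ?S x) * of_real (gauss x) = 0" by (simp add: G_def)
    then show ?case using gauss_pos[of x] by (simp add: less_imp_neq[symmetric])
  qed
qed

section \<open>Tails and lattice sums of decaying functions\<close>

text \<open>Dyadic shells take the place of polar coordinates. On the n-th shell the integrand is
  bounded by its value at radius 2^n \<rho>, and multiplied by the volume of a ball of twice that
  radius this is proportional to \<rho>^(-\<gamma>) 2^(-n \<gamma>), a geometric series.\<close>

lemma nn_integral_radial_tail:
  assumes \<gamma>: "0 < \<gamma>"
  obtains C :: real where "0 < C" "\<And>\<rho>. 0 < \<rho> \<Longrightarrow>
    (\<integral>\<^sup>+x. indicator {x. \<rho> \<le> norm x} x * ennreal (norm (x::real^'d) powr (- (real CARD('d) + \<gamma>))) \<partial>lborel)
      \<le> ennreal (C * \<rho> powr (- \<gamma>))"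
proof -
  let ?D = "CARD('d)"
  let ?U = "unit_ball_vol (real ?D)"
  define r where "r = 2 powr (- \<gamma>)"
  have r: "0 < r" "r < 1" using \<gamma> powr_less_mono[of "- \<gamma>" 0 2] by (auto simp: r_def)
  define C where "C = ?U * 2 ^ ?D / (1 - r)"
  have U: "0 < ?U" by (rule unit_ball_vol_pos) simp
  have "(\<integral>\<^sup>+x. indicator {x. \<rho> \<le> norm x} x * ennreal (norm (x::real^'d) powr (- (real ?D + \<gamma>))) \<partial>lborel)
      \<le> ennreal (C * \<rho> powr (- \<gamma>))" if \<rho>: "0 < \<rho>" for \<rho>
  proof -
    define T where "T n x = ennreal ((2 ^ n * \<rho>) powr (- (real ?D + \<gamma>))) * indicator (cball 0 (2 ^ Suc n * \<rho>)) (x::real^'d)" for n x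
    have T_int: "(\<integral>\<^sup>+x. T n x \<partial>lborel) = ennreal (?U * 2 ^ ?D * \<rho> powr (- \<gamma>) * r ^ n)" for n
    proof -
      have "(\<integral>\<^sup>+x. T n x \<partial>lborel) = ennreal ((2 ^ n * \<rho>) powr (- (real ?D + \<gamma>))) * ennreal (?U * (2 ^ Suc n * \<rho>) ^ ?D)"
        unfolding T_def using \<rho> by (subst nn_integral_cmult_indicator) (auto simp: emeasure_cball)
      also have "\<dots> = ennreal ((2 ^ n * \<rho>) powr (- (real ?D + \<gamma>)) * (?U * (2 * (2 ^ n * \<rho>)) ^ ?D))"
        using \<rho> U by (subst ennreal_mult[symmetric]) (auto simp: mult.assoc)
      also have "(2 ^ n * \<rho>) powr (- (real ?D + \<gamma>)) * (?U * (2 * (2 ^ n * \<rho>)) ^ ?D)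
          = ?U * 2 ^ ?D * ((2 ^ n * \<rho>) powr (- (real ?D + \<gamma>)) * (2 ^ n * \<rho>) powr (real ?D))"
      proof -
        have y: "0 < 2 ^ n * \<rho>" using \<rho> by simp
        have "(2 * (2 ^ n * \<rho>)) ^ ?D = 2 ^ ?D * (2 ^ n * \<rho>) powr (real ?D)"
          by (subst power_mult_distrib) (simp only: powr_realpow[OF y])
        then show ?thesis by (simp add: mult_ac)
      qed
      also have "(2 ^ n * \<rho>) powr (- (real ?D + \<gamma>)) * (2 ^ n * \<rho>) powr (real ?D) = (2 ^ n * \<rho>) powr (- \<gamma>)"
        by (simp flip: powr_add)
      also have "\<dots> = (2 ^ n) powr (- \<gamma>) * \<rho> powr (- \<gamma>)"
        using \<rho> by (simp add: powr_mult)
      also have "(2 ^ n :: real) powr (- \<gamma>) = r ^ n"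
        by (simp add: r_def powr_powr mult.commute flip: powr_realpow)
      finally show ?thesis by (simp add: mult_ac)
    qed
    have "indicator {x. \<rho> \<le> norm x} x * ennreal (norm x powr (- (real ?D + \<gamma>))) \<le> (\<Sum>n. T n x)" for x :: "real^'d"
    proof (cases "\<rho> \<le> norm x")
      case True
      \<comment> \<open>The predecessor of this least exponent is the index of the shell containing
        \<open>x\<close>; it exists because |x| / \<rho> is at least 1.\<close>
      define n where "n = (LEAST n. norm x / \<rho> < 2 ^ n)"
      have ex: "\<exists>n. norm x / \<rho> < 2 ^ n" by (rule real_arch_pow) simp
      have lt: "norm x / \<rho> < 2 ^ n" unfolding n_def using ex by (rule LeastI_ex)
      have "n \<noteq> 0"
      proof
        assume "n = 0"
        then show False using lt True \<rho> by simp
      qed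
      then obtain m where m: "n = Suc m" by (cases n) auto
      then have "\<not> norm x / \<rho> < 2 ^ m" using not_less_Least[of m "\<lambda>n. norm x / \<rho> < 2 ^ n"] by (simp add: n_def)
      then have ge: "2 ^ m * \<rho> \<le> norm x" using \<rho> by (simp add: field_simps)
      have le: "norm x \<le> 2 ^ Suc m * \<rho>" using lt \<rho> m by (simp add: field_simps)
      have "norm x powr (- (real ?D + \<gamma>)) \<le> (2 ^ m * \<rho>) powr (- (real ?D + \<gamma>))"
        using ge \<rho> \<gamma> by (intro powr_mono2') auto
      then have "indicator {x. \<rho> \<le> norm x} x * ennreal (norm x powr (- (real ?D + \<gamma>))) \<le> T m x"
        using le True by (simp add: T_def ennreal_leI)
      also have "\<dots> = (\<Sum>n\<in>{m}. T n x)" by simp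
      also have "\<dots> \<le> (\<Sum>n. T n x)" by (rule sum_le_suminf) auto
      finally show ?thesis .
    qed simp
    then have "(\<integral>\<^sup>+x. indicator {x. \<rho> \<le> norm x} x * ennreal (norm (x::real^'d) powr (- (real ?D + \<gamma>))) \<partial>lborel)
        \<le> (\<integral>\<^sup>+x. (\<Sum>n. T n x) \<partial>lborel)"
      by (intro nn_integral_mono)
    also have "\<dots> = (\<Sum>n. \<integral>\<^sup>+x. T n x \<partial>lborel)"
    proof (rule nn_integral_suminf)
      show "T n \<in> borel_measurable lborel" for n
        unfolding T_def[abs_def] by (intro borel_measurable_times_ennreal borel_measurable_const borel_measurable_indicator) simp
    qed
    also have "\<dots> = ennreal (?U * 2 ^ ?D * \<rho> powr (- \<gamma>) * (1 / (1 - r)))"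
      unfolding T_int
    proof (rule suminf_ennreal_eq)
      show "0 \<le> ?U * 2 ^ ?D * \<rho> powr (- \<gamma>) * r ^ n" for n using U r by simp
      show "(\<lambda>n. ?U * 2 ^ ?D * \<rho> powr (- \<gamma>) * r ^ n) sums (?U * 2 ^ ?D * \<rho> powr (- \<gamma>) * (1 / (1 - r)))"
        using r by (intro sums_mult geometric_sums) auto
    qed
    also have "?U * 2 ^ ?D * \<rho> powr (- \<gamma>) * (1 / (1 - r)) = C * \<rho> powr (- \<gamma>)" by (simp add: C_def)
    finally show ?thesis .
  qed
  moreover have "0 < C" using U r by (simp add: C_def)
  ultimately show ?thesis by (intro that[of C]) auto
qed

text \<open>Pointwise decay is known only beyond \<open>R\<close>, but the bound has to hold for all
  radii from \<rho>0 on. Inside the larger radius R' integrability of \<open>G\<close> takes over,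
  and since only radii \<rho> < R' see this part, it can be charged to the constant.\<close>

lemma weighted_tail_estimate:
  fixes G :: "real^'d \<Rightarrow> real"
  assumes [measurable]: "G \<in> borel_measurable borel" and G0: "\<And>x. 0 \<le> G x"
    and fin: "(\<integral>\<^sup>+x. ennreal (G x) \<partial>lborel) < \<infinity>"
    and \<sigma>: "0 \<le> \<sigma>" and \<gamma>: "0 < \<gamma>" and \<rho>0: "0 < \<rho>0"
    and decay: "AE x in lborel. R \<le> norm x \<longrightarrow> G x \<le> K * norm x powr (- (real CARD('d) + \<gamma> + \<sigma>))"
  obtains C :: real where "0 < C" "\<And>\<rho>. \<rho>0 \<le> \<rho> \<Longrightarrow>
    (\<integral>\<^sup>+x. indicator {x. \<rho> \<le> norm x} x * ennreal (G x * norm x powr \<sigma>) \<partial>lborel) \<le> ennreal (C * \<rho> powr (- \<gamma>))"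
proof -
  let ?D = "real CARD('d)"
  obtain C1 where C1: "0 < C1" "\<And>\<rho>. 0 < \<rho> \<Longrightarrow>
    (\<integral>\<^sup>+x. indicator {x. \<rho> \<le> norm x} x * ennreal (norm (x::real^'d) powr (- (?D + \<gamma>))) \<partial>lborel)
      \<le> ennreal (C1 * \<rho> powr (- \<gamma>))"
    using nn_integral_radial_tail[OF \<gamma>] by blast
  define R' where "R' = max R \<rho>0"
  have R': "0 < R'" "R \<le> R'" using \<rho>0 by (auto simp: R'_def)
  define K' where "K' = max K 0"
  obtain L where L: "(\<integral>\<^sup>+x. ennreal (G x) \<partial>lborel) = ennreal L" "0 \<le> L"
    using fin by (cases "\<integral>\<^sup>+x. ennreal (G x) \<partial>lborel") auto
  define C where "C = (R' powr \<sigma> * L) * R' powr \<gamma> + K' * C1"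
  have K'0: "0 \<le> K'" by (simp add: K'_def)
  have bound: "(\<integral>\<^sup>+x. indicator {x. \<rho> \<le> norm x} x * ennreal (G x * norm x powr \<sigma>) \<partial>lborel) \<le> ennreal (C * \<rho> powr (- \<gamma>))"
    if \<rho>: "\<rho>0 \<le> \<rho>" for \<rho>
  proof -
    have \<rho>p: "0 < \<rho>" using \<rho> \<rho>0 by simp
    define c where "c = (if \<rho> < R' then R' powr \<sigma> else 0)"
    have "AE x in lborel. indicator {x. \<rho> \<le> norm x} x * ennreal (G x * norm x powr \<sigma>)
      \<le> ennreal c * ennreal (G x) + ennreal K' * (indicator {x. \<rho> \<le> norm x} x * ennreal (norm x powr (- (?D + \<gamma>))))"
      using decay
    proof eventually_elim
      case (elim x)
      show ?case
      proof (cases "\<rho> \<le> norm x")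
        case True
        show ?thesis
        proof (cases "norm x < R'")
          case True
          then have c: "c = R' powr \<sigma>" using \<open>\<rho> \<le> norm x\<close> by (simp add: c_def)
          have "norm x powr \<sigma> \<le> c" unfolding c using True \<sigma> by (intro powr_mono2) auto
          then have "G x * norm x powr \<sigma> \<le> c * G x" using mult_right_mono[OF \<open>norm x powr \<sigma> \<le> c\<close> G0[of x]] by (simp only: mult.commute)
          then have "ennreal (G x * norm x powr \<sigma>) \<le> ennreal c * ennreal (G x)"
            using G0[of x] by (simp add: c ennreal_leI flip: ennreal_mult)
          then show ?thesis
            using \<open>\<rho> \<le> norm x\<close> by (simp add: add_increasing2)
        next
          case False
          have nz: "0 < norm x" by (rule less_le_trans[OF \<rho>p \<open>\<rho> \<le> norm x\<close>])
          have "K * norm x powr (- (?D + \<gamma> + \<sigma>)) \<le> K' * norm x powr (- (?D + \<gamma> + \<sigma>))"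
            by (intro mult_right_mono) (auto simp: K'_def)
          then have "G x \<le> K' * norm x powr (- (?D + \<gamma> + \<sigma>))" using elim False R' by simp
          then have "G x * norm x powr \<sigma> \<le> K' * norm x powr (- (?D + \<gamma> + \<sigma>)) * norm x powr \<sigma>"
            by (intro mult_right_mono) auto
          also have "\<dots> = K' * norm x powr (- (?D + \<gamma>))"
            by (simp add: mult.assoc flip: powr_add)
          finally have "ennreal (G x * norm x powr \<sigma>) \<le> ennreal K' * ennreal (norm x powr (- (?D + \<gamma>)))"
            using K'0 by (simp add: ennreal_leI flip: ennreal_mult)
          then show ?thesis using True by (simp add: add_increasing)
        qed
      qed simp
    qed
    then have "(\<integral>\<^sup>+x. indicator {x. \<rho> \<le> norm x} x * ennreal (G x * norm x powr \<sigma>) \<partial>lborel)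
      \<le> (\<integral>\<^sup>+x. ennreal c * ennreal (G x) + ennreal K' * (indicator {x. \<rho> \<le> norm x} x * ennreal (norm x powr (- (?D + \<gamma>)))) \<partial>lborel)"
      by (rule nn_integral_mono_AE)
    also have "\<dots> = ennreal c * ennreal L + ennreal K' * (\<integral>\<^sup>+x. indicator {x. \<rho> \<le> norm x} x * ennreal (norm (x::real^'d) powr (- (?D + \<gamma>))) \<partial>lborel)"
      by (subst nn_integral_add) (auto simp: nn_integral_cmult L)
    also have "\<dots> \<le> ennreal c * ennreal L + ennreal K' * ennreal (C1 * \<rho> powr (- \<gamma>))"
      by (intro add_left_mono mult_left_mono C1 \<rho>p) auto
    also have "\<dots> = ennreal (c * L + K' * (C1 * \<rho> powr (- \<gamma>)))"
      using L K'0 C1 by (simp add: c_def ennreal_mult ennreal_plus)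
    also have "\<dots> \<le> ennreal (C * \<rho> powr (- \<gamma>))"
    proof (rule ennreal_leI)
      \<comment> \<open>For \<rho> < R' the missing factor \<rho>^(-\<gamma>) is supplied by 1 \<le>
        (R' / \<rho>)^\<gamma>.\<close>
      have "c * L \<le> (R' powr \<sigma> * L) * R' powr \<gamma> * \<rho> powr (- \<gamma>)"
      proof (cases "\<rho> < R'")
        case True
        have "1 = \<rho> powr \<gamma> * \<rho> powr (- \<gamma>)" using \<rho>p by (simp flip: powr_add)
        also have "\<dots> \<le> R' powr \<gamma> * \<rho> powr (- \<gamma>)"
          using True \<rho>p \<gamma> by (intro mult_right_mono powr_mono2) auto
        finally have "(R' powr \<sigma> * L) * 1 \<le> (R' powr \<sigma> * L) * (R' powr \<gamma> * \<rho> powr (- \<gamma>))"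
          using L by (intro mult_left_mono) auto
        then show ?thesis using True by (simp add: c_def mult.assoc)
      qed (use L in \<open>simp add: c_def\<close>)
      then show "c * L + K' * (C1 * \<rho> powr (- \<gamma>)) \<le> C * \<rho> powr (- \<gamma>)"
        by (simp add: C_def algebra_simps)
    qed
    finally show ?thesis .
  qed
  have "0 \<le> C" using L K'0 C1 by (simp add: C_def)
  show ?thesis
  proof (rule that[of "C + 1"])
    show "(\<integral>\<^sup>+x. indicator {x. \<rho> \<le> norm x} x * ennreal (G x * norm x powr \<sigma>) \<partial>lborel) \<le> ennreal ((C + 1) * \<rho> powr (- \<gamma>))"
      if "\<rho>0 \<le> \<rho>" for \<rho>
      by (rule order_trans[OF bound[OF that]]) (intro ennreal_leI mult_right_mono, auto)
  qed (use \<open>0 \<le> C\<close> in simp)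
qed

section \<open>Lattice sums uniform in the shift\<close>

lemma norm_cube_le: "t \<in> cube \<Longrightarrow> norm t \<le> real CARD('d)" for t :: "real^'d"
proof -
  assume t: "t \<in> cube"
  have "\<bar>t $ i\<bar> \<le> 1" for i
  proof -
    have "- (1/2) \<le> t $ i \<and> t $ i < 1/2" using t by (simp add: cube_def)
    then show ?thesis by linarith
  qed
  then have "(\<Sum>i\<in>UNIV. \<bar>t $ i\<bar>) \<le> (\<Sum>i\<in>(UNIV::'d set). 1)" by (intro sum_mono)
  then show ?thesis using norm_le_l1_cart[of t] by simp
qed

text \<open>The cut-off at \<delta> removes the singularity at 0, so the summand is dominated by a
  multiple of (1 + |x|)^(-\<tau>) at every point within a cube of it. That function has a finite
  integral for \<tau> > d, which does not see the shift.\<close>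

lemma lattice_sum_powr_bound:
  assumes \<tau>: "real CARD('d) < \<tau>" and \<delta>: "0 < \<delta>"
  obtains C :: real where "0 < C" "\<And>y :: real^'d.
    (\<integral>\<^sup>+k. indicator {x. \<delta> \<le> norm x} (y + k) * ennreal (norm (y + k) powr (- \<tau>)) \<partial>ZS) \<le> ennreal C"
proof -
  let ?D = "real CARD('d)"
  define F where "F x = indicator {x. \<delta> \<le> norm x} x * ennreal (norm x powr (- \<tau>))" for x :: "real^'d"
  \<comment> \<open>Large enough for 1 + |x + t| \<le> \<kappa> |x| whenever |x| \<ge> \<delta> and
    \<open>t\<close> lies in the cube.\<close>
  define \<kappa> where "\<kappa> = (1 + ?D) / \<delta> + 1"
  have \<kappa>: "0 < \<kappa>" using \<delta> by (auto simp: \<kappa>_def intro!: add_pos_pos divide_pos_pos add_nonneg_pos)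
  define G where "G x = ennreal (\<kappa> powr \<tau> * (1 + norm x) powr (- \<tau>))" for x :: "real^'d"
  have FG: "F x \<le> G (x + t)" if t: "t \<in> cube" for x t
  proof (cases "\<delta> \<le> norm x")
    case True
    have "1 + norm (x + t) \<le> 1 + (norm x + ?D)"
      using norm_triangle_ineq[of x t] norm_cube_le[OF t] by simp
    also have "\<dots> \<le> \<kappa> * norm x"
      using True \<delta> mult_left_mono[of \<delta> "norm x" "1 + ?D"] by (simp add: \<kappa>_def field_simps)
    finally have le: "1 + norm (x + t) \<le> \<kappa> * norm x" .
    have "(\<kappa> * norm x) powr (- \<tau>) \<le> (1 + norm (x + t)) powr (- \<tau>)"
      using le \<tau> by (intro powr_mono2') (auto intro: add_pos_nonneg)
    then have "\<kappa> powr \<tau> * (\<kappa> * norm x) powr (- \<tau>) \<le> \<kappa> powr \<tau> * (1 + norm (x + t)) powr (- \<tau>)"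
      by (intro mult_left_mono) auto
    moreover have "\<kappa> powr \<tau> * (\<kappa> * norm x) powr (- \<tau>) = norm x powr (- \<tau>)"
      using \<kappa> by (simp add: powr_mult powr_minus field_simps)
    ultimately show ?thesis using True by (simp add: F_def G_def ennreal_leI)
  qed (simp add: F_def)
  obtain C1 where C1: "0 < C1" "\<And>\<rho>. 0 < \<rho> \<Longrightarrow>
    (\<integral>\<^sup>+x. indicator {x. \<rho> \<le> norm x} x * ennreal (norm (x::real^'d) powr (- (?D + (\<tau> - ?D)))) \<partial>lborel)
      \<le> ennreal (C1 * \<rho> powr (- (\<tau> - ?D)))"
    using nn_integral_radial_tail[of "\<tau> - ?D", where 'd = 'd] \<tau> by auto
  let ?H = "\<lambda>x::real^'d. indicator (cball 0 1) x + indicator {x. 1 \<le> norm x} x * ennreal (norm x powr (- \<tau>))"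
  have "(\<integral>\<^sup>+x. G x \<partial>lborel) \<le> (\<integral>\<^sup>+x. ennreal (\<kappa> powr \<tau>) * ?H x \<partial>lborel)"
  proof (rule nn_integral_mono)
    fix x :: "real^'d"
    have "ennreal ((1 + norm x) powr (- \<tau>)) \<le> ?H x"
    proof (cases "1 \<le> norm x")
      case True
      have "(1 + norm x) powr (- \<tau>) \<le> norm x powr (- \<tau>)" using True \<tau> by (intro powr_mono2') auto
      then show ?thesis using True by (auto intro!: add_increasing ennreal_leI)
    next
      case False
      have "(1 + norm x) powr (- \<tau>) \<le> 1 powr (- \<tau>)" using \<tau> by (intro powr_mono2') auto
      then show ?thesis using False by (simp add: ennreal_le_1)
    qed
    then show "G x \<le> ennreal (\<kappa> powr \<tau>) * ?H x"
      unfolding G_def by (subst ennreal_mult) (auto intro!: mult_left_mono)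
  qed
  also have "\<dots> = ennreal (\<kappa> powr \<tau>) * (emeasure lborel (cball 0 1 :: (real^'d) set) + (\<integral>\<^sup>+x. indicator {x. 1 \<le> norm x} x * ennreal (norm (x::real^'d) powr (- \<tau>)) \<partial>lborel))"
  proof -
    have [measurable]: "(\<lambda>x::real^'d. indicator (cball 0 1) x :: ennreal) \<in> borel_measurable lborel"
      by (intro borel_measurable_indicator) simp
    have [measurable]: "(\<lambda>x::real^'d. indicator {x. 1 \<le> norm x} x * ennreal (norm x powr (- \<tau>))) \<in> borel_measurable lborel"
      by measurable
    have "(\<integral>\<^sup>+x. ennreal (\<kappa> powr \<tau>) * ?H x \<partial>lborel) = ennreal (\<kappa> powr \<tau>) * (\<integral>\<^sup>+x. ?H x \<partial>lborel)"
      by (rule nn_integral_cmult) measurable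
    also have "(\<integral>\<^sup>+x. ?H x \<partial>lborel) = (\<integral>\<^sup>+x. indicator (cball 0 1) (x::real^'d) \<partial>lborel)
        + (\<integral>\<^sup>+x. indicator {x. 1 \<le> norm x} x * ennreal (norm (x::real^'d) powr (- \<tau>)) \<partial>lborel)"
      by (rule nn_integral_add) measurable
    finally show ?thesis by simp
  qed
  also have "\<dots> < \<infinity>"
  proof -
    have "emeasure lborel (cball 0 1 :: (real^'d) set) < \<infinity>" by (rule emeasure_bounded_finite) auto
    moreover have "(\<integral>\<^sup>+x. indicator {x. 1 \<le> norm x} x * ennreal (norm (x::real^'d) powr (- \<tau>)) \<partial>lborel) < \<infinity>"
      using C1(2)[of 1] by (simp add: le_less_trans)
    ultimately show ?thesis by (simp add: ennreal_mult_less_top)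
  qed
  finally obtain C where C: "(\<integral>\<^sup>+x. G x \<partial>lborel) = ennreal C" "0 \<le> C"
    by (cases "\<integral>\<^sup>+x. G x \<partial>lborel") auto
  show ?thesis
  proof (rule that[of "C + 1"])
    fix y :: "real^'d"
    have "(\<integral>\<^sup>+k. F (y + k) \<partial>ZS) \<le> (\<integral>\<^sup>+x. G x \<partial>lborel)"
      by (rule lattice_sum_le_integral[where F = F and G = G]) (auto simp: F_def[abs_def] G_def[abs_def] intro: FG[unfolded F_def G_def])
    also have "\<dots> \<le> ennreal (C + 1)" unfolding C by (intro ennreal_leI) simp
    finally show "(\<integral>\<^sup>+k. indicator {x. \<delta> \<le> norm x} (y + k) * ennreal (norm (y + k) powr (- \<tau>)) \<partial>ZS) \<le> ennreal (C + 1)"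
      by (simp add: F_def)
  qed (use C in simp)
qed

lemma lattice_count_bound:
  obtains L :: real where "0 < L" "\<And>y :: real^'d. (\<integral>\<^sup>+k. indicator (cball 0 R) (y - k) \<partial>ZS) \<le> ennreal L"
proof -
  let ?G = "indicator (cball 0 (R + real CARD('d))) :: real^'d \<Rightarrow> ennreal"
  have le: "(\<integral>\<^sup>+k. indicator (cball 0 R) (y + k) \<partial>ZS) \<le> (\<integral>\<^sup>+x. ?G x \<partial>lborel)" for y :: "real^'d"
  proof (rule lattice_sum_le_integral)
    fix x t :: "real^'d" assume "t \<in> cube"
    then show "indicator (cball 0 R) x \<le> ?G (x + t)"
      using norm_triangle_ineq[of x t] norm_cube_le[of t] by (auto simp: indicator_def)
  qed (auto intro!: borel_measurable_indicator)
  have "(\<integral>\<^sup>+x. ?G x \<partial>lborel) < \<infinity>"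
    using emeasure_bounded_finite[of "cball (0::real^'d) (R + real CARD('d))"] by simp
  then obtain L where L: "(\<integral>\<^sup>+x. ?G x \<partial>lborel) = ennreal L" "0 \<le> L"
    by (cases "\<integral>\<^sup>+x. ?G x \<partial>lborel") auto
  show ?thesis
  proof (rule that[of "L + 1"])
    fix y :: "real^'d"
    have "(\<integral>\<^sup>+k. indicator (cball 0 R) (y - k) \<partial>ZS) \<le> ennreal L"
      using le[of y] nn_integral_ZS_reflect[of "\<lambda>k. indicator (cball 0 R) (y + k)"] by (simp add: L(1))
    then show "(\<integral>\<^sup>+k. indicator (cball 0 R) (y - k) \<partial>ZS) \<le> ennreal (L + 1)"
      by (rule order_trans) (simp add: ennreal_leI)
  qed (use L in simp)
qed

section \<open>Sampling expansions\<close>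

text \<open>The scale \<open>j\<close> has been removed by \<open>y = M\<^sup>j x\<close>, so that \<open>g\<close> stands for the spectrum of \<open>f(M\<^sup>-\<^sup>j \<cdot>)\<close>
  and \<open>s\<close> for the symbol of the differential operator.\<close>

locale sampling =
  fixes \<phi> s g :: "real^'d \<Rightarrow> complex" and \<delta> :: real
  assumes \<phi>_int: "integrable lborel \<phi>"
    and \<phi>_sq: "(\<integral>\<^sup>+x. ennreal ((cmod (\<phi> x))\<^sup>2) \<partial>lborel) < \<infinity>"
    and s_borel [measurable]: "s \<in> borel_measurable borel"
    and g_int: "integrable lborel g"
    and sg_int: "integrable lborel (\<lambda>\<eta>. s \<eta> * g \<eta>)"
    and \<delta>_pos: "0 < \<delta>"
    and near_0: "AE \<xi> in lborel. norm \<xi> < \<delta> \<longrightarrow> fourier \<phi> \<xi> * s (- \<xi>) = 1"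
    and near_lattice: "\<And>l. l \<in> zlattice - {0} \<Longrightarrow>
      AE \<xi> in lborel. norm (l - \<xi>) < \<delta> \<longrightarrow> fourier \<phi> \<xi> = 0"
begin

definition coeff :: "real^'d \<Rightarrow> complex" where
  "coeff k = fourier (\<lambda>\<eta>. s \<eta> * g \<eta>) (- k)"

definition quasi :: "real^'d \<Rightarrow> complex" where
  "quasi y = (\<integral>k. coeff k * \<phi> (y + k) \<partial>ZS)"

definition err :: "real^'d \<Rightarrow> complex" where
  "err y = fourier g y - quasi y"

lemma \<phi>_borel [measurable]: "\<phi> \<in> borel_measurable borel"
  and g_borel [measurable]: "g \<in> borel_measurable borel"
  using \<phi>_int g_int by auto

lemma coeff_bounded: "cmod (coeff k) \<le> (\<integral>\<eta>. cmod (s \<eta> * g \<eta>) \<partial>lborel)"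
  unfolding coeff_def by (rule norm_fourier_le) measurable

text \<open>After moving the shift from \<phi> to the ball, each value of \<phi> is counted once for
  every lattice translate of the ball that contains the point, and these numbers are uniformly
  bounded.\<close>

lemma local_translates_finite:
  "(\<integral>\<^sup>+y. (\<integral>\<^sup>+k. indicator (cball 0 R) y * ennreal (cmod (\<phi> (y + k))) \<partial>ZS) \<partial>lborel) < \<infinity>"
proof -
  obtain L where L: "\<And>y :: real^'d. (\<integral>\<^sup>+k. indicator (cball 0 R) (y - k) \<partial>ZS) \<le> ennreal L"
    using lattice_count_bound by metis
  have [measurable]: "(\<lambda>y. indicator (cball 0 R) (y - k) :: ennreal) \<in> borel_measurable borel" for k :: "real^'d"
    by (rule measurable_compose[where N = borel]) (auto intro!: borel_measurable_indicator)
  have "(\<integral>\<^sup>+y. (\<integral>\<^sup>+k. indicator (cball 0 R) y * ennreal (cmod (\<phi> (y + k))) \<partial>ZS) \<partial>lborel)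
     = (\<integral>\<^sup>+k. (\<integral>\<^sup>+y. indicator (cball 0 R) y * ennreal (cmod (\<phi> (y + k))) \<partial>lborel) \<partial>ZS)"
    by (rule nn_integral_ZS_swap) (auto intro!: borel_measurable_times_ennreal borel_measurable_indicator)
  also have "\<dots> = (\<integral>\<^sup>+k. (\<integral>\<^sup>+y. indicator (cball 0 R) (y - k) * ennreal (cmod (\<phi> y)) \<partial>lborel) \<partial>ZS)"
  proof (rule nn_integral_cong)
    fix k :: "real^'d"
    have "(\<integral>\<^sup>+y. indicator (cball 0 R) ((y + k) - k) * ennreal (cmod (\<phi> (y + k))) \<partial>lborel)
      = (\<integral>\<^sup>+y. indicator (cball 0 R) (y - k) * ennreal (cmod (\<phi> y)) \<partial>lborel)"
      by (rule nn_integral_lborel_translate[of "\<lambda>y. indicator (cball 0 R) (y - k) * ennreal (cmod (\<phi> y))"]) measurable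
    then show "(\<integral>\<^sup>+y. indicator (cball 0 R) y * ennreal (cmod (\<phi> (y + k))) \<partial>lborel)
      = (\<integral>\<^sup>+y. indicator (cball 0 R) (y - k) * ennreal (cmod (\<phi> y)) \<partial>lborel)" by simp
  qed
  also have "\<dots> = (\<integral>\<^sup>+y. (\<integral>\<^sup>+k. indicator (cball 0 R) (y - k) * ennreal (cmod (\<phi> y)) \<partial>ZS) \<partial>lborel)"
    by (rule nn_integral_ZS_swap[symmetric]) measurable
  also have "\<dots> = (\<integral>\<^sup>+y. (\<integral>\<^sup>+k. indicator (cball 0 R) (y - k) \<partial>ZS) * ennreal (cmod (\<phi> y)) \<partial>lborel)"
    by (simp add: nn_integral_multc)
  also have "\<dots> \<le> (\<integral>\<^sup>+y. ennreal L * ennreal (cmod (\<phi> y)) \<partial>lborel)"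
    by (intro nn_integral_mono mult_right_mono L) auto
  also have "\<dots> = ennreal L * (\<integral>\<^sup>+y. ennreal (cmod (\<phi> y)) \<partial>lborel)"
    by (rule nn_integral_cmult) measurable
  also have "\<dots> < \<infinity>"
    using \<phi>_int by (simp add: integrable_iff_bounded ennreal_mult_less_top)
  finally show ?thesis .
qed

text \<open>Bounded coefficients do not make the series converge globally; the bounded support of
  \<open>u\<close> does so locally, and the exchanges of sum and integral below start from here. The
  choice c = 1 serves the pairings of the translates of \<phi> alone.\<close>

lemma local_quasi_finite:
  assumes [measurable]: "u \<in> borel_measurable borel"
    and B: "\<And>y. cmod (u y) \<le> B" and R: "\<And>y. R < norm y \<Longrightarrow> u y = 0"
    and c: "\<And>k. cmod (c k) \<le> D"
  shows "(\<integral>\<^sup>+y. (\<integral>\<^sup>+k. ennreal (cmod (c k * \<phi> (y + k) * u y)) \<partial>ZS) \<partial>lborel) < \<infinity>"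
proof -
  have B0: "0 \<le> B" using B[of 0] norm_ge_zero order_trans by blast
  have D0: "0 \<le> D" using c[of 0] norm_ge_zero order_trans by blast
  have "(\<integral>\<^sup>+y. (\<integral>\<^sup>+k. ennreal (cmod (c k * \<phi> (y + k) * u y)) \<partial>ZS) \<partial>lborel)
    \<le> (\<integral>\<^sup>+y. (\<integral>\<^sup>+k. ennreal (D * B) * (indicator (cball 0 R) y * ennreal (cmod (\<phi> (y + k)))) \<partial>ZS) \<partial>lborel)"
  proof (intro nn_integral_mono)
    fix y k
    show "ennreal (cmod (c k * \<phi> (y + k) * u y)) \<le> ennreal (D * B) * (indicator (cball 0 R) y * ennreal (cmod (\<phi> (y + k))))"
    proof (cases "norm y \<le> R")
      case True
      have "cmod (c k) * cmod (\<phi> (y + k)) * cmod (u y) \<le> D * cmod (\<phi> (y + k)) * B"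
        by (intro mult_mono B c) (auto simp: B0 D0)
      then have "cmod (c k * \<phi> (y + k) * u y) \<le> D * B * cmod (\<phi> (y + k))" by (simp add: norm_mult mult_ac)
      then have "ennreal (cmod (c k * \<phi> (y + k) * u y)) \<le> ennreal (D * B * cmod (\<phi> (y + k)))"
        by (rule ennreal_leI)
      then show ?thesis using True B0 D0 by (simp add: ennreal_mult)
    qed (simp add: R not_le)
  qed
  also have "\<dots> = (\<integral>\<^sup>+y. ennreal (D * B) * (\<integral>\<^sup>+k. indicator (cball 0 R) y * ennreal (cmod (\<phi> (y + k))) \<partial>ZS) \<partial>lborel)"
    by (intro nn_integral_cong nn_integral_cmult) auto
  also have "\<dots> = ennreal (D * B) * (\<integral>\<^sup>+y. (\<integral>\<^sup>+k. indicator (cball 0 R) y * ennreal (cmod (\<phi> (y + k))) \<partial>ZS) \<partial>lborel)"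
    by (rule nn_integral_cmult)
       (auto intro!: borel_measurable_nn_integral_ZS borel_measurable_times_ennreal borel_measurable_indicator)
  also have "\<dots> < \<infinity>" using local_translates_finite by (simp add: ennreal_mult_less_top)
  finally show ?thesis .
qed

lemma quasi_swap:
  assumes [measurable]: "u \<in> borel_measurable borel"
    and B: "\<And>y. cmod (u y) \<le> B" and R: "\<And>y. R < norm y \<Longrightarrow> u y = 0"
  shows "integrable lborel (\<lambda>y. quasi y * u y)"
    and "(\<integral>y. quasi y * u y \<partial>lborel) = (\<integral>k. coeff k * (\<integral>y. \<phi> (y + k) * u y \<partial>lborel) \<partial>ZS)"
    and "AE y in lborel. integrable ZS (\<lambda>k. coeff k * \<phi> (y + k) * u y)"
proof -
  have fin: "(\<integral>\<^sup>+y. (\<integral>\<^sup>+k. ennreal (cmod (coeff k * \<phi> (y + k) * u y)) \<partial>ZS) \<partial>lborel) < \<infinity>"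
    by (rule local_quasi_finite[OF assms coeff_bounded])
  note sw = integral_ZS_swap[OF _ fin]
  have q: "(\<integral>k. coeff k * \<phi> (y + k) * u y \<partial>ZS) = quasi y * u y" for y by (simp add: quasi_def)
  have i: "(\<integral>y. coeff k * \<phi> (y + k) * u y \<partial>lborel) = coeff k * (\<integral>y. \<phi> (y + k) * u y \<partial>lborel)" for k
    by (simp add: mult.assoc)
  show "integrable lborel (\<lambda>y. quasi y * u y)" using sw(2) by (simp add: quasi_def)
  show "(\<integral>y. quasi y * u y \<partial>lborel) = (\<integral>k. coeff k * (\<integral>y. \<phi> (y + k) * u y \<partial>lborel) \<partial>ZS)"
    using sw(1) unfolding q i by simp
  show "AE y in lborel. integrable ZS (\<lambda>k. coeff k * \<phi> (y + k) * u y)" using sw(3) by simp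
qed

text \<open>Absolute convergence on each of countably many balls. It is what later identifies
  \<open>infsum\<close> over the lattice with the integral over \<open>ZS\<close>.\<close>

lemma quasi_summable: "AE y in lborel. integrable ZS (\<lambda>k. coeff k * \<phi> (y + k))"
proof -
  have "AE y in lborel. \<forall>n::nat. integrable ZS (\<lambda>k. coeff k * \<phi> (y + k) * indicator (cball 0 (real n)) y)"
    unfolding AE_all_countable
  proof
    fix n :: nat
    show "AE y in lborel. integrable ZS (\<lambda>k. coeff k * \<phi> (y + k) * indicator (cball 0 (real n)) y)"
      by (rule quasi_swap(3)[where B = 1 and R = "real n"]) (auto simp: indicator_def)
  qed
  then show ?thesis
  proof eventually_elim
    case (elim y)
    obtain n :: nat where "norm y \<le> real n" using real_arch_simple by blast
    then show ?case using elim[rule_format, of n] by simp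
  qed
qed

lemma quasi_borel [measurable]: "quasi \<in> borel_measurable borel"
  unfolding quasi_def by (rule borel_measurable_integral_ZS) measurable

lemma err_borel [measurable]: "err \<in> borel_measurable borel"
  unfolding err_def by measurable

lemma err_locally_integrable: "locally_integrable err"
  unfolding locally_integrable_def
proof
  fix R :: real
  have 1: "integrable lborel (\<lambda>y. quasi y * indicator (cball 0 R) y)"
    by (rule quasi_swap(1)[where B = 1 and R = R]) (auto simp: indicator_def)
  have 2: "integrable lborel (\<lambda>y. fourier g y * indicator (cball 0 R) y)"
    using norm_fourier_le[OF g_borel]
    by (intro integrable_bounded_support[where B = "\<integral>x. cmod (g x) \<partial>lborel" and R = R])
       (auto simp: indicator_def norm_mult integral_nonneg_AE)
  have "indicator (cball 0 R) y *\<^sub>R err y = fourier g y * indicator (cball 0 R) y - quasi y * indicator (cball 0 R) y" for y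
    by (simp add: err_def indicator_def)
  then show "integrable lborel (\<lambda>x. indicator (cball 0 R) x *\<^sub>R err x)" using 1 2 by simp
qed

section \<open>Pairing the error with a fixed test function\<close>

context
  fixes u :: "real^'d \<Rightarrow> complex"
  assumes u: "test_fun u"
begin

lemma u_borel [measurable]: "u \<in> borel_measurable borel"
  by (rule test_fun_borel[OF u])

text \<open>The spectrum of the correlation of \<phi> with \<open>u\<close>: its transform at -k is
  the pairing of \<phi>(y + k) with \<open>u\<close>, so it is the function to be
  periodized.\<close>

definition W :: "real^'d \<Rightarrow> complex" where
  "W \<xi> = fourier \<phi> \<xi> * fourier u (- \<xi>)"

text \<open>A product of two square-integrable transforms; the Plancherel inequality for \<phi> is
  the place where \<phi> must lie in L_2.\<close>

lemma W_int: "integrable lborel W"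
proof (rule integrableI_bounded)
  show "W \<in> borel_measurable lborel" unfolding W_def by measurable
  have "(\<integral>\<^sup>+\<xi>. ennreal (norm (W \<xi>)) \<partial>lborel)
    \<le> (\<integral>\<^sup>+\<xi>. ennreal ((cmod (fourier \<phi> \<xi>))\<^sup>2) + ennreal ((cmod (fourier u (- \<xi>)))\<^sup>2) \<partial>lborel)"
  proof (rule nn_integral_mono)
    fix \<xi>
    let ?a = "cmod (fourier \<phi> \<xi>)" and ?b = "cmod (fourier u (- \<xi>))"
    have "2 * (?a * ?b) \<le> ?a\<^sup>2 + ?b\<^sup>2" using sum_squares_bound[of ?a ?b] by simp
    moreover have "0 \<le> ?a * ?b" by simp
    ultimately have "?a * ?b \<le> ?a\<^sup>2 + ?b\<^sup>2" by linarith
    then show "ennreal (norm (W \<xi>)) \<le> ennreal (?a\<^sup>2) + ennreal (?b\<^sup>2)"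
      by (simp add: W_def norm_mult ennreal_leI flip: ennreal_plus)
  qed
  also have "\<dots> = (\<integral>\<^sup>+\<xi>. ennreal ((cmod (fourier \<phi> \<xi>))\<^sup>2) \<partial>lborel) + (\<integral>\<^sup>+\<xi>. ennreal ((cmod (fourier u (- \<xi>)))\<^sup>2) \<partial>lborel)"
    by (rule nn_integral_add) measurable
  also have "(\<integral>\<^sup>+\<xi>. ennreal ((cmod (fourier u (- \<xi>)))\<^sup>2) \<partial>lborel) = (\<integral>\<^sup>+\<xi>. ennreal ((cmod (fourier u \<xi>))\<^sup>2) \<partial>lborel)"
    by (rule nn_integral_lborel_uminus) measurable
  also have "(\<integral>\<^sup>+\<xi>. ennreal ((cmod (fourier \<phi> \<xi>))\<^sup>2) \<partial>lborel) + (\<integral>\<^sup>+\<xi>. ennreal ((cmod (fourier u \<xi>))\<^sup>2) \<partial>lborel)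
     \<le> (\<integral>\<^sup>+x. ennreal ((cmod (\<phi> x))\<^sup>2) \<partial>lborel) + (\<integral>\<^sup>+x. ennreal ((cmod (u x))\<^sup>2) \<partial>lborel)"
    by (intro add_mono nn_integral_plancherel_le \<phi>_int test_fun_integrable u)
  also have "\<dots> < \<infinity>"
  proof -
    have "integrable lborel (\<lambda>x. cmod (u x) powr 2)" by (rule test_fun_integrable_powr[OF u]) simp
    then show ?thesis using \<phi>_sq by (simp add: integrable_iff_bounded)
  qed
  finally show "(\<integral>\<^sup>+\<xi>. ennreal (norm (W \<xi>)) \<partial>lborel) < \<infinity>" .
qed

lemma W_borel [measurable]: "W \<in> borel_measurable borel"
  using W_int by auto

lemma pairing_translate: "(\<integral>y. \<phi> (y + k) * u y \<partial>lborel) = fourier W (- k)"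
proof -
  obtain B where B: "\<And>x. cmod (u x) \<le> B" using test_fun_bounded[OF u] by metis
  have eq: "fourier (\<lambda>y. \<phi> (y + k)) \<xi> * fourier u (- \<xi>) = W \<xi> * echar (\<xi> \<bullet> (- k))" for \<xi>
    by (simp add: fourier_translate W_def inner_commute)
  have "(\<integral>y. \<phi> (y + k) * u y \<partial>lborel) = (\<integral>\<xi>. fourier (\<lambda>y. \<phi> (y + k)) \<xi> * fourier u (- \<xi>) \<partial>lborel)"
  proof (rule fourier_parseval[OF integrable_lborel_translate[OF \<phi>_int] test_fun_integrable[OF u] _ B])
    show "continuous_on UNIV u" using u by (simp add: test_fun_def)
    show "integrable lborel (\<lambda>\<xi>. fourier (\<lambda>y. \<phi> (y + k)) \<xi> * fourier u (- \<xi>))"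
      unfolding eq by (intro integrable_mult_echar W_int) auto
  qed
  also have "\<dots> = fourier W (- k)" unfolding eq by (simp add: fourier_eq_lborel)
  finally show ?thesis .
qed

text \<open>The summability that Poisson summation demands is seen on the space side, from the
  bounded support of \<open>u\<close>, and not from any smoothness of \<open>W\<close>.\<close>

lemma pairing_summable: "(\<integral>\<^sup>+k. ennreal (cmod (fourier W (- k))) \<partial>ZS) < \<infinity>"
proof -
  obtain B where B: "\<And>x. cmod (u x) \<le> B" using test_fun_bounded[OF u] by metis
  obtain R where R: "\<And>x. R < norm x \<Longrightarrow> u x = 0" using u by (auto simp: test_fun_def)
  have "(\<integral>\<^sup>+k. ennreal (cmod (fourier W (- k))) \<partial>ZS) \<le> (\<integral>\<^sup>+k. (\<integral>\<^sup>+y. ennreal (cmod (1 * \<phi> (y + k) * u y)) \<partial>lborel) \<partial>ZS)"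
    unfolding pairing_translate[symmetric] mult_1 by (intro nn_integral_mono integral_norm_bound_ennreal')
  also have "\<dots> = (\<integral>\<^sup>+y. (\<integral>\<^sup>+k. ennreal (cmod (1 * \<phi> (y + k) * u y)) \<partial>ZS) \<partial>lborel)"
    by (rule nn_integral_ZS_swap[symmetric]) measurable
  also have "\<dots> < \<infinity>"
    by (rule local_quasi_finite[OF u_borel B R, where D = 1]) auto
  finally show ?thesis .
qed

text \<open>The coefficients are themselves integrals of s g against characters. After the exchange
  with the lattice sum, the kernel is the Fourier series with coefficients
  \<open>fourier W (- k)\<close>, that is, the periodization of \<open>W\<close>. Sampling at the
  points -k causes the reflection of s g.\<close>

lemma quasi_pairing:
  "(\<integral>y. quasi y * u y \<partial>lborel) = (\<integral>\<eta>. s (- \<eta>) * g (- \<eta>) * (\<integral>k. W (\<eta> + k) \<partial>ZS) \<partial>lborel)"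
  "integrable lborel (\<lambda>\<eta>. s (- \<eta>) * g (- \<eta>) * (\<integral>k. W (\<eta> + k) \<partial>ZS))"
proof -
  obtain B where B: "\<And>x. cmod (u x) \<le> B" using test_fun_bounded[OF u] by metis
  obtain R where R: "\<And>x. R < norm x \<Longrightarrow> u x = 0" using u by (auto simp: test_fun_def)
  define b where "b k = fourier W (- k)" for k
  define V where "V x = (\<integral>k. b k * echar (k \<bullet> x) \<partial>ZS)" for x
  have [measurable]: "V \<in> borel_measurable borel"
    unfolding V_def by (rule borel_measurable_integral_ZS) measurable
  let ?f = "\<lambda>k \<eta>. (s \<eta> * g \<eta>) * (b k * echar (k \<bullet> (- \<eta>)))"
  have fin: "(\<integral>\<^sup>+\<eta>. (\<integral>\<^sup>+k. ennreal (cmod (?f k \<eta>)) \<partial>ZS) \<partial>lborel) < \<infinity>"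
  proof -
    have "(\<integral>\<^sup>+\<eta>. (\<integral>\<^sup>+k. ennreal (cmod (?f k \<eta>)) \<partial>ZS) \<partial>lborel)
      = (\<integral>\<^sup>+\<eta>. ennreal (cmod (s \<eta> * g \<eta>)) * (\<integral>\<^sup>+k. ennreal (cmod (b k)) \<partial>ZS) \<partial>lborel)"
      by (simp add: norm_mult ennreal_mult nn_integral_cmult)
    also have "\<dots> = (\<integral>\<^sup>+\<eta>. ennreal (cmod (s \<eta> * g \<eta>)) \<partial>lborel) * (\<integral>\<^sup>+k. ennreal (cmod (b k)) \<partial>ZS)"
      by (rule nn_integral_multc) measurable
    also have "\<dots> < \<infinity>"
      using sg_int pairing_summable by (simp add: integrable_iff_bounded ennreal_mult_less_top b_def)
    finally show ?thesis .
  qed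
  have fV: "(\<integral>k. ?f k \<eta> \<partial>ZS) = s \<eta> * g \<eta> * V (- \<eta>)" for \<eta> by (simp add: V_def)
  have int0: "integrable lborel (\<lambda>\<eta>. s \<eta> * g \<eta> * V (- \<eta>))"
    using integral_ZS_swap(2)[OF _ fin] unfolding fV by simp
  have "(\<integral>y. quasi y * u y \<partial>lborel) = (\<integral>k. coeff k * b k \<partial>ZS)"
    using quasi_swap(2)[OF u_borel B R] by (simp add: pairing_translate b_def)
  also have "\<dots> = (\<integral>k. (\<integral>\<eta>. ?f k \<eta> \<partial>lborel) \<partial>ZS)"
  proof (intro Bochner_Integration.integral_cong refl)
    fix k
    have "coeff k * b k = (\<integral>\<eta>. (s \<eta> * g \<eta>) * echar (\<eta> \<bullet> (- k)) \<partial>lborel) * b k"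
      unfolding coeff_def by (subst fourier_eq_lborel) auto
    also have "\<dots> = (\<integral>\<eta>. ((s \<eta> * g \<eta>) * echar (\<eta> \<bullet> (- k))) * b k \<partial>lborel)"
      by (rule integral_mult_left_zero[symmetric])
    also have "\<dots> = (\<integral>\<eta>. ?f k \<eta> \<partial>lborel)"
      by (intro Bochner_Integration.integral_cong refl) (simp add: inner_commute)
    finally show "coeff k * b k = (\<integral>\<eta>. ?f k \<eta> \<partial>lborel)" .
  qed
  also have "\<dots> = (\<integral>\<eta>. (\<integral>k. ?f k \<eta> \<partial>ZS) \<partial>lborel)"
    by (rule integral_ZS_swap(1)[OF _ fin, symmetric]) measurable
  also have "\<dots> = (\<integral>\<eta>. s \<eta> * g \<eta> * V (- \<eta>) \<partial>lborel)" unfolding fV ..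
  also have "\<dots> = (\<integral>\<eta>. s (- \<eta>) * g (- \<eta>) * V \<eta> \<partial>lborel)"
    by (subst integral_lborel_scale[of "-1"]) auto
  finally have 1: "(\<integral>y. quasi y * u y \<partial>lborel) = (\<integral>\<eta>. s (- \<eta>) * g (- \<eta>) * V \<eta> \<partial>lborel)" .
  have int1: "integrable lborel (\<lambda>\<eta>. s (- \<eta>) * g (- \<eta>) * V \<eta>)"
    using integrable_lborel_scale[OF _ int0, of "-1"] by simp
  have ae: "AE \<eta> in lborel. s (- \<eta>) * g (- \<eta>) * V \<eta> = s (- \<eta>) * g (- \<eta>) * (\<integral>k. W (\<eta> + k) \<partial>ZS)"
    using poisson_summation[OF W_int pairing_summable] by eventually_elim (simp add: V_def b_def)
  have [measurable]: "(\<lambda>\<eta>. \<integral>k. W (\<eta> + k) \<partial>ZS) \<in> borel_measurable borel"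
    by (rule borel_measurable_integral_ZS) measurable
  show "(\<integral>y. quasi y * u y \<partial>lborel) = (\<integral>\<eta>. s (- \<eta>) * g (- \<eta>) * (\<integral>k. W (\<eta> + k) \<partial>ZS) \<partial>lborel)"
    unfolding 1 by (rule integral_cong_AE[OF _ _ ae]) measurable
  show "integrable lborel (\<lambda>\<eta>. s (- \<eta>) * g (- \<eta>) * (\<integral>k. W (\<eta> + k) \<partial>ZS))"
    by (subst integrable_cong_AE[OF _ _ ae, symmetric]) (use int1 in measurable)
qed

text \<open>Near the origin the contributions of \<open>f\<close> and of its quasi-interpolant cancel, since there only the
  summand \<open>k = 0\<close> of the periodization survives.\<close>

lemma err_pairing_bound:
  "ennreal (cmod (\<integral>y. err y * u y \<partial>lborel)) \<le>
     (\<integral>\<^sup>+\<eta>. indicator {\<eta>. \<delta> \<le> norm \<eta>} \<eta> * ennreal (cmod (g (- \<eta>))) * (ennreal (cmod (fourier u (- \<eta>)))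
        + ennreal (cmod (s (- \<eta>))) * (\<integral>\<^sup>+k. ennreal (cmod (W (\<eta> + k))) \<partial>ZS)) \<partial>lborel)"
proof -
  obtain B where B: "\<And>x. cmod (u x) \<le> B" using test_fun_bounded[OF u] by metis
  obtain R where R: "\<And>x. R < norm x \<Longrightarrow> u x = 0" using u by (auto simp: test_fun_def)
  let ?U = "\<lambda>\<eta>. \<integral>k. W (\<eta> + k) \<partial>ZS"
  have i1: "integrable lborel (\<lambda>\<eta>. g \<eta> * fourier u \<eta>)"
    by (intro integrable_mult_fourier g_int) measurable
  then have i1': "integrable lborel (\<lambda>\<eta>. g (- \<eta>) * fourier u (- \<eta>))"
    using integrable_lborel_scale[OF _ i1, of "-1"] by simp
  have i0: "integrable lborel (\<lambda>y. fourier g y * u y)"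
    using integrable_mult_fourier[OF test_fun_integrable[OF u] g_borel] by (simp add: mult.commute)
  have "(\<integral>y. err y * u y \<partial>lborel) = (\<integral>y. fourier g y * u y \<partial>lborel) - (\<integral>y. quasi y * u y \<partial>lborel)"
    unfolding err_def left_diff_distrib by (rule Bochner_Integration.integral_diff[OF i0 quasi_swap(1)[OF u_borel B R]])
  also have "(\<integral>y. fourier g y * u y \<partial>lborel) = (\<integral>\<eta>. g \<eta> * fourier u \<eta> \<partial>lborel)"
    by (rule fourier_multiplication_formula[OF g_int test_fun_integrable[OF u]])
  also have "\<dots> = (\<integral>\<eta>. g (- \<eta>) * fourier u (- \<eta>) \<partial>lborel)"
    by (subst integral_lborel_scale[of "-1"]) auto
  also have "(\<integral>\<eta>. g (- \<eta>) * fourier u (- \<eta>) \<partial>lborel) - (\<integral>y. quasi y * u y \<partial>lborel)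
     = (\<integral>\<eta>. g (- \<eta>) * fourier u (- \<eta>) - s (- \<eta>) * g (- \<eta>) * ?U \<eta> \<partial>lborel)"
    unfolding quasi_pairing(1) by (rule Bochner_Integration.integral_diff[symmetric, OF i1' quasi_pairing(2)])
  finally have eq: "(\<integral>y. err y * u y \<partial>lborel) = (\<integral>\<eta>. g (- \<eta>) * fourier u (- \<eta>) - s (- \<eta>) * g (- \<eta>) * ?U \<eta> \<partial>lborel)" .
  \<comment> \<open>Each vanishing condition lives near its own lattice point. Shifted by
    \<open>l\<close> and merged over countably many \<open>l\<close>, they all hold at almost every
    \<eta> near 0.\<close>
  have "AE \<eta> in lborel. \<forall>l\<in>zlattice - {0}. norm \<eta> < \<delta> \<longrightarrow> fourier \<phi> (\<eta> + l) = 0"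
  proof (subst AE_ball_countable)
    show "countable (zlattice - {0} :: (real^'d) set)" using countable_zlattice by (rule countable_subset[rotated]) auto
    show "\<forall>l\<in>zlattice - {0}. AE \<eta> in lborel. norm \<eta> < \<delta> \<longrightarrow> fourier \<phi> (\<eta> + l) = 0"
    proof
      fix l :: "real^'d" assume l: "l \<in> zlattice - {0}"
      have "AE \<xi> in distr lborel borel ((+) l). norm (l - \<xi>) < \<delta> \<longrightarrow> fourier \<phi> \<xi> = 0"
        by (subst lborel_distr_plus) (rule near_lattice[OF l])
      then have "AE \<eta> in lborel. norm (l - (l + \<eta>)) < \<delta> \<longrightarrow> fourier \<phi> (l + \<eta>) = 0"
        by (subst (asm) AE_distr_iff) auto
      then show "AE \<eta> in lborel. norm \<eta> < \<delta> \<longrightarrow> fourier \<phi> (\<eta> + l) = 0" by (simp add: add.commute)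
    qed
  qed
  then have ae: "AE \<eta> in lborel. ennreal (cmod (g (- \<eta>) * fourier u (- \<eta>) - s (- \<eta>) * g (- \<eta>) * ?U \<eta>))
    \<le> indicator {\<eta>. \<delta> \<le> norm \<eta>} \<eta> * ennreal (cmod (g (- \<eta>))) * (ennreal (cmod (fourier u (- \<eta>)))
        + ennreal (cmod (s (- \<eta>))) * (\<integral>\<^sup>+k. ennreal (cmod (W (\<eta> + k))) \<partial>ZS))"
    using near_0
  proof eventually_elim
    case (elim \<eta>)
    show ?case
    proof (cases "\<delta> \<le> norm \<eta>")
      case True
      have "ennreal (cmod (g (- \<eta>) * fourier u (- \<eta>) - s (- \<eta>) * g (- \<eta>) * ?U \<eta>))
        \<le> ennreal (cmod (g (- \<eta>)) * (cmod (fourier u (- \<eta>)) + cmod (s (- \<eta>)) * cmod (?U \<eta>)))"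
        using norm_triangle_ineq4[of "g (- \<eta>) * fourier u (- \<eta>)" "s (- \<eta>) * g (- \<eta>) * ?U \<eta>"]
        by (intro ennreal_leI) (simp add: norm_mult algebra_simps)
      also have "\<dots> = ennreal (cmod (g (- \<eta>))) * (ennreal (cmod (fourier u (- \<eta>))) + ennreal (cmod (s (- \<eta>))) * ennreal (cmod (?U \<eta>)))"
        by (simp add: ennreal_mult ennreal_plus)
      also have "\<dots> \<le> ennreal (cmod (g (- \<eta>))) * (ennreal (cmod (fourier u (- \<eta>)))
        + ennreal (cmod (s (- \<eta>))) * (\<integral>\<^sup>+k. ennreal (cmod (W (\<eta> + k))) \<partial>ZS))"
        by (intro mult_left_mono add_left_mono integral_norm_bound_ennreal') auto
      finally show ?thesis using True by simp
    next
      case False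
      have "?U \<eta> = (\<integral>k. indicator {0} (k::real^'d) *\<^sub>R W \<eta> \<partial>ZS)"
      proof (intro Bochner_Integration.integral_cong refl)
        fix k :: "real^'d" assume "k \<in> space ZS"
        then show "W (\<eta> + k) = indicator {0} k *\<^sub>R W \<eta>"
          using elim(1) False by (cases "k = 0") (auto simp: W_def)
      qed
      also have "\<dots> = W \<eta>" by (simp add: zlattice_closed measure_count_space)
      finally have "s (- \<eta>) * g (- \<eta>) * ?U \<eta> = (fourier \<phi> \<eta> * s (- \<eta>)) * (g (- \<eta>) * fourier u (- \<eta>))"
        by (simp add: W_def)
      also have "\<dots> = g (- \<eta>) * fourier u (- \<eta>)" using elim(2) False by simp
      finally have e: "s (- \<eta>) * g (- \<eta>) * ?U \<eta> = g (- \<eta>) * fourier u (- \<eta>)" .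
      show ?thesis unfolding e by simp
    qed
  qed
  have "ennreal (cmod (\<integral>y. err y * u y \<partial>lborel)) \<le> (\<integral>\<^sup>+\<eta>. ennreal (cmod (g (- \<eta>) * fourier u (- \<eta>) - s (- \<eta>) * g (- \<eta>) * ?U \<eta>)) \<partial>lborel)"
    unfolding eq by (rule integral_norm_bound_ennreal')
  also have "\<dots> \<le> (\<integral>\<^sup>+\<eta>. indicator {\<eta>. \<delta> \<le> norm \<eta>} \<eta> * ennreal (cmod (g (- \<eta>))) * (ennreal (cmod (fourier u (- \<eta>)))
        + ennreal (cmod (s (- \<eta>))) * (\<integral>\<^sup>+k. ennreal (cmod (W (\<eta> + k))) \<partial>ZS)) \<partial>lborel)"
    by (rule nn_integral_mono_AE[OF ae])
  finally show ?thesis .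
qed

end

end

section \<open>The sampling error\<close>

lemma nn_integral_lborel_nonneg_eq:
  "integrable M f \<Longrightarrow> (\<And>x. 0 \<le> f x) \<Longrightarrow> (\<integral>\<^sup>+x. ennreal (f x) \<partial>M) = ennreal (\<integral>x. f x \<partial>M)"
  by (rule nn_integral_eq_integral) auto

text \<open>The scale \<open>t\<close> is left free until both terms can be balanced; the additive
  inequality then does the work of Hoelder's inequality without any norms of products. The factors
  1/Q and 1/P are simply dropped.\<close>

lemma young_scaled:
  fixes a b t P Q :: real
  assumes P: "1 < P" and Q: "Q = P / (P - 1)" and "0 \<le> a" "0 \<le> b" and t: "0 < t"
  shows "a * b \<le> t powr Q * a powr Q + t powr (- P) * b powr P"
proof -
  have Q1: "1 < Q" using P by (simp add: Q field_simps)
  have "1 / Q + 1 / P = 1" using P by (simp add: Q field_simps)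
  then have "(t * a) * (b / t) \<le> (t * a) powr Q / Q + (b / t) powr P / P"
    using assms Q1 by (intro Youngs_inequality) auto
  also have "\<dots> \<le> (t * a) powr Q + (b / t) powr P"
    using P Q1 by (intro add_mono) (auto simp: divide_le_eq mult_le_cancel_left1)
  also have "\<dots> = t powr Q * a powr Q + t powr (- P) * b powr P"
    using assms by (simp add: powr_mult powr_divide powr_minus field_simps)
  finally show ?thesis using t by simp
qed

text \<open>The two terms use the lattice sum in opposite ways. In the first it falls on
  \<open>f\<close>, the spectrum of \<phi>, at fixed \<eta>. In the second a shift of \<eta> by k
  frees \<open>v\<close>, the transform of the test function, and lets the sum fall on the weight
  \<open>b\<close>.\<close>

lemma nn_integral_ZS_young:
  fixes a b f v :: "real^'d \<Rightarrow> ennreal"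
  assumes [measurable]: "a \<in> borel_measurable borel" "b \<in> borel_measurable borel"
      "f \<in> borel_measurable borel" "v \<in> borel_measurable borel"
    and f: "\<And>\<xi>. (\<integral>\<^sup>+k. f (\<xi> + k) \<partial>ZS) \<le> Bf" and b: "\<And>y. (\<integral>\<^sup>+k. b (y + k) \<partial>ZS) \<le> Cb"
    and le: "\<And>\<eta> k. F \<eta> k \<le> a \<eta> * f (\<eta> + k) + b \<eta> * v (- (\<eta> + k))"
  shows "(\<integral>\<^sup>+\<eta>. (\<integral>\<^sup>+k. F \<eta> k \<partial>ZS) \<partial>lborel) \<le> (\<integral>\<^sup>+\<eta>. a \<eta> \<partial>lborel) * Bf + Cb * (\<integral>\<^sup>+\<eta>. v (- \<eta>) \<partial>lborel)"
proof -
  have [measurable]: "(\<lambda>\<eta>. \<integral>\<^sup>+k. a \<eta> * f (\<eta> + k) \<partial>ZS) \<in> borel_measurable borel"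
    by (rule borel_measurable_nn_integral_ZS) measurable
  have [measurable]: "(\<lambda>\<eta>. \<integral>\<^sup>+k. b \<eta> * v (- (\<eta> + k)) \<partial>ZS) \<in> borel_measurable borel"
    by (rule borel_measurable_nn_integral_ZS) measurable
  have "(\<integral>\<^sup>+\<eta>. (\<integral>\<^sup>+k. F \<eta> k \<partial>ZS) \<partial>lborel)
    \<le> (\<integral>\<^sup>+\<eta>. (\<integral>\<^sup>+k. a \<eta> * f (\<eta> + k) + b \<eta> * v (- (\<eta> + k)) \<partial>ZS) \<partial>lborel)"
    by (intro nn_integral_mono le)
  also have "\<dots> = (\<integral>\<^sup>+\<eta>. (\<integral>\<^sup>+k. a \<eta> * f (\<eta> + k) \<partial>ZS) + (\<integral>\<^sup>+k. b \<eta> * v (- (\<eta> + k)) \<partial>ZS) \<partial>lborel)"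
    by (intro nn_integral_cong nn_integral_add) auto
  also have "\<dots> = (\<integral>\<^sup>+\<eta>. (\<integral>\<^sup>+k. a \<eta> * f (\<eta> + k) \<partial>ZS) \<partial>lborel) + (\<integral>\<^sup>+\<eta>. (\<integral>\<^sup>+k. b \<eta> * v (- (\<eta> + k)) \<partial>ZS) \<partial>lborel)"
    by (rule nn_integral_add) measurable
  also have "\<dots> \<le> (\<integral>\<^sup>+\<eta>. a \<eta> \<partial>lborel) * Bf + Cb * (\<integral>\<^sup>+\<eta>. v (- \<eta>) \<partial>lborel)"
  proof (rule add_mono)
    have "(\<integral>\<^sup>+\<eta>. (\<integral>\<^sup>+k. a \<eta> * f (\<eta> + k) \<partial>ZS) \<partial>lborel) = (\<integral>\<^sup>+\<eta>. a \<eta> * (\<integral>\<^sup>+k. f (\<eta> + k) \<partial>ZS) \<partial>lborel)"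
      by (intro nn_integral_cong nn_integral_cmult) auto
    also have "\<dots> \<le> (\<integral>\<^sup>+\<eta>. a \<eta> * Bf \<partial>lborel)" by (intro nn_integral_mono mult_left_mono f) auto
    also have "\<dots> = (\<integral>\<^sup>+\<eta>. a \<eta> \<partial>lborel) * Bf" by (rule nn_integral_multc) measurable
    finally show "(\<integral>\<^sup>+\<eta>. (\<integral>\<^sup>+k. a \<eta> * f (\<eta> + k) \<partial>ZS) \<partial>lborel) \<le> (\<integral>\<^sup>+\<eta>. a \<eta> \<partial>lborel) * Bf" .
    have "(\<integral>\<^sup>+\<eta>. (\<integral>\<^sup>+k. b \<eta> * v (- (\<eta> + k)) \<partial>ZS) \<partial>lborel) = (\<integral>\<^sup>+k. (\<integral>\<^sup>+\<eta>. b \<eta> * v (- (\<eta> + k)) \<partial>lborel) \<partial>ZS)"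
      by (rule nn_integral_ZS_swap) measurable
    also have "\<dots> = (\<integral>\<^sup>+k. (\<integral>\<^sup>+\<eta>. b (\<eta> + - k) * v (- \<eta>) \<partial>lborel) \<partial>ZS)"
    proof (rule nn_integral_cong)
      fix k :: "real^'d"
      have "(\<integral>\<^sup>+\<eta>. b ((\<eta> + k) + - k) * v (- (\<eta> + k)) \<partial>lborel) = (\<integral>\<^sup>+\<eta>. b (\<eta> + - k) * v (- \<eta>) \<partial>lborel)"
        by (rule nn_integral_lborel_translate[of "\<lambda>\<eta>. b (\<eta> + - k) * v (- \<eta>)"]) measurable
      then show "(\<integral>\<^sup>+\<eta>. b \<eta> * v (- (\<eta> + k)) \<partial>lborel) = (\<integral>\<^sup>+\<eta>. b (\<eta> + - k) * v (- \<eta>) \<partial>lborel)" by simp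
    qed
    also have "\<dots> = (\<integral>\<^sup>+\<eta>. (\<integral>\<^sup>+k. b (\<eta> + - k) * v (- \<eta>) \<partial>ZS) \<partial>lborel)"
      by (rule nn_integral_ZS_swap[symmetric]) measurable
    also have "\<dots> = (\<integral>\<^sup>+\<eta>. (\<integral>\<^sup>+k. b (\<eta> + - k) \<partial>ZS) * v (- \<eta>) \<partial>lborel)"
      by (intro nn_integral_cong nn_integral_multc) auto
    also have "\<dots> = (\<integral>\<^sup>+\<eta>. (\<integral>\<^sup>+k. b (\<eta> + k) \<partial>ZS) * v (- \<eta>) \<partial>lborel)"
    proof (rule nn_integral_cong)
      fix \<eta> :: "real^'d"
      show "(\<integral>\<^sup>+k. b (\<eta> + - k) \<partial>ZS) * v (- \<eta>) = (\<integral>\<^sup>+k. b (\<eta> + k) \<partial>ZS) * v (- \<eta>)"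
        by (subst nn_integral_ZS_reflect) (rule refl)
    qed
    also have "\<dots> \<le> (\<integral>\<^sup>+\<eta>. Cb * v (- \<eta>) \<partial>lborel)"
      by (intro nn_integral_mono mult_right_mono b) auto
    also have "\<dots> = Cb * (\<integral>\<^sup>+\<eta>. v (- \<eta>) \<partial>lborel)" by (rule nn_integral_cmult) measurable
    finally show "(\<integral>\<^sup>+\<eta>. (\<integral>\<^sup>+k. b \<eta> * v (- (\<eta> + k)) \<partial>ZS) \<partial>lborel) \<le> Cb * (\<integral>\<^sup>+\<eta>. v (- \<eta>) \<partial>lborel)" .
  qed
  finally show ?thesis .
qed

context sampling
begin

text \<open>The Q-th power of a weighted L_Q norm of the spectrum outside the ball. The argument is
  the full weight exponent and is always taken as N + \<sigma> below. The reflection of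
  \<open>g\<close> matches the pairing formula.\<close>

definition weight :: "real \<Rightarrow> real \<Rightarrow> ennreal" where
  "weight Q \<sigma> = (\<integral>\<^sup>+\<eta>. indicator {\<eta>. \<delta> \<le> norm \<eta>} \<eta> * ennreal (cmod (g (- \<eta>)) powr Q * norm \<eta> powr (\<sigma> * Q)) \<partial>lborel)"

text \<open>Outside the ball 1 + |\<eta>| \<le> (1 + 1/\<delta>) |\<eta>|, so |\<eta>|^N pays for
  the growth of the symbol; the surplus |\<eta>|^(-\<sigma>) is retained for the lattice sum. Where
  no symbol occurs, the whole weight is bounded below by its value at \<delta>.\<close>

lemma symbol_tail_bound:
  assumes s: "\<And>\<eta>. cmod (s \<eta>) \<le> Cs * (1 + norm \<eta>) ^ N" and \<sigma>: "0 \<le> \<sigma>" and \<eta>: "\<delta> \<le> norm \<eta>"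
  shows "cmod (g (- \<eta>)) \<le> (cmod (g (- \<eta>)) * norm \<eta> powr (real N + \<sigma>)) * \<delta> powr (- (real N + \<sigma>))"
    and "cmod (g (- \<eta>)) * cmod (s (- \<eta>))
      \<le> (cmod (g (- \<eta>)) * norm \<eta> powr (real N + \<sigma>)) * (Cs * (1 + 1 / \<delta>) ^ N * norm \<eta> powr (- \<sigma>))"
proof -
  have n0: "0 < norm \<eta>" by (rule less_le_trans[OF \<delta>_pos \<eta>])
  have Cs: "0 \<le> Cs" using order_trans[OF norm_ge_zero s[of 0]] by simp
  have "1 = norm \<eta> powr (real N + \<sigma>) * norm \<eta> powr (- (real N + \<sigma>))"
    using n0 by (subst powr_add[symmetric]) simp
  also have "\<dots> \<le> norm \<eta> powr (real N + \<sigma>) * \<delta> powr (- (real N + \<sigma>))"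
    using \<delta>_pos \<eta> \<sigma> by (intro mult_left_mono powr_mono2') auto
  finally have "cmod (g (- \<eta>)) * 1 \<le> cmod (g (- \<eta>)) * (norm \<eta> powr (real N + \<sigma>) * \<delta> powr (- (real N + \<sigma>)))"
    by (intro mult_left_mono) auto
  then show "cmod (g (- \<eta>)) \<le> (cmod (g (- \<eta>)) * norm \<eta> powr (real N + \<sigma>)) * \<delta> powr (- (real N + \<sigma>))"
    by (simp add: mult.assoc)
  have "1 \<le> norm \<eta> / \<delta>" using \<eta> \<delta>_pos by simp
  then have "1 + norm \<eta> \<le> (1 + 1 / \<delta>) * norm \<eta>" by (simp add: distrib_right)
  then have "(1 + norm \<eta>) ^ N \<le> ((1 + 1 / \<delta>) * norm \<eta>) ^ N" by (intro power_mono) auto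
  also have "\<dots> = (1 + 1 / \<delta>) ^ N * norm \<eta> powr (real N)" using n0 by (simp add: power_mult_distrib powr_realpow)
  finally have "Cs * (1 + norm \<eta>) ^ N \<le> Cs * ((1 + 1 / \<delta>) ^ N * norm \<eta> powr (real N))"
    using Cs by (intro mult_left_mono)
  then have "cmod (s (- \<eta>)) \<le> Cs * ((1 + 1 / \<delta>) ^ N * norm \<eta> powr (real N))"
    using s[of "- \<eta>"] by simp
  also have "\<dots> = norm \<eta> powr (real N + \<sigma>) * (Cs * (1 + 1 / \<delta>) ^ N * norm \<eta> powr (- \<sigma>))"
  proof -
    have "norm \<eta> powr (real N) = norm \<eta> powr (real N + \<sigma>) * norm \<eta> powr (- \<sigma>)"
      by (subst powr_add[symmetric]) simp
    then show ?thesis by simp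
  qed
  finally have "cmod (g (- \<eta>)) * cmod (s (- \<eta>)) \<le> cmod (g (- \<eta>)) * (norm \<eta> powr (real N + \<sigma>) * (Cs * (1 + 1 / \<delta>) ^ N * norm \<eta> powr (- \<sigma>)))"
    by (intro mult_left_mono) auto
  then show "cmod (g (- \<eta>)) * cmod (s (- \<eta>))
      \<le> (cmod (g (- \<eta>)) * norm \<eta> powr (real N + \<sigma>)) * (Cs * (1 + 1 / \<delta>) ^ N * norm \<eta> powr (- \<sigma>))"
    by (simp only: mult.assoc)
qed

text \<open>Both contributions outside the ball are split by Young's inequality with the same scale
  \<open>t\<close>: the weighted spectrum of \<open>g\<close> receives the power Q, the transform of
  \<open>u\<close> the power P, controlled by Hausdorff--Young through \<open>CH\<close>. The
  condition on \<open>X\<close> to be positive is what permits balancing by a power of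
  \<open>X\<close>.\<close>

lemma err_pairing_Lp:
  assumes P: "2 \<le> P" and Q: "Q = P / (P - 1)"
    and s: "\<And>\<eta>. cmod (s \<eta>) \<le> Cs * (1 + norm \<eta>) ^ N" and \<sigma>: "0 \<le> \<sigma>"
    and B: "0 \<le> B" "\<And>\<xi>. (\<integral>\<^sup>+k. ennreal (cmod (fourier \<phi> (\<xi> + k)) powr Q) \<partial>ZS) \<le> ennreal B"
    and CL: "0 \<le> CL" "\<And>y :: real^'d. (\<integral>\<^sup>+k. indicator {x. \<delta> \<le> norm x} (y + k) * ennreal (norm (y + k) powr (- (\<sigma> * P))) \<partial>ZS) \<le> ennreal CL"
    and X: "0 < X" "weight Q (real N + \<sigma>) \<le> ennreal X"
    and u: "test_fun u" and CH: "0 \<le> CH" "(\<integral>\<^sup>+\<xi>. ennreal (cmod (fourier u \<xi>) powr P) \<partial>lborel) \<le> ennreal CH"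
  shows "cmod (\<integral>y. err y * u y \<partial>lborel)
    \<le> ((1 + B) + CH * ((\<delta> powr (- (real N + \<sigma>))) powr P + (Cs * (1 + 1 / \<delta>) ^ N) powr P * CL)) * X powr (1 / Q)"
proof -
  have [measurable]: "u \<in> borel_measurable borel" by (rule test_fun_borel[OF u])
  define D0 where "D0 = \<delta> powr (- (real N + \<sigma>))"
  define D1 where "D1 = Cs * (1 + 1 / \<delta>) ^ N"
  have Cs: "0 \<le> Cs" using order_trans[OF norm_ge_zero s[of 0]] by simp
  have D: "0 \<le> D0" "0 \<le> D1" using Cs \<delta>_pos by (auto simp: D0_def D1_def)
  define h where "h \<eta> = cmod (g (- \<eta>)) * norm \<eta> powr (real N + \<sigma>)" for \<eta>
  have h0: "0 \<le> h \<eta>" for \<eta> by (simp add: h_def)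
  have [measurable]: "h \<in> borel_measurable borel" unfolding h_def by measurable
  let ?I = "\<lambda>\<eta>. indicator {\<eta> :: real^'d. \<delta> \<le> norm \<eta>} \<eta> :: ennreal"
  have [measurable]: "?I \<in> borel_measurable borel" by (intro borel_measurable_indicator) measurable
  have P1: "1 < P" using P by simp
  \<comment> \<open>The balancing scale: with it both \<open>t powr Q * X\<close> and
    \<open>t powr (- P)\<close> equal \<open>X powr (1 / Q)\<close>.\<close>
  define t where "t = X powr (- 1 / (P * Q))"
  have t: "0 < t" using X by (simp add: t_def)
  have Qpos: "1 < Q" using P by (simp add: Q field_simps)
  have pq: "1 - 1 / P = 1 / Q" using P by (simp add: Q field_simps)
  have tQ: "t powr Q * X = X powr (1 / Q)"
  proof -
    have "t powr Q = X powr (- 1 / P)" using Qpos by (simp add: t_def powr_powr)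
    then have "t powr Q * X = X powr (- 1 / P) * X powr 1" using X by simp
    also have "\<dots> = X powr (- 1 / P + 1)" by (rule powr_add[symmetric])
    also have "- 1 / P + 1 = 1 / Q" using pq by simp
    finally show ?thesis .
  qed
  have tP: "t powr (- P) = X powr (1 / Q)" using P by (simp add: t_def powr_powr)
  have hX: "(\<integral>\<^sup>+\<eta>. ?I \<eta> * ennreal (h \<eta> powr Q) \<partial>lborel) \<le> ennreal X"
  proof -
    have "h \<eta> powr Q = cmod (g (- \<eta>)) powr Q * norm \<eta> powr ((real N + \<sigma>) * Q)" for \<eta>
      by (simp add: h_def powr_mult powr_powr)
    then show ?thesis using X(2) by (simp add: weight_def)
  qed
  have Fu: "(\<integral>\<^sup>+\<eta>. ennreal (cmod (fourier u (- \<eta>)) powr P) \<partial>lborel) \<le> ennreal CH"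
    using CH(2) nn_integral_lborel_uminus[of "\<lambda>\<xi>. ennreal (cmod (fourier u \<xi>) powr P)"] by simp
  \<comment> \<open>The contribution of the function itself, which involves neither the symbol nor a
    lattice sum.\<close>
  have T1: "?I \<eta> * ennreal (cmod (g (- \<eta>))) * ennreal (cmod (fourier u (- \<eta>)))
     \<le> ennreal (t powr Q) * (?I \<eta> * ennreal (h \<eta> powr Q)) + ennreal (t powr (- P) * D0 powr P) * ennreal (cmod (fourier u (- \<eta>)) powr P)" for \<eta>
  proof (cases "\<delta> \<le> norm \<eta>")
    case True
    have "cmod (g (- \<eta>)) * cmod (fourier u (- \<eta>)) \<le> h \<eta> * D0 * cmod (fourier u (- \<eta>))"
      using symbol_tail_bound(1)[OF s \<sigma> True] unfolding h_def D0_def by (intro mult_right_mono) auto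
    also have "\<dots> = h \<eta> * (D0 * cmod (fourier u (- \<eta>)))" by simp
    also have "\<dots> \<le> t powr Q * h \<eta> powr Q + t powr (- P) * (D0 * cmod (fourier u (- \<eta>))) powr P"
      using D by (intro young_scaled P1 Q t h0) auto
    also have "(D0 * cmod (fourier u (- \<eta>))) powr P = D0 powr P * cmod (fourier u (- \<eta>)) powr P"
      using D by (simp add: powr_mult)
    finally have "ennreal (cmod (g (- \<eta>)) * cmod (fourier u (- \<eta>)))
      \<le> ennreal (t powr Q * h \<eta> powr Q + t powr (- P) * (D0 powr P * cmod (fourier u (- \<eta>)) powr P))"
      by (rule ennreal_leI)
    then show ?thesis using True D by (simp add: ennreal_mult ennreal_plus mult.assoc)
  qed simp
  \<comment> \<open>The contribution of one lattice translate: |F \<phi>| goes with the Q-th power,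
    whose lattice sum is bounded by \<open>B\<close>, and |\<eta>|^(-\<sigma>) with the P-th power,
    whose lattice sum is bounded by \<open>CL\<close>.\<close>
  have T2: "?I \<eta> * ennreal (cmod (g (- \<eta>))) * (ennreal (cmod (s (- \<eta>))) * ennreal (cmod (W u (\<eta> + k))))
     \<le> ennreal (t powr Q) * (?I \<eta> * ennreal (h \<eta> powr Q)) * ennreal (cmod (fourier \<phi> (\<eta> + k)) powr Q)
      + ennreal (t powr (- P) * D1 powr P) * (?I \<eta> * ennreal (norm \<eta> powr (- (\<sigma> * P))) * ennreal (cmod (fourier u (- (\<eta> + k))) powr P))" for \<eta> k
  proof (cases "\<delta> \<le> norm \<eta>")
    case True
    let ?f = "cmod (fourier \<phi> (\<eta> + k))" and ?u = "cmod (fourier u (- (\<eta> + k)))"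
    have "cmod (g (- \<eta>)) * cmod (s (- \<eta>)) * cmod (W u (\<eta> + k)) \<le> (h \<eta> * (D1 * norm \<eta> powr (- \<sigma>))) * cmod (W u (\<eta> + k))"
      using symbol_tail_bound(2)[OF s \<sigma> True] unfolding h_def D1_def by (intro mult_right_mono) auto
    also have "\<dots> = (h \<eta> * ?f) * (D1 * norm \<eta> powr (- \<sigma>) * ?u)"
      by (simp add: W_def[OF u] norm_mult mult_ac)
    also have "\<dots> \<le> t powr Q * (h \<eta> * ?f) powr Q + t powr (- P) * (D1 * norm \<eta> powr (- \<sigma>) * ?u) powr P"
      using D h0 by (intro young_scaled P1 Q t) auto
    also have "(h \<eta> * ?f) powr Q = h \<eta> powr Q * ?f powr Q" using h0 by (simp add: powr_mult)
    also have "(D1 * norm \<eta> powr (- \<sigma>) * ?u) powr P = D1 powr P * (norm \<eta> powr (- (\<sigma> * P)) * ?u powr P)"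
      using D by (simp add: powr_mult powr_powr)
    finally have "ennreal (cmod (g (- \<eta>)) * cmod (s (- \<eta>)) * cmod (W u (\<eta> + k)))
      \<le> ennreal (t powr Q * (h \<eta> powr Q * ?f powr Q) + t powr (- P) * (D1 powr P * (norm \<eta> powr (- (\<sigma> * P)) * ?u powr P)))"
      by (rule ennreal_leI)
    then show ?thesis using True D by (simp add: ennreal_mult ennreal_plus mult.assoc)
  qed simp
  have S1: "(\<integral>\<^sup>+\<eta>. ?I \<eta> * ennreal (cmod (g (- \<eta>))) * ennreal (cmod (fourier u (- \<eta>))) \<partial>lborel)
    \<le> ennreal (t powr Q * X + t powr (- P) * D0 powr P * CH)"
  proof -
    have "(\<integral>\<^sup>+\<eta>. ?I \<eta> * ennreal (cmod (g (- \<eta>))) * ennreal (cmod (fourier u (- \<eta>))) \<partial>lborel)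
      \<le> (\<integral>\<^sup>+\<eta>. ennreal (t powr Q) * (?I \<eta> * ennreal (h \<eta> powr Q)) + ennreal (t powr (- P) * D0 powr P) * ennreal (cmod (fourier u (- \<eta>)) powr P) \<partial>lborel)"
      by (intro nn_integral_mono T1)
    also have "\<dots> = ennreal (t powr Q) * (\<integral>\<^sup>+\<eta>. ?I \<eta> * ennreal (h \<eta> powr Q) \<partial>lborel)
        + ennreal (t powr (- P) * D0 powr P) * (\<integral>\<^sup>+\<eta>. ennreal (cmod (fourier u (- \<eta>)) powr P) \<partial>lborel)"
      by (subst nn_integral_add, measurable) (subst nn_integral_cmult, measurable, subst nn_integral_cmult, auto)
    also have "\<dots> \<le> ennreal (t powr Q) * ennreal X + ennreal (t powr (- P) * D0 powr P) * ennreal CH"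
      by (intro add_mono mult_left_mono hX Fu) auto
    also have "\<dots> = ennreal (t powr Q * X + t powr (- P) * D0 powr P * CH)"
      using X CH by (simp add: ennreal_mult ennreal_plus)
    finally show ?thesis .
  qed
  have S2: "(\<integral>\<^sup>+\<eta>. ?I \<eta> * ennreal (cmod (g (- \<eta>))) * (ennreal (cmod (s (- \<eta>))) * (\<integral>\<^sup>+k. ennreal (cmod (W u (\<eta> + k))) \<partial>ZS)) \<partial>lborel)
    \<le> ennreal (t powr Q * B * X + t powr (- P) * D1 powr P * CL * CH)"
  proof -
    let ?c = "ennreal (t powr (- P) * D1 powr P)"
    have "(\<integral>\<^sup>+\<eta>. ?I \<eta> * ennreal (cmod (g (- \<eta>))) * (ennreal (cmod (s (- \<eta>))) * (\<integral>\<^sup>+k. ennreal (cmod (W u (\<eta> + k))) \<partial>ZS)) \<partial>lborel)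
      = (\<integral>\<^sup>+\<eta>. (\<integral>\<^sup>+k. ?I \<eta> * ennreal (cmod (g (- \<eta>))) * (ennreal (cmod (s (- \<eta>))) * ennreal (cmod (W u (\<eta> + k)))) \<partial>ZS) \<partial>lborel)"
      by (simp add: nn_integral_cmult)
    also have "\<dots> \<le> (\<integral>\<^sup>+\<eta>. ennreal (t powr Q) * (?I \<eta> * ennreal (h \<eta> powr Q)) \<partial>lborel) * ennreal B
      + (?c * ennreal CL) * (\<integral>\<^sup>+\<eta>. ennreal (cmod (fourier u (- \<eta>)) powr P) \<partial>lborel)"
    proof (rule nn_integral_ZS_young[where f = "\<lambda>\<xi>. ennreal (cmod (fourier \<phi> \<xi>) powr Q)" and v = "\<lambda>\<xi>. ennreal (cmod (fourier u \<xi>) powr P)"])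
      show "?I \<eta> * ennreal (cmod (g (- \<eta>))) * (ennreal (cmod (s (- \<eta>))) * ennreal (cmod (W u (\<eta> + k))))
        \<le> (ennreal (t powr Q) * (?I \<eta> * ennreal (h \<eta> powr Q))) * ennreal (cmod (fourier \<phi> (\<eta> + k)) powr Q)
          + (?c * (?I \<eta> * ennreal (norm \<eta> powr (- (\<sigma> * P))))) * ennreal (cmod (fourier u (- (\<eta> + k))) powr P)" for \<eta> k
        using T2[of \<eta> k] by (simp only: mult.assoc)
      show "(\<integral>\<^sup>+k. ?c * (?I (y + k) * ennreal (norm (y + k) powr (- (\<sigma> * P)))) \<partial>ZS) \<le> ?c * ennreal CL" for y :: "real^'d"
      proof -
        have "(\<integral>\<^sup>+k. ?c * (?I (y + k) * ennreal (norm (y + k) powr (- (\<sigma> * P)))) \<partial>ZS)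
          = ?c * (\<integral>\<^sup>+k. ?I (y + k) * ennreal (norm (y + k) powr (- (\<sigma> * P))) \<partial>ZS)"
          by (rule nn_integral_cmult) simp
        also have "\<dots> \<le> ?c * ennreal CL"
          using CL(2)[of y] by (intro mult_left_mono) simp_all
        finally show ?thesis .
      qed
    qed (use B in measurable)
    also have "(\<integral>\<^sup>+\<eta>. ennreal (t powr Q) * (?I \<eta> * ennreal (h \<eta> powr Q)) \<partial>lborel) = ennreal (t powr Q) * (\<integral>\<^sup>+\<eta>. ?I \<eta> * ennreal (h \<eta> powr Q) \<partial>lborel)"
      by (rule nn_integral_cmult) measurable
    also have "ennreal (t powr Q) * (\<integral>\<^sup>+\<eta>. ?I \<eta> * ennreal (h \<eta> powr Q) \<partial>lborel) * ennreal B
      + (?c * ennreal CL) * (\<integral>\<^sup>+\<eta>. ennreal (cmod (fourier u (- \<eta>)) powr P) \<partial>lborel)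
      \<le> ennreal (t powr Q) * ennreal X * ennreal B + (?c * ennreal CL) * ennreal CH"
      by (intro add_mono mult_right_mono mult_left_mono hX Fu) auto
    also have "\<dots> = ennreal (t powr Q * B * X + t powr (- P) * D1 powr P * CL * CH)"
      using X CH B CL by (simp add: ennreal_mult ennreal_plus mult_ac)
    finally show ?thesis .
  qed
  have "ennreal (cmod (\<integral>y. err y * u y \<partial>lborel)) \<le>
    (\<integral>\<^sup>+\<eta>. ?I \<eta> * ennreal (cmod (g (- \<eta>))) * ennreal (cmod (fourier u (- \<eta>)))
      + ?I \<eta> * ennreal (cmod (g (- \<eta>))) * (ennreal (cmod (s (- \<eta>))) * (\<integral>\<^sup>+k. ennreal (cmod (W u (\<eta> + k))) \<partial>ZS)) \<partial>lborel)"
    using err_pairing_bound[OF u] by (simp only: distrib_left)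
  also have "\<dots> = (\<integral>\<^sup>+\<eta>. ?I \<eta> * ennreal (cmod (g (- \<eta>))) * ennreal (cmod (fourier u (- \<eta>))) \<partial>lborel)
    + (\<integral>\<^sup>+\<eta>. ?I \<eta> * ennreal (cmod (g (- \<eta>))) * (ennreal (cmod (s (- \<eta>))) * (\<integral>\<^sup>+k. ennreal (cmod (W u (\<eta> + k))) \<partial>ZS)) \<partial>lborel)"
  proof (rule nn_integral_add)
    note W_borel[OF u, measurable]
    have [measurable]: "(\<lambda>\<eta>. \<integral>\<^sup>+k. ennreal (cmod (W u (\<eta> + k))) \<partial>ZS) \<in> borel_measurable borel"
      by (rule borel_measurable_nn_integral_ZS) measurable
    show "(\<lambda>\<eta>. ?I \<eta> * ennreal (cmod (g (- \<eta>))) * (ennreal (cmod (s (- \<eta>))) * (\<integral>\<^sup>+k. ennreal (cmod (W u (\<eta> + k))) \<partial>ZS))) \<in> borel_measurable lborel"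
      by measurable
  qed measurable
  also have "\<dots> \<le> ennreal (t powr Q * X + t powr (- P) * D0 powr P * CH) + ennreal (t powr Q * B * X + t powr (- P) * D1 powr P * CL * CH)"
    by (intro add_mono S1 S2)
  also have "\<dots> = ennreal ((t powr Q * X + t powr (- P) * D0 powr P * CH) + (t powr Q * B * X + t powr (- P) * D1 powr P * CL * CH))"
    using X CH B CL by (intro ennreal_plus[symmetric]) auto
  also have "(t powr Q * X + t powr (- P) * D0 powr P * CH) + (t powr Q * B * X + t powr (- P) * D1 powr P * CL * CH)
    = (t powr Q * X) * (1 + B) + t powr (- P) * (CH * (D0 powr P + D1 powr P * CL))"
    by (simp add: algebra_simps)
  also have "\<dots> = ((1 + B) + CH * (D0 powr P + D1 powr P * CL)) * X powr (1 / Q)"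
    unfolding tQ tP by (simp add: algebra_simps)
  finally have "ennreal (cmod (\<integral>y. err y * u y \<partial>lborel)) \<le> ennreal (((1 + B) + CH * (D0 powr P + D1 powr P * CL)) * X powr (1 / Q))" .
  then show ?thesis
    using X CH B CL by (subst (asm) ennreal_le_iff) (auto simp: D0_def D1_def)
qed

text \<open>At the endpoint Q = 1 the trivial bound of F u by the L_1 norm of \<open>u\<close>
  replaces Hausdorff--Young. It comes out of the lattice sum as a constant, so only the sum of |F
  \<phi>| remains and |\<eta>|^(-\<sigma>) is merely bounded by its value at \<delta>.\<close>

lemma err_pairing_Linf:
  assumes s: "\<And>\<eta>. cmod (s \<eta>) \<le> Cs * (1 + norm \<eta>) ^ N" and \<sigma>: "0 \<le> \<sigma>"
    and B: "0 \<le> B" "\<And>\<xi>. (\<integral>\<^sup>+k. ennreal (cmod (fourier \<phi> (\<xi> + k))) \<partial>ZS) \<le> ennreal B"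
    and X: "0 \<le> X" "weight 1 (real N + \<sigma>) \<le> ennreal X" and u: "test_fun u"
  shows "cmod (\<integral>y. err y * u y \<partial>lborel)
    \<le> ((\<delta> powr (- (real N + \<sigma>))) + (Cs * (1 + 1 / \<delta>) ^ N) * \<delta> powr (- \<sigma>) * B) * X * (\<integral>y. cmod (u y) \<partial>lborel)"
proof -
  have [measurable]: "u \<in> borel_measurable borel" by (rule test_fun_borel[OF u])
  define D0 where "D0 = \<delta> powr (- (real N + \<sigma>))"
  define D1 where "D1 = Cs * (1 + 1 / \<delta>) ^ N"
  define D2 where "D2 = D1 * \<delta> powr (- \<sigma>)"
  define Y where "Y = (\<integral>y. cmod (u y) \<partial>lborel)"
  have Y: "0 \<le> Y" unfolding Y_def by (rule integral_nonneg_AE) simp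
  have uY: "cmod (fourier u \<xi>) \<le> Y" for \<xi> unfolding Y_def by (rule norm_fourier_le) measurable
  have Cs: "0 \<le> Cs" using order_trans[OF norm_ge_zero s[of 0]] by simp
  have D: "0 \<le> D0" "0 \<le> D1" "0 \<le> D2" using Cs \<delta>_pos by (auto simp: D0_def D1_def D2_def)
  define h where "h \<eta> = cmod (g (- \<eta>)) * norm \<eta> powr (real N + \<sigma>)" for \<eta>
  have h0: "0 \<le> h \<eta>" for \<eta> by (simp add: h_def)
  have [measurable]: "h \<in> borel_measurable borel" unfolding h_def by measurable
  let ?I = "\<lambda>\<eta>. indicator {\<eta> :: real^'d. \<delta> \<le> norm \<eta>} \<eta> :: ennreal"
  have [measurable]: "?I \<in> borel_measurable borel" by (intro borel_measurable_indicator) measurable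
  have hX: "(\<integral>\<^sup>+\<eta>. ?I \<eta> * ennreal (h \<eta>) \<partial>lborel) \<le> ennreal X"
    using X(2) by (simp add: weight_def h_def)
  have "?I \<eta> * ennreal (cmod (g (- \<eta>))) * (ennreal (cmod (fourier u (- \<eta>)))
        + ennreal (cmod (s (- \<eta>))) * (\<integral>\<^sup>+k. ennreal (cmod (W u (\<eta> + k))) \<partial>ZS))
     \<le> ennreal ((D0 + D2 * B) * Y) * (?I \<eta> * ennreal (h \<eta>))" for \<eta>
  proof (cases "\<delta> \<le> norm \<eta>")
    case True
    have "(\<integral>\<^sup>+k. ennreal (cmod (W u (\<eta> + k))) \<partial>ZS) \<le> (\<integral>\<^sup>+k. ennreal Y * ennreal (cmod (fourier \<phi> (\<eta> + k))) \<partial>ZS)"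
      using Y uY by (intro nn_integral_mono) (auto simp: W_def[OF u] norm_mult mult.commute[of Y] simp flip: ennreal_mult intro!: ennreal_leI mult_left_mono)
    also have "\<dots> = ennreal Y * (\<integral>\<^sup>+k. ennreal (cmod (fourier \<phi> (\<eta> + k))) \<partial>ZS)" by (rule nn_integral_cmult) simp
    also have "\<dots> \<le> ennreal Y * ennreal B" by (intro mult_left_mono B) auto
    finally have WB: "(\<integral>\<^sup>+k. ennreal (cmod (W u (\<eta> + k))) \<partial>ZS) \<le> ennreal (Y * B)"
      using Y B by (simp add: ennreal_mult)
    have a: "cmod (g (- \<eta>)) \<le> h \<eta> * D0" using symbol_tail_bound(1)[OF s \<sigma> True] by (simp add: h_def D0_def)
    have "norm \<eta> powr (- \<sigma>) \<le> \<delta> powr (- \<sigma>)" using True \<delta>_pos \<sigma> by (intro powr_mono2') auto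
    then have "h \<eta> * (D1 * norm \<eta> powr (- \<sigma>)) \<le> h \<eta> * D2"
      unfolding D2_def using h0 D by (intro mult_left_mono) auto
    then have b: "cmod (g (- \<eta>)) * cmod (s (- \<eta>)) \<le> h \<eta> * D2"
      using symbol_tail_bound(2)[OF s \<sigma> True] by (simp add: h_def D1_def)
    have "ennreal (cmod (g (- \<eta>))) * (ennreal (cmod (fourier u (- \<eta>))) + ennreal (cmod (s (- \<eta>))) * (\<integral>\<^sup>+k. ennreal (cmod (W u (\<eta> + k))) \<partial>ZS))
      \<le> ennreal (cmod (g (- \<eta>))) * (ennreal Y + ennreal (cmod (s (- \<eta>))) * ennreal (Y * B))"
      by (intro mult_left_mono add_mono WB ennreal_leI uY) auto
    also have "\<dots> = ennreal (cmod (g (- \<eta>)) * Y + (cmod (g (- \<eta>)) * cmod (s (- \<eta>))) * (Y * B))"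
      using Y B by (simp add: ennreal_mult ennreal_plus distrib_left mult.assoc)
    also have "\<dots> \<le> ennreal ((h \<eta> * D0) * Y + (h \<eta> * D2) * (Y * B))"
      using Y B by (intro ennreal_leI add_mono mult_right_mono a b) auto
    also have "(h \<eta> * D0) * Y + (h \<eta> * D2) * (Y * B) = ((D0 + D2 * B) * Y) * h \<eta>" by (simp add: algebra_simps)
    finally show ?thesis using True D B Y h0 by (simp add: ennreal_mult)
  qed simp
  then have "ennreal (cmod (\<integral>y. err y * u y \<partial>lborel)) \<le> (\<integral>\<^sup>+\<eta>. ennreal ((D0 + D2 * B) * Y) * (?I \<eta> * ennreal (h \<eta>)) \<partial>lborel)"
    by (intro order_trans[OF err_pairing_bound[OF u]] nn_integral_mono)
  also have "\<dots> = ennreal ((D0 + D2 * B) * Y) * (\<integral>\<^sup>+\<eta>. ?I \<eta> * ennreal (h \<eta>) \<partial>lborel)"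
    by (rule nn_integral_cmult) measurable
  also have "\<dots> \<le> ennreal ((D0 + D2 * B) * Y) * ennreal X" by (intro mult_left_mono hX) auto
  also have "\<dots> = ennreal ((D0 + D2 * B) * X * Y)" using D B X Y by (simp add: mult_ac flip: ennreal_mult)
  finally show ?thesis
    using D B X Y by (subst (asm) ennreal_le_iff) (auto simp: D0_def D1_def D2_def Y_def)
qed

lemma err_Lp_bound:
  assumes P: "2 \<le> P" and Q: "Q = P / (P - 1)"
    and s: "\<And>\<eta>. cmod (s \<eta>) \<le> Cs * (1 + norm \<eta>) ^ N" and \<sigma>: "0 \<le> \<sigma>"
    and B: "0 \<le> B" "\<And>\<xi>. (\<integral>\<^sup>+k. ennreal (cmod (fourier \<phi> (\<xi> + k)) powr Q) \<partial>ZS) \<le> ennreal B"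
    and CL: "0 \<le> CL" "\<And>y :: real^'d. (\<integral>\<^sup>+k. indicator {x. \<delta> \<le> norm x} (y + k) * ennreal (norm (y + k) powr (- (\<sigma> * P))) \<partial>ZS) \<le> ennreal CL"
    and X: "0 < X" "weight Q (real N + \<sigma>) \<le> ennreal X"
    and CH: "0 \<le> CH" "\<And>u :: real^'d \<Rightarrow> complex. integrable lborel u \<Longrightarrow> (\<integral>\<^sup>+x. ennreal (cmod (u x) powr Q) \<partial>lborel) \<le> 1
       \<Longrightarrow> (\<integral>\<^sup>+\<xi>. ennreal (cmod (fourier u \<xi>) powr P) \<partial>lborel) \<le> ennreal CH"
  shows "(\<integral>\<^sup>+x. ennreal (cmod (err x) powr P) \<partial>lborel)
    \<le> ennreal ((((1 + B) + CH * ((\<delta> powr (- (real N + \<sigma>))) powr P + (Cs * (1 + 1 / \<delta>) ^ N) powr P * CL)) * X powr (1 / Q)) powr P)"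
proof (rule dual_bound_Lp[OF err_locally_integrable _ Q])
  let ?A = "(1 + B) + CH * ((\<delta> powr (- (real N + \<sigma>))) powr P + (Cs * (1 + 1 / \<delta>) ^ N) powr P * CL)"
  show "1 < P" using P by simp
  show A0: "0 \<le> ?A * X powr (1 / Q)" using B CH CL by auto
  have Q1: "1 < Q" using P by (simp add: Q field_simps)
  fix u :: "real^'d \<Rightarrow> complex" assume u: "test_fun u"
  have [measurable]: "u \<in> borel_measurable borel" by (rule test_fun_borel[OF u])
  define Y where "Y = (\<integral>x. cmod (u x) powr Q \<partial>lborel)"
  have intY: "integrable lborel (\<lambda>x. cmod (u x) powr Q)"
    using test_fun_integrable_powr[OF u] Q1 by simp
  have Y0: "0 \<le> Y" unfolding Y_def by (rule integral_nonneg_AE) simp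
  show "cmod (\<integral>x. err x * u x \<partial>lborel) \<le> ?A * X powr (1 / Q) * (\<integral>x. cmod (u x) powr Q \<partial>lborel) powr (1 / Q)"
  proof (cases "Y = 0")
    case True
    then have "AE x in lborel. cmod (u x) powr Q = 0"
      using integral_nonneg_eq_0_iff_AE[OF intY] by (simp add: Y_def)
    then have "(\<integral>x. err x * u x \<partial>lborel) = 0"
      by (intro integral_eq_zero_AE) (auto elim!: eventually_mono)
    then show ?thesis using A0 by simp
  next
    case False
    then have Yp: "0 < Y" using Y0 by simp
    \<comment> \<open>Scaling to L_Q norm 1, where the Hausdorff--Young constant applies; linearity
      of the pairing restores the norm.\<close>
    define c where "c = Y powr (- 1 / Q)"
    have c: "0 < c" using Yp by (simp add: c_def)
    have cQ: "c powr Q * Y = 1"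
    proof -
      have "c powr Q = Y powr (- 1)" using Q1 by (simp only: c_def powr_powr) simp
      then show ?thesis using Yp by (simp add: powr_minus)
    qed
    let ?v = "\<lambda>x. of_real c * u x"
    have v: "test_fun ?v" by (rule test_fun_cmult[OF u])
    have "(\<integral>\<^sup>+x. ennreal (cmod (?v x) powr Q) \<partial>lborel) = (\<integral>\<^sup>+x. ennreal (c powr Q * cmod (u x) powr Q) \<partial>lborel)"
      using c by (simp add: norm_mult powr_mult)
    also have "\<dots> = ennreal (c powr Q * Y)"
      using intY unfolding Y_def by (subst nn_integral_lborel_nonneg_eq) auto
    also have "\<dots> = 1" using cQ by simp
    finally have "(\<integral>\<^sup>+\<xi>. ennreal (cmod (fourier ?v \<xi>) powr P) \<partial>lborel) \<le> ennreal CH"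
      by (intro CH(2) test_fun_integrable v) simp
    then have "cmod (\<integral>y. err y * ?v y \<partial>lborel) \<le> ?A * X powr (1 / Q)"
      by (intro err_pairing_Lp[OF P Q s \<sigma> B CL X v CH(1)])
    moreover have "(\<integral>y. err y * ?v y \<partial>lborel) = of_real c * (\<integral>y. err y * u y \<partial>lborel)"
      by (subst integral_mult_right_zero[symmetric]) (simp add: mult_ac)
    ultimately have le: "c * cmod (\<integral>y. err y * u y \<partial>lborel) \<le> ?A * X powr (1 / Q)"
      using c by (simp add: norm_mult)
    have "c * Y powr (1 / Q) = 1" using Yp by (simp add: c_def flip: powr_add)
    then have "cmod (\<integral>y. err y * u y \<partial>lborel) = (c * cmod (\<integral>y. err y * u y \<partial>lborel)) * Y powr (1 / Q)"
      by (simp add: mult_ac)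
    also have "\<dots> \<le> ?A * X powr (1 / Q) * Y powr (1 / Q)"
      by (rule mult_right_mono[OF le]) simp
    finally show ?thesis unfolding Y_def[symmetric] .
  qed
qed

lemma err_Linf_bound:
  assumes s: "\<And>\<eta>. cmod (s \<eta>) \<le> Cs * (1 + norm \<eta>) ^ N" and \<sigma>: "0 \<le> \<sigma>"
    and B: "0 \<le> B" "\<And>\<xi>. (\<integral>\<^sup>+k. ennreal (cmod (fourier \<phi> (\<xi> + k))) \<partial>ZS) \<le> ennreal B"
    and X: "0 \<le> X" "weight 1 (real N + \<sigma>) \<le> ennreal X"
  shows "AE x in lborel. cmod (err x) \<le> ((\<delta> powr (- (real N + \<sigma>))) + (Cs * (1 + 1 / \<delta>) ^ N) * \<delta> powr (- \<sigma>) * B) * X"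
proof (rule dual_bound_Linf[OF err_locally_integrable])
  have Cs: "0 \<le> Cs" using order_trans[OF norm_ge_zero s[of 0]] by simp
  show "0 \<le> ((\<delta> powr (- (real N + \<sigma>))) + (Cs * (1 + 1 / \<delta>) ^ N) * \<delta> powr (- \<sigma>) * B) * X"
    using Cs B X \<delta>_pos by auto
qed (rule err_pairing_Linf[OF s \<sigma> B X])

end

section \<open>Lebesgue norms\<close>

text \<open>The extended values 0 and \<infinity> of \<open>q\<close> have to be excluded by hand,
  since 1 / q is then \<infinity> or 0 and the sum of the reciprocals is not 1.\<close>

lemma conjugate_exponents:
  fixes p q :: ennreal
  assumes p: "2 \<le> p" and pq: "1 / p + 1 / q = 1"
  obtains "p = \<infinity>" "q = ennreal 1" | P where "2 \<le> P" "p = ennreal P" "q = ennreal (P / (P - 1))"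
proof (cases p)
  case top
  then have q1: "1 / q = 1" using pq by simp
  have "q = ennreal 1"
  proof (cases q)
    case (real r)
    have "r \<noteq> 0" using q1 real by (auto simp: ennreal_divide_zero)
    then have "ennreal (1 / r) = ennreal 1" using q1 real by (simp add: divide_ennreal flip: ennreal_1)
    then have "r = 1" using real by (simp add: ennreal_eq_1)
    then show ?thesis using real by simp
  next
    case top
    then show ?thesis using q1 by simp
  qed
  then show ?thesis using top that(1) by simp
next
  case (real P)
  have "ennreal 2 \<le> ennreal P" using p real by simp
  then have P: "2 \<le> P" using real by (subst (asm) ennreal_le_iff) auto
  have p1: "1 / p = ennreal (1 / P)" using P real by (simp add: divide_ennreal flip: ennreal_1)
  have "q = ennreal (P / (P - 1))"
  proof (cases q)
    case (real r)
    have r0: "r \<noteq> 0"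
    proof
      assume "r = 0"
      then show False using pq p1 real by (simp add: ennreal_divide_zero)
    qed
    then have "1 / q = ennreal (1 / r)" using real by (simp add: divide_ennreal flip: ennreal_1)
    then have "ennreal (1 / P + 1 / r) = ennreal 1"
      using pq p1 P real r0 by (simp add: ennreal_plus)
    then have "1 / P + 1 / r = 1" using P real by (subst (asm) ennreal_inj) auto
    then have "1 / r = (P - 1) / P" using P by (simp add: field_simps)
    then have "r = P / (P - 1)" using P r0 by (simp add: field_simps)
    then show ?thesis using real by simp
  next
    case top
    then have "ennreal (1 / P) = ennreal 1" using pq p1 by simp
    then have "1 / P = 1" using P by (subst (asm) ennreal_inj) auto
    then show ?thesis using P by simp
  qed
  then show ?thesis using that(2)[OF P] real by simp
qed

section \<open>From the extended-valued norms to integrals over Borel representatives\<close>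

lemma ennreal_powr_ennreal: "0 \<le> c \<Longrightarrow> ennreal_powr (ennreal c) r = ennreal (c powr r)"
  by (simp add: ennreal_powr_def)

lemma ennreal_powr_less_top: "ennreal_powr x r < \<infinity> \<Longrightarrow> x < \<infinity>"
  by (auto simp: ennreal_powr_def less_top split: if_splits)

lemma borel_measurable_ennreal_powr [measurable]: "(\<lambda>x. ennreal_powr x r) \<in> borel_measurable borel"
  unfolding ennreal_powr_def by measurable

lemma Lp_norm_eq:
  fixes f :: "real^'d \<Rightarrow> complex"
  assumes "0 < P"
  shows "Lp_norm (ennreal P) f = ennreal_powr (\<integral>\<^sup>+x. ennreal (cmod (f x) powr P) \<partial>lborel) (1 / P)"
  using assms by (simp add: Lp_norm_def eLp_norm_def ennreal_powr_ennreal nn_integral_completion)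

lemma Lp_finite_norm:
  fixes f :: "real^'d \<Rightarrow> complex"
  assumes "0 < P" "f \<in> Lp (ennreal P)"
  shows "(\<integral>\<^sup>+x. ennreal (cmod (f x) powr P) \<partial>lborel) < \<infinity>"
  by (rule ennreal_powr_less_top[where r = "1 / P"]) (use assms in \<open>simp add: Lp_def Lp_norm_eq\<close>)

lemma Lp_norm_leI:
  fixes f :: "real^'d \<Rightarrow> complex"
  assumes P: "0 < P" and A: "0 \<le> A" and le: "(\<integral>\<^sup>+x. ennreal (cmod (f x) powr P) \<partial>lborel) \<le> ennreal (A powr P)"
  shows "Lp_norm (ennreal P) f \<le> ennreal A"
proof -
  obtain c where c: "(\<integral>\<^sup>+x. ennreal (cmod (f x) powr P) \<partial>lborel) = ennreal c" "0 \<le> c"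
    using le by (cases "\<integral>\<^sup>+x. ennreal (cmod (f x) powr P) \<partial>lborel") (auto simp: top_unique)
  then have "c \<le> A powr P" using le by (simp add: ennreal_le_iff)
  then have "c powr (1 / P) \<le> (A powr P) powr (1 / P)" using P c by (intro powr_mono2) auto
  also have "\<dots> = A" using P A by (simp add: powr_powr)
  finally show ?thesis using P c by (simp add: Lp_norm_eq ennreal_powr_ennreal ennreal_leI)
qed

lemma Lp_norm_top_leI:
  fixes f :: "real^'d \<Rightarrow> complex"
  assumes [measurable]: "f \<in> borel_measurable lebesgue" and ae: "AE x in lebesgue. cmod (f x) \<le> A"
  shows "Lp_norm \<infinity> f \<le> ennreal A"
proof -
  have "esssup lebesgue (\<lambda>x. ennreal (cmod (f x))) \<le> ennreal A"
  proof (rule esssup_I)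
    show "AE x in lebesgue. ennreal (cmod (f x)) \<le> ennreal A"
      using ae by eventually_elim (rule ennreal_leI)
  qed measurable
  then show ?thesis by (simp add: Lp_norm_def eLp_norm_def)
qed

lemma Lp_top_bounded:
  fixes f :: "real^'d \<Rightarrow> complex"
  assumes "f \<in> Lp \<infinity>"
  obtains c where "0 \<le> c" "AE x in lborel. cmod (f x) \<le> c"
proof -
  have "esssup lebesgue (\<lambda>x. ennreal (cmod (f x))) < \<infinity>"
    using assms by (simp add: Lp_def Lp_norm_def eLp_norm_def)
  then obtain c where c: "esssup lebesgue (\<lambda>x. ennreal (cmod (f x))) = ennreal c" "0 \<le> c"
    by (cases "esssup lebesgue (\<lambda>x. ennreal (cmod (f x)))") auto
  have "AE x in lebesgue. ennreal (cmod (f x)) \<le> ennreal c"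
    using esssup_AE[of "\<lambda>x. ennreal (cmod (f x))" lebesgue] unfolding c .
  then have "AE x in lborel. ennreal (cmod (f x)) \<le> ennreal c" by (simp only: AE_completion_iff)
  then have "AE x in lborel. cmod (f x) \<le> c"
    by eventually_elim (use c in \<open>simp add: ennreal_le_iff\<close>)
  then show ?thesis using that c by blast
qed

text \<open>For infinite \<open>A\<close> both sides are suprema of finite sums: each finite sum is
  an integral over part of \<open>A\<close>, and the integral is a series along an enumeration whose
  partial sums are finite sums.\<close>

lemma infsum_ennreal_eq_nn_integral:
  fixes f :: "'a \<Rightarrow> ennreal"
  assumes "countable A"
  shows "infsum f A = (\<integral>\<^sup>+k. f k \<partial>count_space A)"
proof (cases "finite A")
  case True
  then show ?thesis by (simp add: nn_integral_count_space_finite)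
next
  case False
  have sup: "infsum f A = (SUP F\<in>{F. finite F \<and> F \<subseteq> A}. sum f F)"
    by (rule nonneg_infsum_complete) simp
  have bij: "bij_betw (from_nat_into A) UNIV A"
    using assms False by (rule bij_betw_from_nat_into)
  have inj: "inj (from_nat_into A)" using bij by (simp add: bij_betw_def)
  have eq: "(\<integral>\<^sup>+k. f k \<partial>count_space A) = (SUP n. \<Sum>i<n. f (from_nat_into A i))"
    using nn_integral_bij_count_space[OF bij, of f]
    by (simp add: nn_integral_count_space_nat suminf_eq_SUP)
  show ?thesis
  proof (rule antisym)
    show "infsum f A \<le> (\<integral>\<^sup>+k. f k \<partial>count_space A)"
      unfolding sup
    proof (rule SUP_least, safe)
      fix F assume F: "finite F" "F \<subseteq> A"
      have "sum f F = (\<integral>\<^sup>+k. f k * indicator F k \<partial>count_space A)"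
        using F by (subst nn_integral_count_space'[of F]) auto
      also have "\<dots> \<le> (\<integral>\<^sup>+k. f k \<partial>count_space A)"
        by (intro nn_integral_mono) (auto simp: indicator_def)
      finally show "sum f F \<le> (\<integral>\<^sup>+k. f k \<partial>count_space A)" .
    qed
    show "(\<integral>\<^sup>+k. f k \<partial>count_space A) \<le> infsum f A"
      unfolding eq sup
    proof (rule SUP_least)
      fix n
      have "(\<Sum>i<n. f (from_nat_into A i)) = sum f (from_nat_into A ` {..<n})"
        by (subst sum.reindex) (auto intro: inj_on_subset[OF inj])
      also have "\<dots> \<le> (SUP F\<in>{F. finite F \<and> F \<subseteq> A}. sum f F)"
        using bij by (intro SUP_upper) (auto simp: bij_betw_def)
      finally show "(\<Sum>i<n. f (from_nat_into A i)) \<le> (SUP F\<in>{F. finite F \<and> F \<subseteq> A}. sum f F)" .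
    qed
  qed
qed

lemma infsum_eq_integral_ZS:
  fixes f :: "real^'d \<Rightarrow> complex"
  assumes "integrable ZS f"
  shows "f summable_on zlattice" "infsum f zlattice = (\<integral>k. f k \<partial>ZS)"
proof -
  have a: "Infinite_Set_Sum.abs_summable_on f zlattice"
    using assms by (simp add: Infinite_Set_Sum.abs_summable_on_def)
  then have "(\<lambda>x. norm (f x)) summable_on zlattice"
    by (simp add: abs_summable_equivalent)
  then show "f summable_on zlattice" by (rule abs_summable_summable)
  show "infsum f zlattice = (\<integral>k. f k \<partial>ZS)"
    using infsetsum_infsum[OF a] by (simp add: infsetsum_def)
qed

lemma AE_lborel_translates:
  fixes Pr :: "real^'d \<Rightarrow> bool"
  assumes "AE x in lborel. Pr x"
  shows "AE x in lborel. \<forall>k\<in>zlattice. Pr (x + k)"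
proof (subst AE_ball_countable[OF countable_zlattice], intro ballI)
  fix k :: "real^'d"
  obtain S where S: "S \<in> null_sets lborel" "{x. \<not> Pr x} \<subseteq> S"
    using assms by (auto elim!: AE_E simp: null_sets_def)
  have [measurable]: "S \<in> sets borel" using S by auto
  have "(\<integral>\<^sup>+x. indicator S (x + k) \<partial>lborel) = (\<integral>\<^sup>+x. indicator S x \<partial>lborel)"
    by (rule nn_integral_lborel_translate) simp
  also have "\<dots> = 0" using S by (simp add: null_sets_def)
  finally have "AE x in lborel. indicator S (x + k) = (0::ennreal)"
    by (subst (asm) nn_integral_0_iff_AE) auto
  then show "AE x in lborel. Pr (x + k)"
    by eventually_elim (use S in \<open>auto simp: indicator_def split: if_splits\<close>)
qed

lemma AE_lborel_linear:
  fixes f :: "real^'d \<Rightarrow> real^'d"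
  assumes "linear f" and c: "\<And>F. F \<in> borel_measurable borel \<Longrightarrow> (\<integral>\<^sup>+x. F (f x) \<partial>lborel) = ennreal c * (\<integral>\<^sup>+x. F x \<partial>lborel)"
    and "AE x in lborel. Pr x"
  shows "AE x in lborel. Pr (f x)"
proof -
  have [measurable]: "f \<in> borel \<rightarrow>\<^sub>M borel"
    using assms(1) by (auto intro!: borel_measurable_continuous_onI linear_continuous_on simp: linear_conv_bounded_linear)
  obtain S where S: "S \<in> null_sets lborel" "{x. \<not> Pr x} \<subseteq> S"
    using assms(3) by (auto elim!: AE_E simp: null_sets_def)
  have [measurable]: "S \<in> sets borel" using S by auto
  have "(\<integral>\<^sup>+x. indicator S (f x) \<partial>lborel) = ennreal c * (\<integral>\<^sup>+x. indicator S x \<partial>lborel)"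
    by (rule c) simp
  also have "\<dots> = 0" using S by (simp add: null_sets_def)
  finally have "AE x in lborel. indicator S (f x) = (0::ennreal)"
    by (subst (asm) nn_integral_0_iff_AE) auto
  then show ?thesis
    by eventually_elim (use S in \<open>auto simp: indicator_def split: if_splits\<close>)
qed

text \<open>The bound on the lattice sums of the transform of \<phi> is assumed at every point;
  equality of the transforms everywhere lets it survive the passage to a Borel
  representative.\<close>

lemma fourier_cong_AE:
  fixes f h :: "real^'d \<Rightarrow> complex"
  assumes "AE x in lborel. f x = h x" "f \<in> borel_measurable lebesgue" "h \<in> borel_measurable borel"
  shows "fourier f = fourier h"
proof
  fix \<xi> :: "real^'d"
  have e [measurable]: "(\<lambda>x. exp (- 2 * of_real pi * \<i> * of_real (x \<bullet> \<xi>))) \<in> borel_measurable lebesgue"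
    by (rule measurable_completion) simp
  have h [measurable]: "h \<in> borel_measurable lebesgue" using assms(3) by (intro measurable_completion) simp
  have ae: "AE x in lebesgue. f x = h x" using assms(1) by (rule AE_completion)
  note assms(2) [measurable]
  show "fourier f \<xi> = fourier h \<xi>"
    unfolding fourier_def
  proof (rule integral_cong_AE)
    show "AE x in lebesgue. f x * exp (- 2 * of_real pi * \<i> * of_real (x \<bullet> \<xi>)) = h x * exp (- 2 * of_real pi * \<i> * of_real (x \<bullet> \<xi>))"
      using ae by eventually_elim simp
  qed (intro borel_measurable_times e h assms(2))+
qed

lemma torus_borel [measurable]: "torus \<in> sets borel"
  unfolding torus_def by measurable

text \<open>On the torus, a set of finite measure, a periodization in L_p is also in L_1, and
  unfolding turns this into integrability over the whole space. Together with \<phi> in L_p and p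
  \<ge> 2 this puts \<phi> in L_2. Elementary inequalities such as r \<le> 1 + r^P and r^2 \<le> r +
  r^P replace comparisons of norms.\<close>

lemma periodized_Lp_borel_version:
  fixes \<phi> :: "real^'d \<Rightarrow> complex"
  assumes \<phi>: "\<phi> \<in> periodized_Lp p" and p: "p = \<infinity> \<or> (\<exists>P\<ge>2. p = ennreal P)"
  obtains \<psi> where "AE x in lborel. \<phi> x = \<psi> x" "fourier \<phi> = fourier \<psi>" "integrable lborel \<psi>"
    "(\<integral>\<^sup>+x. ennreal ((cmod (\<psi> x))\<^sup>2) \<partial>lborel) < \<infinity>"
proof -
  have Lp: "\<phi> \<in> Lp p" and per: "eLp_norm p (lebesgue_on torus) (\<lambda>x. \<Sum>\<^sub>\<infinity>k\<in>zlattice. ennreal (cmod (\<phi> (x + k)))) < \<infinity>"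
    using \<phi> by (auto simp: periodized_Lp_def)
  have \<phi>m: "\<phi> \<in> borel_measurable lebesgue" using Lp by (simp add: Lp_def)
  obtain \<psi> where \<psi>: "\<psi> \<in> borel_measurable lborel" "AE x in lborel. \<phi> x = \<psi> x"
    by (rule completion_ex_borel_measurable_complex[OF \<phi>m])
  have [measurable]: "\<psi> \<in> borel_measurable borel" using \<psi>(1) by simp
  define \<Psi> where "\<Psi> x = (\<integral>\<^sup>+k. ennreal (cmod (\<psi> (x + k))) \<partial>ZS)" for x
  have [measurable]: "\<Psi> \<in> borel_measurable borel"
    unfolding \<Psi>_def by (rule borel_measurable_nn_integral_ZS) measurable
  have \<Psi>: "AE x in lborel. (\<Sum>\<^sub>\<infinity>k\<in>zlattice. ennreal (cmod (\<phi> (x + k)))) = \<Psi> x"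
    using AE_lborel_translates[OF \<psi>(2)]
    by eventually_elim (auto simp: \<Psi>_def infsum_ennreal_eq_nn_integral[OF countable_zlattice] intro!: nn_integral_cong)
  have torus: "(torus :: (real^'d) set) \<inter> space lebesgue \<in> sets lebesgue"
    by (auto intro: sets_completionI_sets)
  have tfin: "emeasure lborel (torus :: (real^'d) set) < \<infinity>"
  proof (rule emeasure_bounded_finite)
    have "torus \<subseteq> cbox (\<chi> i. (- (1/2) :: real)) ((\<chi> i. 1/2) :: real^'d)" by (auto simp: torus_def mem_box_cart)
    then show "bounded (torus :: (real^'d) set)" by (rule bounded_subset[OF bounded_cbox])
  qed
  have \<Psi>fin: "(\<integral>\<^sup>+x. indicator torus x * \<Psi> x \<partial>lborel) < \<infinity>"
    using p
  proof
    assume inf: "p = \<infinity>"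
    let ?F = "\<lambda>x. \<Sum>\<^sub>\<infinity>k\<in>zlattice. ennreal (cmod (\<phi> (x + k)))"
    let ?E = "esssup (lebesgue_on torus) ?F"
    have "?E < \<infinity>" using per inf by (simp add: eLp_norm_def)
    have "AE x in lebesgue_on torus. ?F x \<le> ?E" by (rule esssup_AE)
    then have "AE x in lebesgue. x \<in> torus \<longrightarrow> ?F x \<le> ?E"
      by (subst (asm) AE_restrict_space_iff[OF torus])
    then have "AE x in lborel. x \<in> torus \<longrightarrow> ?F x \<le> ?E" by (simp only: AE_completion_iff)
    then have "AE x in lborel. indicator torus x * \<Psi> x \<le> ?E * indicator torus x"
      using \<Psi> by eventually_elim (auto simp: indicator_def)
    then have "(\<integral>\<^sup>+x. indicator torus x * \<Psi> x \<partial>lborel) \<le> (\<integral>\<^sup>+x. ?E * indicator torus (x::real^'d) \<partial>lborel)"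
      by (rule nn_integral_mono_AE)
    also have "\<dots> = ?E * emeasure lborel (torus :: (real^'d) set)"
      by (rule nn_integral_cmult_indicator) simp
    also have "\<dots> < \<infinity>" using \<open>?E < \<infinity>\<close> tfin by (simp add: ennreal_mult_less_top)
    finally show ?thesis .
  next
    assume "\<exists>P\<ge>2. p = ennreal P"
    then obtain P where P: "2 \<le> P" "p = ennreal P" by auto
    let ?F = "\<lambda>x. \<Sum>\<^sub>\<infinity>k\<in>zlattice. ennreal (cmod (\<phi> (x + k)))"
    have "(\<integral>\<^sup>+x. ennreal_powr (?F x) P \<partial>lebesgue_on torus) < \<infinity>"
      by (rule ennreal_powr_less_top[where r = "1 / P"]) (use per P in \<open>simp add: eLp_norm_def\<close>)
    then have "(\<integral>\<^sup>+x. ennreal_powr (?F x) P * indicator torus x \<partial>lborel) < \<infinity>"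
      by (simp add: nn_integral_restrict_space[OF torus] nn_integral_completion)
    also have "(\<integral>\<^sup>+x. ennreal_powr (?F x) P * indicator torus x \<partial>lborel) = (\<integral>\<^sup>+x. ennreal_powr (\<Psi> x) P * indicator torus x \<partial>lborel)"
      by (rule nn_integral_cong_AE) (use \<Psi> in \<open>auto elim!: eventually_mono\<close>)
    finally have fin: "(\<integral>\<^sup>+x. ennreal_powr (\<Psi> x) P * indicator torus x \<partial>lborel) < \<infinity>" .
    have "indicator torus x * \<Psi> x \<le> indicator torus x + ennreal_powr (\<Psi> x) P * indicator torus x" for x
    proof (cases "\<Psi> x")
      case (real r)
      have "r \<le> 1 + r powr P"
      proof (cases "r \<le> 1")
        case False
        then have "r powr 1 \<le> r powr P" using P by (intro powr_mono) auto
        then show ?thesis using False by simp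
      qed (simp add: add_increasing2)
      then have "ennreal r \<le> 1 + ennreal (r powr P)"
        by (simp add: ennreal_leI flip: ennreal_1 ennreal_plus)
      then show ?thesis using real by (auto simp: indicator_def ennreal_powr_ennreal)
    next
      case top
      then show ?thesis by (auto simp: ennreal_powr_def indicator_def)
    qed
    then have "(\<integral>\<^sup>+x. indicator torus x * \<Psi> x \<partial>lborel)
      \<le> (\<integral>\<^sup>+x. indicator torus x + ennreal_powr (\<Psi> x) P * indicator torus x \<partial>lborel)"
      by (intro nn_integral_mono)
    also have "\<dots> = emeasure lborel (torus :: (real^'d) set) + (\<integral>\<^sup>+x. ennreal_powr (\<Psi> x) P * indicator torus x \<partial>lborel)"
      by (subst nn_integral_add) auto
    also have "\<dots> < \<infinity>" using tfin fin by simp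
    finally show ?thesis .
  qed
  have int1: "(\<integral>\<^sup>+x. ennreal (cmod (\<psi> x)) \<partial>lborel) < \<infinity>"
  proof -
    have "(\<integral>\<^sup>+x. ennreal (cmod (\<psi> x)) \<partial>lborel) = (\<integral>\<^sup>+x. indicator cube x * \<Psi> x \<partial>lborel)"
      unfolding \<Psi>_def by (rule nn_integral_unfold) measurable
    also have "\<dots> \<le> (\<integral>\<^sup>+x. indicator torus x * \<Psi> x \<partial>lborel)"
      using cube_subset_torus by (intro nn_integral_mono) (auto simp: indicator_def)
    finally show ?thesis using \<Psi>fin by simp
  qed
  have sq: "(\<integral>\<^sup>+x. ennreal ((cmod (\<psi> x))\<^sup>2) \<partial>lborel) < \<infinity>"
    using p
  proof
    assume "p = \<infinity>"
    then obtain c where c: "0 \<le> c" "AE x in lborel. cmod (\<phi> x) \<le> c" using Lp_top_bounded Lp by metis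
    have "AE x in lborel. ennreal ((cmod (\<psi> x))\<^sup>2) \<le> ennreal c * ennreal (cmod (\<psi> x))"
      using c(2) \<psi>(2) by eventually_elim (auto simp: power2_eq_square c(1) mult_right_mono ennreal_leI simp flip: ennreal_mult)
    then have "(\<integral>\<^sup>+x. ennreal ((cmod (\<psi> x))\<^sup>2) \<partial>lborel) \<le> (\<integral>\<^sup>+x. ennreal c * ennreal (cmod (\<psi> x)) \<partial>lborel)"
      by (rule nn_integral_mono_AE)
    also have "\<dots> = ennreal c * (\<integral>\<^sup>+x. ennreal (cmod (\<psi> x)) \<partial>lborel)" by (rule nn_integral_cmult) measurable
    also have "\<dots> < \<infinity>" using int1 by (simp add: ennreal_mult_less_top)
    finally show ?thesis .
  next
    assume "\<exists>P\<ge>2. p = ennreal P"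
    then obtain P where P: "2 \<le> P" "p = ennreal P" by auto
    have "(\<integral>\<^sup>+x. ennreal (cmod (\<phi> x) powr P) \<partial>lborel) < \<infinity>" using P Lp by (intro Lp_finite_norm) auto
    also have "(\<integral>\<^sup>+x. ennreal (cmod (\<phi> x) powr P) \<partial>lborel) = (\<integral>\<^sup>+x. ennreal (cmod (\<psi> x) powr P) \<partial>lborel)"
      by (rule nn_integral_cong_AE) (use \<psi>(2) in \<open>auto elim!: eventually_mono\<close>)
    finally have fin: "(\<integral>\<^sup>+x. ennreal (cmod (\<psi> x) powr P) \<partial>lborel) < \<infinity>" .
    have "(\<integral>\<^sup>+x. ennreal ((cmod (\<psi> x))\<^sup>2) \<partial>lborel) \<le> (\<integral>\<^sup>+x. ennreal (cmod (\<psi> x)) + ennreal (cmod (\<psi> x) powr P) \<partial>lborel)"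
    proof (rule nn_integral_mono)
      fix x
      let ?r = "cmod (\<psi> x)"
      have "?r\<^sup>2 \<le> ?r + ?r powr P"
      proof (cases "?r \<le> 1")
        case True
        then have "?r * ?r \<le> ?r * 1" by (intro mult_left_mono) auto
        then show ?thesis by (simp add: power2_eq_square add_increasing2)
      next
        case False
        then have "?r powr 2 \<le> ?r powr P" using P by (intro powr_mono) auto
        then show ?thesis by (simp add: add_increasing)
      qed
      then show "ennreal (?r\<^sup>2) \<le> ennreal ?r + ennreal (?r powr P)"
        by (simp add: ennreal_leI flip: ennreal_plus)
    qed
    also have "\<dots> = (\<integral>\<^sup>+x. ennreal (cmod (\<psi> x)) \<partial>lborel) + (\<integral>\<^sup>+x. ennreal (cmod (\<psi> x) powr P) \<partial>lborel)"
      by (rule nn_integral_add) measurable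
    also have "\<dots> < \<infinity>" using int1 fin by simp
    finally show ?thesis .
  qed
  show ?thesis
  proof (rule that[OF \<psi>(2) fourier_cong_AE[OF \<psi>(2) \<phi>m] _ sq])
    show "integrable lborel \<psi>" using int1 by (intro integrableI_bounded) auto
  qed measurable
qed

section \<open>Dilated spectra\<close>

text \<open>On a large ball |g| \<le> 1 + |g|^Q suffices. Outside it the decay exceeds the weight (1
  + |x|)^N by the order d + \<epsilon>, which is integrable at infinity.\<close>

lemma decay_weight_integrable:
  fixes g :: "real^'d \<Rightarrow> complex"
  assumes [measurable]: "g \<in> borel_measurable borel" and Q: "1 \<le> Q"
    and gQ: "(\<integral>\<^sup>+x. ennreal (cmod (g x) powr Q) \<partial>lborel) < \<infinity>" and \<epsilon>: "0 < \<epsilon>"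
    and decay: "AE x in lborel. R \<le> norm x \<longrightarrow> cmod (g x) \<le> K * norm x powr (- real N - real CARD('d) - \<epsilon>)"
  shows "integrable lborel (\<lambda>x. (1 + norm x) ^ N * cmod (g x))"
proof (rule integrableI_bounded)
  define R' where "R' = max R 1"
  define K' where "K' = max K 0"
  let ?D = "real CARD('d)"
  obtain C where C: "\<And>\<rho>. 0 < \<rho> \<Longrightarrow>
    (\<integral>\<^sup>+x. indicator {x. \<rho> \<le> norm x} x * ennreal (norm (x::real^'d) powr (- (?D + \<epsilon>))) \<partial>lborel) \<le> ennreal (C * \<rho> powr (- \<epsilon>))"
    using nn_integral_radial_tail[OF \<epsilon>, where 'd = 'd] by blast
  let ?F = "\<lambda>x. ennreal ((1 + R') ^ N) * (indicator {x. norm x \<le> R'} x + ennreal (cmod (g x) powr Q))"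
  let ?H = "\<lambda>x::real^'d. ennreal (2 ^ N * K') * (indicator {x. 1 \<le> norm x} x * ennreal (norm x powr (- (?D + \<epsilon>))))"
  have "AE x in lborel. ennreal (norm ((1 + norm x) ^ N * cmod (g x))) \<le> ?F x + ?H x"
    using decay
  proof eventually_elim
    case (elim x)
    show ?case
    proof (cases "norm x \<le> R'")
      case True
      have "cmod (g x) \<le> 1 + cmod (g x) powr Q"
      proof (cases "cmod (g x) \<le> 1")
        case False
        then have "cmod (g x) powr 1 \<le> cmod (g x) powr Q" using Q by (intro powr_mono) auto
        then show ?thesis using False by simp
      qed (simp add: add_increasing2)
      moreover have "(1 + norm x) ^ N \<le> (1 + R') ^ N" using True by (intro power_mono) auto
      moreover have "0 \<le> (1 + R') ^ N" by (simp add: R'_def)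
      ultimately have "(1 + norm x) ^ N * cmod (g x) \<le> (1 + R') ^ N * (1 + cmod (g x) powr Q)"
        by (intro mult_mono) auto
      then have "ennreal (norm ((1 + norm x) ^ N * cmod (g x))) \<le> ennreal ((1 + R') ^ N * (1 + cmod (g x) powr Q))"
        by (intro ennreal_leI) (simp add: abs_mult)
      also have "\<dots> = ennreal ((1 + R') ^ N) * (ennreal 1 + ennreal (cmod (g x) powr Q))"
        using \<open>0 \<le> (1 + R') ^ N\<close> by (simp only: ennreal_mult ennreal_plus powr_ge_zero zero_le_one add_nonneg_nonneg)
      also have "\<dots> = ?F x" using True by simp
      finally show ?thesis by (rule order_trans) simp
    next
      case False
      then have x: "1 \<le> norm x" "R \<le> norm x" by (auto simp: R'_def)
      have "cmod (g x) \<le> K' * norm x powr (- real N - ?D - \<epsilon>)"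
        using elim x(2) mult_right_mono[of K K' "norm x powr (- real N - ?D - \<epsilon>)"] by (simp add: K'_def)
      moreover have "(1 + norm x) ^ N \<le> (2 * norm x) ^ N" using x by (intro power_mono) auto
      ultimately have "(1 + norm x) ^ N * cmod (g x) \<le> (2 * norm x) ^ N * (K' * norm x powr (- real N - ?D - \<epsilon>))"
        by (intro mult_mono) (auto simp: K'_def)
      also have "\<dots> = 2 ^ N * K' * (norm x powr real N * norm x powr (- real N - ?D - \<epsilon>))"
        using x by (subst powr_realpow) (auto simp: power_mult_distrib)
      also have "norm x powr real N * norm x powr (- real N - ?D - \<epsilon>) = norm x powr (- (?D + \<epsilon>))"
        by (simp flip: powr_add)
      finally have "ennreal (norm ((1 + norm x) ^ N * cmod (g x))) \<le> ennreal (2 ^ N * K' * norm x powr (- (?D + \<epsilon>)))"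
        by (intro ennreal_leI) (simp add: abs_mult)
      also have "\<dots> = ?H x" using x by (simp add: ennreal_mult K'_def)
      finally show ?thesis by (rule order_trans) simp
    qed
  qed
  then have "(\<integral>\<^sup>+x. ennreal (norm ((1 + norm x) ^ N * cmod (g x))) \<partial>lborel) \<le> (\<integral>\<^sup>+x. ?F x + ?H x \<partial>lborel)"
    by (rule nn_integral_mono_AE)
  also have "\<dots> = (\<integral>\<^sup>+x. ?F x \<partial>lborel) + (\<integral>\<^sup>+x. ?H x \<partial>lborel)"
    by (rule nn_integral_add) measurable
  also have "(\<integral>\<^sup>+x. ?F x \<partial>lborel) = ennreal ((1 + R') ^ N) * (emeasure lborel {x::real^'d. norm x \<le> R'} + (\<integral>\<^sup>+x. ennreal (cmod (g x) powr Q) \<partial>lborel))"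
    by (subst nn_integral_cmult, measurable, subst nn_integral_add) auto
  also have "(\<integral>\<^sup>+x. ?H x \<partial>lborel) = ennreal (2 ^ N * K') *
      (\<integral>\<^sup>+x. indicator {x. 1 \<le> norm x} x * ennreal (norm (x::real^'d) powr (- (?D + \<epsilon>))) \<partial>lborel)"
    by (rule nn_integral_cmult) measurable
  also have "ennreal ((1 + R') ^ N) * (emeasure lborel {x::real^'d. norm x \<le> R'} + (\<integral>\<^sup>+x. ennreal (cmod (g x) powr Q) \<partial>lborel)) + \<dots> < \<infinity>"
    using gQ emeasure_lborel_cball_finite[of "0::real^'d" R', unfolded cball_def] order.strict_trans1[OF C[of 1] ennreal_less_top]
    by (simp add: ennreal_mult_less_top)
  finally show "(\<integral>\<^sup>+x. ennreal (norm ((1 + norm x) ^ N * cmod (g x))) \<partial>lborel) < \<infinity>" .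
qed measurable

text \<open>The count of exponents: the decay of |g|^Q has order (N + d + \<epsilon>) Q, the weight
  takes (N + d r + \<epsilon>/2) Q of it, and by (1 - r) Q = 1 there remains d + \<epsilon> Q/2, so
  that the tail decays like \<rho>^(- \<epsilon> Q/2).\<close>

lemma decay_tail_weight:
  fixes g :: "real^'d \<Rightarrow> complex"
  assumes [measurable]: "g \<in> borel_measurable borel" and Q: "1 \<le> Q" and r: "(1 - r) * Q = 1" "0 \<le> r"
    and gQ: "(\<integral>\<^sup>+x. ennreal (cmod (g x) powr Q) \<partial>lborel) < \<infinity>" and \<epsilon>: "0 < \<epsilon>" and \<rho>0: "0 < \<rho>0"
    and decay: "AE x in lborel. R \<le> norm x \<longrightarrow> cmod (g x) \<le> K * norm x powr (- real N - real CARD('d) - \<epsilon>)"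
  obtains C where "0 < C" "\<And>\<rho>. \<rho>0 \<le> \<rho> \<Longrightarrow>
    (\<integral>\<^sup>+x. indicator {x. \<rho> \<le> norm x} x *
      ennreal (cmod (g x) powr Q * norm x powr ((real N + (real CARD('d) * r + \<epsilon> / 2)) * Q)) \<partial>lborel)
    \<le> ennreal (C * \<rho> powr (- (\<epsilon> * Q / 2)))"
proof (rule weighted_tail_estimate[of "\<lambda>x. cmod (g x) powr Q" "(real N + (real CARD('d) * r + \<epsilon> / 2)) * Q" "\<epsilon> * Q / 2" \<rho>0 R "max K 0 powr Q"])
  let ?D = "real CARD('d)"
  show "AE x in lborel. R \<le> norm x \<longrightarrow> cmod (g x) powr Q
    \<le> max K 0 powr Q * norm x powr (- (?D + \<epsilon> * Q / 2 + (real N + (?D * r + \<epsilon> / 2)) * Q))"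
    using decay
  proof eventually_elim
    case (elim x)
    show ?case
    proof
      assume "R \<le> norm x"
      then have "cmod (g x) \<le> max K 0 * norm x powr (- real N - ?D - \<epsilon>)"
        using elim mult_right_mono[of K "max K 0" "norm x powr (- real N - ?D - \<epsilon>)"] by simp
      then have "cmod (g x) powr Q \<le> (max K 0 * norm x powr (- real N - ?D - \<epsilon>)) powr Q"
        using Q by (intro powr_mono2) auto
      also have "\<dots> = max K 0 powr Q * norm x powr ((- real N - ?D - \<epsilon>) * Q)"
        by (simp add: powr_mult powr_powr)
      also have "(- real N - ?D - \<epsilon>) * Q = - (?D * ((1 - r) * Q) + \<epsilon> * Q / 2 + (real N + (?D * r + \<epsilon> / 2)) * Q)"
        by (simp add: algebra_simps)
      finally show "cmod (g x) powr Q \<le> max K 0 powr Q * norm x powr (- (?D + \<epsilon> * Q / 2 + (real N + (?D * r + \<epsilon> / 2)) * Q))"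
        by (simp add: r)
    qed
  qed
qed (use assms that in auto)

text \<open>The spectrum of the rescaled function when \<open>f\<close> is the adjoint of M^j and
  \<open>c\<close> its Jacobian. The sign in \<open>- f \<eta>\<close> accounts for the given
  function being the transform of \<open>g\<close> at the reflected point.\<close>

definition dilated :: "(real^'d \<Rightarrow> real^'d) \<Rightarrow> real \<Rightarrow> (real^'d \<Rightarrow> complex) \<Rightarrow> real^'d \<Rightarrow> complex" where
  "dilated f c g \<eta> = of_real (1 / c) * g (- f \<eta>)"

lemma borel_measurable_linear:
  fixes f :: "real^'d \<Rightarrow> real^'d"
  assumes "linear f"
  shows "f \<in> borel \<rightarrow>\<^sub>M borel"
  using assms by (auto intro!: borel_measurable_continuous_onI linear_continuous_on simp: linear_conv_bounded_linear)

context
  fixes A B :: "real^'d \<Rightarrow> real^'d" and c b :: real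
  assumes A: "linear A" and B: "linear B" and AB: "\<And>x. A (B x) = x" and BA: "\<And>x. B (A x) = x"
    and c: "0 < c" "\<And>F. F \<in> borel_measurable borel \<Longrightarrow> (\<integral>\<^sup>+x. F (adjoint A x) \<partial>lborel) = ennreal c * (\<integral>\<^sup>+x. F x \<partial>lborel)"
    and b: "0 < b" "\<And>x. norm (B x) \<le> b * norm x"
begin

lemma adjoint_linear_borel [measurable]: "adjoint A \<in> borel \<rightarrow>\<^sub>M borel"
  by (intro borel_measurable_linear adjoint_linear A)

lemma adjoint_inverse: "adjoint B (adjoint A x) = x"
proof (rule vector_eq_ldot[THEN iffD1], intro allI)
  show "z \<bullet> adjoint B (adjoint A x) = z \<bullet> x" for z
    by (simp add: adjoint_works[OF A] adjoint_works[OF B] AB)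
qed

lemma norm_le_adjoint: "norm x \<le> b * norm (adjoint A x)"
  using norm_adjoint_le[OF B b(2), of "adjoint A x"] by (simp add: adjoint_inverse)

lemma borel_measurable_dilated [measurable]:
  assumes [measurable]: "g \<in> borel_measurable borel"
  shows "dilated (adjoint A) c g \<in> borel_measurable borel"
  unfolding dilated_def by measurable

lemma integrable_dilated:
  assumes [measurable]: "g \<in> borel_measurable borel" and g: "integrable lborel (\<lambda>x. (1 + norm x) ^ N * cmod (g x))"
  shows "integrable lborel (\<lambda>x. (1 + norm x) ^ N * cmod (dilated (adjoint A) c g x))"
proof (rule integrableI_bounded)
  let ?F = "\<lambda>x. ennreal ((1 + norm (- x)) ^ N * cmod (g (- x)))"
  let ?K = "(1 + b) ^ N * (1 / c)"
  have "ennreal (norm ((1 + norm x) ^ N * cmod (dilated (adjoint A) c g x))) \<le> ennreal ?K * ?F (adjoint A x)" for x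
  proof -
    have "1 + norm x \<le> (1 + b) * (1 + norm (adjoint A x))"
      using norm_le_adjoint[of x] b(1) by (simp add: algebra_simps add_increasing)
    then have "(1 + norm x) ^ N \<le> ((1 + b) * (1 + norm (adjoint A x))) ^ N" by (intro power_mono) auto
    then have "(1 + norm x) ^ N * cmod (dilated (adjoint A) c g x)
      \<le> ((1 + b) * (1 + norm (adjoint A x))) ^ N * cmod (dilated (adjoint A) c g x)"
      by (intro mult_right_mono) auto
    also have "\<dots> = ?K * ((1 + norm (- adjoint A x)) ^ N * cmod (g (- adjoint A x)))"
      using c by (simp add: dilated_def norm_mult norm_divide power_mult_distrib)
    finally have "ennreal (norm ((1 + norm x) ^ N * cmod (dilated (adjoint A) c g x)))
      \<le> ennreal (?K * ((1 + norm (- adjoint A x)) ^ N * cmod (g (- adjoint A x))))"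
      by (intro ennreal_leI) (simp add: abs_mult)
    also have "\<dots> = ennreal ?K * ?F (adjoint A x)" using b(1) c(1) by (intro ennreal_mult) auto
    finally show ?thesis .
  qed
  then have "(\<integral>\<^sup>+x. ennreal (norm ((1 + norm x) ^ N * cmod (dilated (adjoint A) c g x))) \<partial>lborel)
    \<le> (\<integral>\<^sup>+x. ennreal ?K * ?F (adjoint A x) \<partial>lborel)"
    by (intro nn_integral_mono)
  also have "\<dots> = ennreal ?K * (\<integral>\<^sup>+x. ?F (adjoint A x) \<partial>lborel)" by (rule nn_integral_cmult) measurable
  also have "(\<integral>\<^sup>+x. ?F (adjoint A x) \<partial>lborel) = ennreal c * (\<integral>\<^sup>+x. ?F x \<partial>lborel)" by (rule c(2)) measurable
  also have "(\<integral>\<^sup>+x. ?F x \<partial>lborel) = (\<integral>\<^sup>+x. ennreal ((1 + norm x) ^ N * cmod (g x)) \<partial>lborel)"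
    by (rule nn_integral_lborel_uminus) measurable
  also have "ennreal ?K * (ennreal c * \<dots>) < \<infinity>"
    using g by (simp add: integrable_iff_bounded abs_mult ennreal_mult_less_top)
  finally show "(\<integral>\<^sup>+x. ennreal (norm ((1 + norm x) ^ N * cmod (dilated (adjoint A) c g x))) \<partial>lborel) < \<infinity>" .
qed (use adjoint_linear_borel borel_measurable_dilated[OF assms(1)] in measurable)

lemma fourier_dilated:
  assumes [measurable]: "g \<in> borel_measurable borel"
  shows "fourier (dilated (adjoint A) c g) x = fourier g (- B x)"
proof -
  let ?H = "\<lambda>\<zeta>. g (- \<zeta>) * echar (\<zeta> \<bullet> B x)"
  have "fourier (dilated (adjoint A) c g) x = (\<integral>\<eta>. of_real (1 / c) * ?H (adjoint A \<eta>) \<partial>lborel)"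
  proof (subst fourier_eq_lborel)
    have "\<eta> \<bullet> x = adjoint A \<eta> \<bullet> B x" for \<eta>
      using adjoint_works[OF A, of "B x" \<eta>] by (simp add: AB inner_commute)
    then show "(\<integral>\<eta>. dilated (adjoint A) c g \<eta> * echar (\<eta> \<bullet> x) \<partial>lborel) = (\<integral>\<eta>. of_real (1 / c) * ?H (adjoint A \<eta>) \<partial>lborel)"
      by (simp add: dilated_def)
  qed measurable
  also have "\<dots> = of_real (1 / c) * (\<integral>\<eta>. ?H (adjoint A \<eta>) \<partial>lborel)" by simp
  also have "(\<integral>\<eta>. ?H (adjoint A \<eta>) \<partial>lborel) = of_real c * (\<integral>\<zeta>. ?H \<zeta> \<partial>lborel)"
  proof (rule integral_linear_change[OF adjoint_linear[OF A] c])
    show "?H \<in> borel_measurable borel"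
      by (intro borel_measurable_times measurable_compose[OF _ borel_measurable_echar] borel_measurable_inner) measurable
  qed
  also have "(\<integral>\<zeta>. ?H \<zeta> \<partial>lborel) = fourier (\<lambda>\<zeta>. g (- \<zeta>)) (B x)" by (subst fourier_eq_lborel) auto
  also have "\<dots> = fourier g (- B x)" by (rule fourier_reflect) measurable
  finally show ?thesis using c by simp
qed

text \<open>The substitution by \<open>adjoint A\<close> maps the exterior of the ball of radius
  \<delta> into that of radius \<delta> / b. The factor 1 / c of the dilation contributes c^(-Q),
  the change of variables c, and the comparison of the weights b^\<sigma>.\<close>

lemma weight_dilated:
  assumes [measurable]: "g \<in> borel_measurable borel" and \<sigma>: "0 \<le> \<sigma>"
    and T: "(\<integral>\<^sup>+x. indicator {x. \<delta> / b \<le> norm x} x * ennreal (cmod (g x) powr Q * norm x powr \<sigma>) \<partial>lborel) \<le> ennreal T" "0 \<le> T"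
  shows "(\<integral>\<^sup>+\<eta>. indicator {\<eta>. \<delta> \<le> norm \<eta>} \<eta> * ennreal (cmod (dilated (adjoint A) c g (- \<eta>)) powr Q * norm \<eta> powr \<sigma>) \<partial>lborel)
    \<le> ennreal (c powr (1 - Q) * b powr \<sigma> * T)"
proof -
  let ?F = "\<lambda>x. indicator {x. \<delta> / b \<le> norm x} x * ennreal (cmod (g x) powr Q * norm x powr \<sigma>)"
  let ?K = "c powr (- Q) * b powr \<sigma>"
  have "indicator {\<eta>. \<delta> \<le> norm \<eta>} \<eta> * ennreal (cmod (dilated (adjoint A) c g (- \<eta>)) powr Q * norm \<eta> powr \<sigma>)
    \<le> ennreal ?K * ?F (adjoint A \<eta>)" for \<eta>
  proof (cases "\<delta> \<le> norm \<eta>")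
    case True
    have m: "adjoint A (- \<eta>) = - adjoint A \<eta>" using adjoint_linear[OF A] by (rule linear_neg)
    have "\<delta> / b \<le> norm (adjoint A \<eta>)"
      using True norm_le_adjoint[of \<eta>] b(1) by (simp add: field_simps)
    moreover have "cmod (dilated (adjoint A) c g (- \<eta>)) = 1 / c * cmod (g (adjoint A \<eta>))"
      using c(1) by (simp add: dilated_def m norm_mult norm_divide)
    then have "cmod (dilated (adjoint A) c g (- \<eta>)) powr Q = c powr (- Q) * cmod (g (adjoint A \<eta>)) powr Q"
      using c(1) by (simp add: powr_mult powr_divide powr_minus_divide)
    moreover have "norm \<eta> powr \<sigma> \<le> b powr \<sigma> * norm (adjoint A \<eta>) powr \<sigma>"
      using powr_mono2[OF \<sigma> _ norm_le_adjoint[of \<eta>]] b(1) by (simp add: powr_mult)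
    ultimately have "cmod (dilated (adjoint A) c g (- \<eta>)) powr Q * norm \<eta> powr \<sigma>
      \<le> (c powr (- Q) * cmod (g (adjoint A \<eta>)) powr Q) * (b powr \<sigma> * norm (adjoint A \<eta>) powr \<sigma>)"
      by (intro mult_mono) auto
    also have "\<dots> = ?K * (cmod (g (adjoint A \<eta>)) powr Q * norm (adjoint A \<eta>) powr \<sigma>)" by (simp only: mult_ac)
    finally have "ennreal (cmod (dilated (adjoint A) c g (- \<eta>)) powr Q * norm \<eta> powr \<sigma>)
      \<le> ennreal ?K * ennreal (cmod (g (adjoint A \<eta>)) powr Q * norm (adjoint A \<eta>) powr \<sigma>)"
      by (simp add: ennreal_leI flip: ennreal_mult)
    then show ?thesis using True \<open>\<delta> / b \<le> norm (adjoint A \<eta>)\<close> by simp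
  qed simp
  then have "(\<integral>\<^sup>+\<eta>. indicator {\<eta>. \<delta> \<le> norm \<eta>} \<eta> * ennreal (cmod (dilated (adjoint A) c g (- \<eta>)) powr Q * norm \<eta> powr \<sigma>) \<partial>lborel)
    \<le> (\<integral>\<^sup>+\<eta>. ennreal ?K * ?F (adjoint A \<eta>) \<partial>lborel)" by (intro nn_integral_mono)
  also have "\<dots> = ennreal ?K * (\<integral>\<^sup>+\<eta>. ?F (adjoint A \<eta>) \<partial>lborel)" by (rule nn_integral_cmult) measurable
  also have "(\<integral>\<^sup>+\<eta>. ?F (adjoint A \<eta>) \<partial>lborel) = ennreal c * (\<integral>\<^sup>+x. ?F x \<partial>lborel)" by (rule c(2)) measurable
  also have "ennreal ?K * (ennreal c * (\<integral>\<^sup>+x. ?F x \<partial>lborel)) \<le> ennreal ?K * (ennreal c * ennreal T)"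
    by (intro mult_left_mono T) auto
  also have "\<dots> = ennreal (?K * (c * T))" using c T by (simp add: ennreal_mult)
  also have "?K * (c * T) = c powr (1 - Q) * b powr \<sigma> * T"
    using c by (simp add: powr_diff powr_minus divide_inverse mult_ac)
  finally show ?thesis .
qed

end

section \<open>Sampling errors at a fixed scale\<close>

lemma symb_reflect: "symb is (- x) = cnj (symb is x)"
  by (induction "is") auto

text \<open>Turns the hypothesis on the conjugate of the transform of \<phi> times the transform of
  the distribution into the condition \<open>near_0\<close>, where the symbol has the original
  coefficients and a reflected argument.\<close>

lemma op_symb_reflect: "op_symb N a (- x) = cnj (op_symb N (\<lambda>\<beta>. cnj (a \<beta>)) x)"
  by (simp add: op_symb_def symb_reflect)

text \<open>The error in the theorem is a pointwise \<open>infsum\<close>, whose measurability is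
  known only through its agreement almost everywhere with a Borel function.\<close>

lemma borel_measurable_completion_AE:
  fixes f h :: "'a \<Rightarrow> 'b::topological_space"
  assumes h: "h \<in> borel_measurable M" and eq: "AE x in M. f x = h x"
  shows "f \<in> borel_measurable (completion M)"
proof (rule measurableI)
  fix S :: "'b set" assume S: "S \<in> sets borel"
  show "f -` S \<inter> space (completion M) \<in> sets (completion M)"
  proof (rule completion.in_sets_AE)
    show "AE x in completion M. x \<in> h -` S \<inter> space M \<longleftrightarrow> x \<in> f -` S \<inter> space (completion M)"
      using AE_completion[OF eq] AE_space by eventually_elim auto
    show "h -` S \<inter> space M \<in> sets (completion M)"
      using measurable_sets[OF h S] by (rule sets_completionI_sets)
  qed auto
qed simp

text \<open>The order of quantifiers is the point: the constant is chosen before the spectrum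
  \<open>G\<close>, the map \<open>A\<close> and its Jacobian \<open>c\<close>, hence does not
  depend on the scale. The factor \<open>c powr r\<close> is the effect of composing with
  \<open>A\<close> on the L_p norm. The strict inequality for \<sigma> is \<sigma> P > d, the
  condition for the lattice sums.\<close>

lemma sampling_error_norm:
  fixes \<phi> s :: "real^'d \<Rightarrow> complex"
  assumes exps: "(p = \<infinity> \<and> Q = 1 \<and> r = 0) \<or> (\<exists>P\<ge>2. p = ennreal P \<and> Q = P / (P - 1) \<and> r = 1 / P)"
    and s: "\<And>\<eta>. cmod (s \<eta>) \<le> Cs * (1 + norm \<eta>) ^ N"
    and B: "0 \<le> B" "\<And>\<xi>. (\<integral>\<^sup>+k. ennreal (cmod (fourier \<phi> (\<xi> + k)) powr Q) \<partial>ZS) \<le> ennreal B"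
    and \<delta>: "0 < \<delta>" and \<sigma>: "0 \<le> \<sigma>" "real CARD('d) * r < \<sigma>"
  obtains C where "0 \<le> C" "\<And>G X (A :: real^'d \<Rightarrow> real^'d) c h. sampling \<phi> s G \<delta> \<Longrightarrow> 0 < X \<Longrightarrow> sampling.weight G \<delta> Q (real N + \<sigma>) \<le> ennreal X \<Longrightarrow>
    linear A \<Longrightarrow> 0 < c \<Longrightarrow> (\<And>F. F \<in> borel_measurable borel \<Longrightarrow> (\<integral>\<^sup>+x. F (A x) \<partial>lborel) = ennreal c * (\<integral>\<^sup>+x. F x \<partial>lborel)) \<Longrightarrow>
    AE x in lborel. h x = sampling.err \<phi> s G (A x) \<Longrightarrow> Lp_norm p h \<le> ennreal (C * (c powr r * X powr (1 / Q)))"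
  using exps
proof (elim disjE exE conjE)
  assume p: "p = \<infinity>" and Q: "Q = 1" and r: "r = 0"
  let ?C = "(\<delta> powr (- (real N + \<sigma>))) + (Cs * (1 + 1 / \<delta>) ^ N) * \<delta> powr (- \<sigma>) * B"
  have "0 \<le> Cs" using order_trans[OF norm_ge_zero s[of 0]] by simp
  then have C: "0 \<le> ?C" using B \<delta> by auto
  show ?thesis
  proof (rule that[OF C])
    fix G X c and A :: "real^'d \<Rightarrow> real^'d" and h :: "real^'d \<Rightarrow> complex"
    assume samp: "sampling \<phi> s G \<delta>" and X: "0 < X" "sampling.weight G \<delta> Q (real N + \<sigma>) \<le> ennreal X"
      and A: "linear A" and c: "0 < c" "\<And>F. F \<in> borel_measurable borel \<Longrightarrow> (\<integral>\<^sup>+x. F (A x) \<partial>lborel) = ennreal c * (\<integral>\<^sup>+x. F x \<partial>lborel)"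
      and h: "AE x in lborel. h x = sampling.err \<phi> s G (A x)"
    interpret sampling \<phi> s G \<delta> by (rule samp)
    have [measurable]: "A \<in> borel \<rightarrow>\<^sub>M borel" by (rule borel_measurable_linear[OF A])
    have B': "(\<integral>\<^sup>+k. ennreal (cmod (fourier \<phi> (\<xi> + k))) \<partial>ZS) \<le> ennreal B" for \<xi>
      using B(2)[of \<xi>] by (simp add: Q)
    have bound: "AE x in lborel. cmod (err x) \<le> ?C * X"
      by (rule err_Linf_bound[OF s \<sigma>(1) B(1) B']) (use X in \<open>simp_all add: Q\<close>)
    have "AE x in lborel. cmod (err (A x)) \<le> ?C * X" by (rule AE_lborel_linear[OF A _ bound]) (rule c(2))
    then have "AE x in lborel. cmod (h x) \<le> ?C * X" using h by eventually_elim simp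
    then have "AE x in lebesgue. cmod (h x) \<le> ?C * X" by (rule AE_completion)
    moreover have "h \<in> borel_measurable lebesgue"
      by (rule borel_measurable_completion_AE[OF _ h]) measurable
    ultimately have "Lp_norm \<infinity> h \<le> ennreal (?C * X)" by (intro Lp_norm_top_leI)
    then show "Lp_norm p h \<le> ennreal (?C * (c powr r * X powr (1 / Q)))" using X c by (simp add: p Q r)
  qed
next
  fix P assume P: "2 \<le> P" "p = ennreal P" and Q: "Q = P / (P - 1)" and r: "r = 1 / P"
  have "real CARD('d) < \<sigma> * P" using \<sigma>(2) P by (simp add: r field_simps)
  from lattice_sum_powr_bound[OF this \<delta>] obtain CL where CL: "0 < CL" "\<And>y :: real^'d. (\<integral>\<^sup>+k. indicator {x. \<delta> \<le> norm x} (y + k) * ennreal (norm (y + k) powr (- (\<sigma> * P))) \<partial>ZS) \<le> ennreal CL"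
    by blast
  obtain CH where CH: "0 < CH" "\<And>u :: real^'d \<Rightarrow> complex. integrable lborel u \<Longrightarrow> (\<integral>\<^sup>+x. ennreal (cmod (u x) powr Q) \<partial>lborel) \<le> 1
       \<Longrightarrow> (\<integral>\<^sup>+\<xi>. ennreal (cmod (fourier u \<xi>) powr P) \<partial>lborel) \<le> ennreal CH"
    using hausdorff_young[OF P(1) Q] by blast
  let ?C = "(1 + B) + CH * ((\<delta> powr (- (real N + \<sigma>))) powr P + (Cs * (1 + 1 / \<delta>) ^ N) powr P * CL)"
  have C: "0 \<le> ?C" using B CH CL by auto
  show ?thesis
  proof (rule that[OF C])
    fix G X c and A :: "real^'d \<Rightarrow> real^'d" and h :: "real^'d \<Rightarrow> complex"
    assume samp: "sampling \<phi> s G \<delta>" and X: "0 < X" "sampling.weight G \<delta> Q (real N + \<sigma>) \<le> ennreal X"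
      and A: "linear A" and c: "0 < c" "\<And>F. F \<in> borel_measurable borel \<Longrightarrow> (\<integral>\<^sup>+x. F (A x) \<partial>lborel) = ennreal c * (\<integral>\<^sup>+x. F x \<partial>lborel)"
      and h: "AE x in lborel. h x = sampling.err \<phi> s G (A x)"
    interpret sampling \<phi> s G \<delta> by (rule samp)
    have bound: "(\<integral>\<^sup>+x. ennreal (cmod (err x) powr P) \<partial>lborel) \<le> ennreal ((?C * X powr (1 / Q)) powr P)"
      by (rule err_Lp_bound[OF P(1) Q s \<sigma>(1) B _ CL(2) X _ CH(2)]) (use CL(1) CH(1) in simp_all)
    have powr: "c * Y powr P = (c powr r * Y) powr P" for Y
      using c(1) P by (simp add: powr_mult r powr_powr)
    have nonneg: "0 \<le> c powr r * (?C * X powr (1 / Q))" by (intro mult_nonneg_nonneg C) auto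
    have "(\<integral>\<^sup>+x. ennreal (cmod (h x) powr P) \<partial>lborel) = (\<integral>\<^sup>+x. ennreal (cmod (err (A x)) powr P) \<partial>lborel)"
      by (rule nn_integral_cong_AE) (use h in \<open>eventually_elim, simp\<close>)
    also have "\<dots> = ennreal c * (\<integral>\<^sup>+x. ennreal (cmod (err x) powr P) \<partial>lborel)"
      by (rule c(2)) measurable
    also have "\<dots> \<le> ennreal c * ennreal ((?C * X powr (1 / Q)) powr P)"
      by (rule mult_left_mono[OF bound]) simp
    also have "\<dots> = ennreal (c * (?C * X powr (1 / Q)) powr P)" by (rule ennreal_mult[symmetric]) (use c(1) in auto)
    also have "c * (?C * X powr (1 / Q)) powr P = (c powr r * (?C * X powr (1 / Q))) powr P" by (rule powr)
    finally have "Lp_norm (ennreal P) h \<le> ennreal (c powr r * (?C * X powr (1 / Q)))"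
      using P by (intro Lp_norm_leI nonneg) auto
    then show "Lp_norm p h \<le> ennreal (?C * (c powr r * X powr (1 / Q)))"
      by (simp only: P(2) mult.left_commute)
  qed
qed

lemma sampling_dilated:
  fixes \<phi> g :: "real^'d \<Rightarrow> complex"
  assumes \<phi>: "integrable lborel \<phi>" "(\<integral>\<^sup>+x. ennreal ((cmod (\<phi> x))\<^sup>2) \<partial>lborel) < \<infinity>"
    and G: "G \<in> borel_measurable borel" "integrable lborel (\<lambda>x. (1 + norm x) ^ N * cmod (G x))"
    and \<delta>: "0 < \<delta>"
    and near_0: "AE \<xi> in lborel. norm \<xi> < \<delta> \<longrightarrow> fourier \<phi> \<xi> * op_symb N a (- \<xi>) = 1"
    and near_lattice: "\<And>l. l \<in> zlattice - {0} \<Longrightarrow> AE \<xi> in lborel. norm (l - \<xi>) < \<delta> \<longrightarrow> fourier \<phi> \<xi> = 0"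
  shows "sampling \<phi> (op_symb N a) G \<delta>"
proof
  note [measurable] = G(1)
  show "integrable lborel G"
  proof (rule Bochner_Integration.integrable_bound[OF G(2)])
    show "AE x in lborel. norm (G x) \<le> norm ((1 + norm x) ^ N * cmod (G x))"
      by (intro AE_I2) (simp add: abs_mult mult_le_cancel_right1 one_le_power)
  qed measurable
  obtain C where C: "0 < C" "\<And>x. cmod (op_symb N a x) \<le> C * (1 + norm x) ^ N" using op_symb_bound by blast
  show "integrable lborel (\<lambda>\<eta>. op_symb N a \<eta> * G \<eta>)"
  proof (rule Bochner_Integration.integrable_bound)
    show "integrable lborel (\<lambda>x. C * ((1 + norm x) ^ N * cmod (G x)))" using G(2) by (rule integrable_mult_right)
    show "AE x in lborel. norm (op_symb N a x * G x) \<le> norm (C * ((1 + norm x) ^ N * cmod (G x)))"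
      using mult_right_mono[OF C(2) norm_ge_zero] C(1) by (intro AE_I2) (simp add: norm_mult abs_mult mult.assoc)
  qed measurable
qed (use assms in auto)

section \<open>The approximation order\<close>

text \<open>A real pair with r = 1/p, including Q = 1 and r = 0 for p = \<infinity>, allows a single
  computation of the exponents in all cases.\<close>

lemma conjugate_exponents_real:
  fixes p q :: ennreal
  assumes "2 \<le> p" "1 / p + 1 / q = 1"
  obtains Q r where "1 \<le> Q" "0 \<le> r" "(1 - r) * Q = 1" "enn2real q = Q" "enn2real (1 / p) = r" "q = ennreal Q"
    "(p = \<infinity> \<and> Q = 1 \<and> r = 0) \<or> (\<exists>P\<ge>2. p = ennreal P \<and> Q = P / (P - 1) \<and> r = 1 / P)"
  using assms
proof (cases rule: conjugate_exponents)
  case 1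
  then show ?thesis by (intro that[of 1 0]) auto
next
  case (2 P)
  have "1 / p = ennreal (1 / P)" using 2 by (simp add: divide_ennreal flip: ennreal_1)
  then show ?thesis using 2 by (intro that[of "P / (P - 1)" "1 / P"]) (auto simp: field_simps)
qed

theorem theorem9:
  fixes p q :: ennreal
    and N :: nat
    and M :: "real^'d^'d"
    and a :: "nat^'d \<Rightarrow> complex"
    and \<phi>t :: "'d distr"
    and \<phi>t_hat \<phi> g f :: "real^'d \<Rightarrow> complex"
    and \<delta> \<epsilon> :: real
  assumes p: "2 \<le> p" and pq: "1 / p + 1 / q = 1"
    and M: "dilation_matrix M"
    and a0: "a 0 \<noteq> 0"
    and phit: "\<phi>t = assoc_distr N a"
    and phit_hat: "represents \<phi>t_hat (distr_fourier \<phi>t)"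
    and phi: "\<phi> \<in> periodized_Lp p"
    and phi_hat_bounded:
      "\<exists>B::real. \<forall>\<xi>. (\<Sum>\<^sub>\<infinity>k\<in>zlattice. ennreal (cmod (fourier \<phi> (\<xi> + k)) powr enn2real q)) \<le> ennreal B"
    and delta: "0 < \<delta>" "\<delta> < 1/2"
    and phi_hat_0: "AE \<xi> in lebesgue. norm \<xi> < \<delta> \<longrightarrow> cnj (fourier \<phi> \<xi>) * \<phi>t_hat \<xi> = 1"
    and phi_hat_l: "\<And>l. l \<in> zlattice - {0} \<Longrightarrow>
      AE \<xi> in lebesgue. norm (l - \<xi>) < \<delta> \<longrightarrow> fourier \<phi> \<xi> = 0"
    and g: "g \<in> Lp q"
    and eps: "0 < \<epsilon>"
    and g_decay: "\<exists>K R. AE \<xi> in lebesgue. R \<le> norm \<xi> \<longrightarrow>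
      cmod (g \<xi>) \<le> K * norm \<xi> powr (- real N - real CARD('d) - \<epsilon>)"
    and f: "\<And>x. f x = fourier g (- x)"
  shows "\<forall>\<theta>>0. (\<forall>\<mu>. is_eigenvalue M \<mu> \<longrightarrow> \<theta> < cmod \<mu>) \<longrightarrow>
    (\<exists>C::real. \<forall>j::nat.
      (AE x in lebesgue.
        (\<lambda>k. sample_coeff M N a f j k * scaled_translate M \<phi> j k x) summable_on zlattice) \<and>
      Lp_norm p (\<lambda>x. f x - of_real (\<bar>det M\<bar> powr (- real j / 2)) *
          (\<Sum>\<^sub>\<infinity>k\<in>zlattice. sample_coeff M N a f j k * scaled_translate M \<phi> j k x))
        \<le> ennreal (C * \<theta> powr (- real j * (real N + real CARD('d) * enn2real (1 / p) + \<epsilon>))))"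
proof (intro allI impI)
  fix \<theta> :: real assume \<theta>: "0 < \<theta>" "\<forall>\<mu>. is_eigenvalue M \<mu> \<longrightarrow> \<theta> < cmod \<mu>"
  let ?d = "real CARD('d)"
  obtain Q r where Q: "1 \<le> Q" and r: "0 \<le> r" "(1 - r) * Q = 1" and qQ: "enn2real q = Q" "q = ennreal Q"
    and pr: "enn2real (1 / p) = r"
    and exps: "(p = \<infinity> \<and> Q = 1 \<and> r = 0) \<or> (\<exists>P\<ge>2. p = ennreal P \<and> Q = P / (P - 1) \<and> r = 1 / P)"
    by (rule conjugate_exponents_real[OF p pq])
  have gm: "g \<in> borel_measurable lebesgue" using g by (simp add: Lp_def)
  obtain g' where g': "g' \<in> borel_measurable lborel" "AE x in lborel. g x = g' x"
    by (rule completion_ex_borel_measurable_complex[OF gm])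
  have g'm [measurable]: "g' \<in> borel_measurable borel" using g'(1) by simp
  have fg: "fourier g = fourier g'" by (rule fourier_cong_AE[OF g'(2) gm g'm])
  have "(\<integral>\<^sup>+x. ennreal (cmod (g x) powr Q) \<partial>lborel) < \<infinity>"
    using g Q unfolding qQ by (intro Lp_finite_norm) auto
  also have "(\<integral>\<^sup>+x. ennreal (cmod (g x) powr Q) \<partial>lborel) = (\<integral>\<^sup>+x. ennreal (cmod (g' x) powr Q) \<partial>lborel)"
    by (rule nn_integral_cong_AE) (use g'(2) in \<open>eventually_elim, simp\<close>)
  finally have gQ: "(\<integral>\<^sup>+x. ennreal (cmod (g' x) powr Q) \<partial>lborel) < \<infinity>" .
  obtain K R where "AE \<xi> in lborel. R \<le> norm \<xi> \<longrightarrow> cmod (g \<xi>) \<le> K * norm \<xi> powr (- real N - ?d - \<epsilon>)"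
    using g_decay unfolding AE_completion_iff by blast
  then have decay: "AE \<xi> in lborel. R \<le> norm \<xi> \<longrightarrow> cmod (g' \<xi>) \<le> K * norm \<xi> powr (- real N - ?d - \<epsilon>)"
    using g'(2) by eventually_elim simp
  have g'w: "integrable lborel (\<lambda>x. (1 + norm x) ^ N * cmod (g' x))"
    by (rule decay_weight_integrable[OF g'm Q gQ eps decay])
  have pP: "p = \<infinity> \<or> (\<exists>P\<ge>2. p = ennreal P)" using exps by auto
  obtain \<psi> where \<psi>: "AE x in lborel. \<phi> x = \<psi> x" "fourier \<phi> = fourier \<psi>" "integrable lborel \<psi>"
    "(\<integral>\<^sup>+x. ennreal ((cmod (\<psi> x))\<^sup>2) \<partial>lborel) < \<infinity>"
    by (rule periodized_Lp_borel_version[OF phi pP])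
  obtain B0 where B0: "\<And>\<xi>. (\<Sum>\<^sub>\<infinity>k\<in>zlattice. ennreal (cmod (fourier \<phi> (\<xi> + k)) powr Q)) \<le> ennreal B0"
    using phi_hat_bounded unfolding qQ(1) by blast
  define B where "B = max B0 0"
  have B: "0 \<le> B" "\<And>\<xi>. (\<integral>\<^sup>+k. ennreal (cmod (fourier \<psi> (\<xi> + k)) powr Q) \<partial>ZS) \<le> ennreal B"
    using B0 order_trans[OF B0 ennreal_leI[of B0 B]]
    by (auto simp: B_def \<psi>(2) infsum_ennreal_eq_nn_integral[OF countable_zlattice])
  define s where "s = op_symb N a"
  obtain Cs where Cs: "\<And>x. cmod (s x) \<le> Cs * (1 + norm x) ^ N"
    unfolding s_def by (rule op_symb_bound[of N a]) blast
  have near_0: "AE \<xi> in lborel. norm \<xi> < \<delta> \<longrightarrow> fourier \<psi> \<xi> * op_symb N a (- \<xi>) = 1"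
  proof -
    have "AE \<xi> in lborel. \<phi>t_hat \<xi> = op_symb N (\<lambda>\<beta>. cnj (a \<beta>)) \<xi>"
      using represents_fourier_assoc_distr[of \<phi>t_hat N a] phit_hat unfolding phit AE_completion_iff by blast
    moreover have "AE \<xi> in lborel. norm \<xi> < \<delta> \<longrightarrow> cnj (fourier \<psi> \<xi>) * \<phi>t_hat \<xi> = 1"
      using phi_hat_0 unfolding AE_completion_iff \<psi>(2) .
    ultimately show ?thesis
    proof eventually_elim
      case (elim \<xi>)
      have eq: "fourier \<psi> \<xi> * op_symb N a (- \<xi>) = cnj (cnj (fourier \<psi> \<xi>) * \<phi>t_hat \<xi>)"
        by (simp add: elim(1) op_symb_reflect)
      show ?case using elim(2) by (auto simp only: eq complex_cnj_one)
    qed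
  qed
  have near_lattice: "AE \<xi> in lborel. norm (l - \<xi>) < \<delta> \<longrightarrow> fourier \<psi> \<xi> = 0" if "l \<in> zlattice - {0}" for l
    using phi_hat_l[OF that] unfolding AE_completion_iff \<psi>(2) .
  \<comment> \<open>Half of \<epsilon> puts \<sigma> strictly above d/p, as the lattice sums
    require; the other half is kept for the tail of \<open>g\<close>.\<close>
  define \<sigma> where "\<sigma> = ?d * r + \<epsilon> / 2"
  have \<sigma>: "0 \<le> \<sigma>" "?d * r < \<sigma>" using r eps by (auto simp: \<sigma>_def)
  obtain C1 where C1: "0 \<le> C1" "\<And>G X (A :: real^'d \<Rightarrow> real^'d) c h. sampling \<psi> s G \<delta> \<Longrightarrow> 0 < X \<Longrightarrow>
    sampling.weight G \<delta> Q (real N + \<sigma>) \<le> ennreal X \<Longrightarrow>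
    linear A \<Longrightarrow> 0 < c \<Longrightarrow> (\<And>F. F \<in> borel_measurable borel \<Longrightarrow> (\<integral>\<^sup>+x. F (A x) \<partial>lborel) = ennreal c * (\<integral>\<^sup>+x. F x \<partial>lborel)) \<Longrightarrow>
    AE x in lborel. h x = sampling.err \<psi> s G (A x) \<Longrightarrow> Lp_norm p h \<le> ennreal (C1 * (c powr r * X powr (1 / Q)))"
    using sampling_error_norm[OF exps Cs B delta(1) \<sigma>] by blast
  \<comment> \<open>The given \<theta> may be smaller than 1. The maximum with 1 still lies below
    every eigenvalue modulus, and its powers are at least 1, so the tail radius \<delta> / b below
    never drops under \<delta> / c0, where the tail estimate starts.\<close>
  define \<theta>1 where "\<theta>1 = max \<theta> 1"
  have \<theta>1: "1 \<le> \<theta>1" "\<theta> \<le> \<theta>1" "0 < \<theta>1" by (auto simp: \<theta>1_def)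
  have eig: "\<theta>1 < cmod \<mu>" if "is_eigenvalue M \<mu>" for \<mu>
    using that \<theta>(2) M by (auto simp: \<theta>1_def dilation_matrix_def)
  have noteig: "\<not> is_eigenvalue M 0" using eig[of 0] \<theta>1 by auto
  have detM: "det M \<noteq> 0" by (rule matrix_inv_right_left(3)[OF noteig])
  obtain c0 where c0: "0 < c0" "\<And>j x. norm (mat_pow (matrix_inv M) j x) \<le> c0 * norm x / \<theta>1 ^ j"
    using mat_pow_inverse_bound[OF \<theta>1(3) eig] by blast
  have "0 < \<delta> / c0" using delta c0 by simp
  from decay_tail_weight[OF g'm Q r(2,1) gQ eps this decay] obtain CT where CT: "0 < CT" "\<And>\<rho>. \<delta> / c0 \<le> \<rho> \<Longrightarrow>
    (\<integral>\<^sup>+x. indicator {x. \<rho> \<le> norm x} x * ennreal (cmod (g' x) powr Q * norm x powr ((real N + \<sigma>) * Q)) \<partial>lborel)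
    \<le> ennreal (CT * \<rho> powr (- (\<epsilon> * Q / 2)))"
    unfolding \<sigma>_def by blast
  define E where "E = real N + ?d * r + \<epsilon>"
  have E0: "0 \<le> E" using r eps by (simp add: E_def)
  define C where "C = C1 * (CT powr (1 / Q) * \<delta> powr (- (\<epsilon> / 2)) * c0 powr E)"
  have main: "(AE x in lebesgue. (\<lambda>k. sample_coeff M N a f j k * scaled_translate M \<phi> j k x) summable_on zlattice) \<and>
      Lp_norm p (\<lambda>x. f x - of_real (\<bar>det M\<bar> powr (- real j / 2)) *
          (\<Sum>\<^sub>\<infinity>k\<in>zlattice. sample_coeff M N a f j k * scaled_translate M \<phi> j k x))
        \<le> ennreal (C * \<theta> powr (- real j * E))" for j
  proof -
    let ?A = "mat_pow M j" and ?B = "mat_pow (matrix_inv M) j"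
    have lin: "linear ?A" "linear ?B" by (rule linear_mat_pow)+
    note inv = mat_pow_inverse[OF noteig, of j]
    obtain c where c: "0 < c"
      "\<And>F. F \<in> borel_measurable borel \<Longrightarrow> (\<integral>\<^sup>+x. F (?A x) \<partial>lborel) = ennreal c * (\<integral>\<^sup>+x. F x \<partial>lborel)"
      "\<And>F. F \<in> borel_measurable borel \<Longrightarrow> (\<integral>\<^sup>+x. F (adjoint ?A x) \<partial>lborel) = ennreal c * (\<integral>\<^sup>+x. F x \<partial>lborel)"
      by (rule nn_integral_linear_change_adjoint[OF lin inv]) blast
    define b where "b = c0 / \<theta>1 ^ j"
    have b: "0 < b" "norm (?B x) \<le> b * norm x" for x using c0 \<theta>1 by (auto simp: b_def)
    define G where "G = dilated (adjoint ?A) c g'"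
    have G: "G \<in> borel_measurable borel" "integrable lborel (\<lambda>x. (1 + norm x) ^ N * cmod (G x))"
      using borel_measurable_dilated[OF lin inv c(1,3) b g'm] integrable_dilated[OF lin inv c(1,3) b g'm g'w]
      by (simp_all add: G_def)
    have FG: "fourier G x = f (?B x)" for x
      unfolding G_def f fg by (rule fourier_dilated[OF lin inv c(1,3) b g'm])
    have samp: "sampling \<psi> s G \<delta>"
      unfolding s_def by (rule sampling_dilated[OF \<psi>(3,4) G delta(1) near_0 near_lattice])
    interpret sampling \<psi> s G \<delta> by (rule samp)
    have coeff: "sample_coeff M N a f j k = coeff k" for k
    proof -
      have "sample_coeff M N a f j k = diff_op N a (fourier G) (- k)"
        unfolding sample_coeff_def by (simp only: FG[symmetric])
      also have "\<dots> = coeff k" unfolding coeff_def unfolding s_def by (rule diff_op_fourier[OF G])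
      finally show ?thesis .
    qed
    \<comment> \<open>Everything about the series is settled in the variable y = M^j x, for a Borel
      representative of \<phi>, and then pulled back along the linear map.\<close>
    have "AE x in lborel. (\<forall>k\<in>zlattice. \<phi> (x + k) = \<psi> (x + k)) \<and> integrable ZS (\<lambda>k. coeff k * \<psi> (x + k))"
      using AE_lborel_translates[OF \<psi>(1)] quasi_summable by eventually_elim simp
    note good0 = this
    have good: "AE x in lborel. (\<forall>k\<in>zlattice. \<phi> (?A x + k) = \<psi> (?A x + k)) \<and> integrable ZS (\<lambda>k. coeff k * \<psi> (?A x + k))"
      by (rule AE_lborel_linear[OF lin(1) _ good0]) (rule c(2))
    have pointwise: "(\<lambda>k. sample_coeff M N a f j k * scaled_translate M \<phi> j k x) summable_on zlattice"
      "f x - of_real (\<bar>det M\<bar> powr (- real j / 2)) *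
          (\<Sum>\<^sub>\<infinity>k\<in>zlattice. sample_coeff M N a f j k * scaled_translate M \<phi> j k x) = err (?A x)"
      if x: "\<forall>k\<in>zlattice. \<phi> (?A x + k) = \<psi> (?A x + k)" "integrable ZS (\<lambda>k. coeff k * \<psi> (?A x + k))" for x
    proof -
      let ?m = "complex_of_real (\<bar>det M\<bar> powr (real j / 2))"
      have summand: "sample_coeff M N a f j k * scaled_translate M \<phi> j k x = ?m * (coeff k * \<psi> (?A x + k))"
        if "k \<in> zlattice" for k
        using x(1) that by (simp add: coeff scaled_translate_def)
      have cong: "(\<lambda>k. sample_coeff M N a f j k * scaled_translate M \<phi> j k x) summable_on zlattice
        \<longleftrightarrow> (\<lambda>k. ?m * (coeff k * \<psi> (?A x + k))) summable_on zlattice"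
        by (rule summable_on_cong) (rule summand)
      show "(\<lambda>k. sample_coeff M N a f j k * scaled_translate M \<phi> j k x) summable_on zlattice"
        unfolding cong by (rule summable_on_cmult_right[OF infsum_eq_integral_ZS(1)[OF x(2)]])
      have "(\<Sum>\<^sub>\<infinity>k\<in>zlattice. sample_coeff M N a f j k * scaled_translate M \<phi> j k x)
        = (\<Sum>\<^sub>\<infinity>k\<in>zlattice. ?m * (coeff k * \<psi> (?A x + k)))"
        by (rule infsum_cong) (rule summand)
      also have "\<dots> = ?m * quasi (?A x)"
        unfolding quasi_def infsum_eq_integral_ZS(2)[OF x(2), symmetric] by (rule infsum_cmult_right')
      finally have sum: "(\<Sum>\<^sub>\<infinity>k\<in>zlattice. sample_coeff M N a f j k * scaled_translate M \<phi> j k x) = ?m * quasi (?A x)" .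
      have "\<bar>det M\<bar> powr (- real j / 2) * \<bar>det M\<bar> powr (real j / 2) = 1"
        using detM by (simp flip: powr_add)
      then have "complex_of_real (\<bar>det M\<bar> powr (- real j / 2)) * ?m = 1" by (simp only: of_real_mult[symmetric] of_real_1)
      then have "complex_of_real (\<bar>det M\<bar> powr (- real j / 2)) * (?m * quasi (?A x)) = quasi (?A x)"
        by (simp only: mult.assoc[symmetric] mult_1_left)
      moreover have "f x = fourier G (?A x)" by (simp add: FG inv)
      ultimately show "f x - of_real (\<bar>det M\<bar> powr (- real j / 2)) *
          (\<Sum>\<^sub>\<infinity>k\<in>zlattice. sample_coeff M N a f j k * scaled_translate M \<phi> j k x) = err (?A x)"
        by (simp only: sum err_def)
    qed
    have "AE x in lborel. (\<lambda>k. sample_coeff M N a f j k * scaled_translate M \<phi> j k x) summable_on zlattice"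
      using good by eventually_elim (blast intro: pointwise(1))
    then have summable: "AE x in lebesgue. (\<lambda>k. sample_coeff M N a f j k * scaled_translate M \<phi> j k x) summable_on zlattice"
      by (rule AE_completion)
    have error: "AE x in lborel. f x - of_real (\<bar>det M\<bar> powr (- real j / 2)) *
          (\<Sum>\<^sub>\<infinity>k\<in>zlattice. sample_coeff M N a f j k * scaled_translate M \<phi> j k x) = err (?A x)"
      using good by eventually_elim (blast intro: pointwise(2))
    define T where "T = CT * (\<delta> / b) powr (- (\<epsilon> * Q / 2))"
    have T0: "0 < T" using CT delta b by (simp add: T_def)
    have "\<delta> / c0 * 1 \<le> \<delta> / c0 * \<theta>1 ^ j"
      using delta c0 one_le_power[OF \<theta>1(1), of j] by (intro mult_left_mono) auto
    then have "\<delta> / c0 \<le> \<delta> / b" by (simp add: b_def)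
    note tail = CT(2)[OF this, folded T_def]
    define X where "X = c powr (1 - Q) * b powr ((real N + \<sigma>) * Q) * T"
    have X0: "0 < X" using c(1) b(1) T0 by (simp add: X_def)
    have weight: "weight Q (real N + \<sigma>) \<le> ennreal X"
      unfolding weight_def X_def unfolding G_def
      by (rule weight_dilated[OF lin inv c(1,3) b g'm _ tail]) (use \<sigma> Q T0 in auto)
    \<comment> \<open>The determinant disappears here: c^r from the L_p norm meets c^((1 - Q)/Q) =
      c^(-r) from the weighted norm of the dilated spectrum. The weight supplies b^(N + \<sigma>),
      the tail beyond \<delta> / b supplies b^(\<epsilon>/2), and together they are b^E.\<close>
    have "c powr r * X powr (1 / Q) = CT powr (1 / Q) * \<delta> powr (- (\<epsilon> / 2)) * b powr E"
    proof -
      have Q': "0 < Q" using Q by simp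
      have r': "r = 1 - 1 / Q" using r(2) Q' by (simp add: field_simps)
      have "X powr (1 / Q) = c powr ((1 - Q) / Q) * b powr (real N + \<sigma>) * (CT powr (1 / Q) * (\<delta> / b) powr (- (\<epsilon> / 2)))"
        using Q' by (simp add: X_def T_def powr_mult powr_powr)
      also have "(1 - Q) / Q = - r" using Q' by (simp add: r' field_simps)
      also have "(\<delta> / b) powr (- (\<epsilon> / 2)) = \<delta> powr (- (\<epsilon> / 2)) * b powr (\<epsilon> / 2)"
        using delta b(1) by (simp add: powr_divide powr_minus field_simps)
      finally have "c powr r * X powr (1 / Q)
        = (c powr r * c powr (- r)) * (CT powr (1 / Q) * \<delta> powr (- (\<epsilon> / 2)) * (b powr (real N + \<sigma>) * b powr (\<epsilon> / 2)))"
        by (simp only: mult_ac)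
      moreover have "c powr r * c powr (- r) = 1" using c(1) by (simp flip: powr_add)
      moreover have "b powr (real N + \<sigma>) * b powr (\<epsilon> / 2) = b powr E"
        by (simp add: E_def \<sigma>_def add_ac flip: powr_add)
      ultimately show ?thesis by simp
    qed
    \<comment> \<open>As E \<ge> 0, passing from \<theta>1 back to the possibly smaller \<theta>
      only enlarges the bound.\<close>
    moreover have "b powr E \<le> c0 powr E * \<theta> powr (- real j * E)"
    proof -
      have "b powr E = c0 powr E * \<theta>1 powr (- real j * E)"
        using \<theta>1 c0 by (simp add: b_def powr_divide powr_minus_divide powr_powr flip: powr_realpow)
      also have "\<dots> \<le> c0 powr E * \<theta> powr (- real j * E)"
        using \<theta>(1) \<theta>1(2) E0 by (intro mult_left_mono powr_mono2') auto
      finally show ?thesis .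
    qed
    then have "CT powr (1 / Q) * \<delta> powr (- (\<epsilon> / 2)) * b powr E
      \<le> CT powr (1 / Q) * \<delta> powr (- (\<epsilon> / 2)) * (c0 powr E * \<theta> powr (- real j * E))"
      by (rule mult_left_mono) simp
    ultimately have "C1 * (c powr r * X powr (1 / Q))
      \<le> C1 * (CT powr (1 / Q) * \<delta> powr (- (\<epsilon> / 2)) * (c0 powr E * \<theta> powr (- real j * E)))"
      using C1(1) by (simp only: mult_left_mono)
    also have "\<dots> = C * \<theta> powr (- real j * E)" by (simp add: C_def)
    finally have final: "ennreal (C1 * (c powr r * X powr (1 / Q))) \<le> ennreal (C * \<theta> powr (- real j * E))"
      by (rule ennreal_leI)
    have "Lp_norm p (\<lambda>x. f x - of_real (\<bar>det M\<bar> powr (- real j / 2)) *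
          (\<Sum>\<^sub>\<infinity>k\<in>zlattice. sample_coeff M N a f j k * scaled_translate M \<phi> j k x))
        \<le> ennreal (C1 * (c powr r * X powr (1 / Q)))"
      by (rule C1(2)[OF samp X0 weight lin(1) c(1) _ error]) (rule c(2))
    then show ?thesis using summable order_trans[OF _ final] by blast
  qed
  then show "\<exists>C::real. \<forall>j::nat.
    (AE x in lebesgue. (\<lambda>k. sample_coeff M N a f j k * scaled_translate M \<phi> j k x) summable_on zlattice) \<and>
      Lp_norm p (\<lambda>x. f x - of_real (\<bar>det M\<bar> powr (- real j / 2)) *
          (\<Sum>\<^sub>\<infinity>k\<in>zlattice. sample_coeff M N a f j k * scaled_translate M \<phi> j k x))
        \<le> ennreal (C * \<theta> powr (- real j * (real N + ?d * enn2real (1 / p) + \<epsilon>)))"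
    unfolding pr E_def by blast
qed

end
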